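(* Suppose all investors use the strategy $\hat{\boldsymbol{L}}$ (investor $m$ using $\hat{\boldsymbol{L}}^m$), and the profile $(\hat{\boldsymbol{L}}^1,\dots,\hat{\boldsymbol{L}}^M)$ together with the initial wealth $y_0\in\mathbb{R}^M_{++}$ is feasible. Let $W_t=|Y_t|$ be the total wealth and $V_t=1/W_t$. Then $V$ is a supermartingale, and the limit $W_\infty=\lim_{t\to\infty}W_t$ exists a.s. with $W_\infty\in(0,\infty]$. Moreover, if $X$ is quasi-continuous, i.e. $\bar\nu\equiv0$, then $\{W_\infty=\infty\}=\{(1\wedge|x|^2)*\nu_\infty=\infty\}$ up to a null set.
   Context: Setting: $(\Omega,\mathcal{F},\mathbb{F}=(\mathcal{F}_t)_{t\ge0},\mathbb{P})$ filtered probability space with usual conditions, $\mathcal{P}$ predictable $\sigma$-algebra; equalities of processes up to indistinguishability. $|x|=\sum_n|x^n|$; for $x\in\mathbb{R}^{MN}$, $x^m=(x^{m,n})_n$, $x^{\cdot,n}=(x^{m,n})_m$. $M\ge2$ investors, $N\ge1$ assets. Payoff process $X$: adapted, nondecreasing, càdlàg, $\mathbb{R}^N_+$-valued, $X_0=0$; $X^c_t=X_t-\sum_{0<s\le t}\Delta X_s$; $\nu$ the compensator of the jump measure of $X$, chosen with $\bar\nu_t:=\nu(\{t\}\times\mathbb{R}^N_+)\in[0,1]$; $\nu_{\{t\}}(A)=\nu(\{t\}\times A)$; $f*\nu_t=\int_0^t\int f(s,x)\nu(ds,dx)$; $G_t=|X^c_t|+(|x|\wedge1)*\nu_t$. Strategies: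 $D$ = càdlàg $y\colon\mathbb{R}_+\to\mathbb{R}^M_+$, $\mathcal{D}_t=\sigma(y_u,u\le t)$, $E=\Omega\times D$, $\mathcal{E}_t=\mathcal{F}_t\otimes\mathcal{D}_t$, $\mathcal{P}^E$ the $\sigma$-algebra on $E\times\mathbb{R}_+$ generated by measurable functions left-continuous in $t$ and $\mathcal{E}_t$-measurable for fixed $t$. A strategy is a $\mathcal{P}^E$-measurable $\boldsymbol{L}_t(\omega,y)\in\mathbb{R}^N_+$, $\boldsymbol{L}_0=0$, nondecreasing càdlàg in $t$. Feasibility: for predictable nondecreasing càdlàg $H$ with $G\ll H$ (pathwise absolute continuity a.s.), $\mathbb{P}\otimes H(A)=\mathbb{E}\int\mathbb{1}_A\,dH$ on $\mathcal{P}$, and $dL/dH$ is a predictable version of the Lebesgue derivative of $\mathbb{P}\otimes L$ w.r.t. $\mathbb{P}\otimes H$ (Lebesgue derivative $d\tilde P/dP=Z$: $\tilde P(A)=\int_AZ\,dP+\tilde P(A\cap\Gamma)$ with $P(\Gamma)=0$). A profile $(\boldsymbol{L}^1,\dots,\boldsymbol{L}^M)$ and $y_0\in\mathbb{R}^M_{++}$ are feasible if there is a unique (up to indistinguishability) nonnegative càdlàg adapted $\mathbb{R}^M_+$-valued process $Y$ (wealth process) such that (1) for each $m$, a.s. for all $t$, $Y^m_t=y^m_0-|L^m_t|+\sum_n\int_0^t\frac{l^{m,n}_s}{|l^{\cdot,n}_s|}dX^n_s$ where $L^m_t(\omega)=\boldsymbol{L}^m_t(\omega,Y(\omega))$, $l^{m,n}=dL^{m,n}/dH$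 and $0/0=0$; (2) if $Y^m_t(\omega)=0$ or $Y^m_{t-}(\omega)=0$, then $L^m_s(\omega)=L^m_{t-}(\omega)$ and $Y^m_s(\omega)=0$ for all $s\ge t$. Candidate strategy: partition $\Omega\times\mathbb{R}_+\times(0,\infty)$ into $\Gamma_0=\{\bar\nu_t=0\}$, $\Gamma_1=\{0<\bar\nu_t<1$, or $\bar\nu_t=1$ and $\int\frac{c}{|x|}\nu_{\{t\}}(dx)>1\}$, $\Gamma_2=\{\bar\nu_t=1$ and $\int\frac{c}{|x|}\nu_{\{t\}}(dx)\le1\}$. On $\Gamma_1$ let $z^*(\omega,t,c)\in(0,c)$ be the unique solution of $\int\frac{c}{z+|x|}\nu_{\{t\}}(dx)=1-\frac cz(1-\bar\nu_t)$, and put $\zeta_t(c)=c\mathbb{1}(\Gamma_0)+z^*\mathbb{1}(\Gamma_1)$. Choose a predictable $\mathbb{R}^N_+$-valued $b$ and a transition kernel $K_{\omega,t}(dx)$ from $(\Omega\times\mathbb{R}_+,\mathcal{P})$ to $\mathbb{R}^N_+$ with $X^c=b\cdot G$ and $\nu(dt,dx)=K_t(dx)dG_t$ for all $\omega,t$, satisfying $|b_t|=0$ if $\Delta G_t>0$, $K_t(\{0\})=0$, and $|b_t|+\int(1\wedge|x|)K_t(dx)=1$. Define $\hat\lambda_t(0)=0$ and $\hat\lambda_t(c)=\frac{b_t}{c}+\int_{\mathbb{R}^N_+}\frac{x}{\zeta_t(c)+|x|}K_t(dx)$ for $c>0$. The strategy $\hat{\boldsymbol{L}}$, when used by investor $m$,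 is $\hat{\boldsymbol{L}}^m_t(\omega,y)=\int_0^t y^m_{s-}\hat\lambda_s(|y_{s-}|)\,dG_s$ with $y_{0-}=y_0$. *)

theory Defs
  imports "HOL-Probability.Probability"
begin

definition l1 :: "real^'i \<Rightarrow> real" where
  "l1 x = (\<Sum>i\<in>UNIV. \<bar>x $ i\<bar>)"

definition nonneg_vecs :: "(real^'i) set" where
  "nonneg_vecs = {x. \<forall>i. 0 \<le> x $ i}"

definition leftlim :: "'b \<Rightarrow> (real \<Rightarrow> 'b::t2_space) \<Rightarrow> real \<Rightarrow> 'b" where
  "leftlim c f t = (if t \<le> 0 then c else Lim (at_left t) f)"

definition cadlag :: "(real \<Rightarrow> 'b::topological_space) \<Rightarrow> bool" where
  "cadlag f \<longleftrightarrow> (\<forall>t\<ge>0. continuous (at_right t) f \<and> (t > 0 \<longrightarrow> (\<exists>l. (f \<longlongrightarrow> l) (at_left t))))"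

text \<open>Lebesgue--Stieltjes measure of a path defined on [0,\<infinity>) (constant on (-\<infinity>,0]);
  integrals "\<integral>_0^t f dF" are integrals over {0<..t} with respect to this measure.\<close>
definition LS :: "(real \<Rightarrow> real) \<Rightarrow> real measure" where
  "LS F = interval_measure (\<lambda>s. F (max s 0))"

definition filtration :: "'a measure \<Rightarrow> (real \<Rightarrow> 'a measure) \<Rightarrow> bool" where
  "filtration M F \<longleftrightarrow> (\<forall>t\<ge>0. subalgebra M (F t)) \<and>
     (\<forall>s t. 0 \<le> s \<longrightarrow> s \<le> t \<longrightarrow> sets (F s) \<subseteq> sets (F t))"

definition usual_conditions :: "'a measure \<Rightarrow> (real \<Rightarrow> 'a measure) \<Rightarrow> bool" where
  "usual_conditions M F \<longleftrightarrow> filtration M F \<and>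
     (\<forall>t\<ge>0. sets (F t) = (\<Inter>s\<in>{t<..}. sets (F s))) \<and>
     (\<forall>t\<ge>0. null_sets M \<subseteq> sets (F t))"

definition adapted :: "'a measure \<Rightarrow> (real \<Rightarrow> 'a measure) \<Rightarrow> (real \<Rightarrow> 'a \<Rightarrow> 'b::topological_space) \<Rightarrow> bool" where
  "adapted M F Z \<longleftrightarrow> (\<forall>t\<ge>0. Z t \<in> borel_measurable (F t))"

definition pred_sigma :: "'a measure \<Rightarrow> (real \<Rightarrow> 'a measure) \<Rightarrow> ('a \<times> real) measure" where
  "pred_sigma M F = sigma (space M \<times> {0..})
     {{p \<in> space M \<times> {0..}. Z (snd p) (fst p) \<in> B} | Z B.
        adapted M F (Z :: real \<Rightarrow> 'a \<Rightarrow> real) \<and>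
        (\<forall>\<omega>\<in>space M. \<forall>t>0. continuous (at_left t) (\<lambda>s. Z s \<omega>)) \<and>
        B \<in> sets (borel :: real measure)}"

definition predictable :: "'a measure \<Rightarrow> (real \<Rightarrow> 'a measure) \<Rightarrow> (real \<Rightarrow> 'a \<Rightarrow> 'b::topological_space) \<Rightarrow> bool" where
  "predictable M F Z \<longleftrightarrow> (\<lambda>p. Z (snd p) (fst p)) \<in> borel_measurable (pred_sigma M F)"

definition indist :: "'a measure \<Rightarrow> (real \<Rightarrow> 'a \<Rightarrow> 'b) \<Rightarrow> (real \<Rightarrow> 'a \<Rightarrow> 'b) \<Rightarrow> bool" where
  "indist M Y Y' \<longleftrightarrow> (AE \<omega> in M. \<forall>t\<ge>0. Y t \<omega> = Y' t \<omega>)"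

definition supermartingale :: "'a measure \<Rightarrow> (real \<Rightarrow> 'a measure) \<Rightarrow> (real \<Rightarrow> 'a \<Rightarrow> real) \<Rightarrow> bool" where
  "supermartingale M F V \<longleftrightarrow> adapted M F V \<and> (\<forall>t\<ge>0. integrable M (V t)) \<and>
     (\<forall>s t. 0 \<le> s \<longrightarrow> s \<le> t \<longrightarrow> (AE \<omega> in M. real_cond_exp M (F s) (V t) \<omega> \<le> V s \<omega>))"

definition jump :: "(real \<Rightarrow> 'a \<Rightarrow> real^'n) \<Rightarrow> 'a \<Rightarrow> real \<Rightarrow> real^'n" where
  "jump X \<omega> s = X s \<omega> - Lim (at_left s) (\<lambda>r. X r \<omega>)"

definition cont_part :: "(real \<Rightarrow> 'a \<Rightarrow> real^'n) \<Rightarrow> real \<Rightarrow> 'a \<Rightarrow> real^'n" where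
  "cont_part X t \<omega> = X t \<omega> - infsum (jump X \<omega>) {0<..t}"

definition jump_measure :: "(real \<Rightarrow> 'a \<Rightarrow> real^'n) \<Rightarrow> 'a \<Rightarrow> (real \<times> (real^'n)) measure" where
  "jump_measure X \<omega> = measure_of UNIV (sets borel)
     (\<lambda>A. \<integral>\<^sup>+ s. indicator A (s, jump X \<omega> s) \<partial>count_space {s. 0 < s \<and> jump X \<omega> s \<noteq> 0})"

definition compensator :: "'a measure \<Rightarrow> (real \<Rightarrow> 'a measure) \<Rightarrow> (real \<Rightarrow> 'a \<Rightarrow> real^'n)
    \<Rightarrow> ('a \<Rightarrow> (real \<times> (real^'n)) measure) \<Rightarrow> bool" where
  "compensator M F X \<nu> \<longleftrightarrow>
     (\<forall>\<omega>\<in>space M. sets (\<nu> \<omega>) = sets borel \<and>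
        emeasure (\<nu> \<omega>) ({..0} \<times> UNIV) = 0 \<and> emeasure (\<nu> \<omega>) (UNIV \<times> (UNIV - nonneg_vecs)) = 0) \<and>
     (\<forall>A \<in> sets borel. (\<lambda>\<omega>. emeasure (\<nu> \<omega>) A) \<in> borel_measurable M) \<and>
     (\<forall>W :: ('a \<times> real) \<times> (real^'n) \<Rightarrow> ennreal.
        W \<in> borel_measurable (pred_sigma M F \<Otimes>\<^sub>M borel) \<longrightarrow>
          (\<lambda>p. \<integral>\<^sup>+ q. indicator {0<..snd p} (fst q) * W ((fst p, fst q), snd q) \<partial>\<nu> (fst p))
             \<in> borel_measurable (pred_sigma M F) \<and>
          (\<integral>\<^sup>+ \<omega>. (\<integral>\<^sup>+ q. indicator {0<..} (fst q) * W ((\<omega>, fst q), snd q) \<partial>jump_measure X \<omega>) \<partial>M) =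
          (\<integral>\<^sup>+ \<omega>. (\<integral>\<^sup>+ q. indicator {0<..} (fst q) * W ((\<omega>, fst q), snd q) \<partial>\<nu> \<omega>) \<partial>M))"

definition nubar :: "('a \<Rightarrow> (real \<times> (real^'n)) measure) \<Rightarrow> 'a \<Rightarrow> real \<Rightarrow> real" where
  "nubar \<nu> \<omega> t = enn2real (emeasure (\<nu> \<omega>) ({t} \<times> nonneg_vecs))"

definition nu_at_int :: "('a \<Rightarrow> (real \<times> (real^'n)) measure) \<Rightarrow> 'a \<Rightarrow> real \<Rightarrow> (real^'n \<Rightarrow> real) \<Rightarrow> ennreal" where
  "nu_at_int \<nu> \<omega> t f = (\<integral>\<^sup>+ q. indicator ({t} \<times> nonneg_vecs) q * ennreal (f (snd q)) \<partial>\<nu> \<omega>)"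

definition Gproc :: "(real \<Rightarrow> 'a \<Rightarrow> real^'n) \<Rightarrow> ('a \<Rightarrow> (real \<times> (real^'n)) measure) \<Rightarrow> real \<Rightarrow> 'a \<Rightarrow> real" where
  "Gproc X \<nu> t \<omega> = l1 (cont_part X t \<omega>) +
     enn2real (\<integral>\<^sup>+ q. indicator ({0<..t} \<times> UNIV) q * ennreal (min (l1 (snd q)) 1) \<partial>\<nu> \<omega>)"

definition Gamma1 :: "('a \<Rightarrow> (real \<times> (real^'n)) measure) \<Rightarrow> 'a \<Rightarrow> real \<Rightarrow> real \<Rightarrow> bool" where
  "Gamma1 \<nu> \<omega> t c \<longleftrightarrow> (0 < nubar \<nu> \<omega> t \<and> nubar \<nu> \<omega> t < 1) \<or>
     (nubar \<nu> \<omega> t = 1 \<and> nu_at_int \<nu> \<omega> t (\<lambda>x. c / l1 x) > 1)"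

definition zstar :: "('a \<Rightarrow> (real \<times> (real^'n)) measure) \<Rightarrow> 'a \<Rightarrow> real \<Rightarrow> real \<Rightarrow> real" where
  "zstar \<nu> \<omega> t c = (THE z. 0 < z \<and> z < c \<and>
     enn2ereal (nu_at_int \<nu> \<omega> t (\<lambda>x. c / (z + l1 x))) = ereal (1 - c / z * (1 - nubar \<nu> \<omega> t)))"

definition zeta :: "('a \<Rightarrow> (real \<times> (real^'n)) measure) \<Rightarrow> 'a \<Rightarrow> real \<Rightarrow> real \<Rightarrow> real" where
  "zeta \<nu> \<omega> t c = (if nubar \<nu> \<omega> t = 0 then c
                    else if Gamma1 \<nu> \<omega> t c then zstar \<nu> \<omega> t c else 0)"

definition lam_hat :: "('a \<Rightarrow> (real \<times> (real^'n)) measure) \<Rightarrow> ('a \<Rightarrow> real \<Rightarrow> real^'n)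
    \<Rightarrow> ('a \<Rightarrow> real \<Rightarrow> (real^'n) measure) \<Rightarrow> 'a \<Rightarrow> real \<Rightarrow> real \<Rightarrow> real^'n" where
  "lam_hat \<nu> b K \<omega> t c = (if c = 0 then 0 else
     (1 / c) *\<^sub>R b \<omega> t + (\<integral> x. (1 / (zeta \<nu> \<omega> t c + l1 x)) *\<^sub>R x \<partial>K \<omega> t))"

definition L_hat :: "(real \<Rightarrow> 'a \<Rightarrow> real^'n) \<Rightarrow> ('a \<Rightarrow> (real \<times> (real^'n)) measure) \<Rightarrow> ('a \<Rightarrow> real \<Rightarrow> real^'n)
    \<Rightarrow> ('a \<Rightarrow> real \<Rightarrow> (real^'n) measure) \<Rightarrow> real^'m \<Rightarrow> 'm \<Rightarrow> 'a \<Rightarrow> (real \<Rightarrow> real^'m) \<Rightarrow> real \<Rightarrow> real^'n" where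
  "L_hat X \<nu> b K y0 m \<omega> y t = (\<chi> n. LINT s:{0<..t}|LS (\<lambda>r. Gproc X \<nu> r \<omega>).
      (leftlim y0 y s $ m) * (lam_hat \<nu> b K \<omega> s (l1 (leftlim y0 y s)) $ n))"

definition PZ :: "'a measure \<Rightarrow> (real \<Rightarrow> 'a \<Rightarrow> real) \<Rightarrow> ('a \<times> real) set \<Rightarrow> ennreal" where
  "PZ M Z A = (\<integral>\<^sup>+ \<omega>. (\<integral>\<^sup>+ s. indicator A (\<omega>, s) \<partial>LS (\<lambda>r. Z r \<omega>)) \<partial>M)"

text \<open>l is a predictable version of the Lebesgue derivative dZ/dH of P\<otimes>Z w.r.t. P\<otimes>H on \<P>.\<close>
definition leb_deriv :: "'a measure \<Rightarrow> (real \<Rightarrow> 'a measure) \<Rightarrow> (real \<Rightarrow> 'a \<Rightarrow> real)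
    \<Rightarrow> (real \<Rightarrow> 'a \<Rightarrow> real) \<Rightarrow> ('a \<Rightarrow> real \<Rightarrow> real) \<Rightarrow> bool" where
  "leb_deriv M F Z H l \<longleftrightarrow>
     (\<lambda>p. l (fst p) (snd p)) \<in> borel_measurable (pred_sigma M F) \<and>
     (\<forall>\<omega>\<in>space M. \<forall>t\<ge>0. 0 \<le> l \<omega> t) \<and>
     (\<exists>\<Gamma>\<in>sets (pred_sigma M F). PZ M H \<Gamma> = 0 \<and>
        (\<forall>A\<in>sets (pred_sigma M F).
           PZ M Z A = (\<integral>\<^sup>+ \<omega>. (\<integral>\<^sup>+ s. indicator A (\<omega>, s) * ennreal (l \<omega> s) \<partial>LS (\<lambda>r. H r \<omega>)) \<partial>M)
                      + PZ M Z (A \<inter> \<Gamma>)))"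

definition wealth_process :: "'a measure \<Rightarrow> (real \<Rightarrow> 'a measure) \<Rightarrow> (real \<Rightarrow> 'a \<Rightarrow> real^'n)
    \<Rightarrow> (real \<Rightarrow> 'a \<Rightarrow> real) \<Rightarrow> ('m \<Rightarrow> 'a \<Rightarrow> (real \<Rightarrow> real^'m) \<Rightarrow> real \<Rightarrow> real^'n)
    \<Rightarrow> real^'m \<Rightarrow> (real \<Rightarrow> 'a \<Rightarrow> real^'m) \<Rightarrow> bool" where
  "wealth_process M F X H Lp y0 Y \<longleftrightarrow>
     adapted M F Y \<and>
     (\<forall>\<omega>\<in>space M. \<forall>t\<ge>0. Y t \<omega> \<in> nonneg_vecs) \<and>
     (\<forall>\<omega>\<in>space M. cadlag (\<lambda>t. Y t \<omega>)) \<and>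
     (\<exists>l :: 'm \<Rightarrow> 'n \<Rightarrow> 'a \<Rightarrow> real \<Rightarrow> real.
        (\<forall>m n. leb_deriv M F (\<lambda>t \<omega>. Lp m \<omega> (\<lambda>s. Y s \<omega>) t $ n) H (l m n)) \<and>
        (\<forall>m. AE \<omega> in M. \<forall>t\<ge>0.
           Y t \<omega> $ m = y0 $ m - l1 (Lp m \<omega> (\<lambda>s. Y s \<omega>) t)
             + (\<Sum>n\<in>UNIV. LINT s:{0<..t}|LS (\<lambda>r. X r \<omega> $ n).
                   l m n \<omega> s / (\<Sum>m'\<in>UNIV. \<bar>l m' n \<omega> s\<bar>)))) \<and>
     (\<forall>\<omega>\<in>space M. \<forall>m. \<forall>t\<ge>0.
        (Y t \<omega> $ m = 0 \<or> leftlim y0 (\<lambda>s. Y s \<omega>) t $ m = 0) \<longrightarrow>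
        (\<forall>s\<ge>t. Lp m \<omega> (\<lambda>r. Y r \<omega>) s = leftlim 0 (\<lambda>r. Lp m \<omega> (\<lambda>r'. Y r' \<omega>) r) t
                \<and> Y s \<omega> $ m = 0))"

definition feasible :: "'a measure \<Rightarrow> (real \<Rightarrow> 'a measure) \<Rightarrow> (real \<Rightarrow> 'a \<Rightarrow> real^'n)
    \<Rightarrow> (real \<Rightarrow> 'a \<Rightarrow> real) \<Rightarrow> ('m \<Rightarrow> 'a \<Rightarrow> (real \<Rightarrow> real^'m) \<Rightarrow> real \<Rightarrow> real^'n)
    \<Rightarrow> real^'m \<Rightarrow> bool" where
  "feasible M F X H Lp y0 \<longleftrightarrow> (\<forall>m. 0 < y0 $ m) \<and>
     (\<exists>Y. wealth_process M F X H Lp y0 Y \<and>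
          (\<forall>Y'. wealth_process M F X H Lp y0 Y' \<longrightarrow> indist M Y Y'))"

end

theory Submission
  imports Defs
begin

text \<open>
  The number z of the strategy is the wealth left after investing before a payoff: it solves
  E (c / (z + |jump|)) = 1 (the jump being completed by an atom at 0), so that W jumps from c to z + |jump|
  and 1 / W has mean at most 1 / c afterwards; continuous payoffs are returned to the investors exactly.
  To make this rigorous without integrability assumptions, 1 / (e + W) is used instead of 1 / W and its
  jumps are compensated along a predictable localising set of times; then e tends to 0. This gives both
  the positivity of W and the supermartingale property, and the limit follows from the convergence theorem.
  If \<nu> has no fixed atoms, the balance for 1 / (e + W) is an equality whose drift is the \<nu>-integral of
  e a^2 / ((e + w)^2 (w + a) (e + w + a)), with a the payoff and w the wealth. Its finiteness for e = 1 shows that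
  the quadratic activity is finite where W stays bounded; conversely, while the quadratic activity is
  bounded, letting e tend to infinity excludes that W tends to infinity.
\<close>

section \<open>Nonnegative integrals, at most one factor measurable\<close>

text \<open>A payoff is shared in the proportions l/|l| with 0/0 = 0, so it is lost in an asset in
  which nobody invests. The strategy excludes this up to null sets of dG and of \<nu>; for the jumps
  of X themselves the compensator only yields an equality of means. Hence the pathwise statements
  keep the payoff \<open>xl\<close> of the assets in use, and the full payoff |x| enters together
  with \<nu>. The sum over the jumps of X is not known to be measurable in \<omega>, which is why
  nonnegative integrals of arbitrary functions are added by inequalities. Balances are written as
  relations between nonnegative terms, with gains on one side and losses on the other, and a term is
  cancelled only after its mean has been shown to be finite. For this the times are restricted to {A
  \<le> k}, where A is the jump part of G. The inequality for a fixed jump rests on concavity: 1/(e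
  + w) is a concave function of 1/w, so the bound on the mean of 1/w carries over to every e >
  0.\<close>

lemma nn_integral_superadditive:
  "(\<integral>\<^sup>+x. f x \<partial>M) + (\<integral>\<^sup>+x. g x \<partial>M) \<le> (\<integral>\<^sup>+x. f x + g x \<partial>M)"
proof -
  have "(\<integral>\<^sup>+x. f x \<partial>M) + (\<integral>\<^sup>+x. g x \<partial>M) =
     (SUP s\<in>{s. simple_function M s \<and> s \<le> f}. integral\<^sup>S M s) + (SUP s\<in>{s. simple_function M s \<and> s \<le> g}. integral\<^sup>S M s)"
    by (simp add: nn_integral_def)
  also have "\<dots> = (SUP s\<in>{s. simple_function M s \<and> s \<le> f}. SUP s'\<in>{s. simple_function M s \<and> s \<le> g}. integral\<^sup>S M s + integral\<^sup>S M s')"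
  proof -
    have "{s. simple_function M s \<and> s \<le> f} \<noteq> {}" "{s. simple_function M s \<and> s \<le> g} \<noteq> {}"
      by (auto intro!: exI[of _ "\<lambda>_. 0"] simp: le_fun_def)
    then show ?thesis
      by (subst ennreal_SUP_add_left[symmetric], simp)
         (intro SUP_cong refl, subst ennreal_SUP_add_right[symmetric], simp_all)
  qed
  also have "\<dots> \<le> (\<integral>\<^sup>+x. f x + g x \<partial>M)"
  proof (intro SUP_least, clarsimp)
    fix s s' assume *: "simple_function M s" "s \<le> f" "simple_function M s'" "s' \<le> g"
    then have "integral\<^sup>S M s + integral\<^sup>S M s' = (\<integral>\<^sup>+x. s x + s' x \<partial>M)"
      by (simp add: nn_integral_eq_simple_integral[symmetric] nn_integral_add borel_measurable_simple_function)
    also have "\<dots> \<le> (\<integral>\<^sup>+x. f x + g x \<partial>M)"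
      using * by (intro nn_integral_mono add_mono) (auto simp: le_fun_def)
    finally show "integral\<^sup>S M s + integral\<^sup>S M s' \<le> (\<integral>\<^sup>+x. f x + g x \<partial>M)" .
  qed
  finally show ?thesis .
qed

text \<open>A simple function s below f + g leaves s - f below g wherever f is finite, so
  measurability is asked of f alone. Together with superadditivity this gives additivity when one
  summand is measurable with finite integral.\<close>

lemma nn_integral_add_le_left_measurable:
  assumes f: "f \<in> borel_measurable M" and fin: "(\<integral>\<^sup>+x. f x \<partial>M) < \<infinity>"
  shows "(\<integral>\<^sup>+x. f x + g x \<partial>M) \<le> (\<integral>\<^sup>+x. f x \<partial>M) + (\<integral>\<^sup>+x. g x \<partial>M)"
  unfolding nn_integral_def[of M "\<lambda>x. f x + g x"]
proof (intro SUP_least, clarsimp)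
  fix s assume s: "simple_function M s" "s \<le> (\<lambda>x. f x + g x)"
  note [measurable] = f borel_measurable_simple_function[OF s(1)]
  have "integral\<^sup>S M s = (\<integral>\<^sup>+x. s x \<partial>M)"
    using s by (simp add: nn_integral_eq_simple_integral)
  also have "\<dots> \<le> (\<integral>\<^sup>+x. f x + (s x - f x) \<partial>M)"
  proof (intro nn_integral_mono)
    fix x show "s x \<le> f x + (s x - f x)"
      by (cases "f x \<le> s x") (auto simp: add_diff_inverse_ennreal intro: add_increasing2)
  qed
  also have "\<dots> = (\<integral>\<^sup>+x. f x \<partial>M) + (\<integral>\<^sup>+x. s x - f x \<partial>M)"
    by (intro nn_integral_add) auto
  also have "(\<integral>\<^sup>+x. s x - f x \<partial>M) \<le> (\<integral>\<^sup>+x. g x \<partial>M)"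
  proof (rule nn_integral_mono_AE)
    have "AE x in M. f x \<noteq> \<infinity>"
      using nn_integral_noteq_infinite[OF f] fin by auto
    then show "AE x in M. s x - f x \<le> g x"
    proof eventually_elim
      case (elim x)
      then show ?case
        using s(2) by (metis ennreal_minus_le_iff le_fun_def infinity_ennreal_def)
    qed
  qed
  finally show "integral\<^sup>S M s \<le> (\<integral>\<^sup>+x. f x \<partial>M) + (\<integral>\<^sup>+x. g x \<partial>M)"
    by (simp add: add_left_mono)
qed

text \<open>Over a countable set an integral is the sum of the values weighted by the atoms. This
  turns the parts of dX and dG that sit on fixed times into sums over times.\<close>

lemma nn_integral_atoms:
  assumes f: "f \<in> borel_measurable M" and X: "countable X" "\<And>x. x \<in> X \<Longrightarrow> {x} \<in> sets M"
  shows "(\<integral>\<^sup>+x\<in>X. f x \<partial>M) = (\<integral>\<^sup>+x. f x * emeasure M {x} \<partial>count_space X)"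
proof -
  have XM: "X \<in> sets M" using sets.countable[OF X(2) X(1)] by auto
  have "(\<integral>\<^sup>+x\<in>X. f x \<partial>M) = emeasure (density M f) X"
    using f XM by (simp add: emeasure_density)
  also have "\<dots> = (\<integral>\<^sup>+x. emeasure (density M f) {x} \<partial>count_space X)"
    using X by (intro emeasure_countable_singleton) auto
  also have "\<dots> = (\<integral>\<^sup>+x. f x * emeasure M {x} \<partial>count_space X)"
    using f X by (intro nn_integral_cong) (simp add: emeasure_density nn_integral_indicator_singleton)
  finally show ?thesis .
qed

section \<open>Measures on the half line given by their values on intervals\<close>

lemma measure_eqI_Ioc0:
  fixes N N' :: "real measure"
  assumes sets: "sets N = sets borel" "sets N' = sets borel"
    and zero: "emeasure N {..0} = 0" "emeasure N' {..0} = 0"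
    and eq: "\<And>t. t \<ge> 0 \<Longrightarrow> emeasure N {0<..t} = emeasure N' {0<..t}"
    and fin: "\<And>t. t \<ge> 0 \<Longrightarrow> emeasure N {0<..t} < \<infinity>"
  shows "N = N'"
proof (rule measure_eqI_generator_eq[where E="range atMost" and A="\<lambda>i. {..real i}" and \<Omega>=UNIV])
  have split: "emeasure K {..t} = emeasure K {0<..t}" if "t \<ge> 0" "sets K = sets borel" "emeasure K {..0} = 0" for t and K :: "real measure"
  proof -
    have "emeasure K {..t} = emeasure K ({..0} \<union> {0<..t})"
      using that by (intro arg_cong[where f="emeasure K"]) auto
    also have "\<dots> = emeasure K {..0} + emeasure K {0<..t}"
      using that by (intro plus_emeasure[symmetric]) auto
    finally show ?thesis using that by simp
  qed
  have neg: "emeasure K {..t} = 0" if "t < 0" "sets K = sets borel" "emeasure K {..0} = 0" for t and K :: "real measure"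
    using that emeasure_mono[of "{..t}" "{..0}" K] by auto
  show "Int_stable (range atMost :: real set set)" by (auto simp: Int_stable_def)
  show "emeasure N X = emeasure N' X" if X: "X \<in> range atMost" for X
  proof -
    obtain t where t: "X = {..t}" using X by auto
    show ?thesis
    proof (cases "t \<ge> 0")
      case True
      then show ?thesis unfolding t
        using split[OF True sets(1) zero(1)] split[OF True sets(2) zero(2)] eq[OF True] by simp
    next
      case False
      then show ?thesis unfolding t using neg[OF _ sets(1) zero(1)] neg[OF _ sets(2) zero(2)] by auto
    qed
  qed
  show "sets N = sigma_sets UNIV (range atMost)" "sets N' = sigma_sets UNIV (range atMost)"
    using sets by (simp_all add: borel_eq_atMost[where 'a=real])
  show "(\<Union>i. {..real i}) = UNIV" by (auto simp: real_arch_simple)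
  show "emeasure N {..real i} \<noteq> \<infinity>" for i
    using split[of "real i" N] fin[of "real i"] sets(1) zero(1) by simp
qed auto

text \<open>Holds for every F: by definition \<open>interval_measure\<close> is either a measure
  with the prescribed values or the zero measure. This breaks a circle, because G is shown to be
  right-continuous and nondecreasing from integrals against the measure that G itself
  induces.\<close>

lemma finite_interval_measure:
  "emeasure (interval_measure F) {a<..b} < \<infinity>"
proof (cases "a \<le> b")
  case True
  let ?I = "{(a::real, b). a \<le> b}"
  let ?G = "\<lambda>(a::real, b). {a<..b}"
  let ?m = "\<lambda>(a, b). ennreal (F b - F a)"
  let ?P = "\<lambda>\<mu>'. (\<forall>i\<in>?I. \<mu>' (?G i) = ?m i) \<and> measure_space UNIV (sigma_sets UNIV (?G ` ?I)) \<mu>'"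
  show ?thesis
  proof (cases "(\<exists>\<mu>'. ?P \<mu>') \<and> \<not> (\<forall>i\<in>?I. ?m i = 0)")
    case T: True
    then have eq: "interval_measure F = measure_of UNIV (?G ` ?I) (SOME \<mu>'. ?P \<mu>')"
      unfolding interval_measure_def extend_measure_def by (rule if_P)
    have P: "?P (SOME \<mu>'. ?P \<mu>')" using T by (intro someI_ex[of ?P]) simp
    define \<mu>' where "\<mu>' = (SOME \<mu>'. ?P \<mu>')"
    have P1: "\<mu>' (?G (a,b)) = ?m (a,b)" using P True unfolding \<mu>'_def[symmetric] by blast
    have P2: "measure_space UNIV (sigma_sets UNIV (?G ` ?I)) \<mu>'" using P unfolding \<mu>'_def[symmetric] by blast
    have sets: "sets (interval_measure F) = sigma_sets UNIV (?G ` ?I)"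
      unfolding interval_measure_def by (intro sets_extend_measure) auto
    have "emeasure (interval_measure F) (?G (a,b)) = \<mu>' (?G (a,b))"
    proof (rule emeasure_measure_of[OF eq[folded \<mu>'_def]])
      show "?G (a, b) \<in> sets (interval_measure F)" by simp
      show "positive (sets (interval_measure F)) \<mu>'" "countably_additive (sets (interval_measure F)) \<mu>'"
        using P2 unfolding sets measure_space_def by auto
    qed auto
    also note P1
    finally show ?thesis by simp
  next
    case F: False
    then have eq: "interval_measure F = measure_of UNIV (?G ` ?I) (\<lambda>_. 0)"
      unfolding interval_measure_def extend_measure_def by (rule if_not_P)
    have "emeasure (interval_measure F) {a<..b} = 0"
      by (simp add: eq emeasure_sigma)
    then show ?thesis by simp
  qed
qed simp

lemma sets_LS [simp, measurable_cong]: "sets (LS F) = sets borel"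
  by (simp add: LS_def)

lemma space_LS [simp]: "space (LS F) = UNIV"
  by (simp add: LS_def)

lemma finite_LS: "emeasure (LS F) {a<..b} < \<infinity>"
  unfolding LS_def by (rule finite_interval_measure)

text \<open>The regularity under which \<open>LS F\<close> gives {a<..b} the mass F b - F a; to the
  left of 0 the path is extended by a constant.\<close>

definition rc_mono :: "(real \<Rightarrow> real) \<Rightarrow> bool" where
  "rc_mono F \<longleftrightarrow> mono_on {0..} F \<and> (\<forall>t\<ge>0. continuous (at_right t) F)"

lemma rc_mono_extend:
  assumes "rc_mono F"
  shows "x \<le> y \<Longrightarrow> F (max x 0) \<le> F (max y 0)" "continuous (at_right a) (\<lambda>s. F (max s 0))"
proof -
  show "x \<le> y \<Longrightarrow> F (max x 0) \<le> F (max y 0)"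
    using assms by (auto simp: rc_mono_def mono_on_def)
  show "continuous (at_right a) (\<lambda>s. F (max s 0))"
  proof (cases "a \<ge> 0")
    case True
    have "(F \<longlongrightarrow> F a) (at_right a)" using assms True by (auto simp: rc_mono_def continuous_within)
    then have "((\<lambda>s. F (max s 0)) \<longlongrightarrow> F a) (at_right a)"
      by (rule Lim_transform_eventually) (use True in \<open>auto simp: eventually_at_filter max_def\<close>)
    then show ?thesis using True by (simp add: continuous_within max_def)
  next
    case False
    have "((\<lambda>s. F (max s 0)) \<longlongrightarrow> F 0) (at_right a)"
    proof (rule tendsto_eventually)
      show "\<forall>\<^sub>F s in at_right a. F (max s 0) = F 0"
        using False eventually_at_right[of a 0 "\<lambda>s. F (max s 0) = F 0"] by (auto intro!: exI[of _ 0])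
    qed
    then show ?thesis using False by (simp add: continuous_within max_def)
  qed
qed

lemma emeasure_LS_Ioc:
  assumes "rc_mono F" "0 \<le> a" "a \<le> b"
  shows "emeasure (LS F) {a<..b} = ennreal (F b - F a)"
  unfolding LS_def using assms rc_mono_extend[OF assms(1)]
  by (subst emeasure_interval_measure_Ioc) (auto simp: max_absorb1)

lemma emeasure_LS_nonpos:
  assumes "rc_mono F"
  shows "emeasure (LS F) {..0} = 0"
proof -
  have "emeasure (LS F) (\<Union>i. {- real i<..0}) = 0"
    unfolding LS_def using rc_mono_extend[OF assms]
    by (intro emeasure_UN_eq_0) (auto simp: emeasure_interval_measure_Ioc)
  moreover have "(\<Union>i. {- real i<..0}) = {..0::real}"
  proof (intro equalityI subsetI)
    fix x :: real assume "x \<in> {..0}"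
    moreover obtain i where "- x < real i" using reals_Archimedean2 by blast
    ultimately show "x \<in> (\<Union>i. {- real i<..0})" by (auto intro!: exI[of _ i])
  qed auto
  ultimately show ?thesis by simp
qed

lemma LS_eqI:
  assumes F: "rc_mono F" and N: "sets N = sets borel" "emeasure N {..0} = 0"
    and eq: "\<And>t. t \<ge> 0 \<Longrightarrow> emeasure N {0<..t} = ennreal (F t - F 0)"
  shows "LS F = N"
  using assms emeasure_LS_nonpos[OF F]
  by (intro measure_eqI_Ioc0) (auto simp: emeasure_LS_Ioc)

text \<open>The measure is only locally finite, so its atoms are collected from the restrictions to
  bounded intervals.\<close>

lemma countable_atoms_LS: "countable {s. emeasure (LS F) {s} \<noteq> 0}"
proof -
  have "countable {s. measure (density (LS F) (indicator {-real i<..real i})) {s} \<noteq> 0}" for i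
    by (intro finite_measure.countable_support finite_measureI)
       (use finite_LS[of F "-real i" "real i"] in \<open>auto simp: emeasure_density\<close>)
  then have "countable (\<Union>i. {s. measure (density (LS F) (indicator {-real i<..real i})) {s} \<noteq> 0})"
    by auto
  moreover have "{s. emeasure (LS F) {s} \<noteq> 0} \<subseteq> (\<Union>i. {s. measure (density (LS F) (indicator {-real i<..real i})) {s} \<noteq> 0})"
  proof clarsimp
    fix s assume s: "emeasure (LS F) {s} \<noteq> 0"
    obtain i where i: "\<bar>s\<bar> < real i" using reals_Archimedean2 by blast
    have "emeasure (LS F) {s} \<le> emeasure (LS F) {-real i<..real i}"
      using i by (intro emeasure_mono) auto
    then have "emeasure (LS F) {s} < \<infinity>" using finite_LS by (meson order_le_less_trans)
    then have "measure (density (LS F) (indicator {-real i<..real i})) {s} \<noteq> 0"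
      using s i by (subst measure_def, subst emeasure_density)
        (auto simp: nn_integral_indicator_singleton enn2real_eq_0_iff minus_less_iff abs_less_iff)
    then show "\<exists>i. measure (density (LS F) (indicator {-real i<..real i})) {s} \<noteq> 0" ..
  qed
  ultimately show ?thesis by (rule countable_subset[rotated])
qed

section \<open>Cadlag paths\<close>

lemma cadlag_leftlim:
  fixes f :: "real \<Rightarrow> 'b::t2_space"
  assumes "cadlag f" "t > 0"
  shows "(f \<longlongrightarrow> leftlim c f t) (at_left t)"
proof -
  obtain l where l: "(f \<longlongrightarrow> l) (at_left t)" using assms unfolding cadlag_def by (meson less_imp_le)
  then have "Lim (at_left t) f = l" by (intro tendsto_Lim) auto
  then show ?thesis using l assms by (simp add: leftlim_def)
qed

lemma cadlag_right:
  assumes "cadlag f" "t \<ge> 0"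
  shows "(f \<longlongrightarrow> f t) (at_right t)"
  using assms by (auto simp: cadlag_def continuous_within)

text \<open>The denominators n + 2 keep the sequence strictly between 0 and t, so that adaptedness
  can be used along it.\<close>

lemma at_left_approx: "filterlim (\<lambda>n. t - t / real (n + 2)) (at_left t) sequentially" if "t > 0" for t :: real
  unfolding filterlim_at
proof
  show "\<forall>\<^sub>F n in sequentially. t - t / real (n + 2) \<in> {..<t} \<and> t - t / real (n + 2) \<noteq> t"
    using that by (auto simp: field_simps)
  have "(\<lambda>n. t / real (n + 2)) \<longlonglongrightarrow> 0"
    by (rule LIMSEQ_ignore_initial_segment[where f="\<lambda>n. t / real n"]) (rule lim_const_over_n)
  from tendsto_diff[OF tendsto_const[of t] this] show "(\<lambda>n. t - t / real (n + 2)) \<longlonglongrightarrow> t" by simp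
qed

text \<open>Near t the path is within e/2 of its left limit, and this closed bound is inherited by
  the left limits at neighbouring times.\<close>

lemma leftlim_leftcont:
  fixes f :: "real \<Rightarrow> 'b::metric_space"
  assumes f: "cadlag f" and t: "t > 0"
  shows "(leftlim c f \<longlongrightarrow> leftlim c f t) (at_left t)"
proof (rule tendstoI)
  fix e :: real assume e: "e > 0"
  have "\<forall>\<^sub>F x in at_left t. dist (f x) (leftlim c f t) < e / 2"
    using cadlag_leftlim[OF assms, of c] e by (intro tendstoD) auto
  then obtain b where b: "b < t" "\<And>x. b < x \<Longrightarrow> x < t \<Longrightarrow> dist (f x) (leftlim c f t) < e / 2"
    by (auto simp: eventually_at_left_field)
  have "dist (leftlim c f x) (leftlim c f t) < e" if x: "max b 0 < x" "x < t" for x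
  proof -
    have "((\<lambda>y. dist (f y) (leftlim c f t)) \<longlongrightarrow> dist (leftlim c f x) (leftlim c f t)) (at_left x)"
      using x by (intro tendsto_dist cadlag_leftlim f tendsto_const) auto
    moreover have "\<forall>\<^sub>F y in at_left x. dist (f y) (leftlim c f t) \<le> e / 2"
      using x b(2) unfolding eventually_at_left_field by (intro exI[of _ "max b 0"]) (auto simp: less_imp_le)
    ultimately have "dist (leftlim c f x) (leftlim c f t) \<le> e / 2"
      by (intro tendsto_upperbound) auto
    then show ?thesis using e by simp
  qed
  then show "\<forall>\<^sub>F x in at_left t. dist (leftlim c f x) (leftlim c f t) < e"
    using b(1) t unfolding eventually_at_left_field by (intro exI[of _ "max b 0"]) auto
qed

text \<open>The one-sided limits bound the path near each point, separately on both sides, and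
  compactness of {0..t} leaves finitely many bounds.\<close>

lemma cadlag_bounded:
  fixes f :: "real \<Rightarrow> real"
  assumes f: "cadlag f" and t: "t \<ge> 0"
  shows "\<exists>B. \<forall>s\<in>{0..t}. \<bar>f s\<bar> \<le> B"
proof -
  have ex: "\<exists>e>0. \<exists>B. \<forall>y\<in>{0..t}. \<bar>y - x\<bar> < e \<longrightarrow> \<bar>f y\<bar> \<le> B" if x: "x \<in> {0..t}" for x
  proof -
    have "\<forall>\<^sub>F y in at_right x. dist (f y) (f x) < 1"
      using x by (intro tendstoD cadlag_right f) auto
    then obtain b where b: "b > x" "\<And>y. x < y \<Longrightarrow> y < b \<Longrightarrow> dist (f y) (f x) < 1"
      by (auto simp: eventually_at_right_field)
    have "\<exists>a<x. \<exists>B. \<forall>y\<in>{0..t}. a < y \<longrightarrow> y < x \<longrightarrow> \<bar>f y\<bar> \<le> B"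
    proof (cases "x > 0")
      case True
      have "\<forall>\<^sub>F y in at_left x. dist (f y) (leftlim 0 f x) < 1"
        using x True by (intro tendstoD cadlag_leftlim f) auto
      then obtain a where a: "a < x" "\<And>y. a < y \<Longrightarrow> y < x \<Longrightarrow> dist (f y) (leftlim 0 f x) < 1"
        by (auto simp: eventually_at_left_field)
      show ?thesis
        using a by (intro exI[of _ a] conjI exI[of _ "1 + \<bar>leftlim 0 f x\<bar>"]) (force simp: dist_real_def)+
    next
      case False
      then show ?thesis by (intro exI[of _ "x - 1"]) auto
    qed
    then obtain a B where a: "a < x" "\<And>y. y \<in> {0..t} \<Longrightarrow> a < y \<Longrightarrow> y < x \<Longrightarrow> \<bar>f y\<bar> \<le> B" by metis
    have "\<forall>y\<in>{0..t}. \<bar>y - x\<bar> < min (x - a) (b - x) \<longrightarrow> \<bar>f y\<bar> \<le> max B (1 + \<bar>f x\<bar>)"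
    proof (intro ballI impI)
      fix y assume y: "y \<in> {0..t}" "\<bar>y - x\<bar> < min (x - a) (b - x)"
      consider "y < x" | "y = x" | "y > x" by linarith
      then show "\<bar>f y\<bar> \<le> max B (1 + \<bar>f x\<bar>)"
      proof cases
        case 1 then show ?thesis using a(2)[of y] y by (auto simp: le_max_iff_disj)
      next
        case 3 then show ?thesis using b(2)[of y] y by (auto simp: dist_real_def le_max_iff_disj)
      qed (auto simp: le_max_iff_disj)
    qed
    moreover have "min (x - a) (b - x) > 0" using a b by auto
    ultimately show ?thesis by blast
  qed
  then obtain e B where eB: "\<And>x. x \<in> {0..t} \<Longrightarrow> e x > 0"
    "\<And>x y. x \<in> {0..t} \<Longrightarrow> y \<in> {0..t} \<Longrightarrow> \<bar>y - x\<bar> < e x \<Longrightarrow> \<bar>f y\<bar> \<le> (B x :: real)" by metis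
  have "{0..t} \<subseteq> (\<Union>x\<in>{0..t}. ball x (e x))" using eB(1) by (auto intro!: bexI)
  then obtain I where I: "I \<subseteq> {0..t}" "finite I" "{0..t} \<subseteq> (\<Union>x\<in>I. ball x (e x))"
    using compactE_image[of "{0..t}" "{0..t}" "\<lambda>x. ball x (e x)"] by auto
  have "I \<noteq> {}" using I t by auto
  show ?thesis
  proof (intro exI[of _ "Max (B ` I)"] ballI)
    fix s assume s: "s \<in> {0..t}"
    then obtain x where x: "x \<in> I" "s \<in> ball x (e x)" using I by auto
    then have "\<bar>f s\<bar> \<le> B x" using eB(2)[of x s] s I by (auto simp: dist_real_def abs_minus_commute)
    then show "\<bar>f s\<bar> \<le> Max (B ` I)" using x I by (meson Max_ge finite_imageI image_eqI order_trans)
  qed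
qed

text \<open>Such a set is an interval with left end s, open or closed at its supremum; in the open
  case the right ends approach the supremum from below. In both cases they belong to S, which allows
  an estimate at the times of S to be passed to the limit.\<close>

lemma downclosed_exhaust:
  fixes S :: "real set"
  assumes S: "S \<subseteq> {s<..t}" "\<And>r r'. r \<in> S \<Longrightarrow> s < r' \<Longrightarrow> r' \<le> r \<Longrightarrow> r' \<in> S" and ne: "S \<noteq> {}"
  obtains r :: "nat \<Rightarrow> real" where "incseq r" "\<And>n. r n \<in> S" "S = (\<Union>n. {s<..r n})"
proof -
  have bdd: "bdd_above S" using S(1) by (meson bdd_above_Ioc bdd_above_mono)
  show ?thesis
  proof (cases "Sup S \<in> S")
    case True
    have "S = (\<Union>n::nat. {s<..Sup S})"
      using S(2)[OF True] S(1) cSup_upper[OF _ bdd] by (auto simp: subset_eq)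
    then show ?thesis using True by (intro that[of "\<lambda>_. Sup S"]) (auto simp: incseq_def)
  next
    case False
    have le: "x \<le> Sup S" if "x \<in> S" for x using cSup_upper[OF that bdd] .
    have lt: "x < Sup S" if "x \<in> S" for x using le[OF that] that False by (metis order_le_imp_less_or_eq)
    obtain x0 where x0: "x0 \<in> S" using ne by auto
    define r where "r n = Sup S - (Sup S - x0) / real (Suc n)" for n
    have pos: "Sup S - x0 > 0" using lt[OF x0] by simp
    have inS: "x \<in> S" if x: "s < x" "x < Sup S" for x
    proof -
      obtain y where "y \<in> S" "x < y" using less_cSupE[OF x(2) ne] by blast
      then show ?thesis using S(2)[of y x] \<open>s < x\<close> by auto
    qed
    have r: "s < r n" "r n < Sup S" for n
    proof -
      have "(Sup S - x0) / real (Suc n) \<le> (Sup S - x0) / 1" using pos by (intro divide_left_mono) auto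
      then have "x0 \<le> r n" by (simp add: r_def del: of_nat_Suc)
      then show "s < r n" using x0 S(1) by auto
      show "r n < Sup S" using pos by (simp add: r_def)
    qed
    have inc: "incseq r"
      unfolding r_def incseq_def using pos by (auto intro!: divide_left_mono)
    have "S = (\<Union>n. {s<..r n})"
    proof (intro equalityI subsetI)
      fix x assume x: "x \<in> S"
      have "r \<longlonglongrightarrow> Sup S"
        unfolding r_def using tendsto_diff[OF tendsto_const LIMSEQ_Suc[OF lim_const_over_n[of "Sup S - x0"]], of "Sup S"] by simp
      then have "\<forall>\<^sub>F n in sequentially. x < r n" using lt[OF x] by (rule order_tendstoD)
      then obtain n where "x < r n" by (auto simp: eventually_sequentially)
      then show "x \<in> (\<Union>n. {s<..r n})" using x S(1) by (auto intro!: exI[of _ n])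
    next
      fix x assume "x \<in> (\<Union>n. {s<..r n})"
      then obtain n where "s < x" "x \<le> r n" by auto
      then show "x \<in> S" using inS[of x] r(2)[of n] by auto
    qed
    then show ?thesis using inc inS r by (intro that[of r]) auto
  qed
qed

text \<open>At the end of a down-closed set of times the value itself may be dropped, as it is nonnegative.\<close>

lemma stop_downclosed:
  fixes v :: "real \<Rightarrow> ennreal" and m n :: "real measure"
  assumes [simp]: "sets m = sets borel" "sets n = sets borel"
    and le: "\<And>r. s \<le> r \<Longrightarrow> r \<le> t \<Longrightarrow> v r + emeasure m {s<..r} \<le> v0 + emeasure n {s<..r}"
    and down: "\<And>r r'. r \<in> S \<Longrightarrow> s < r' \<Longrightarrow> r' \<le> r \<Longrightarrow> r' \<in> S" and st: "s \<le> t"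
  shows "indicator S t * v t + emeasure m (S \<inter> {s<..t}) \<le> v0 + emeasure n (S \<inter> {s<..t})"
proof (cases "t \<in> S")
  case True
  then have "S \<inter> {s<..t} = {s<..t}" using down by auto
  then show ?thesis using le[OF st] True by simp
next
  case False
  show ?thesis
  proof (cases "S \<inter> {s<..t} = {}")
    case True
    then show ?thesis using False by simp
  next
    case ne: False
    obtain r where r: "incseq r" "\<And>n. r n \<in> S \<inter> {s<..t}" "S \<inter> {s<..t} = (\<Union>n. {s<..r n})"
      using downclosed_exhaust[of "S \<inter> {s<..t}" s t, OF _ _ ne] down by auto
    have "emeasure m (S \<inter> {s<..t}) = (SUP k. emeasure m {s<..r k})"
      unfolding r(3) using r(1) by (intro SUP_emeasure_incseq[symmetric]) (auto simp: incseq_def, meson order_trans)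
    also have "\<dots> \<le> v0 + emeasure n (S \<inter> {s<..t})"
    proof (rule SUP_least)
      fix k
      have "emeasure m {s<..r k} \<le> v (r k) + emeasure m {s<..r k}" by simp
      also have "\<dots> \<le> v0 + emeasure n {s<..r k}" using r(2)[of k] by (intro le) auto
      also have "\<dots> \<le> v0 + emeasure n (S \<inter> {s<..t})"
        unfolding r(3) by (intro add_left_mono emeasure_mono) auto
      finally show "emeasure m {s<..r k} \<le> v0 + emeasure n (S \<inter> {s<..t})" .
    qed
    finally show ?thesis using False by simp
  qed
qed

section \<open>The chain rule for the reciprocal of a path of finite variation\<close>

text \<open>The sums are integrals of step functions, and dominated convergence takes the place of
  uniform continuity: for each fixed r the weights of the cells containing r have to converge.
  Weights built from the values at both ends of a cell, and limits with jumps, are therefore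
  allowed.\<close>

lemma riemann_stieltjes:
  fixes c :: "nat \<Rightarrow> nat \<Rightarrow> real"
  defines "pt \<equiv> \<lambda>s t n i. s + real i * (t - s) / real (Suc n)"
  assumes N: "sets N = sets borel" "emeasure N {s<..t} < \<infinity>" and st: "s < t"
    and B: "\<And>n i. \<bar>c n i\<bar> \<le> B"
    and lim: "\<And>r i. s < r \<Longrightarrow> r \<le> t \<Longrightarrow> (\<And>n. i n \<le> n \<and> pt s t n (i n) < r \<and> r \<le> pt s t n (Suc (i n))) \<Longrightarrow>
       (\<lambda>n. c n (i n)) \<longlonglongrightarrow> g r"
  shows "set_integrable N {s<..t} g" (is ?I)
    and "(\<lambda>n. \<Sum>i<Suc n. c n i * measure N {pt s t n i<..pt s t n (Suc i)}) \<longlonglongrightarrow> (LINT r:{s<..t}|N. g r)" (is ?L)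
proof -
  define J where "J n i = {pt s t n i<..pt s t n (Suc i)}" for n i
  have pt0: "pt s t n 0 = s" and ptn: "pt s t n (Suc n) = t" for n by (simp_all add: pt_def)
  have mono: "i \<le> j \<Longrightarrow> pt s t n i \<le> pt s t n j" for n i j
    using st by (auto simp: pt_def intro!: divide_right_mono mult_right_mono)
  have "\<exists>i\<le>n. pt s t n i < r \<and> r \<le> pt s t n (Suc i)" if r: "s < r" "r \<le> t" for r n
  proof -
    define i where "i = (LEAST i. r \<le> pt s t n (Suc i))"
    have ex: "r \<le> pt s t n (Suc n)" using r ptn by simp
    then have 1: "r \<le> pt s t n (Suc i)" unfolding i_def by (rule LeastI)
    have 2: "i \<le> n" unfolding i_def using ex by (rule Least_le)
    have "pt s t n i < r"
    proof (cases i)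
      case 0 then show ?thesis using r pt0 by simp
    next
      case (Suc j)
      then have "\<not> r \<le> pt s t n (Suc j)" using not_less_Least[of j "\<lambda>i. r \<le> pt s t n (Suc i)"] unfolding i_def by auto
      then show ?thesis using Suc by simp
    qed
    then show ?thesis using 1 2 by auto
  qed
  then have "\<forall>n r. \<exists>i. s < r \<longrightarrow> r \<le> t \<longrightarrow> i \<le> n \<and> pt s t n i < r \<and> r \<le> pt s t n (Suc i)"
    by blast
  \<comment> \<open>\<open>idx n r\<close> is the number of the cell containing r. Cells are open on
    the left, so the left grid point lies strictly before r.\<close>
  then obtain idx where idx: "\<And>n r. s < r \<Longrightarrow> r \<le> t \<Longrightarrow> idx n r \<le> n \<and> pt s t n (idx n r) < r \<and> r \<le> pt s t n (Suc (idx n r))"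
    by metis
  have uniq: "i = idx n r" if "s < r" "r \<le> t" "r \<in> J n i" for n r i
  proof (rule ccontr)
    assume "i \<noteq> idx n r"
    then consider "Suc i \<le> idx n r" | "Suc (idx n r) \<le> i" by linarith
    then show False
      using mono[of "Suc i" "idx n r" n] mono[of "Suc (idx n r)" i n] idx[OF that(1,2), of n] that(3)
      by cases (auto simp: J_def)
  qed
  define \<sigma> where "\<sigma> n r = (\<Sum>i<Suc n. c n i * indicator (J n i) r)" for n r
  have Jst: "J n i \<subseteq> {s<..t}" if "i < Suc n" for n i
    using mono[of 0 i n] mono[of "Suc i" "Suc n" n] that by (auto simp: J_def pt0 ptn)
  have \<sigma>: "\<sigma> n r = indicator {s<..t} r * c n (idx n r)" for n r
  proof (cases "s < r \<and> r \<le> t")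
    case True
    have "\<sigma> n r = (\<Sum>i<Suc n. if i = idx n r then c n i else 0)"
      unfolding \<sigma>_def using uniq[of r n] True idx[of r n]
      by (intro sum.cong refl) (auto simp: J_def indicator_def)
    also have "\<dots> = c n (idx n r)" using idx[of r n] True by (subst sum.delta) auto
    finally show ?thesis using True by simp
  next
    case False
    then have "r \<notin> J n i" if "i < Suc n" for i using Jst[OF that] by auto
    then show ?thesis using False by (auto simp: \<sigma>_def intro!: sum.neutral)
  qed
  have finJ: "emeasure N (J n i) < \<infinity>" if "i < Suc n" for n i
    using emeasure_mono[OF Jst[OF that], of N] N by (auto simp: order_le_less_trans)
  have meas: "J n i \<in> sets N" for n i using N by (simp add: J_def)
  have int\<sigma>: "(LINT r|N. \<sigma> n r) = (\<Sum>i<Suc n. c n i * measure N (J n i))" for n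
    unfolding \<sigma>_def using finJ meas by (subst Bochner_Integration.integral_sum) auto
  have lim\<sigma>: "(\<lambda>n. \<sigma> n r) \<longlonglongrightarrow> indicator {s<..t} r *\<^sub>R g r" for r
  proof (cases "s < r \<and> r \<le> t")
    case True
    then show ?thesis using lim[of r "\<lambda>n. idx n r"] idx[of r] by (auto simp: \<sigma>)
  qed (auto simp: \<sigma>)
  have \<sigma>m: "\<sigma> n \<in> borel_measurable N" for n unfolding \<sigma>_def using meas by measurable
  have gm: "(\<lambda>r. indicator {s<..t} r *\<^sub>R g r) \<in> borel_measurable N"
    by (rule borel_measurable_LIMSEQ_real[OF lim\<sigma> \<sigma>m])
  have Bi: "integrable N (\<lambda>r. indicator {s<..t} r * B)"
    using N by (intro integrable_mult_left integrable_real_indicator) auto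
  have bound: "norm (\<sigma> n r) \<le> indicator {s<..t} r * B" for n r
    using B[of n "idx n r"] by (auto simp: \<sigma> indicator_def)
  show ?I unfolding set_integrable_def
    by (rule integrable_dominated_convergence[where s=\<sigma>, OF gm \<sigma>m Bi]) (use lim\<sigma> bound in auto)
  have "(\<lambda>n. LINT r|N. \<sigma> n r) \<longlonglongrightarrow> (LINT r|N. indicator {s<..t} r *\<^sub>R g r)"
    by (rule integral_dominated_convergence[where s=\<sigma>, OF gm \<sigma>m Bi]) (use lim\<sigma> bound in auto)
  then show ?L by (simp add: int\<sigma> set_lebesgue_integral_def J_def)
qed

text \<open>The identity 1/(e+b) - 1/(e+a) = (a - b)/((e+a)(e+b)) telescopes exactly over a grid, so
  no second-order term appears. In the cell around r the right end converges to r from the right and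
  the left end strictly from the left; this produces one factor with W r and one with the left limit
  \<open>Wm r\<close>, also at jumps. Payoffs stay on the left and investments on the right, so all
  terms are nonnegative.\<close>

lemma reciprocal_chain_rule:
  fixes W Wm :: "real \<Rightarrow> real" and \<alpha> :: "'n::finite \<Rightarrow> real measure"
  assumes sets: "\<And>n. sets (\<alpha> n) = sets borel" "sets \<beta> = sets borel"
    and fin: "\<And>n t. emeasure (\<alpha> n) {0<..t} < \<infinity>" "\<And>t. emeasure \<beta> {0<..t} < \<infinity>"
    and W: "\<And>t. t \<ge> 0 \<Longrightarrow> W t = w0 + (\<Sum>n\<in>UNIV. measure (\<alpha> n) {0<..t}) - measure \<beta> {0<..t}"
    and Wnn: "\<And>t. t \<ge> 0 \<Longrightarrow> W t \<ge> 0"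
    and right: "\<And>t. t \<ge> 0 \<Longrightarrow> (W \<longlongrightarrow> W t) (at_right t)"
    and left: "\<And>t. t > 0 \<Longrightarrow> (W \<longlongrightarrow> Wm t) (at_left t)"
    and e: "e > 0" and st: "0 \<le> s" "s \<le> t"
  defines "g \<equiv> \<lambda>r. ennreal (1 / ((e + W r) * (e + Wm r)))"
  shows "(\<lambda>r. indicator {s<..t} r * g r) \<in> borel_measurable borel"
    "ennreal (1 / (e + W t)) + (\<Sum>n\<in>UNIV. \<integral>\<^sup>+r\<in>{s<..t}. g r \<partial>\<alpha> n) =
     ennreal (1 / (e + W s)) + (\<integral>\<^sup>+r\<in>{s<..t}. g r \<partial>\<beta>)"
proof -
  have "(\<lambda>r. indicator {s<..t} r * g r) \<in> borel_measurable borel \<and>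
    ennreal (1 / (e + W t)) + (\<Sum>n\<in>UNIV. \<integral>\<^sup>+r\<in>{s<..t}. g r \<partial>\<alpha> n) =
     ennreal (1 / (e + W s)) + (\<integral>\<^sup>+r\<in>{s<..t}. g r \<partial>\<beta>)"
  proof (cases "s = t")
    case False
    then have lt: "s < t" using st by simp
    define h where "h r = 1 / ((e + W r) * (e + Wm r))" for r
    define pt where "pt n i = s + real i * (t - s) / real (Suc n)" for n i
    define c where "c n i = 1 / ((e + W (pt n (Suc i))) * (e + W (pt n i)))" for n i
    have pt: "pt n i \<ge> 0" for n i using st lt by (auto simp: pt_def)
    have Wmnn: "Wm r \<ge> 0" if "r > 0" for r
    proof (rule tendsto_lowerbound[OF left[OF that]])
      show "\<forall>\<^sub>F x in at_left r. 0 \<le> W x"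
        unfolding eventually_at_left_field using that Wnn by (intro exI[of _ 0]) auto
    qed auto
    have pt0: "pt n 0 = s" and ptn: "pt n (Suc n) = t" for n
      by (simp_all add: pt_def nonzero_mult_div_cancel_left del: of_nat_Suc)
    \<comment> \<open>Here e > 0 supplies the dominating constant, however close W comes to
      0.\<close>
    have cB: "\<bar>c n i\<bar> \<le> 1 / e\<^sup>2" for n i
    proof -
      have "e * e \<le> (e + W (pt n (Suc i))) * (e + W (pt n i))"
        using e Wnn[OF pt] by (intro mult_mono) auto
      then show ?thesis unfolding c_def power2_eq_square using e Wnn[OF pt]
        by (subst abs_of_nonneg) (auto intro!: divide_left_mono mult_pos_pos add_pos_nonneg)
    qed
    have lim: "(\<lambda>n. c n (i n)) \<longlonglongrightarrow> h r"
      if r: "s < r" "r \<le> t" and i: "\<And>n. i n \<le> n \<and> pt n (i n) < r \<and> r \<le> pt n (Suc (i n))" for r i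
    proof -
      have d: "pt n (Suc (i n)) - pt n (i n) = (t - s) / real (Suc n)" for n
        by (simp add: pt_def distrib_right add_divide_distrib)
      have d0: "(\<lambda>n. (t - s) / real (Suc n)) \<longlonglongrightarrow> 0"
        by (rule LIMSEQ_Suc[OF lim_const_over_n])
      have dd: "r - (t - s) / real (Suc n) \<le> pt n (i n)" "pt n (Suc (i n)) \<le> r + (t - s) / real (Suc n)" for n
        using d[of n] i[of n] by linarith+
      have "(\<lambda>n. pt n (i n)) \<longlonglongrightarrow> r"
        by (rule tendsto_sandwich[of "\<lambda>n. r - (t - s) / real (Suc n)" _ _ "\<lambda>_. r"])
           (use i dd tendsto_diff[OF tendsto_const d0, of r] in \<open>auto simp: less_imp_le\<close>)
      \<comment> \<open>The left ends lie strictly before r and see the left limit; the right ends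
        may equal r and see the value.\<close>
      then have LL: "filterlim (\<lambda>n. pt n (i n)) (at_left r) sequentially"
        unfolding filterlim_at using i by (simp add: order.strict_implies_not_eq)
      have L: "(\<lambda>n. W (pt n (i n))) \<longlonglongrightarrow> Wm r"
        by (rule filterlim_compose[OF left LL]) (use r st in simp)
      have R0: "(\<lambda>n. pt n (Suc (i n))) \<longlonglongrightarrow> r"
        by (rule tendsto_sandwich[of "\<lambda>_. r" _ _ "\<lambda>n. r + (t - s) / real (Suc n)"])
           (use i dd tendsto_add[OF tendsto_const d0, of r] in \<open>auto simp: less_imp_le\<close>)
      have "continuous (at r within {r..}) W"
        using right[of r] r st by (simp add: continuous_within at_within_Ici_at_right)
      then have R: "(\<lambda>n. W (pt n (Suc (i n)))) \<longlonglongrightarrow> W r"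
        using i by (intro continuous_within_tendsto_compose'[OF _ _ R0]) auto
      have "(e + W r) * (e + Wm r) \<noteq> 0" using e Wnn[of r] Wmnn[of r] r st by (auto simp: add_eq_0_iff)
      then show ?thesis unfolding c_def h_def by (intro tendsto_intros L R)
    qed
    have step: "1 / (e + W (pt n (Suc i))) - 1 / (e + W (pt n i)) =
       c n i * measure \<beta> {pt n i<..pt n (Suc i)} - (\<Sum>k\<in>UNIV. c n i * measure (\<alpha> k) {pt n i<..pt n (Suc i)})" for n i
    proof -
      have le: "pt n i \<le> pt n (Suc i)" using lt by (auto simp: pt_def intro!: divide_right_mono mult_right_mono)
      have inc: "measure K {0<..pt n (Suc i)} = measure K {0<..pt n i} + measure K {pt n i<..pt n (Suc i)}"
        if "sets K = sets borel" "\<And>t. emeasure K {0<..t} < \<infinity>" for K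
      proof -
        have "{0<..pt n (Suc i)} = {0<..pt n i} \<union> {pt n i<..pt n (Suc i)}" using le pt[of n i] by auto
        moreover have "emeasure K {pt n i<..pt n (Suc i)} < \<infinity>"
          by (rule order_le_less_trans[OF emeasure_mono that(2)[of "pt n (Suc i)"]]) (use pt[of n i] that in auto)
        ultimately show ?thesis using that by (simp add: measure_Union less_top[symmetric] disjoint_iff)
      qed
      have d: "W (pt n (Suc i)) - W (pt n i) = (\<Sum>k\<in>UNIV. measure (\<alpha> k) {pt n i<..pt n (Suc i)}) - measure \<beta> {pt n i<..pt n (Suc i)}"
        using W[OF pt[of n i]] W[OF pt[of n "Suc i"]] inc[OF sets(1) fin(1)] inc[OF sets(2) fin(2)]
        by (simp add: sum.distrib)
      have p: "e + W (pt n i) > 0" "e + W (pt n (Suc i)) > 0" using e Wnn[OF pt] by (auto intro!: add_pos_nonneg)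
      have "1 / (e + W (pt n (Suc i))) - 1 / (e + W (pt n i)) = c n i * (W (pt n i) - W (pt n (Suc i)))"
        using p by (simp add: c_def field_simps)
      also have "W (pt n i) - W (pt n (Suc i)) = measure \<beta> {pt n i<..pt n (Suc i)} - (\<Sum>k\<in>UNIV. measure (\<alpha> k) {pt n i<..pt n (Suc i)})"
        using d by simp
      finally show ?thesis by (simp add: right_diff_distrib sum_distrib_left)
    qed
    have tele: "1 / (e + W t) - 1 / (e + W s) = (\<Sum>i<Suc n. c n i * measure \<beta> {pt n i<..pt n (Suc i)})
        - (\<Sum>k\<in>UNIV. \<Sum>i<Suc n. c n i * measure (\<alpha> k) {pt n i<..pt n (Suc i)})" for n
    proof -
      have "1 / (e + W t) - 1 / (e + W s) = (\<Sum>i<Suc n. 1 / (e + W (pt n (Suc i))) - 1 / (e + W (pt n i)))"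
        using sum_lessThan_telescope[of "\<lambda>i. 1 / (e + W (pt n i))" "Suc n"] unfolding ptn pt0 by (rule sym)
      then show ?thesis by (simp only: step sum_subtractf) (subst sum.swap, simp)
    qed
    have finst: "emeasure (\<alpha> n) {s<..t} < \<infinity>" for n
      by (rule order_le_less_trans[OF emeasure_mono fin(1)[of n t]]) (use st sets in auto)
    have finst': "emeasure \<beta> {s<..t} < \<infinity>"
      by (rule order_le_less_trans[OF emeasure_mono fin(2)[of t]]) (use st sets in auto)
    note rs = riemann_stieltjes[of _ s t c "1 / e\<^sup>2" h, folded pt_def, OF _ _ lt cB lim]
    have A: "set_integrable (\<alpha> k) {s<..t} h"
       "(\<lambda>n. \<Sum>i<Suc n. c n i * measure (\<alpha> k) {pt n i<..pt n (Suc i)}) \<longlonglongrightarrow> (LINT r:{s<..t}|\<alpha> k. h r)" for k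
      by (rule rs[OF sets(1) finst]; assumption)+
    have B: "set_integrable \<beta> {s<..t} h"
       "(\<lambda>n. \<Sum>i<Suc n. c n i * measure \<beta> {pt n i<..pt n (Suc i)}) \<longlonglongrightarrow> (LINT r:{s<..t}|\<beta>. h r)"
      by (rule rs[OF sets(2) finst']; assumption)+
    have "(\<lambda>n. (\<Sum>i<Suc n. c n i * measure \<beta> {pt n i<..pt n (Suc i)})
        - (\<Sum>k\<in>UNIV. \<Sum>i<Suc n. c n i * measure (\<alpha> k) {pt n i<..pt n (Suc i)}))
      \<longlonglongrightarrow> (LINT r:{s<..t}|\<beta>. h r) - (\<Sum>k\<in>UNIV. LINT r:{s<..t}|\<alpha> k. h r)"
      by (intro tendsto_diff tendsto_sum A B)
    then have eq: "1 / (e + W t) - 1 / (e + W s) = (LINT r:{s<..t}|\<beta>. h r) - (\<Sum>k\<in>UNIV. LINT r:{s<..t}|\<alpha> k. h r)"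
      unfolding tele[symmetric] by (simp only: LIMSEQ_const_iff)
    have hpos: "0 \<le> h r" if "s < r" for r
      using that st e Wnn[of r] Wmnn[of r] by (auto simp: h_def intro!: divide_nonneg_pos mult_pos_pos add_pos_nonneg)
    have nn: "(\<integral>\<^sup>+r\<in>{s<..t}. g r \<partial>K) = ennreal (LINT r:{s<..t}|K. h r)" if "set_integrable K {s<..t} h" for K
    proof -
      have "(\<integral>\<^sup>+r\<in>{s<..t}. g r \<partial>K) = (\<integral>\<^sup>+r. ennreal (indicator {s<..t} r *\<^sub>R h r) \<partial>K)"
        by (intro nn_integral_cong) (auto simp: g_def h_def indicator_def)
      also have "\<dots> = ennreal (LINT r|K. indicator {s<..t} r *\<^sub>R h r)"
        using that hpos by (intro nn_integral_eq_integral) (auto simp: set_integrable_def indicator_def)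
      finally show ?thesis by (simp add: set_lebesgue_integral_def)
    qed
    have pos: "0 \<le> (LINT r:{s<..t}|K. h r)" for K
      unfolding set_lebesgue_integral_def using hpos by (intro integral_nonneg_AE) (auto simp: indicator_def)
    have "(\<lambda>r. ennreal (indicator {s<..t} r *\<^sub>R h r)) \<in> borel_measurable borel"
      using borel_measurable_integrable[OF B(1)[unfolded set_integrable_def]] sets(2)
      by (intro measurable_compose[OF _ measurable_ennreal]) (simp cong: measurable_cong_sets)
    also have "(\<lambda>r. ennreal (indicator {s<..t} r *\<^sub>R h r)) = (\<lambda>r. indicator {s<..t} r * g r)"
      by (auto simp: g_def h_def indicator_def fun_eq_iff)
    finally have m: "(\<lambda>r. indicator {s<..t} r * g r) \<in> borel_measurable borel" .
    have "1 / (e + W t) + (\<Sum>k\<in>UNIV. LINT r:{s<..t}|\<alpha> k. h r) = 1 / (e + W s) + (LINT r:{s<..t}|\<beta>. h r)"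
      using eq by simp
    then have "ennreal (1 / (e + W t)) + (\<Sum>k\<in>UNIV. ennreal (LINT r:{s<..t}|\<alpha> k. h r)) = ennreal (1 / (e + W s)) + ennreal (LINT r:{s<..t}|\<beta>. h r)"
      using e Wnn[of s] Wnn[of t] st pos by (simp add: ennreal_plus[symmetric] sum_nonneg del: ennreal_plus)
    then show ?thesis using m A(1) B(1) by (simp add: nn)
  qed simp
  then show "(\<lambda>r. indicator {s<..t} r * g r) \<in> borel_measurable borel"
    "ennreal (1 / (e + W t)) + (\<Sum>n\<in>UNIV. \<integral>\<^sup>+r\<in>{s<..t}. g r \<partial>\<alpha> n) =
     ennreal (1 / (e + W s)) + (\<integral>\<^sup>+r\<in>{s<..t}. g r \<partial>\<beta>)" by auto
qed

section \<open>Predictable processes\<close>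

lemma measurable_vec_nth:
  fixes f :: "'a \<Rightarrow> real^'n"
  assumes "f \<in> borel_measurable M"
  shows "(\<lambda>x. f x $ i) \<in> borel_measurable M"
  by (rule measurable_compose[OF assms borel_measurable_nth])

lemma filtrationD:
  assumes "filtration M F" "t \<ge> 0"
  shows "space (F t) = space M" "sets (F t) \<subseteq> sets M" "s \<in> {0..t} \<Longrightarrow> sets (F s) \<subseteq> sets (F t)"
    "f \<in> measurable (F t) N \<Longrightarrow> f \<in> measurable M N"
proof -
  have "subalgebra M (F t)" using assms by (auto simp: filtration_def)
  then show "space (F t) = space M" "sets (F t) \<subseteq> sets M"
    "f \<in> measurable (F t) N \<Longrightarrow> f \<in> measurable M N"
    using measurable_from_subalg by (auto simp: subalgebra_def)
  show "s \<in> {0..t} \<Longrightarrow> sets (F s) \<subseteq> sets (F t)" using assms by (auto simp: filtration_def)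
qed

lemma filtration_mono_measurable:
  assumes "filtration M F" "0 \<le> s" "s \<le> t" "f \<in> measurable (F s) N"
  shows "f \<in> measurable (F t) N"
proof -
  have "sets (F s) \<subseteq> sets (F t)" "space (F s) = space M" "space (F t) = space M"
    using filtrationD(1,3)[OF assms(1)] assms by auto
  then show ?thesis using assms(4) by (auto simp: measurable_def)
qed

lemma space_pred_sigma [simp]: "space (pred_sigma M F) = space M \<times> {0..}"
  by (simp add: pred_sigma_def space_measure_of_conv)

lemma measurable_pred_leftcont:
  fixes Z :: "real \<Rightarrow> 'a \<Rightarrow> real"
  assumes "\<And>t. t \<ge> 0 \<Longrightarrow> Z t \<in> borel_measurable (F t)"
    and "\<And>w t. w \<in> space M \<Longrightarrow> t > 0 \<Longrightarrow> ((\<lambda>s. Z s w) \<longlongrightarrow> Z t w) (at_left t)"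
  shows "(\<lambda>p. Z (snd p) (fst p)) \<in> borel_measurable (pred_sigma M F)"
proof (rule measurableI)
  fix B :: "real set" assume "B \<in> sets borel"
  then have "{p \<in> space M \<times> {0..}. Z (snd p) (fst p) \<in> B} \<in> {{p \<in> space M \<times> {0..}. Z (snd p) (fst p) \<in> B} | Z B.
        adapted M F (Z :: real \<Rightarrow> 'a \<Rightarrow> real) \<and>
        (\<forall>w\<in>space M. \<forall>t>0. continuous (at_left t) (\<lambda>s. Z s w)) \<and>
        B \<in> sets (borel :: real measure)}"
    using assms by (auto simp: adapted_def continuous_within intro!: exI[of _ Z] exI[of _ B])
  then have "{p \<in> space M \<times> {0..}. Z (snd p) (fst p) \<in> B} \<in> sets (pred_sigma M F)"
    unfolding pred_sigma_def by (intro in_measure_of) auto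
  also have "{p \<in> space M \<times> {0..}. Z (snd p) (fst p) \<in> B} = (\<lambda>p. Z (snd p) (fst p)) -` B \<inter> space (pred_sigma M F)"
    by auto
  finally show "(\<lambda>p. Z (snd p) (fst p)) -` B \<inter> space (pred_sigma M F) \<in> sets (pred_sigma M F)" .
qed simp

text \<open>The predictable sigma-algebra is generated by adapted left-continuous processes, so a
  map into it is tested on these alone.\<close>

lemma measurable_into_pred:
  assumes "h \<in> space N \<rightarrow> space M \<times> {0..}"
    and "\<And>Z :: real \<Rightarrow> 'a \<Rightarrow> real. (\<And>t. t \<ge> 0 \<Longrightarrow> Z t \<in> borel_measurable (F t)) \<Longrightarrow>
       (\<And>w t. w \<in> space M \<Longrightarrow> t > 0 \<Longrightarrow> ((\<lambda>s. Z s w) \<longlongrightarrow> Z t w) (at_left t)) \<Longrightarrow>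
       (\<lambda>x. Z (snd (h x)) (fst (h x))) \<in> borel_measurable N"
  shows "h \<in> measurable N (pred_sigma M F)"
  unfolding pred_sigma_def
proof (rule measurable_measure_of)
  fix A assume "A \<in> {{p \<in> space M \<times> {0..}. Z (snd p) (fst p) \<in> B} | Z B.
        adapted M F (Z :: real \<Rightarrow> 'a \<Rightarrow> real) \<and>
        (\<forall>w\<in>space M. \<forall>t>0. continuous (at_left t) (\<lambda>s. Z s w)) \<and>
        B \<in> sets (borel :: real measure)}"
  then obtain Z B where A: "A = {p \<in> space M \<times> {0..}. Z (snd p) (fst p) \<in> B}"
    and Z: "adapted M F (Z :: real \<Rightarrow> 'a \<Rightarrow> real)"
        "\<forall>w\<in>space M. \<forall>t>0. continuous (at_left t) (\<lambda>s. Z s w)" and B: "B \<in> sets (borel :: real measure)"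
    by auto
  have m: "(\<lambda>x. Z (snd (h x)) (fst (h x))) \<in> borel_measurable N"
    using Z by (intro assms(2)) (auto simp: adapted_def continuous_within)
  have "h -` A \<inter> space N = (\<lambda>x. Z (snd (h x)) (fst (h x))) -` B \<inter> space N"
    using assms(1) by (auto simp: A)
  also have "\<dots> \<in> sets N" using measurable_sets[OF m B] .
  finally show "h -` A \<inter> space N \<in> sets N" .
qed (use assms(1) in auto)

lemma measurable_time_section:
  assumes "filtration M F" "t \<ge> 0"
  shows "(\<lambda>w. (w, t)) \<in> measurable (F t) (pred_sigma M F)"
  using assms filtrationD(1)[OF assms] by (intro measurable_into_pred) auto

text \<open>Replacing the time by grid points with countably many values reduces joint measurability
  to that of the single random variables.\<close>

lemma measurable_joint_approx:
  fixes Z :: "real \<Rightarrow> 'a \<Rightarrow> real"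
  assumes Z: "\<And>t. t \<ge> 0 \<Longrightarrow> Z t \<in> borel_measurable M"
    and q: "\<And>n. q n \<in> measurable borel (count_space UNIV)" and c: "\<And>n. countable (range (q n))"
    and q0: "\<And>n s. q n s \<ge> (0::real)"
    and lim: "\<And>w s. w \<in> space M \<Longrightarrow> (\<lambda>n. Z (q n s) w) \<longlonglongrightarrow> Z (max 0 s) w"
  shows "(\<lambda>(w, s). Z (max 0 s) w) \<in> borel_measurable (M \<Otimes>\<^sub>M borel)"
proof (rule borel_measurable_LIMSEQ_real)
  show "\<And>p. p \<in> space (M \<Otimes>\<^sub>M borel) \<Longrightarrow> (\<lambda>n. (\<lambda>(w, s). Z (q n s) w) p) \<longlonglongrightarrow> (\<lambda>(w, s). Z (max 0 s) w) p"
    using lim by (auto simp: space_pair_measure)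
  fix n
  show "(\<lambda>(w, s). Z (q n s) w) \<in> borel_measurable (M \<Otimes>\<^sub>M borel)"
    unfolding case_prod_beta
  proof (rule measurable_compose_countable'[where I="range (q n)" and g="\<lambda>p. q n (snd p)" and f="\<lambda>i p. Z i (fst p)"])
    fix i assume "i \<in> range (q n)"
    then show "(\<lambda>p. Z i (fst p)) \<in> borel_measurable (M \<Otimes>\<^sub>M borel)"
      using Z[of i] q0 by (intro measurable_compose[OF measurable_fst]) auto
  next
    have "(\<lambda>p. q n (snd p)) \<in> measurable (M \<Otimes>\<^sub>M borel) (count_space UNIV)"
      by (intro measurable_compose[OF measurable_snd q])
    then show "(\<lambda>p. q n (snd p)) \<in> measurable (M \<Otimes>\<^sub>M borel) (count_space (range (q n)))"
      by (rule measurable_count_space_extend[OF subset_UNIV, rotated]) auto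
  qed (rule c)
qed

lemma measurable_joint_leftcont:
  fixes Z :: "real \<Rightarrow> 'a \<Rightarrow> real"
  assumes Z: "\<And>t. t \<ge> 0 \<Longrightarrow> Z t \<in> borel_measurable M"
    and lc: "\<And>w t. w \<in> space M \<Longrightarrow> t > 0 \<Longrightarrow> ((\<lambda>s. Z s w) \<longlongrightarrow> Z t w) (at_left t)"
  shows "(\<lambda>(w, s). Z (max 0 s) w) \<in> borel_measurable (M \<Otimes>\<^sub>M borel)"
\<comment> \<open>Ceiling minus 1 gives the last grid point strictly before s, so left-continuity at
  s applies; the outer \<open>max 0\<close> keeps it in the domain of Z.\<close>
proof (rule measurable_joint_approx[OF Z, where q="\<lambda>n s. max 0 ((real_of_int \<lceil>s * real (Suc n)\<rceil> - 1) / real (Suc n))"])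
  fix n
  show "(\<lambda>s. max 0 ((real_of_int \<lceil>s * real (Suc n)\<rceil> - 1) / real (Suc n))) \<in> measurable borel (count_space UNIV)"
    by (intro measurable_compose[where N="count_space UNIV" and g="\<lambda>i::int. max 0 ((real_of_int i - 1) / real (Suc n))" and f="\<lambda>s. \<lceil>s * real (Suc n)\<rceil>"]) auto
  have "range (\<lambda>s. max 0 ((real_of_int \<lceil>s * real (Suc n)\<rceil> - 1) / real (Suc n))) \<subseteq> range (\<lambda>i::int. max 0 ((real_of_int i - 1) / real (Suc n)))"
    by (intro image_subsetI rangeI)
  then show "countable (range (\<lambda>s. max 0 ((real_of_int \<lceil>s * real (Suc n)\<rceil> - 1) / real (Suc n))))"
    by (rule countable_subset) simp
next
  fix w s assume w: "w \<in> space M"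
  let ?q = "\<lambda>n. max 0 ((real_of_int \<lceil>s * real (Suc n)\<rceil> - 1) / real (Suc n))"
  show "(\<lambda>n. Z (?q n) w) \<longlonglongrightarrow> Z (max 0 s) w"
  proof (cases "s > 0")
    case False
    have "?q n = 0" for n
    proof -
      have "s * real (Suc n) \<le> 0" using False by (intro mult_nonpos_nonneg) auto
      then have "\<lceil>s * real (Suc n)\<rceil> \<le> 0" by (simp add: ceiling_le_iff)
      then have "(real_of_int \<lceil>s * real (Suc n)\<rceil> - 1) / real (Suc n) \<le> 0" by (intro divide_nonpos_pos) auto
      then show ?thesis by (rule max_absorb1)
    qed
    then show ?thesis using False by simp
  next
    case True
    have lt: "?q n < s" for n
    proof -
      have "real_of_int \<lceil>s * real (Suc n)\<rceil> - 1 < s * real (Suc n)" by linarith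
      then show ?thesis using True by (simp add: pos_divide_less_eq del: of_nat_Suc)
    qed
    have ge: "s - 1 / real (Suc n) \<le> ?q n" for n
    proof -
      have "s * real (Suc n) \<le> real_of_int \<lceil>s * real (Suc n)\<rceil>" by linarith
      then have "(s * real (Suc n) - 1) / real (Suc n) \<le> (real_of_int \<lceil>s * real (Suc n)\<rceil> - 1) / real (Suc n)"
        by (intro divide_right_mono) auto
      also have "(s * real (Suc n) - 1) / real (Suc n) = s - 1 / real (Suc n)" by (simp add: diff_divide_distrib del: of_nat_Suc)
      finally show ?thesis by simp
    qed
    have "(\<lambda>n. s - 1 / real (Suc n)) \<longlonglongrightarrow> s"
      using tendsto_diff[OF tendsto_const LIMSEQ_Suc[OF lim_const_over_n[of 1]], of s] by simp
    then have "?q \<longlonglongrightarrow> s"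
      by (rule tendsto_sandwich[rotated 2, OF _ tendsto_const]) (use lt ge in \<open>auto simp: less_imp_le simp del: of_nat_Suc\<close>)
    then have "filterlim ?q (at_left s) sequentially"
      unfolding filterlim_at using lt by (simp add: order.strict_implies_not_eq del: of_nat_Suc)
    from filterlim_compose[OF lc[OF w True] this] show ?thesis using True by simp
  qed
qed auto

lemma measurable_joint_rightcont:
  fixes Z :: "real \<Rightarrow> 'a \<Rightarrow> real"
  assumes Z: "\<And>t. t \<ge> 0 \<Longrightarrow> Z t \<in> borel_measurable M"
    and rc: "\<And>w t. w \<in> space M \<Longrightarrow> t \<ge> 0 \<Longrightarrow> ((\<lambda>s. Z s w) \<longlongrightarrow> Z t w) (at_right t)"
  shows "(\<lambda>(w, s). Z (max 0 s) w) \<in> borel_measurable (M \<Otimes>\<^sub>M borel)"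
\<comment> \<open>Floor plus 1 gives the first grid point strictly after s, as convergence along
  \<open>at_right\<close> requires.\<close>
proof (rule measurable_joint_approx[OF Z, where q="\<lambda>n s. max 0 ((real_of_int \<lfloor>max 0 s * real (Suc n)\<rfloor> + 1) / real (Suc n))"])
  fix n
  show "(\<lambda>s. max 0 ((real_of_int \<lfloor>max 0 s * real (Suc n)\<rfloor> + 1) / real (Suc n))) \<in> measurable borel (count_space UNIV)"
    by (intro measurable_compose[where N="count_space UNIV" and g="\<lambda>i::int. max 0 ((real_of_int i + 1) / real (Suc n))" and f="\<lambda>s. \<lfloor>max 0 s * real (Suc n)\<rfloor>"]) auto
  have "range (\<lambda>s. max 0 ((real_of_int \<lfloor>max 0 s * real (Suc n)\<rfloor> + 1) / real (Suc n))) \<subseteq> range (\<lambda>i::int. max 0 ((real_of_int i + 1) / real (Suc n)))"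
    by (intro image_subsetI rangeI)
  then show "countable (range (\<lambda>s. max 0 ((real_of_int \<lfloor>max 0 s * real (Suc n)\<rfloor> + 1) / real (Suc n))))"
    by (rule countable_subset) simp
next
  fix w s0 assume w: "w \<in> space M"
  define s where "s = max 0 (s0::real)"
  let ?q = "\<lambda>n. max 0 ((real_of_int \<lfloor>s * real (Suc n)\<rfloor> + 1) / real (Suc n))"
  have s0: "s \<ge> 0" by (simp add: s_def)
  have lt: "s < ?q n" for n
  proof -
    have "s * real (Suc n) < real_of_int \<lfloor>s * real (Suc n)\<rfloor> + 1" by linarith
    then have "s < (real_of_int \<lfloor>s * real (Suc n)\<rfloor> + 1) / real (Suc n)" by (simp add: pos_less_divide_eq del: of_nat_Suc)
    then show ?thesis by simp
  qed
  have ge: "?q n \<le> s + 1 / real (Suc n)" for n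
  proof -
    have "real_of_int \<lfloor>s * real (Suc n)\<rfloor> \<le> s * real (Suc n)" by linarith
    then have "(real_of_int \<lfloor>s * real (Suc n)\<rfloor> + 1) / real (Suc n) \<le> (s * real (Suc n) + 1) / real (Suc n)"
      by (intro divide_right_mono) auto
    also have "(s * real (Suc n) + 1) / real (Suc n) = s + 1 / real (Suc n)" by (simp add: add_divide_distrib del: of_nat_Suc)
    finally show ?thesis using s0 by simp
  qed
  have "(\<lambda>n. s + 1 / real (Suc n)) \<longlonglongrightarrow> s"
    using tendsto_add[OF tendsto_const LIMSEQ_Suc[OF lim_const_over_n[of 1]], of s] by simp
  then have "?q \<longlonglongrightarrow> s"
    by (rule tendsto_sandwich[rotated 2, OF tendsto_const]) (use lt ge in \<open>auto simp: less_imp_le simp del: of_nat_Suc\<close>)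
  then have "filterlim ?q (at_right s) sequentially"
    unfolding filterlim_at using lt by (simp add: order.strict_implies_not_eq[symmetric] del: of_nat_Suc)
  from filterlim_compose[OF rc[OF w s0] this]
  show "(\<lambda>n. Z (max 0 ((real_of_int \<lfloor>max 0 s0 * real (Suc n)\<rfloor> + 1) / real (Suc n))) w) \<longlonglongrightarrow> Z (max 0 s0) w"
    by (simp add: s_def)
qed auto

text \<open>Predictable processes are jointly measurable. The truncation \<open>max 0 s\<close>
  appears because the predictable sigma-algebra lives on times in [0,\<infinity>), whereas the
  measures induced by paths live on the whole line.\<close>

lemma measurable_joint_section:
  assumes "filtration M F"
  shows "(\<lambda>(w, s). (w, max 0 s)) \<in> measurable (M \<Otimes>\<^sub>M borel) (pred_sigma M F)"
proof (rule measurable_into_pred)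
  fix Z :: "real \<Rightarrow> 'a \<Rightarrow> real"
  assume "\<And>t. t \<ge> 0 \<Longrightarrow> Z t \<in> borel_measurable (F t)"
     and lc: "\<And>w t. w \<in> space M \<Longrightarrow> t > 0 \<Longrightarrow> ((\<lambda>s. Z s w) \<longlongrightarrow> Z t w) (at_left t)"
  then have "(\<lambda>(w, s). Z (max 0 s) w) \<in> borel_measurable (M \<Otimes>\<^sub>M borel)"
    by (intro measurable_joint_leftcont filtrationD(4)[OF assms]) auto
  then show "(\<lambda>x. Z (snd (case x of (w, s) \<Rightarrow> (w, max 0 s))) (fst (case x of (w, s) \<Rightarrow> (w, max 0 s)))) \<in> borel_measurable (M \<Otimes>\<^sub>M borel)"
    by (simp add: case_prod_beta)
qed (auto simp: space_pair_measure)

lemma measurable_path_section: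
  assumes "filtration M F" "w \<in> space M"
  shows "(\<lambda>s. (w, max 0 s)) \<in> measurable borel (pred_sigma M F)"
  using measurable_compose[OF measurable_Pair1'[OF assms(2), of borel] measurable_joint_section[OF assms(1)]]
  by simp

text \<open>Left limits form a left-continuous path, and at t they are limits of values at earlier
  times, hence known at t.\<close>

lemma predictable_leftlim:
  fixes Y :: "real \<Rightarrow> 'a \<Rightarrow> real^'m"
  assumes F: "filtration M F" and ad: "adapted M F Y" and cad: "\<And>w. w \<in> space M \<Longrightarrow> cadlag (\<lambda>t. Y t w)"
  shows "(\<lambda>p. leftlim c (\<lambda>s. Y s (fst p)) (snd p) $ m) \<in> borel_measurable (pred_sigma M F)"
proof (rule measurable_pred_leftcont[where Z="\<lambda>t w. leftlim c (\<lambda>s. Y s w) t $ m"])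
  fix t :: real assume t: "t \<ge> 0"
  show "(\<lambda>w. leftlim c (\<lambda>s. Y s w) t $ m) \<in> borel_measurable (F t)"
  proof (cases "t = 0")
    case False
    show ?thesis
    proof (rule borel_measurable_LIMSEQ_real)
      fix w assume "w \<in> space (F t)"
      then have "w \<in> space M" using filtrationD(1)[OF F t] by simp
      from cadlag_leftlim[OF cad[OF this], of t c] False t
      show "(\<lambda>n. Y (t - t / real (n + 2)) w $ m) \<longlonglongrightarrow> leftlim c (\<lambda>s. Y s w) t $ m"
        by (intro tendsto_vec_nth filterlim_compose[OF _ at_left_approx[of t]]) auto
    next
      fix n
      have "0 \<le> t - t / real (n + 2)" using t by (simp add: field_simps)
      then have "Y (t - t / real (n + 2)) \<in> borel_measurable (F (t - t / real (n + 2)))"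
        using ad by (simp add: adapted_def)
      then have "Y (t - t / real (n + 2)) \<in> borel_measurable (F t)"
        by (rule filtration_mono_measurable[OF F, rotated 2]) (use \<open>0 \<le> t - t / real (n + 2)\<close> t in auto)
      then show "(\<lambda>w. Y (t - t / real (n + 2)) w $ m) \<in> borel_measurable (F t)"
        by (rule measurable_vec_nth)
    qed
  qed (simp add: leftlim_def)
next
  fix w and t :: real assume "w \<in> space M" "t > 0"
  then show "((\<lambda>s. leftlim c (\<lambda>s. Y s w) s $ m) \<longlongrightarrow> leftlim c (\<lambda>s. Y s w) t $ m) (at_left t)"
    by (intro tendsto_vec_nth leftlim_leftcont cad)
qed

text \<open>Brings the conditioning event of a supermartingale inequality into the predictable
  setting: with B in F s the indicator is adapted, and the half-open interval makes it
  left-continuous.\<close>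

lemma predictable_rectangle:
  assumes F: "filtration M F" and s: "0 \<le> s" and B: "B \<in> sets (F s)"
  shows "(\<lambda>p. indicator B (fst p) * indicator {s<..t} (snd p) :: real) \<in> borel_measurable (pred_sigma M F)"
proof (rule measurable_pred_leftcont[where Z="\<lambda>r w. indicator B w * indicator {s<..t} r"])
  fix r :: real assume r: "r \<ge> 0"
  show "(\<lambda>w. indicator B w * indicator {s<..t} r :: real) \<in> borel_measurable (F r)"
  proof (cases "s < r")
    case True
    then have "B \<in> sets (F r)" using filtrationD(3)[OF F r, of s] B s by auto
    then show ?thesis by measurable
  qed simp
next
  fix w and r :: real assume "w \<in> space M" "r > 0"
  have "\<forall>\<^sub>F u in at_left r. indicator {s<..t} u = (indicator {s<..t} r :: real)"
  proof -
    consider "r \<le> s" | "s < r" "r \<le> t" | "s < r" "r > t" by linarith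
    then show ?thesis
    proof cases
      case 1 then show ?thesis unfolding eventually_at_left_field by (intro exI[of _ "r - 1"]) auto
    next
      case 2 then show ?thesis unfolding eventually_at_left_field by (intro exI[of _ s]) auto
    next
      case 3 then show ?thesis unfolding eventually_at_left_field by (intro exI[of _ "max s t"]) auto
    qed
  qed
  then show "((\<lambda>u. indicator B w * indicator {s<..t} u :: real) \<longlongrightarrow> indicator B w * indicator {s<..t} r) (at_left r)"
    by (intro tendsto_mult tendsto_const tendsto_eventually)
qed

section \<open>Measurable families of locally finite measures on the half line\<close>

text \<open>The restriction to (0,k] is divided by 1 plus its mass, which gives a subprobability
  kernel and never divides by 0; then k tends to infinity. Measurability is asked on the intervals
  (0,t], which is what adapted paths provide.\<close>

lemma measurable_nn_integral_kernel:
  fixes N :: "'a \<Rightarrow> real measure" and f :: "'a \<times> real \<Rightarrow> ennreal"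
  assumes sets: "\<And>w. w \<in> space M \<Longrightarrow> sets (N w) = sets borel"
    and zero: "\<And>w. w \<in> space M \<Longrightarrow> emeasure (N w) {..0} = 0"
    and fin: "\<And>w t. w \<in> space M \<Longrightarrow> emeasure (N w) {0<..t} < \<infinity>"
    and meas: "\<And>t. (\<lambda>w. emeasure (N w) {0<..t}) \<in> borel_measurable M"
    and f: "f \<in> borel_measurable (M \<Otimes>\<^sub>M borel)"
  shows "(\<lambda>w. \<integral>\<^sup>+s. f (w, s) \<partial>N w) \<in> borel_measurable M"
proof -
  define c where "c k w = 1 + emeasure (N w) {0<..real k}" for k w
  define L where "L k w = density (N w) (\<lambda>s. indicator {0<..real k} s * inverse (c k w))" for k w
  have c: "c k w \<noteq> 0" "c k w \<noteq> \<infinity>" if "w \<in> space M" for k w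
    using fin[OF that, of "real k"] by (auto simp: c_def)
  have cm[measurable]: "c k \<in> borel_measurable M" for k unfolding c_def using meas by measurable
  have eL: "emeasure (L k w) A = emeasure (N w) ({0<..real k} \<inter> A) * inverse (c k w)"
    if "w \<in> space M" "A \<in> sets borel" for k w A
  proof -
    have [simp, measurable_cong]: "sets (N w) = sets borel" by (rule sets[OF that(1)])
    have "emeasure (L k w) A = (\<integral>\<^sup>+s. indicator ({0<..real k} \<inter> A) s * inverse (c k w) \<partial>N w)"
      unfolding L_def using that by (subst emeasure_density) (auto intro!: nn_integral_cong simp: indicator_def)
    then show ?thesis using that by (simp add: nn_integral_multc)
  qed
  have L: "L k \<in> measurable M (subprob_algebra borel)" for k
  proof (rule measurable_subprob_algebra_generated[where \<Omega>=UNIV and G="range atMost"])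
    show "sets borel = sigma_sets UNIV (range (atMost :: real \<Rightarrow> _))" by (simp add: borel_eq_atMost)
    fix w assume w: "w \<in> space M"
    show "sets (L k w) = sets borel" using sets[OF w] by (simp add: L_def)
    show "subprob_space (L k w)"
    proof (rule subprob_spaceI)
      have sp: "space (L k w) = UNIV" using sets_eq_imp_space_eq[OF sets[OF w]] by (simp add: L_def)
      have "emeasure (N w) {0<..real k} * inverse (c k w) \<le> c k w * inverse (c k w)"
        by (intro mult_right_mono) (auto simp: c_def)
      also have "\<dots> = 1" using c[OF w, of k] by (simp add: ennreal_divide_self[unfolded divide_ennreal_def] less_top)
      finally show "emeasure (L k w) (space (L k w)) \<le> 1" using eL[OF w, of UNIV k] by (simp add: sp)
      show "space (L k w) \<noteq> {}" by (simp add: sp)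
    qed
  next
    fix A :: "real set" assume "A \<in> range atMost"
    then obtain t where A: "A = {..t}" by auto
    have "{0<..real k} \<inter> A = {0<..min (real k) t}" by (auto simp: A)
    then have "(\<lambda>w. emeasure (N w) ({0<..real k} \<inter> A) * inverse (c k w)) \<in> borel_measurable M"
      using meas[of "min (real k) t"] by simp
    then show "(\<lambda>w. emeasure (L k w) A) \<in> borel_measurable M"
      by (rule measurable_cong[THEN iffD1, rotated]) (simp add: eL A)
  next
    have "(\<lambda>w. emeasure (N w) {0<..real k} * inverse (c k w)) \<in> borel_measurable M" using meas by measurable
    then show "(\<lambda>w. emeasure (L k w) UNIV) \<in> borel_measurable M"
      by (rule measurable_cong[THEN iffD1, rotated]) (simp add: eL)
  qed (auto simp: Int_stable_def)
  have "(\<lambda>w. SUP k. c k w * (\<integral>\<^sup>+s. f (w, s) \<partial>L k w)) \<in> borel_measurable M"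
    using L f by (intro borel_measurable_SUP borel_measurable_times_ennreal cm nn_integral_measurable_subprob_algebra2[where N=borel]) auto
  moreover have "(\<integral>\<^sup>+s. f (w, s) \<partial>N w) = (SUP k. c k w * (\<integral>\<^sup>+s. f (w, s) \<partial>L k w))" if w: "w \<in> space M" for w
  proof -
    have [simp, measurable_cong]: "sets (N w) = sets borel" by (rule sets[OF w])
    have [measurable]: "(\<lambda>s. f (w, s)) \<in> borel_measurable borel"
      using measurable_compose[OF measurable_Pair1'[OF w, of borel] f] by simp
    have eq: "c k w * (\<integral>\<^sup>+s. f (w, s) \<partial>L k w) = (\<integral>\<^sup>+s. f (w, s) * indicator {0<..real k} s \<partial>N w)" for k
    proof -
      have "(\<integral>\<^sup>+s. f (w, s) \<partial>L k w) = (\<integral>\<^sup>+s. inverse (c k w) * (f (w, s) * indicator {0<..real k} s) \<partial>N w)"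
        unfolding L_def by (subst nn_integral_density) (auto simp: mult_ac intro!: nn_integral_cong)
      also have "\<dots> = inverse (c k w) * (\<integral>\<^sup>+s. f (w, s) * indicator {0<..real k} s \<partial>N w)"
        by (rule nn_integral_cmult) measurable
      finally show ?thesis
        using c[OF w, of k] by (simp add: mult.assoc[symmetric] ennreal_divide_self[unfolded divide_ennreal_def] less_top)
    qed
    have "AE s in N w. s > 0"
      using zero[OF w] by (intro AE_I[where N="{..0}"]) auto
    then have "(\<integral>\<^sup>+s. f (w, s) \<partial>N w) = (\<integral>\<^sup>+s. (SUP k. f (w, s) * indicator {0<..real k} s) \<partial>N w)"
    proof (intro nn_integral_cong_AE, eventually_elim)
      fix s :: real assume "s > 0"
      show "f (w, s) = (SUP k. f (w, s) * indicator {0<..real k} s)"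
      proof (rule antisym)
        obtain k where "s \<le> real k" using real_arch_simple by blast
        then show "f (w, s) \<le> (SUP k. f (w, s) * indicator {0<..real k} s)"
          using \<open>s > 0\<close> by (intro SUP_upper2[of k]) auto
        show "(SUP k. f (w, s) * indicator {0<..real k} s) \<le> f (w, s)"
          by (intro SUP_least) (auto simp: indicator_def)
      qed
    qed
    also have "\<dots> = (SUP k. \<integral>\<^sup>+s. f (w, s) * indicator {0<..real k} s \<partial>N w)"
      by (intro nn_integral_monotone_convergence_SUP) (auto simp: incseq_def le_fun_def indicator_def)
    finally show ?thesis by (simp add: eq)
  qed
  ultimately show ?thesis by (simp cong: measurable_cong)
qed

section \<open>Convergence of nonnegative supermartingales\<close>

text \<open>The state of Doob's upcrossing strategy: true from a visit to (-\<infinity>,a] until b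
  is reached next.\<close>

fun seeking_high :: "real \<Rightarrow> real \<Rightarrow> (nat \<Rightarrow> real) \<Rightarrow> nat \<Rightarrow> bool" where
  "seeking_high a b Z 0 = (Z 0 \<le> a)"
| "seeking_high a b Z (Suc i) = (if seeking_high a b Z i then Z (Suc i) < b else Z (Suc i) \<le> a)"

fun upcrossings :: "real \<Rightarrow> real \<Rightarrow> (nat \<Rightarrow> real) \<Rightarrow> nat \<Rightarrow> nat" where
  "upcrossings a b Z 0 = 0"
| "upcrossings a b Z (Suc i) = upcrossings a b Z i + (if seeking_high a b Z i \<and> b \<le> Z (Suc i) then 1 else 0)"

text \<open>The gains of the strategy that holds one unit while waiting for the level b.\<close>

lemma upcrossings_gain:
  assumes ab: "a < b"
  shows "(b - a) * real (upcrossings a b Z n) + (if seeking_high a b Z n then Z n - a else 0)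
     \<le> (\<Sum>i<n. if seeking_high a b Z i then Z (Suc i) - Z i else 0)"
  by (induction n) (use ab in \<open>auto simp: algebra_simps not_less not_le\<close>)

lemma upcrossings_mono: "i \<le> j \<Longrightarrow> upcrossings a b Z i \<le> upcrossings a b Z j"
  by (induction j rule: dec_induct) auto

lemma upcrossings_le: "upcrossings a b Z i \<le> i"
  by (induction i) auto

lemma upcrossings_step:
  assumes ab: "a < b" and ij: "i < j" and Z: "Z i \<le> a" "b \<le> Z j"
  shows "Suc (upcrossings a b Z i) \<le> upcrossings a b Z j"
proof -
  have hi: "seeking_high a b Z i" using Z ab by (cases i) auto
  have "seeking_high a b Z j \<and> upcrossings a b Z i \<le> upcrossings a b Z j \<or> Suc (upcrossings a b Z i) \<le> upcrossings a b Z j"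
    if "i \<le> j" for j
    using that by (induction j rule: dec_induct) (use hi in \<open>auto split: if_splits\<close>)
  from this[of j] have "seeking_high a b Z j \<or> Suc (upcrossings a b Z i) \<le> upcrossings a b Z j" using ij by auto
  moreover have "\<not> seeking_high a b Z j" using ij Z ab by (cases j) auto
  ultimately show ?thesis by simp
qed

text \<open>For a supermartingale the expected gain of the upcrossing strategy is at most 0. Since Z
  is nonnegative, an unfinished upcrossing loses at most a, which is the numerator of the
  bound.\<close>

lemma (in prob_space) upcrossing_inequality:
  fixes Z :: "nat \<Rightarrow> 'a \<Rightarrow> real" and G :: "nat \<Rightarrow> 'a measure"
  assumes ab: "0 \<le> a" "a < b"
    and sub: "\<And>i. subalgebra M (G i)" and inc: "\<And>i j. i \<le> j \<Longrightarrow> sets (G i) \<subseteq> sets (G j)"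
    and ad: "\<And>i. Z i \<in> borel_measurable (G i)" and int: "\<And>i. integrable M (Z i)"
    and nn: "\<And>i w. 0 \<le> Z i w"
    and super: "\<And>i B. B \<in> sets (G i) \<Longrightarrow> (LINT w:B|M. Z (Suc i) w) \<le> (LINT w:B|M. Z i w)"
  shows "(\<integral>\<^sup>+w. ennreal (real (upcrossings a b (\<lambda>i. Z i w) n)) \<partial>M) \<le> ennreal (a / (b - a))"
    and "(\<lambda>w. real (upcrossings a b (\<lambda>i. Z i w) n)) \<in> borel_measurable M"
proof -
  have sp: "space (G i) = space M" for i using sub by (auto simp: subalgebra_def)
  have adm: "Z i \<in> borel_measurable (G j)" if "i \<le> j" for i j
    using ad[of i] inc[OF that] sp by (auto simp: measurable_def)
  have H: "Measurable.pred (G i) (\<lambda>w. seeking_high a b (\<lambda>i. Z i w) i)" for i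
  proof (induction i)
    case 0
    have [measurable]: "Z 0 \<in> borel_measurable (G 0)" by (rule ad)
    show ?case by simp
  next
    case (Suc i)
    have [measurable]: "Z (Suc i) \<in> borel_measurable (G (Suc i))" by (rule ad)
    have [measurable]: "Measurable.pred (G (Suc i)) (\<lambda>w. seeking_high a b (\<lambda>i. Z i w) i)"
      using Suc inc[of i "Suc i"] sp by (auto simp: measurable_def)
    show ?case by simp
  qed
  have HM[measurable]: "Measurable.pred M (\<lambda>w. seeking_high a b (\<lambda>i. Z i w) i)" for i
    by (rule measurable_from_subalg[OF sub H])
  have ZM[measurable]: "Z i \<in> borel_measurable M" for i by (rule measurable_from_subalg[OF sub ad])
  show um: "(\<lambda>w. real (upcrossings a b (\<lambda>i. Z i w) n)) \<in> borel_measurable M" for n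
    by (induction n) auto
  have ui: "integrable M (\<lambda>w. real (upcrossings a b (\<lambda>i. Z i w) n))" for n
    by (rule integrable_const_bound[of _ "real n"]) (auto intro!: um simp: upcrossings_le)
  define B where "B i = {w \<in> space M. seeking_high a b (\<lambda>i. Z i w) i}" for i
  have B: "B i \<in> sets (G i)" for i using H[of i] sp[of i] by (simp add: B_def pred_def)
  have BM: "B i \<in> sets M" for i unfolding B_def by measurable
  have path: "(b - a) * real (upcrossings a b (\<lambda>i. Z i w) n) \<le>
      a + (\<Sum>i<n. indicator (B i) w *\<^sub>R Z (Suc i) w - indicator (B i) w *\<^sub>R Z i w)" if "w \<in> space M" for w
  proof -
    have "(\<Sum>i<n. if seeking_high a b (\<lambda>i. Z i w) i then Z (Suc i) w - Z i w else 0) =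
       (\<Sum>i<n. indicator (B i) w *\<^sub>R Z (Suc i) w - indicator (B i) w *\<^sub>R Z i w)"
      using that by (intro sum.cong) (auto simp: B_def indicator_def)
    moreover have "- a \<le> (if seeking_high a b (\<lambda>i. Z i w) n then Z n w - a else 0)" using nn[of n w] ab by auto
    ultimately show ?thesis using upcrossings_gain[OF ab(2), of "\<lambda>i. Z i w" n] by linarith
  qed
  have intB: "integrable M (\<lambda>w. indicator (B i) w *\<^sub>R Z j w)" for i j
    using int BM by (rule integrable_mult_indicator[rotated])
  have "(b - a) * (LINT w|M. real (upcrossings a b (\<lambda>i. Z i w) n)) =
     (LINT w|M. (b - a) * real (upcrossings a b (\<lambda>i. Z i w) n))" by simp
  also have "\<dots> \<le> (LINT w|M. a + (\<Sum>i<n. indicator (B i) w *\<^sub>R Z (Suc i) w - indicator (B i) w *\<^sub>R Z i w))"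
    using intB ui path by (intro integral_mono Bochner_Integration.integrable_add Bochner_Integration.integrable_sum Bochner_Integration.integrable_diff integrable_mult_right) auto
  also have "\<dots> = a + (\<Sum>i<n. (LINT w:B i|M. Z (Suc i) w) - (LINT w:B i|M. Z i w))"
    using intB by (subst Bochner_Integration.integral_add, simp, simp, subst Bochner_Integration.integral_sum)
       (auto simp: set_lebesgue_integral_def prob_space)
  also have "\<dots> \<le> a" using super[OF B] by (auto intro!: sum_nonpos)
  finally have "(LINT w|M. real (upcrossings a b (\<lambda>i. Z i w) n)) \<le> a / (b - a)"
    using ab by (simp add: pos_le_divide_eq mult.commute)
  then show "(\<integral>\<^sup>+w. ennreal (real (upcrossings a b (\<lambda>i. Z i w) n)) \<partial>M) \<le> ennreal (a / (b - a))"
    using ui by (subst nn_integral_eq_integral) (auto intro: ennreal_leI)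
qed

text \<open>Right-continuity keeps the path below a, or above b, for a short while after each visit,
  so fine dyadic grids register each of finitely many oscillations. The number
  \<open>n * 2 ^ n\<close> of steps lets the horizon n grow with the resolution.\<close>

lemma oscillation_upcrossings:
  fixes v :: "real \<Rightarrow> real"
  assumes ab: "a < b" and rc: "\<And>t. t \<ge> 0 \<Longrightarrow> (v \<longlongrightarrow> v t) (at_right t)"
    and low: "\<And>T. \<exists>t>T. v t < a" and high: "\<And>T. \<exists>t>T. v t > b"
  shows "\<exists>n0. \<forall>n\<ge>n0. k \<le> upcrossings a b (\<lambda>i. v (real i / 2 ^ n)) (n * 2 ^ n)"
proof -
  have grid: "\<exists>i. t \<le> real i / 2 ^ n \<and> real i / 2 ^ n < t + d"
    if t: "t \<ge> 0" and n: "1 / 2 ^ n < d" for t d :: real and n :: nat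
  proof (intro exI[of _ "nat \<lceil>t * 2 ^ n\<rceil>"] conjI)
    have nn: "0 \<le> t * 2 ^ n" using t by simp
    have 1: "t * 2 ^ n \<le> real (nat \<lceil>t * 2 ^ n\<rceil>)" by (simp add: real_nat_ceiling_ge)
    then show "t \<le> real (nat \<lceil>t * 2 ^ n\<rceil>) / 2 ^ n" by (simp add: pos_le_divide_eq)
    have "real (nat \<lceil>t * 2 ^ n\<rceil>) < t * 2 ^ n + 1" using nn by linarith
    also have "\<dots> < t * 2 ^ n + d * 2 ^ n" using n by (simp add: pos_divide_less_eq)
    finally show "real (nat \<lceil>t * 2 ^ n\<rceil>) / 2 ^ n < t + d" by (simp add: pos_divide_less_eq distrib_right)
  qed
  have small: "\<exists>n0. \<forall>n\<ge>n0. 1 / 2 ^ n < (d::real)" if "d > 0" for d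
  proof -
    have "(\<lambda>n. 1 / 2 ^ n :: real) \<longlonglongrightarrow> 0"
      using LIMSEQ_power_zero[of "1/2::real"] by (simp add: power_one_over)
    from order_tendstoD(2)[OF this that] show ?thesis by (simp add: eventually_sequentially)
  qed
  have nbh: "\<exists>d>0. \<forall>u. t \<le> u \<and> u < t + d \<longrightarrow> P (v u)"
    if "t \<ge> 0" "P (v t)" "open {x. P x}" for t P
  proof -
    have "\<forall>\<^sub>F u in at_right t. v u \<in> {x. P x}"
      by (rule topological_tendstoD[OF rc[OF that(1)] that(3)]) (use that in simp)
    then obtain c where "c > t" "\<And>u. t < u \<Longrightarrow> u < c \<Longrightarrow> P (v u)" by (auto simp: eventually_at_right_field)
    then show ?thesis using that(2) by (intro exI[of _ "c - t"]) (auto simp: le_less)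
  qed
  have "\<exists>T\<ge>0. \<exists>n0. \<forall>n\<ge>n0. \<exists>i. real i / 2 ^ n \<le> T \<and> k \<le> upcrossings a b (\<lambda>i. v (real i / 2 ^ n)) i"
  proof (induction k)
    case 0
    show ?case by (intro exI[of _ 0] conjI allI impI exI[of _ "0::nat"]) auto
  next
    case (Suc k)
    then obtain T n0 where T: "T \<ge> 0" "\<And>n. n \<ge> n0 \<Longrightarrow> \<exists>i. real i / 2 ^ n \<le> T \<and> k \<le> upcrossings a b (\<lambda>i. v (real i / 2 ^ n)) i"
      by auto
    obtain t1 where t1: "t1 > T" "v t1 < a" using low by blast
    obtain d1 where d1: "d1 > 0" "\<And>u. t1 \<le> u \<Longrightarrow> u < t1 + d1 \<Longrightarrow> v u < a"
      using nbh[of t1 "\<lambda>x. x < a"] t1 T open_lessThan[of a] by (auto simp: lessThan_def)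
    obtain t2 where t2: "t2 > t1 + d1" "v t2 > b" using high by blast
    obtain d2 where d2: "d2 > 0" "\<And>u. t2 \<le> u \<Longrightarrow> u < t2 + d2 \<Longrightarrow> v u > b"
      using nbh[of t2 "\<lambda>x. x > b"] t1 t2 T d1 open_greaterThan[of b] by (auto simp: greaterThan_def)
    obtain n1 where n1: "\<And>n. n \<ge> n1 \<Longrightarrow> 1 / 2 ^ n < min d1 d2" using small[of "min d1 d2"] d1 d2 by auto
    have "0 \<le> t2 + d2" using t2 t1 T d1 d2 by auto
    moreover have "\<forall>n\<ge>max n0 n1. \<exists>i. real i / 2 ^ n \<le> t2 + d2 \<and> Suc k \<le> upcrossings a b (\<lambda>i. v (real i / 2 ^ n)) i"
    proof (intro allI impI)
      fix n assume n: "n \<ge> max n0 n1"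
      obtain i0 where i0: "real i0 / 2 ^ n \<le> T" "k \<le> upcrossings a b (\<lambda>i. v (real i / 2 ^ n)) i0" using T(2)[of n] n by auto
      obtain i where i: "t1 \<le> real i / 2 ^ n" "real i / 2 ^ n < t1 + d1" using grid[of t1 n d1] n1[of n] n t1 T by auto
      obtain j where j: "t2 \<le> real j / 2 ^ n" "real j / 2 ^ n < t2 + d2" using grid[of t2 n d2] n1[of n] n t1 t2 d1 T by auto
      have "real i0 / 2 ^ n < real i / 2 ^ n" "real i / 2 ^ n < real j / 2 ^ n" using i0 i j t1 t2 by linarith+
      then have "i0 < i" "i < j" by (auto simp: divide_less_cancel)
      have "k \<le> upcrossings a b (\<lambda>i. v (real i / 2 ^ n)) i"
        using i0(2) upcrossings_mono[of i0 i a b "\<lambda>i. v (real i / 2 ^ n)"] \<open>i0 < i\<close> by linarith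
      then have "Suc k \<le> upcrossings a b (\<lambda>i. v (real i / 2 ^ n)) j"
        using upcrossings_step[OF ab \<open>i < j\<close>, of "\<lambda>i. v (real i / 2 ^ n)"] d1(2)[OF i] d2(2)[OF j] by auto
      then show "\<exists>i. real i / 2 ^ n \<le> t2 + d2 \<and> Suc k \<le> upcrossings a b (\<lambda>i. v (real i / 2 ^ n)) i"
        using j by (intro exI[of _ j]) auto
    qed
    ultimately show ?case by blast
  qed
  then obtain T n0 where T: "T \<ge> 0" "\<And>n. n \<ge> n0 \<Longrightarrow> \<exists>i. real i / 2 ^ n \<le> T \<and> k \<le> upcrossings a b (\<lambda>i. v (real i / 2 ^ n)) i"
    by auto
  obtain N where N: "T \<le> real N" using real_arch_simple by blast
  show ?thesis
  proof (intro exI[of _ "max n0 N"] allI impI)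
    fix n assume n: "n \<ge> max n0 N"
    obtain i where i: "real i / 2 ^ n \<le> T" "k \<le> upcrossings a b (\<lambda>i. v (real i / 2 ^ n)) i" using T(2)[of n] n by auto
    have "real i \<le> T * 2 ^ n" using i(1) by (simp add: pos_divide_le_eq)
    also have "\<dots> \<le> real n * 2 ^ n" using N n by (intro mult_right_mono) auto
    finally have "real i \<le> real (n * 2 ^ n)" by simp
    then have "i \<le> n * 2 ^ n" by (simp only: of_nat_le_iff)
    then show "k \<le> upcrossings a b (\<lambda>i. v (real i / 2 ^ n)) (n * 2 ^ n)"
      using i(2) upcrossings_mono[of i "n * 2 ^ n" a b "\<lambda>i. v (real i / 2 ^ n)"] by linarith
  qed
qed

text \<open>Doob's theorem from upcrossings along dyadic grids: by Fatou's lemma their lower limit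
  is a.s. finite, while an oscillation across rational levels a < b would drive it to infinity.
  Right-continuity is asked a.s. because 1/W has it only on paths where W stays positive.\<close>

theorem (in prob_space) supermartingale_convergence:
  fixes V :: "real \<Rightarrow> 'a \<Rightarrow> real"
  assumes F: "filtration M F" and ad: "\<And>t. t \<ge> 0 \<Longrightarrow> V t \<in> borel_measurable (F t)"
    and nn: "\<And>t w. t \<ge> 0 \<Longrightarrow> 0 \<le> V t w" and int: "\<And>t. t \<ge> 0 \<Longrightarrow> integrable M (V t)"
    and super: "\<And>s t B. 0 \<le> s \<Longrightarrow> s \<le> t \<Longrightarrow> B \<in> sets (F s) \<Longrightarrow> (LINT w:B|M. V t w) \<le> (LINT w:B|M. V s w)"
    and rc: "AE w in M. \<forall>t\<ge>0. ((\<lambda>s. V s w) \<longlongrightarrow> V t w) (at_right t)"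
  shows "AE w in M. \<exists>l. ((\<lambda>t. V t w) \<longlongrightarrow> l) at_top"
proof -
  define U where "U a b n w = upcrossings a b (\<lambda>i. V (real i / 2 ^ n) w) (n * 2 ^ n)" for a b n w
  have U: "(\<integral>\<^sup>+w. ennreal (real (U a b n w)) \<partial>M) \<le> ennreal (a / (b - a))"
    "(\<lambda>w. real (U a b n w)) \<in> borel_measurable M" if "0 \<le> a" "a < b" for a b n
  proof -
    have *: "real i / 2 ^ n \<le> real (Suc i) / 2 ^ n" "real i / 2 ^ n \<le> real j / 2 ^ n" if "i \<le> j" for i j
      using that by (auto intro!: divide_right_mono)
    show "(\<integral>\<^sup>+w. ennreal (real (U a b n w)) \<partial>M) \<le> ennreal (a / (b - a))"
      "(\<lambda>w. real (U a b n w)) \<in> borel_measurable M"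
      unfolding U_def
      by (rule upcrossing_inequality[OF that, where G="\<lambda>i. F (real i / 2 ^ n)"];
        use F in \<open>simp add: ad nn int super * filtration_def divide_right_mono\<close>)+
  qed
  have notosc: "AE w in M. \<not> (\<forall>k. \<exists>n0. \<forall>n\<ge>n0. k \<le> U a b n w)" if ab: "0 \<le> a" "a < b" for a b
  proof -
    have Um[measurable]: "(\<lambda>w. ennreal (real (U a b n w))) \<in> borel_measurable M" for n
      using U(2)[OF ab] by measurable
    have "(\<integral>\<^sup>+w. liminf (\<lambda>n. ennreal (real (U a b n w))) \<partial>M) \<le> liminf (\<lambda>n. \<integral>\<^sup>+w. ennreal (real (U a b n w)) \<partial>M)"
      by (rule nn_integral_liminf) measurable
    also have "\<dots> \<le> ennreal (a / (b - a))"
      using U(1)[OF ab] by (intro Liminf_le) auto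
    finally have "(\<integral>\<^sup>+w. liminf (\<lambda>n. ennreal (real (U a b n w))) \<partial>M) \<noteq> \<infinity>"
      by (auto simp: top_unique)
    then have "AE w in M. liminf (\<lambda>n. ennreal (real (U a b n w))) \<noteq> \<infinity>"
      by (intro nn_integral_noteq_infinite) auto
    then show ?thesis
    proof eventually_elim
      case (elim w)
      show ?case
      proof
        assume *: "\<forall>k. \<exists>n0. \<forall>n\<ge>n0. k \<le> U a b n w"
        have "of_nat k \<le> liminf (\<lambda>n. ennreal (real (U a b n w)))" for k :: nat
        proof (rule Liminf_bounded)
          show "\<forall>\<^sub>F n in sequentially. of_nat k \<le> ennreal (real (U a b n w))"
            using *[rule_format, of k] by (auto simp: eventually_sequentially ennreal_of_nat_eq_real_of_nat[symmetric])
        qed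
        then have "liminf (\<lambda>n. ennreal (real (U a b n w))) = \<infinity>"
          using ennreal_Ex_less_of_nat[of "liminf (\<lambda>n. ennreal (real (U a b n w)))"] by (auto simp: less_top[symmetric] not_less[symmetric])
        with elim show False by simp
      qed
    qed
  qed
  have "AE w in M. \<forall>q\<in>{(a, b). 0 \<le> a \<and> a < b \<and> a \<in> \<rat> \<and> b \<in> \<rat>}. \<not> (\<forall>k. \<exists>n0. \<forall>n\<ge>n0. k \<le> U (fst q) (snd q) n w)"
  proof (rule AE_ball_countable')
    show "countable {(a, b). 0 \<le> a \<and> a < b \<and> a \<in> \<rat> \<and> b \<in> (\<rat> :: real set)}"
      by (rule countable_subset[of _ "\<rat> \<times> \<rat>"]) (auto simp: countable_rat)
  qed (use notosc in auto)
  \<comment> \<open>Fatou's lemma along the integer times excludes the limit \<infinity>.\<close>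
  moreover have "AE w in M. liminf (\<lambda>n. ennreal (V (real n) w)) \<noteq> \<infinity>"
  proof -
    have [measurable]: "V t \<in> borel_measurable M" if "t \<ge> 0" for t using filtrationD(4)[OF F that ad[OF that]] .
    have "(\<integral>\<^sup>+w. liminf (\<lambda>n. ennreal (V (real n) w)) \<partial>M) \<le> liminf (\<lambda>n. \<integral>\<^sup>+w. ennreal (V (real n) w) \<partial>M)"
      by (rule nn_integral_liminf) measurable
    also have "\<dots> \<le> ennreal (LINT w|M. V 0 w)"
    proof (rule Liminf_le[OF _ always_eventually[OF allI]])
      fix n
      have "space M \<in> sets (F 0)" using filtrationD(1)[OF F, of 0] sets.top[of "F 0"] by simp
      then have "(LINT w|M. V (real n) w) \<le> (LINT w|M. V 0 w)"
        using super[of 0 "real n" "space M"] by (simp add: set_integral_space int)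
      then show "(\<integral>\<^sup>+w. ennreal (V (real n) w) \<partial>M) \<le> ennreal (LINT w|M. V 0 w)"
        using int nn by (subst nn_integral_eq_integral) (auto intro: ennreal_leI)
    qed auto
    finally have "(\<integral>\<^sup>+w. liminf (\<lambda>n. ennreal (V (real n) w)) \<partial>M) \<noteq> \<infinity>" by (auto simp: top_unique)
    then show ?thesis by (intro nn_integral_noteq_infinite) auto
  qed
  ultimately show ?thesis using rc
  proof eventually_elim
    case (elim w)
    let ?v = "\<lambda>t. ereal (V t w)"
    have v0: "0 \<le> Liminf at_top ?v"
      using nn by (intro Liminf_bounded) (auto simp: eventually_at_top_linorder intro!: exI[of _ 0])
    have le: "Liminf at_top ?v \<le> Limsup at_top ?v" by (rule Liminf_le_Limsup) simp
    have "Liminf at_top ?v = Limsup at_top ?v"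
    proof (rule ccontr)
      assume "\<not> ?thesis"
      then have "Liminf at_top ?v < Limsup at_top ?v" using le by simp
      then obtain b where b: "Liminf at_top ?v < ereal (real_of_rat b)" "ereal (real_of_rat b) < Limsup at_top ?v"
        using ereal_dense3 by blast
      then obtain a where a: "Liminf at_top ?v < ereal (real_of_rat a)" "ereal (real_of_rat a) < ereal (real_of_rat b)"
        using ereal_dense3[OF b(1)] by blast
      let ?a = "real_of_rat a" and ?b = "real_of_rat b"
      have a0: "0 \<le> ?a" using v0 a(1) by (metis ereal_less_eq(5) less_imp_le order_trans)
      have ab: "?a < ?b" using a(2) by simp
      have low: "\<exists>t>T. V t w < ?a" for T
      proof (rule ccontr)
        assume "\<not> ?thesis"
        then have "\<forall>\<^sub>F t in at_top. ereal ?a \<le> ?v t"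
          unfolding eventually_at_top_dense ereal_less_eq by (meson not_less)
        then have "ereal ?a \<le> Liminf at_top ?v" by (rule Liminf_bounded)
        then show False using a(1) by simp
      qed
      have high: "\<exists>t>T. V t w > ?b" for T
      proof (rule ccontr)
        assume "\<not> ?thesis"
        then have "\<forall>\<^sub>F t in at_top. ?v t \<le> ereal ?b"
          unfolding eventually_at_top_dense ereal_less_eq by (meson not_less)
        then have "Limsup at_top ?v \<le> ereal ?b" by (rule Limsup_bounded)
        then show False using b(2) by simp
      qed
      have "\<forall>k. \<exists>n0. \<forall>n\<ge>n0. k \<le> U ?a ?b n w"
        unfolding U_def using oscillation_upcrossings[OF ab, of "\<lambda>t. V t w"] elim(3) low high by blast
      moreover have "(?a, ?b) \<in> {(a, b). 0 \<le> a \<and> a < b \<and> a \<in> \<rat> \<and> b \<in> \<rat>}"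
        using a0 ab by simp
      ultimately show False using bspec[OF elim(1), of "(?a, ?b)"] by simp
    qed
    then obtain L where L: "(?v \<longlongrightarrow> L) at_top"
      using tendsto_iff_Liminf_eq_Limsup[of at_top ?v] by auto
    have L0: "0 \<le> L" using L nn
      by (intro tendsto_lowerbound[OF L]) (auto simp: eventually_at_top_linorder intro!: exI[of _ 0])
    have "L \<noteq> \<infinity>"
    proof
      assume "L = \<infinity>"
      have "k \<le> liminf (\<lambda>n. ennreal (V (real n) w))" if k: "k \<noteq> \<infinity>" for k
      proof (rule Liminf_bounded)
        obtain c where c: "k = ennreal c" "c \<ge> 0" using k by (cases k) auto
        have "\<forall>\<^sub>F t in at_top. ereal c < ?v t"
          using order_tendstoD(1)[OF L[unfolded \<open>L = \<infinity>\<close>], of "ereal c"] by simp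
        then have "\<forall>\<^sub>F n in sequentially. c < V (real n) w"
          using filterlim_real_sequentially by (auto simp: filterlim_iff)
        then show "\<forall>\<^sub>F n in sequentially. k \<le> ennreal (V (real n) w)"
          by eventually_elim (auto simp: c intro: ennreal_leI)
      qed
      then have "liminf (\<lambda>n. ennreal (V (real n) w)) + 1 \<le> liminf (\<lambda>n. ennreal (V (real n) w))"
        using elim(2) by auto
      then have "liminf (\<lambda>n. ennreal (V (real n) w)) = \<infinity>"
        by (cases "liminf (\<lambda>n. ennreal (V (real n) w))")
           (auto simp: ennreal_1[symmetric] ennreal_plus[symmetric] simp del: ennreal_1 ennreal_plus)
      with elim(2) show False by simp
    qed
    then obtain l where "L = ereal l" using L0 by (cases L) auto
    then show ?case using L by (intro exI[of _ l]) simp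
  qed
qed

section \<open>The post-investment wealth\<close>

lemma l1_nonneg [simp]: "0 \<le> l1 x"
  by (simp add: l1_def sum_nonneg)

lemma l1_eq_0_iff [simp]: "l1 x = 0 \<longleftrightarrow> x = 0"
  by (auto simp: l1_def sum_nonneg_eq_0_iff vec_eq_iff)

lemma l1_zero [simp]: "l1 0 = 0"
  by simp

lemma l1_pos_iff: "0 < l1 x \<longleftrightarrow> x \<noteq> 0"
  using l1_nonneg[of x] l1_eq_0_iff[of x] by linarith

lemma borel_measurable_l1 [measurable]: "l1 \<in> borel_measurable borel"
  unfolding l1_def by measurable

lemma l1_nonneg_vec: "x \<in> nonneg_vecs \<Longrightarrow> l1 x = (\<Sum>i\<in>UNIV. x $ i)"
  by (simp add: l1_def nonneg_vecs_def)

lemma nonneg_vecs_borel [measurable, simp]: "nonneg_vecs \<in> sets borel"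
proof -
  have "nonneg_vecs = {x::real^'n. \<forall>i. 0 \<le> x $ i}" by (simp add: nonneg_vecs_def)
  also have "closed \<dots>" by (intro closed_Collect_all closed_Collect_le continuous_intros)
  finally show ?thesis by (rule borel_closed)
qed

text \<open>With v = 1/wl the left side is v/(1 + e v), a concave function of v. The right side is
  its tangent at v = 1/c, with slope 1/(1 + e/c)^2 = c^2/(c + e)^2.\<close>

lemma reciprocal_tangent:
  fixes c wl e :: real
  assumes "c > 0" "wl > 0" "e > 0"
  shows "1 / (e + wl) \<le> 1 / (e + c) + c\<^sup>2 / (c + e)\<^sup>2 * (1 / wl - 1 / c)"
proof -
  have "1 / (e + c) + c\<^sup>2 / (c + e)\<^sup>2 * (1 / wl - 1 / c) - 1 / (e + wl) = (c - wl)\<^sup>2 * e / (wl * (c + e)\<^sup>2 * (e + wl))"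
  proof -
    have nz: "e + c \<noteq> 0" "e + wl \<noteq> 0" "c + e \<noteq> 0" "c \<noteq> 0" "wl \<noteq> 0" using assms by auto
    then show ?thesis by (simp add: divide_simps power2_eq_square) algebra
  qed
  also have "\<dots> \<ge> 0" using assms by (intro divide_nonneg_pos mult_nonneg_nonneg mult_pos_pos) auto
  finally show ?thesis by simp
qed

text \<open>The jump at a fixed time has law \<kappa>, completed by an atom of mass 1 - p at the jump size 0.
  The wealth before the jump is c, and z remains after the investment; the second alternative is \<Gamma>_2.\<close>

definition invested :: "(real^'n) measure \<Rightarrow> real \<Rightarrow> real \<Rightarrow> real \<Rightarrow> bool" where
  "invested \<kappa> p c z \<longleftrightarrow> 0 \<le> z \<and> z \<le> c \<and>
     (0 < z \<and> (LINT x|\<kappa>. c / (z + l1 x)) + c / z * (1 - p) = 1 \<or>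
      z = 0 \<and> p = 1 \<and> (\<integral>\<^sup>+x. ennreal (c / l1 x) \<partial>\<kappa>) \<le> 1)"

locale jump_law =
  fixes \<kappa> :: "(real^'n) measure" and p c :: real
  assumes sets_k [simp, measurable_cong]: "sets \<kappa> = sets borel" and mass: "emeasure \<kappa> UNIV = ennreal p"
    and p01: "0 \<le> p" "p \<le> 1" and nz: "AE x in \<kappa>. 0 < l1 x" and c: "c > 0"
begin

lemma space_k [simp]: "space \<kappa> = UNIV"
  using sets_eq_imp_space_eq[OF sets_k] by simp

lemma fin: "finite_measure \<kappa>"
  by (rule finite_measureI) (simp add: mass)

lemma measure_k: "measure \<kappa> UNIV = p"
  by (simp add: measure_def mass p01)

lemma integral_const_k: "(LINT x|\<kappa>. (r::real)) = p * r"
  by (simp add: measure_k)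

lemma integrable_const_k: "integrable \<kappa> (\<lambda>x. r::real)"
  using finite_measure.integrable_const[OF fin] .

lemma bounded_integrable:
  fixes f :: "real^'n \<Rightarrow> real"
  assumes [measurable]: "f \<in> borel_measurable borel" and "\<And>x. \<bar>f x\<bar> \<le> B"
  shows "integrable \<kappa> f"
  by (rule finite_measure.integrable_const_bound[OF fin, of _ B]) (use assms in auto)

lemma int_frac: "integrable \<kappa> (\<lambda>x. r / (z + l1 x))" if "z > 0"
proof (rule bounded_integrable[of _ "\<bar>r\<bar> / z"])
  fix x
  show "\<bar>r / (z + l1 x)\<bar> \<le> \<bar>r\<bar> / z" using that l1_nonneg[of x]
    by (auto simp: abs_divide abs_of_pos add_pos_nonneg intro!: divide_left_mono mult_pos_pos)
qed measurable

lemma nn_frac: "(\<integral>\<^sup>+x. ennreal (c / (z + l1 x)) \<partial>\<kappa>) = ennreal (LINT x|\<kappa>. c / (z + l1 x))" if "z > 0"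
  using c that by (intro nn_integral_eq_integral int_frac) auto

lemma frac_nonneg: "0 \<le> (LINT x|\<kappa>. c / (z + l1 x))" if "z \<ge> 0"
  using c that by (intro integral_nonneg_AE) auto

text \<open>The mean of c/(z + |jump|); the atom at jump size 0 contributes c/z with mass 1 -
  p.\<close>

definition h :: "real \<Rightarrow> real" where "h z = (LINT x|\<kappa>. c / (z + l1 x)) + c / z * (1 - p)"

lemma h_antimono: "0 < z \<Longrightarrow> z \<le> z' \<Longrightarrow> h z' \<le> h z"
  unfolding h_def using c p01
  by (intro add_mono integral_mono int_frac mult_right_mono divide_left_mono mult_pos_pos) (auto simp: add_pos_nonneg)

text \<open>For p < 1 the atom at 0 gives strictness; for p = 1 the law \<kappa> has positive mass
  and its integrand is strictly decreasing in z.\<close>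

lemma h_strict: assumes "0 < z" "z < z'" shows "h z' < h z"
proof (cases "p < 1")
  case True
  have "(LINT x|\<kappa>. c / (z' + l1 x)) \<le> (LINT x|\<kappa>. c / (z + l1 x))"
    using c assms by (intro integral_mono int_frac divide_left_mono mult_pos_pos) (auto simp: add_pos_nonneg)
  moreover have "c / z' * (1 - p) < c / z * (1 - p)"
    using True c assms by (intro mult_strict_right_mono divide_strict_left_mono) auto
  ultimately show ?thesis by (simp add: h_def)
next
  case False
  then have p: "p = 1" using p01 by simp
  have "(LINT x|\<kappa>. c / (z' + l1 x)) < (LINT x|\<kappa>. c / (z + l1 x))"
  proof (rule finite_measure.integral_less_AE_space[OF fin])
    show "AE x in \<kappa>. c / (z' + l1 x) < c / (z + l1 x)"
      using c assms by (intro AE_I2 divide_strict_left_mono mult_pos_pos) (auto simp: add_pos_nonneg)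
  qed (use assms int_frac in \<open>auto simp: mass p\<close>)
  then show ?thesis unfolding h_def using p by simp
qed

text \<open>On [z0,\<infinity>) the integrand is Lipschitz in z with constant c/z0^2, uniformly in
  x, and \<kappa> has mass p.\<close>

lemma h_cont: assumes "0 < z0" shows "continuous_on {z0..} h"
proof -
  have "(p * c / (z0 * z0))-lipschitz_on {z0..} (\<lambda>z. LINT x|\<kappa>. c / (z + l1 x))"
  proof (rule lipschitz_onI)
    fix z z' assume z: "z \<in> {z0..}" "z' \<in> {z0..}"
    have pt: "\<bar>c / (z + l1 x) - c / (z' + l1 x)\<bar> \<le> c / (z0 * z0) * \<bar>z - z'\<bar>" for x :: "real^'n"
    proof -
      have pos: "0 < z + l1 x" "0 < z' + l1 x" "z0 \<le> z + l1 x" "z0 \<le> z' + l1 x" using z assms l1_nonneg[of x] unfolding atLeast_iff by linarith+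
      have "c / (z + l1 x) - c / (z' + l1 x) = c / ((z + l1 x) * (z' + l1 x)) * (z' - z)"
        using pos by (simp add: field_simps)
      then have "\<bar>c / (z + l1 x) - c / (z' + l1 x)\<bar> = c / ((z + l1 x) * (z' + l1 x)) * \<bar>z - z'\<bar>"
        using c pos by (simp add: abs_mult abs_minus_commute)
      also have "\<dots> \<le> c / (z0 * z0) * \<bar>z - z'\<bar>"
      proof (intro mult_right_mono divide_left_mono)
        show "z0 * z0 \<le> (z + l1 x) * (z' + l1 x)" using pos assms by (intro mult_mono) linarith+
        show "0 < (z + l1 x) * (z' + l1 x) * (z0 * z0)" using pos assms by (intro mult_pos_pos)
      qed (use c in auto)
      finally show ?thesis .
    qed
    have "dist (LINT x|\<kappa>. c / (z + l1 x)) (LINT x|\<kappa>. c / (z' + l1 x)) = \<bar>LINT x|\<kappa>. c / (z + l1 x) - c / (z' + l1 x)\<bar>"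
      using z assms int_frac by (simp add: dist_real_def)
    also have "\<dots> \<le> (LINT x|\<kappa>. \<bar>c / (z + l1 x) - c / (z' + l1 x)\<bar>)" by (rule integral_abs_bound)
    also have "\<dots> \<le> (LINT x|\<kappa>. c / (z0 * z0) * \<bar>z - z'\<bar>)"
      using z assms int_frac pt by (intro integral_mono integrable_abs Bochner_Integration.integrable_diff integrable_const_k) auto
    also have "\<dots> = p * c / (z0 * z0) * dist z z'" by (simp add: measure_k dist_real_def)
    finally show "dist (LINT x|\<kappa>. c / (z + l1 x)) (LINT x|\<kappa>. c / (z' + l1 x)) \<le> p * c / (z0 * z0) * dist z z'" .
  qed (use c p01 assms in auto)
  then have "continuous_on {z0..} (\<lambda>z. LINT x|\<kappa>. c / (z + l1 x))" by (rule lipschitz_on_continuous_on)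
  then show ?thesis unfolding h_def using assms by (intro continuous_intros) auto
qed

text \<open>Jumps are a.s. nonzero under \<kappa>, so c/(c + |x|) < 1 there and the mean is below p
  + (1 - p).\<close>

lemma h_c: assumes "p > 0" shows "h c < 1"
proof -
  have "(LINT x|\<kappa>. c / (c + l1 x)) < (LINT x|\<kappa>. 1)"
  proof (rule finite_measure.integral_less_AE_space[OF fin])
    show "AE x in \<kappa>. c / (c + l1 x) < 1" using nz by eventually_elim (use c in \<open>simp add: pos_divide_less_eq add_pos_pos\<close>)
  qed (use c int_frac assms integrable_const_k in \<open>auto simp: mass\<close>)
  then show ?thesis using c unfolding integral_const_k by (simp add: h_def)
qed

text \<open>For p < 1 the atom at 0 alone exceeds 1: the chosen z makes its contribution equal to 2.
  For p = 1 the integral increases to that of c/|x| as z decreases to 0, and this exceeds 1 by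
  assumption.\<close>

lemma h_small:
  assumes "p < 1 \<or> (\<integral>\<^sup>+x. ennreal (c / l1 x) \<partial>\<kappa>) > 1"
  shows "\<exists>z>0. h z > 1"
proof (cases "p < 1")
  case True
  let ?z = "c * (1 - p) / 2"
  have "?z > 0" using c True by simp
  moreover have "c / ?z * (1 - p) = 2" using c True by (simp add: field_simps)
  then have "h ?z \<ge> 2" unfolding h_def using frac_nonneg[of ?z] c True by simp
  ultimately show ?thesis by (intro exI[of _ ?z]) auto
next
  case False
  then have p: "p = 1" and *: "(\<integral>\<^sup>+x. ennreal (c / l1 x) \<partial>\<kappa>) > 1" using assms p01 by auto
  have "(\<integral>\<^sup>+x. ennreal (c / l1 x) \<partial>\<kappa>) = (\<integral>\<^sup>+x. (SUP n. ennreal (c / (1 / real (Suc n) + l1 x))) \<partial>\<kappa>)"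
  proof (rule nn_integral_cong_AE)
    show "AE x in \<kappa>. ennreal (c / l1 x) = (SUP n. ennreal (c / (1 / real (Suc n) + l1 x)))"
      using nz
    proof eventually_elim
      case (elim x)
      have "(\<lambda>n. c / (1 / real (Suc n) + l1 x)) \<longlonglongrightarrow> c / (0 + l1 x)"
        using elim by (intro tendsto_intros LIMSEQ_Suc[OF lim_const_over_n]) auto
      then have "(\<lambda>n. ennreal (c / (1 / real (Suc n) + l1 x))) \<longlonglongrightarrow> ennreal (c / (0 + l1 x))"
        by (rule tendsto_ennrealI)
      moreover have "incseq (\<lambda>n. ennreal (c / (1 / real (Suc n) + l1 x)))"
        using elim c by (intro incseq_SucI ennreal_leI divide_left_mono add_mono mult_pos_pos add_pos_pos) (auto simp: field_simps)
      ultimately show ?case by (simp add: LIMSEQ_unique[OF LIMSEQ_SUP])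
    qed
  qed
  also have "\<dots> = (SUP n. \<integral>\<^sup>+x. ennreal (c / (1 / real (Suc n) + l1 x)) \<partial>\<kappa>)"
  proof (rule nn_integral_monotone_convergence_SUP)
    show "incseq (\<lambda>n x. ennreal (c / (1 / real (Suc n) + l1 x)))"
      using c by (intro incseq_SucI le_funI ennreal_leI divide_left_mono add_mono mult_pos_pos add_pos_nonneg) (auto simp: field_simps)
  qed measurable
  finally obtain n where "1 < (\<integral>\<^sup>+x. ennreal (c / (1 / real (Suc n) + l1 x)) \<partial>\<kappa>)"
    using * by (auto simp: less_SUP_iff)
  then have "1 < ennreal (LINT x|\<kappa>. c / (1 / real (Suc n) + l1 x))" by (subst (asm) nn_frac) auto
  then have "1 < h (1 / real (Suc n))"
    unfolding h_def using p by (auto simp: ennreal_less_iff simp flip: ennreal_1 simp del: of_nat_Suc)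
  then show ?thesis by (intro exI[of _ "1 / real (Suc n)"]) auto
qed

lemma root_exists:
  assumes "p > 0" "p < 1 \<or> (\<integral>\<^sup>+x. ennreal (c / l1 x) \<partial>\<kappa>) > 1"
  shows "\<exists>!z. 0 < z \<and> z < c \<and> h z = 1"
proof -
  obtain z0 where z0: "z0 > 0" "h z0 > 1" using h_small[OF assms(2)] by auto
  have lt: "z0 < c" using h_antimono[OF c, of z0] h_c[OF assms(1)] z0 by (meson leI less_trans not_le order_less_le_trans)
  have "\<exists>z. z0 \<le> z \<and> z \<le> c \<and> h z = 1"
    using z0 lt h_c[OF assms(1)] continuous_on_subset[OF h_cont[OF z0(1)], of "{z0..c}"]
    by (intro IVT2') auto
  then obtain z where z: "z0 \<le> z" "z \<le> c" "h z = 1" by auto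
  then have "0 < z \<and> z < c \<and> h z = 1" using z0 h_c[OF assms(1)] by (auto simp: order_less_le)
  moreover have "z' = z" if "0 < z'" "h z' = 1" for z'
    using h_strict[of z z'] h_strict[of z' z] that calculation by (metis less_irrefl linorder_neqE_linordered_idom)
  ultimately show ?thesis by auto
qed

lemma root_iff:
  assumes "0 < z"
  shows "enn2ereal (\<integral>\<^sup>+x. ennreal (c / (z + l1 x)) \<partial>\<kappa>) = ereal (1 - c / z * (1 - p)) \<longleftrightarrow> h z = 1"
  using frac_nonneg[of z] assms by (auto simp: nn_frac h_def enn2ereal_ennreal)

text \<open>h is strictly decreasing with value 1 at z > 0, so a < z means h a > 1; for z = 0 the
  mean at a is at most that of c/|x|, hence at most 1. The right side does not mention z, and so
  transports measurability to the implicitly defined z.\<close>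

lemma invested_gt_iff:
  assumes z: "invested \<kappa> p c z" and a: "a > 0"
  shows "a < z \<longleftrightarrow> 1 < (\<integral>\<^sup>+x. ennreal (c / (a + l1 x)) \<partial>\<kappa>) + ennreal (c / a * (1 - p))"
proof -
  have eq: "(\<integral>\<^sup>+x. ennreal (c / (a + l1 x)) \<partial>\<kappa>) + ennreal (c / a * (1 - p)) = ennreal (h a)"
    using frac_nonneg[of a] a c p01 by (simp add: nn_frac h_def ennreal_plus)
  have pos: "(1 < ennreal (h a)) = (1 < h a)"
    by (metis ennreal_1 ennreal_less_iff zero_le_one)
  show ?thesis
  proof (cases "z = 0")
    case True
    then have p: "p = 1" "(\<integral>\<^sup>+x. ennreal (c / l1 x) \<partial>\<kappa>) \<le> 1" using z by (auto simp: invested_def)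
    have "(\<integral>\<^sup>+x. ennreal (c / (a + l1 x)) \<partial>\<kappa>) \<le> (\<integral>\<^sup>+x. ennreal (c / l1 x) \<partial>\<kappa>)"
      using nz by (intro nn_integral_mono_AE, eventually_elim) (use c a in \<open>auto intro!: ennreal_leI divide_left_mono\<close>)
    then show ?thesis using p True a by (simp add: not_less order.trans)
  next
    case False
    then have "0 < z" "h z = 1" using z by (auto simp: invested_def h_def)
    then show ?thesis unfolding eq pos
      using h_strict[of a z] h_antimono[of z a] a by (metis leI not_le)
  qed
qed

text \<open>Writing c|x|/(z + |x|) = c - z c/(z + |x|) and inserting the equation for z gives p c -
  z + c (1 - p) = c - z. So the investment at a fixed time is exactly what separates c from the
  wealth z left over.\<close>

lemma invested_cost:
  assumes z: "invested \<kappa> p c z"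
  shows "(\<integral>\<^sup>+x. ennreal (c * l1 x / (z + l1 x)) \<partial>\<kappa>) = ennreal (c - z)"
proof (cases "z = 0")
  case True
  then have p: "p = 1" using z by (auto simp: invested_def)
  have "(\<integral>\<^sup>+x. ennreal (c * l1 x / (z + l1 x)) \<partial>\<kappa>) = (\<integral>\<^sup>+x. ennreal c \<partial>\<kappa>)"
    using nz by (intro nn_integral_cong_AE, eventually_elim) (auto simp: True l1_pos_iff)
  also have "\<dots> = ennreal c" by (simp add: mass p)
  finally show ?thesis by (simp add: True)
next
  case False
  then have z': "0 < z" "(LINT x|\<kappa>. c / (z + l1 x)) + c / z * (1 - p) = 1" "z \<le> c" using z by (auto simp: invested_def)
  have eq: "c * l1 x / (z + l1 x) = c - z * (c / (z + l1 x))" for x :: "real^'n"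
  proof -
    have "z + l1 x > 0" using z'(1) l1_nonneg[of x] by linarith
    then show ?thesis by (simp add: field_simps)
  qed
  have i: "integrable \<kappa> (\<lambda>x. c - z * (c / (z + l1 x)))"
    by (intro Bochner_Integration.integrable_diff integrable_mult_right integrable_const_k int_frac z'(1))
  have "(\<integral>\<^sup>+x. ennreal (c * l1 x / (z + l1 x)) \<partial>\<kappa>) = ennreal (LINT x|\<kappa>. c * l1 x / (z + l1 x))"
    using i c z'(1) by (intro nn_integral_eq_integral) (auto simp only: eq[symmetric], auto)
  also have "(LINT x|\<kappa>. c * l1 x / (z + l1 x)) = p * c - z * (LINT x|\<kappa>. c / (z + l1 x))"
    unfolding eq Bochner_Integration.integral_diff[OF integrable_const_k integrable_mult_right[OF int_frac[OF z'(1)]]]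
      integral_mult_right_zero integral_const_k ..
  also have "\<dots> = c - z"
  proof -
    have "z * (LINT x|\<kappa>. c / (z + l1 x)) = z * (1 - c / z * (1 - p))" using z' by (metis add_diff_cancel_right')
    also have "\<dots> = z - c * (1 - p)" using z' by (simp add: field_simps)
    finally show ?thesis by (simp add: algebra_simps)
  qed
  finally show ?thesis .
qed

text \<open>Says that the mean of 1/(e + z + |jump|) is at most 1/(e + c). In terms of the
  differences 1/(e + z) - 1/(e + z + |x|) the atom at 0 drops out and \<kappa> alone is integrated.
  The tangent inequality is applied at z + |x|, and the mean of 1/(z + |jump|) is at most
  1/c.\<close>

lemma invested_growth:
  assumes z: "invested \<kappa> p c z" and e: "e > 0"
  shows "ennreal (1 / (e + z) - 1 / (e + c)) \<le> (\<integral>\<^sup>+x. ennreal (1 / (e + z) - 1 / (e + z + l1 x)) \<partial>\<kappa>)"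
proof -
  define q where "q = c\<^sup>2 / (c + e)\<^sup>2"
  have q: "q \<ge> 0" by (simp add: q_def)
  have zc: "0 \<le> z" "z \<le> c" using z by (auto simp: invested_def)
  have d: "0 \<le> 1 / (e + z) - 1 / (e + z + l1 x)" for x :: "real^'n"
    using zc e l1_nonneg[of x] by (simp add: frac_le)
  have i: "integrable \<kappa> (\<lambda>x. 1 / (e + z) - 1 / (e + z + l1 x))"
    using zc e by (intro Bochner_Integration.integrable_diff integrable_const_k int_frac) auto
  have tan: "1 / (e + z) - 1 / (e + c) - q * (1 / (z + l1 x) - 1 / c) \<le> 1 / (e + z) - 1 / (e + z + l1 x)" if "0 < z + l1 x" for x :: "real^'n"
    using reciprocal_tangent[OF c that e] by (simp add: q_def algebra_simps)
  have "1 / (e + z) - 1 / (e + c) \<le> (LINT x|\<kappa>. 1 / (e + z) - 1 / (e + z + l1 x))"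
  proof (cases "z = 0")
    case True
    then have p: "p = 1" "(\<integral>\<^sup>+x. ennreal (c / l1 x) \<partial>\<kappa>) \<le> 1" using z by (auto simp: invested_def)
    have ic: "integrable \<kappa> (\<lambda>x. c / l1 x)"
      using p(2) c by (intro integrableI_nonneg) (auto simp: order_le_less_trans ennreal_one_less_top)
    have "ennreal (LINT x|\<kappa>. c / l1 x) \<le> 1"
      using p(2) c by (subst (asm) nn_integral_eq_integral[OF ic]) auto
    then have J: "(LINT x|\<kappa>. c / l1 x) \<le> 1"
      by (simp flip: ennreal_1)
    have ic': "integrable \<kappa> (\<lambda>x. 1 / l1 x)" using integrable_mult_right[OF ic, of "1 / c"] c by simp
    have J': "c * (LINT x|\<kappa>. 1 / l1 x) \<le> 1" using J by (subst integral_mult_right_zero[symmetric]) simp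
    have "(LINT x|\<kappa>. 1 / (e + z) - 1 / (e + c) - q * (1 / l1 x - 1 / c)) \<le> (LINT x|\<kappa>. 1 / (e + z) - 1 / (e + z + l1 x))"
      using nz by (intro integral_mono_AE i Bochner_Integration.integrable_diff integrable_mult_right integrable_const_k ic', eventually_elim)
         (use tan True in auto)
    moreover have "(LINT x|\<kappa>. 1 / (e + z) - 1 / (e + c) - q * (1 / l1 x - 1 / c)) = 1 / (e + z) - 1 / (e + c) - q * ((LINT x|\<kappa>. 1 / l1 x) - 1 / c)"
      using ic' integrable_const_k by (simp add: measure_k p)
    moreover have "q * ((LINT x|\<kappa>. 1 / l1 x) - 1 / c) \<le> 0"
      using J' c q by (intro mult_nonneg_nonpos) (auto simp: pos_le_divide_eq mult.commute)
    ultimately show ?thesis by linarith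
  next
    case False
    then have z': "0 < z" "(LINT x|\<kappa>. c / (z + l1 x)) + c / z * (1 - p) = 1" using z by (auto simp: invested_def)
    have ic': "integrable \<kappa> (\<lambda>x. 1 / (z + l1 x))" by (rule int_frac[OF z'(1)])
    have "c * (LINT x|\<kappa>. 1 / (z + l1 x)) = 1 - c / z * (1 - p)"
      using z'(2) by (subst integral_mult_right_zero[symmetric]) simp
    then have J: "(LINT x|\<kappa>. 1 / (z + l1 x)) = 1 / c - (1 - p) / z"
      using c z'(1) by (simp add: field_simps)
    have "(LINT x|\<kappa>. 1 / (e + z) - 1 / (e + c) - q * (1 / (z + l1 x) - 1 / c)) \<le> (LINT x|\<kappa>. 1 / (e + z) - 1 / (e + z + l1 x))"
      using z'(1) by (intro integral_mono i Bochner_Integration.integrable_diff integrable_mult_right integrable_const_k ic' tan) (auto simp: add_pos_nonneg)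
    moreover have "(LINT x|\<kappa>. 1 / (e + z) - 1 / (e + c) - q * (1 / (z + l1 x) - 1 / c)) =
        p * (1 / (e + z) - 1 / (e + c)) - q * ((1 / c - (1 - p) / z) - p * (1 / c))"
      using ic' integrable_const_k by (simp add: measure_k J)
    \<comment> \<open>The mass 1 - p missing from \<kappa> sits at wealth z, where the tangent
      inequality gives the sign of the last term.\<close>
    moreover have "p * (1 / (e + z) - 1 / (e + c)) - q * ((1 / c - (1 - p) / z) - p * (1 / c)) =
      (1 / (e + z) - 1 / (e + c)) + (1 - p) * ((1 / (e + c) + q * (1 / z - 1 / c)) - 1 / (e + z))"
      by (simp add: algebra_simps diff_divide_distrib)
    moreover have "0 \<le> (1 - p) * ((1 / (e + c) + q * (1 / z - 1 / c)) - 1 / (e + z))"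
      using reciprocal_tangent[OF c z'(1) e] p01 by (simp add: q_def)
    ultimately show ?thesis by linarith
  qed
  then show ?thesis
    using i d by (subst nn_integral_eq_integral) (auto intro: ennreal_leI)
qed

text \<open>For |x| \<le> 1 the quotient is at most 2|x|, otherwise at most c. The constant is twice
  as large so that the same bound also serves the case z < c/2.\<close>

lemma frac_bound_half:
  assumes "c / 2 \<le> z"
  shows "c * l1 x / (z + l1 x) \<le> max (2 * c) 4 * min 1 (l1 x)"
proof -
  have "c * l1 x / (z + l1 x) \<le> c * l1 x / (c / 2 + l1 x)"
    using assms c l1_nonneg[of x] by (intro divide_left_mono mult_pos_pos) (auto simp: add_pos_nonneg)
  also have "\<dots> \<le> max (2 * c) 4 * min 1 (l1 x)"
  proof (cases "l1 x \<le> 1")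
    case True
    have "c * l1 x / (c / 2 + l1 x) \<le> c * l1 x / (c / 2)"
      using c l1_nonneg[of x] by (intro divide_left_mono mult_pos_pos) (auto simp: add_pos_nonneg)
    also have "\<dots> = 2 * l1 x" using c by simp
    also have "\<dots> \<le> max (2 * c) 4 * l1 x" by (intro mult_right_mono) auto
    finally show ?thesis using True by simp
  next
    case False
    have "c * l1 x / (c / 2 + l1 x) \<le> c" using c l1_nonneg[of x] by (simp add: pos_divide_le_eq add_pos_nonneg field_simps)
    then show ?thesis using False c by simp
  qed
  finally show ?thesis .
qed

text \<open>If z < c/2, then h (c/2) is at most 1, which says that the \<kappa>-integral of 2
  c|x|/(c/2 + |x|) is at least c and hence at least the cost c - z. So the cost is controlled by the
  integrand that defines G even when z is small or 0.\<close>

lemma invested_cost_bound: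
  assumes z: "invested \<kappa> p c z"
  shows "(\<integral>\<^sup>+x. ennreal (c * l1 x / (z + l1 x)) \<partial>\<kappa>) \<le> (\<integral>\<^sup>+x. ennreal (max (2 * c) 4 * min 1 (l1 x)) \<partial>\<kappa>)"
proof (cases "c / 2 \<le> z")
  case True
  then show ?thesis by (intro nn_integral_mono ennreal_leI frac_bound_half)
next
  case False
  have c2: "c / 2 > 0" using c by simp
  have "\<not> 1 < ennreal (h (c / 2))"
    using invested_gt_iff[OF z c2] False frac_nonneg[of "c / 2"] c p01 by (simp add: nn_frac h_def ennreal_plus)
  then have h: "h (c / 2) \<le> 1" by (metis ennreal_1 ennreal_less_iff zero_le_one leI)
  have pt: "c * (2 - c / (c / 2 + l1 x)) \<le> max (2 * c) 4 * min 1 (l1 x)" for x :: "real^'n"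
  proof -
    have "c * (2 - c / (c / 2 + l1 x)) = 2 * (c * l1 x / (c / 2 + l1 x))"
    proof -
      have "c / 2 + l1 x > 0" using c l1_nonneg[of x] by linarith
      then have "2 - c / (c / 2 + l1 x) = 2 * l1 x / (c / 2 + l1 x)" by (simp add: field_simps)
      then show ?thesis by simp
    qed
    also have "\<dots> \<le> max (2 * c) 4 * min 1 (l1 x)"
    proof (cases "l1 x \<le> 1")
      case True
      have "c * l1 x / (c / 2 + l1 x) \<le> c * l1 x / (c / 2)"
        using c l1_nonneg[of x] by (intro divide_left_mono mult_pos_pos) (auto simp: add_pos_nonneg)
      also have "\<dots> = 2 * l1 x" using c by simp
      finally have "2 * (c * l1 x / (c / 2 + l1 x)) \<le> 4 * l1 x" by simp
      also have "\<dots> \<le> max (2 * c) 4 * l1 x" by (intro mult_right_mono) auto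
      finally show ?thesis using True by simp
    next
      case False
      have "c * l1 x / (c / 2 + l1 x) \<le> c" using c l1_nonneg[of x] by (simp add: pos_divide_le_eq add_pos_nonneg field_simps)
      then show ?thesis using False c by simp
    qed
    finally show ?thesis .
  qed
  have i: "integrable \<kappa> (\<lambda>x. c * (2 - c / (c / 2 + l1 x)))"
    by (intro integrable_mult_right Bochner_Integration.integrable_diff integrable_const_k int_frac c2)
  have i2: "integrable \<kappa> (\<lambda>x. max (2 * c) 4 * min 1 (l1 x))"
    by (rule bounded_integrable[of _ "max (2 * c) 4"]) (use c in \<open>auto simp: abs_mult intro!: mult_left_le\<close>)
  have "c - z \<le> c" using z by (auto simp: invested_def)
  also have "c \<le> c * (2 * p - (LINT x|\<kappa>. c / (c / 2 + l1 x)))"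
  proof -
    have "c / (c / 2) * (1 - p) = 2 - 2 * p" using c by (simp add: field_simps)
    then have "1 \<le> 2 * p - (LINT x|\<kappa>. c / (c / 2 + l1 x))" using h unfolding h_def by linarith
    from mult_left_mono[OF this, of c] show ?thesis using c by simp
  qed
  also have "\<dots> = (LINT x|\<kappa>. c * (2 - c / (c / 2 + l1 x)))"
    using int_frac[OF c2, of c] integrable_const_k by (simp add: measure_k)
  also have "\<dots> \<le> (LINT x|\<kappa>. max (2 * c) 4 * min 1 (l1 x))"
    by (intro integral_mono i i2 pt)
  finally have "ennreal (c - z) \<le> (\<integral>\<^sup>+x. ennreal (max (2 * c) 4 * min 1 (l1 x)) \<partial>\<kappa>)"
    using c by (subst nn_integral_eq_integral[OF i2]) (auto intro!: ennreal_leI)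
  then show ?thesis by (simp add: invested_cost[OF z])
qed

end

text \<open>The law of the payoff jump at the fixed time t, with total mass
  \<open>nubar\<close>.\<close>

definition atom_law :: "(real \<times> (real^'n)) measure \<Rightarrow> real \<Rightarrow> (real^'n) measure" where
  "atom_law N t = distr (density N (indicator ({t} \<times> nonneg_vecs))) borel snd"

lemma nn_integral_atom_law:
  assumes [measurable_cong]: "sets N = sets borel" and f: "f \<in> borel_measurable borel"
  shows "(\<integral>\<^sup>+x. f x \<partial>atom_law N t) = (\<integral>\<^sup>+q. indicator ({t} \<times> nonneg_vecs) q * f (snd q) \<partial>N)"
proof -
  have [measurable]: "snd \<in> borel_measurable N" "{t} \<times> nonneg_vecs \<in> sets N"
    using assms(1) by (simp_all cong: measurable_cong_sets add: borel_prod[symmetric])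
  note f[measurable]
  show ?thesis unfolding atom_law_def
    by (subst nn_integral_distr) (simp_all add: nn_integral_density)
qed

lemma emeasure_atom_law:
  assumes s: "sets N = sets borel" and B: "B \<in> sets borel"
  shows "emeasure (atom_law N t) B = emeasure N ({t} \<times> (B \<inter> nonneg_vecs))"
proof -
  have "emeasure (atom_law N t) B = (\<integral>\<^sup>+x. indicator B x \<partial>atom_law N t)"
    using B by (simp add: atom_law_def)
  also have "\<dots> = (\<integral>\<^sup>+q. indicator ({t} \<times> (B \<inter> nonneg_vecs)) q \<partial>N)"
    using B by (subst nn_integral_atom_law[OF s]) (auto intro!: nn_integral_cong simp: indicator_def)
  also have "\<dots> = emeasure N ({t} \<times> (B \<inter> nonneg_vecs))"
    using B by (intro nn_integral_indicator) (simp add: s borel_prod[symmetric])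
  finally show ?thesis .
qed

text \<open>Without a fixed jump the law is null and z = c solves the equation, since only c/c = 1
  remains. On \<Gamma>_1 the root exists and is unique, so \<open>THE\<close> denotes it. What is
  left is the boundary case z = 0 with p = 1.\<close>

lemma zeta_invested:
  assumes s: "sets (\<nu> w) = sets borel" and le1: "emeasure (\<nu> w) ({t} \<times> nonneg_vecs) \<le> 1"
    and z0: "emeasure (\<nu> w) ({t} \<times> {0}) = 0" and c: "c > 0"
  shows "jump_law (atom_law (\<nu> w) t) (nubar \<nu> w t) c"
    and "invested (atom_law (\<nu> w) t) (nubar \<nu> w t) c (zeta \<nu> w t c)"
proof -
  let ?k = "atom_law (\<nu> w) t" and ?p = "nubar \<nu> w t"
  have m: "emeasure ?k UNIV = ennreal ?p"
    using le1 by (subst emeasure_atom_law[OF s]) (auto simp: nubar_def ennreal_enn2real_if top_unique)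
  have p1: "0 \<le> ?p" "?p \<le> 1" using le1 by (auto simp: nubar_def intro!: enn2real_leI)
  have "emeasure ?k {0} = 0" using z0
    by (subst emeasure_atom_law[OF s]) (auto simp: nonneg_vecs_def)
  then have nz: "AE x in ?k. 0 < l1 x"
    by (intro AE_I[where N="{0}"]) (auto simp: l1_pos_iff atom_law_def)
  show J: "jump_law ?k ?p c"
    by unfold_locales (use m p1 nz c in \<open>auto simp: atom_law_def\<close>)
  interpret jump_law ?k ?p c by (rule J)
  have int: "nu_at_int \<nu> w t f = (\<integral>\<^sup>+x. ennreal (f x) \<partial>?k)" if "f \<in> borel_measurable borel" for f
    unfolding nu_at_int_def using that by (subst nn_integral_atom_law[OF s]) auto
  have frac: "nu_at_int \<nu> w t (\<lambda>x. c / (z + l1 x)) = (\<integral>\<^sup>+x. ennreal (c / (z + l1 x)) \<partial>?k)" for z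
    by (rule int) measurable
  have frac0: "nu_at_int \<nu> w t (\<lambda>x. c / l1 x) = (\<integral>\<^sup>+x. ennreal (c / l1 x) \<partial>?k)"
    by (rule int) measurable
  consider "?p = 0" | "?p > 0" "Gamma1 \<nu> w t c" | "?p > 0" "\<not> Gamma1 \<nu> w t c" using p1 by linarith
  then show "invested ?k ?p c (zeta \<nu> w t c)"
  proof cases
    case 1
    have "emeasure ?k UNIV = 0" using m 1 by simp
    then have "AE x in ?k. False" by (intro AE_I[where N=UNIV]) auto
    then have "AE x in ?k. c / (c + l1 x) = 0" by eventually_elim simp
    then have "(LINT x|?k. c / (c + l1 x)) = (LINT x|?k. 0)"
      by (intro integral_cong_AE) measurable
    then show ?thesis using c 1 by (simp add: invested_def zeta_def)
  next
    case 2
    have G: "?p < 1 \<or> (\<integral>\<^sup>+x. ennreal (c / l1 x) \<partial>?k) > 1" using 2(2) p1 by (auto simp: Gamma1_def frac0)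
    have "zeta \<nu> w t c = (THE z. 0 < z \<and> z < c \<and> h z = 1)"
    proof -
      have "(\<lambda>z. 0 < z \<and> z < c \<and> enn2ereal (nu_at_int \<nu> w t (\<lambda>x. c / (z + l1 x))) = ereal (1 - c / z * (1 - ?p)))
          = (\<lambda>z. 0 < z \<and> z < c \<and> h z = 1)"
        unfolding frac using root_iff by blast
      then show ?thesis using 2 by (simp add: zeta_def zstar_def)
    qed
    moreover have "0 < (THE z. 0 < z \<and> z < c \<and> h z = 1) \<and> (THE z. 0 < z \<and> z < c \<and> h z = 1) < c \<and> h (THE z. 0 < z \<and> z < c \<and> h z = 1) = 1"
      by (rule theI'[OF root_exists[OF 2(1) G]])
    ultimately show ?thesis by (simp add: invested_def h_def)
  next
    case 3
    then have "?p = 1" "(\<integral>\<^sup>+x. ennreal (c / l1 x) \<partial>?k) \<le> 1" using p1 by (auto simp: Gamma1_def frac0 not_less)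
    then show ?thesis using 3 c by (simp add: invested_def zeta_def)
  qed
qed

section \<open>Locally finite measures as right-continuous functions\<close>

text \<open>Restricted to (0,t+1] the measure is finite, and its distribution function is
  right-continuous at t.\<close>

lemma rc_mono_measure:
  assumes N: "sets N = sets borel" and fin: "\<And>t. emeasure N {0<..t} < \<infinity>"
  shows "rc_mono (\<lambda>t. measure N {0<..t})"
  unfolding rc_mono_def
proof (intro conjI allI impI)
  show "mono_on {0..} (\<lambda>t. measure N {0<..t})"
    using N fin by (auto intro!: mono_onI measure_mono_fmeasurable fmeasurableI)
  fix t :: real assume "t \<ge> 0"
  define N' where "N' = density N (indicator {0<..t+1})"
  have e: "emeasure N' A = emeasure N (A \<inter> {0<..t+1})" if "A \<in> sets borel" for A
    unfolding N'_def using N that by (simp add: emeasure_density Int_commute nn_integral_set_ennreal[symmetric])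
      (simp add: indicator_inter_arith[symmetric] Int_commute)
  have [simp]: "space N = UNIV" using sets_eq_imp_space_eq[OF N] by simp
  have [simp]: "space N' = UNIV" using sets_eq_imp_space_eq[OF N] by (simp add: N'_def)
  have fb: "finite_borel_measure N'"
    using e[of UNIV] fin[of "t+1"] N
    by (intro finite_borel_measure.intro finite_borel_measure_axioms.intro finite_measureI) (auto simp: N'_def)
  have "continuous (at_right t) (cdf N')"
    by (rule finite_borel_measure.cdf_is_right_cont[OF fb])
  then have lim: "(cdf N' \<longlongrightarrow> cdf N' t) (at_right t)" by (simp add: continuous_within)
  have eq: "cdf N' s = measure N {0<..s}" if "s \<le> t + 1" for s
  proof -
    have "{..s} \<inter> {0<..t+1} = {0<..s}" using that by auto
    then show ?thesis unfolding cdf_def measure_def by (simp add: e)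
  qed
  have "\<forall>\<^sub>F s in at_right t. cdf N' s = measure N {0<..s}"
    unfolding eventually_at_right_field using eq by (intro exI[of _ "t + 1"]) auto
  from Lim_transform_eventually[OF lim this] show "continuous (at_right t) (\<lambda>t. measure N {0<..t})"
    by (simp add: continuous_within eq)
qed

lemma rc_mono_add: "rc_mono f \<Longrightarrow> rc_mono g \<Longrightarrow> rc_mono (\<lambda>t. f t + g t)"
  by (auto simp: rc_mono_def mono_on_def continuous_within intro!: add_mono tendsto_add)

lemma rc_mono_sum: "(\<And>i. i \<in> I \<Longrightarrow> rc_mono (f i)) \<Longrightarrow> rc_mono (\<lambda>t. \<Sum>i\<in>I. f i t)"
  by (auto simp: rc_mono_def mono_on_def continuous_within intro!: sum_mono tendsto_sum)

lemma rc_mono_cong: "rc_mono f \<Longrightarrow> (\<And>t. t \<ge> 0 \<Longrightarrow> f t = g t) \<Longrightarrow> rc_mono g"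
proof -
  assume f: "rc_mono f" and eq: "\<And>t. t \<ge> 0 \<Longrightarrow> f t = g t"
  have "(g \<longlongrightarrow> g t) (at_right t)" if t: "t \<ge> 0" for t
  proof -
    have "(f \<longlongrightarrow> f t) (at_right t)" using f t by (auto simp: rc_mono_def continuous_within)
    then show ?thesis unfolding eq[OF t]
      by (rule Lim_transform_eventually) (use eq t in \<open>auto simp: eventually_at_filter\<close>)
  qed
  then show ?thesis using f eq by (auto simp: rc_mono_def mono_on_def continuous_within)
qed

lemma LS_left_limit:
  assumes F: "rc_mono F" and t: "t > 0"
  shows "(F \<longlongrightarrow> F t - measure (LS F) {t}) (at_left t)" and "emeasure (LS F) {t} < \<infinity>"
proof -
  show fin: "emeasure (LS F) {t} < \<infinity>"
    by (rule order_le_less_trans[OF emeasure_mono finite_LS[of F 0 t]]) (use t in auto)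
  show "(F \<longlongrightarrow> F t - measure (LS F) {t}) (at_left t)"
  proof (rule tendsto_at_left_sequentially[of 0])
    fix S :: "nat \<Rightarrow> real"
    assume S: "\<And>n. S n < t" "\<And>n. 0 < S n" "incseq S" "S \<longlonglongrightarrow> t"
    have "(\<Inter>n. {S n<..t}) = {t}"
    proof -
      have "x = t" if "\<And>n. S n < x" "x \<le> t" for x
        using LIMSEQ_le_const2[OF S(4), of x] that by (auto intro: antisym less_imp_le)
      then show ?thesis using S(1) by auto
    qed
    moreover have "(\<lambda>n. measure (LS F) {S n<..t}) \<longlonglongrightarrow> measure (LS F) (\<Inter>n. {S n<..t})"
    proof (rule Lim_measure_decseq)
      show "decseq (\<lambda>n. {S n<..t})" using S(3) by (fastforce simp: decseq_def incseq_def)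
    qed (use finite_LS[of F] in \<open>auto simp: less_top\<close>)
    moreover have "measure (LS F) {S n<..t} = F t - F (S n)" for n
      using F S(1,2)[of n] t by (simp add: measure_def emeasure_LS_Ioc rc_mono_def mono_on_def)
    ultimately have "(\<lambda>n. F t - F (S n)) \<longlonglongrightarrow> measure (LS F) {t}" by simp
    from tendsto_diff[OF tendsto_const[of "F t"] this] show "(\<lambda>n. F (S n)) \<longlonglongrightarrow> F t - measure (LS F) {t}" by simp
  qed (use t in auto)
qed

lemma LS_jump:
  assumes F: "rc_mono F" and t: "t > 0"
  shows "F t - Lim (at_left t) F = measure (LS F) {t}"
  using tendsto_Lim[OF _ LS_left_limit(1)[OF assms]] by simp

section \<open>The characteristics of the payoff process\<close>

locale payoff_characteristics =
  fixes M :: "'a measure" and F :: "real \<Rightarrow> 'a measure"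
    and X :: "real \<Rightarrow> 'a \<Rightarrow> real^'n::finite"
    and \<nu> :: "'a \<Rightarrow> (real \<times> (real^'n)) measure"
    and b :: "'a \<Rightarrow> real \<Rightarrow> real^'n" and K :: "'a \<Rightarrow> real \<Rightarrow> (real^'n) measure"
  assumes prob: "prob_space M" and filt: "filtration M F"
    and X_adapted: "adapted M F X"
    and X_cadlag: "\<forall>w\<in>space M. cadlag (\<lambda>t. X t w)"
    and X_mono: "\<forall>w\<in>space M. \<forall>s t. 0 \<le> s \<longrightarrow> s \<le> t \<longrightarrow> (\<forall>n. X s w $ n \<le> X t w $ n)"
    and X_zero: "\<forall>w\<in>space M. X 0 w = 0"
    and nu_comp: "compensator M F X \<nu>"
    and nu_bar_le1: "\<forall>w\<in>space M. \<forall>t. emeasure (\<nu> w) ({t} \<times> nonneg_vecs) \<le> 1"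
    and b_pred: "predictable M F (\<lambda>t w. b w t)"
    and b_nonneg: "\<forall>w\<in>space M. \<forall>t. b w t \<in> nonneg_vecs"
    and K_sets: "\<forall>w\<in>space M. \<forall>t. sets (K w t) = sets borel"
    and K_kernel: "\<forall>B\<in>sets borel. (\<lambda>p. emeasure (K (fst p) (snd p)) B) \<in> borel_measurable (pred_sigma M F)"
    and K_support: "\<forall>w\<in>space M. \<forall>t. emeasure (K w t) (UNIV - nonneg_vecs) = 0"
    and K_zero: "\<forall>w\<in>space M. \<forall>t. emeasure (K w t) {0} = 0"
    and Xc_eq: "\<forall>w\<in>space M. \<forall>t\<ge>0. \<forall>n. cont_part X t w $ n =
                  (LINT s:{0<..t}|LS (\<lambda>r. Gproc X \<nu> r w). b w s $ n)"
    and nu_eq: "\<forall>w\<in>space M. \<forall>A\<in>sets borel. emeasure (\<nu> w) A =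
                  (\<integral>\<^sup>+ s. indicator {0<..} s * emeasure (K w s) (Pair s -` A) \<partial>LS (\<lambda>r. Gproc X \<nu> r w))"
    and b_jump: "\<forall>w\<in>space M. \<forall>t>0.
                  Gproc X \<nu> t w - Lim (at_left t) (\<lambda>r. Gproc X \<nu> r w) > 0 \<longrightarrow> l1 (b w t) = 0"
    and bK_norm: "\<forall>w\<in>space M. \<forall>t\<ge>0.
                  ennreal (l1 (b w t)) + (\<integral>\<^sup>+ x. ennreal (min 1 (l1 x)) \<partial>K w t) = 1"
begin

abbreviation G :: "'a \<Rightarrow> real measure" where "G w \<equiv> LS (\<lambda>r. Gproc X \<nu> r w)"

lemma sets_nu: "w \<in> space M \<Longrightarrow> sets (\<nu> w) = sets borel"
  using nu_comp by (auto simp: compensator_def)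

lemma b_path_measurable: "w \<in> space M \<Longrightarrow> (\<lambda>s. b w (max 0 s) $ n) \<in> borel_measurable borel"
  using measurable_compose[OF measurable_path_section[OF filt] b_pred[unfolded predictable_def]]
  by (intro measurable_vec_nth) simp

lemma b_nonneg': "w \<in> space M \<Longrightarrow> 0 \<le> b w t $ n"
  using b_nonneg by (auto simp: nonneg_vecs_def)

lemma bK_le1:
  assumes "w \<in> space M" "t \<ge> 0"
  shows "l1 (b w t) \<le> 1" "(\<integral>\<^sup>+ x. ennreal (min 1 (l1 x)) \<partial>K w t) \<le> 1" "b w t $ n \<le> 1"
proof -
  have *: "ennreal (l1 (b w t)) + (\<integral>\<^sup>+ x. ennreal (min 1 (l1 x)) \<partial>K w t) = 1" using bK_norm assms by blast
  have "ennreal (l1 (b w t)) \<le> 1" unfolding *[symmetric] by simp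
  then show 1: "l1 (b w t) \<le> 1" by (simp flip: ennreal_1)
  show "(\<integral>\<^sup>+ x. ennreal (min 1 (l1 x)) \<partial>K w t) \<le> 1" unfolding *[symmetric] by simp
  have "b w t $ n \<le> \<bar>b w t $ n\<bar>" by simp
  also have "\<dots> \<le> l1 (b w t)" unfolding l1_def by (rule member_le_sum) auto
  finally show "b w t $ n \<le> 1" using 1 by simp
qed

lemma K_AE: "w \<in> space M \<Longrightarrow> AE x in K w t. x \<in> nonneg_vecs \<and> x \<noteq> 0"
proof -
  assume w: "w \<in> space M"
  have "AE x in K w t. x \<in> nonneg_vecs"
    using K_support w K_sets by (intro AE_I[where N="UNIV - nonneg_vecs"]) auto
  moreover have "AE x in K w t. x \<noteq> 0"
    using K_zero w K_sets by (intro AE_I[where N="{0}"]) auto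
  ultimately show ?thesis by eventually_elim simp
qed

lemma K_int_measurable0:
  assumes w: "w \<in> space M" and f: "f \<in> borel_measurable borel"
  shows "(\<lambda>s. \<integral>\<^sup>+x. f x \<partial>K w (max 0 s)) \<in> borel_measurable borel"
proof -
  have [simp]: "sets (K w t) = sets borel" for t using K_sets w by auto
  have [simp]: "space (K w t) = UNIV" for t using sets_eq_imp_space_eq[of "K w t" borel] by simp
  show ?thesis
  using f
proof induction
  case (cong f g)
  then show ?case by (simp add: fun_eq_iff)
next
  case (set A)
  have "(\<lambda>s. emeasure (K w (max 0 s)) A) \<in> borel_measurable borel"
    using measurable_compose[OF measurable_path_section[OF filt w] K_kernel[rule_format, of A]] set by simp
  then show ?case using K_sets w set by (simp add: nn_integral_indicator)
next
  case (mult u c)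
  have "(\<lambda>x. u x) \<in> borel_measurable (K w (max 0 s))" for s using K_sets w mult by (simp cong: measurable_cong_sets)
  then show ?case using mult by (simp add: nn_integral_cmult)
next
  case (add u v)
  have "(\<lambda>x. u x) \<in> borel_measurable (K w (max 0 s))" "(\<lambda>x. v x) \<in> borel_measurable (K w (max 0 s))" for s
    using K_sets w add by (simp_all cong: measurable_cong_sets)
  then show ?case using add by (simp add: nn_integral_add)
next
  case (seq U)
  have "U i \<in> borel_measurable (K w (max 0 s))" for s i using K_sets w seq by (simp cong: measurable_cong_sets)
  then show ?case using seq by (simp add: nn_integral_monotone_convergence_SUP image_comp)
qed
qed

text \<open>K may have infinite mass near 0, but min 1 |x| has K-integral at most 1. Weighting by it
  gives a subprobability kernel, and the integrand is divided by the weight, which is positive off x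
  = 0.\<close>

lemma K_int_measurable:
  assumes w: "w \<in> space M" and f: "f \<in> borel_measurable (borel \<Otimes>\<^sub>M borel)"
  shows "(\<lambda>s. \<integral>\<^sup>+x. f (s, x) \<partial>K w (max 0 s)) \<in> borel_measurable borel"
proof -
  have [simp, measurable_cong]: "sets (K w t) = sets borel" for t using K_sets w by auto
  define L where "L s = density (K w (max 0 s)) (\<lambda>x. ennreal (min 1 (l1 x)))" for s
  have L: "L \<in> measurable borel (subprob_algebra borel)"
  proof (rule measurable_subprob_algebra)
    fix s :: real
    have [simp]: "space (K w t) = UNIV" for t using sets_eq_imp_space_eq[of "K w t" borel] by simp
    show "subprob_space (L s)"
    proof (rule subprob_spaceI)
      have "emeasure (L s) (space (L s)) = (\<integral>\<^sup>+x. ennreal (min 1 (l1 x)) \<partial>K w (max 0 s))"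
        unfolding L_def by (subst emeasure_density) (auto intro!: nn_integral_cong)
      then show "emeasure (L s) (space (L s)) \<le> 1" using bK_le1(2)[OF w, of "max 0 s"] by simp
      show "space (L s) \<noteq> {}" using sets_eq_imp_space_eq[of "K w (max 0 s)" borel] by (simp add: L_def)
    qed
    show "sets (L s) = sets borel" by (simp add: L_def)
  next
    fix A :: "(real^'n) set" assume A[measurable]: "A \<in> sets borel"
    have "(\<lambda>s. \<integral>\<^sup>+x. ennreal (min 1 (l1 x)) * indicator A x \<partial>K w (max 0 s)) \<in> borel_measurable borel"
      by (intro K_int_measurable0[OF w]) measurable
    then show "(\<lambda>s. emeasure (L s) A) \<in> borel_measurable borel"
      using A by (simp add: L_def emeasure_density)
  qed
  have "(\<lambda>s. \<integral>\<^sup>+x. f (s, x) / ennreal (min 1 (l1 x)) \<partial>L s) \<in> borel_measurable borel"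
  proof (rule nn_integral_measurable_subprob_algebra2[OF _ L])
    have "(\<lambda>q. f q / ennreal (min 1 (l1 (snd q)))) \<in> borel_measurable (borel \<Otimes>\<^sub>M borel)"
      using f by measurable
    then show "(\<lambda>(s, x). f (s, x) / ennreal (min 1 (l1 x))) \<in> borel_measurable (borel \<Otimes>\<^sub>M borel)"
      by (simp add: case_prod_beta')
  qed
  moreover have "(\<integral>\<^sup>+x. f (s, x) / ennreal (min 1 (l1 x)) \<partial>L s) = (\<integral>\<^sup>+x. f (s, x) \<partial>K w (max 0 s))" for s
  proof -
    have [measurable]: "(\<lambda>x. f (s, x)) \<in> borel_measurable borel"
      using f by measurable
    have "(\<integral>\<^sup>+x. f (s, x) / ennreal (min 1 (l1 x)) \<partial>L s) = (\<integral>\<^sup>+x. ennreal (min 1 (l1 x)) * (f (s, x) / ennreal (min 1 (l1 x))) \<partial>K w (max 0 s))"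
      unfolding L_def by (subst nn_integral_density) auto
    also have "\<dots> = (\<integral>\<^sup>+x. f (s, x) \<partial>K w (max 0 s))"
      using K_AE[OF w, of "max 0 s"]
    proof (intro nn_integral_cong_AE, eventually_elim)
      fix x :: "real^'n" assume "x \<in> nonneg_vecs \<and> x \<noteq> 0"
      then have "0 < min 1 (l1 x)" by (simp add: l1_pos_iff)
      then have "ennreal (min 1 (l1 x)) \<noteq> 0" "ennreal (min 1 (l1 x)) \<noteq> \<top>" by auto
      then show "ennreal (min 1 (l1 x)) * (f (s, x) / ennreal (min 1 (l1 x))) = f (s, x)"
        by (simp add: ennreal_times_divide ennreal_mult_divide_eq mult.commute)
    qed
    finally show ?thesis .
  qed
  ultimately show ?thesis by simp
qed

lemma nu_integral:
  assumes w: "w \<in> space M" and f: "f \<in> borel_measurable borel"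
  shows "(\<integral>\<^sup>+q. f q \<partial>\<nu> w) = (\<integral>\<^sup>+s. indicator {0<..} s * (\<integral>\<^sup>+x. f (s, x) \<partial>K w s) \<partial>G w)"
proof -
  have [simp, measurable_cong]: "sets (K w t) = sets borel" for t using K_sets w by auto
  have [simp, measurable_cong]: "sets (\<nu> w) = sets borel" by (rule sets_nu[OF w])
  have [simp]: "space (K w t) = UNIV" for t using sets_eq_imp_space_eq[of "K w t" borel] by simp
  have km: "(\<lambda>s. indicator {0<..} s * (\<integral>\<^sup>+x. g (s, x) \<partial>K w s)) \<in> borel_measurable borel"
    if "g \<in> borel_measurable borel" for g
  proof -
    have "(\<lambda>s. indicator {0<..} s * (\<integral>\<^sup>+x. g (s, x) \<partial>K w (max 0 s))) \<in> borel_measurable borel"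
      using K_int_measurable[OF w, of g] that by (auto simp: borel_prod)
    also have "(\<lambda>s. indicator {0<..} s * (\<integral>\<^sup>+x. g (s, x) \<partial>K w (max 0 s))) = (\<lambda>s. indicator {0<..} s * (\<integral>\<^sup>+x. g (s, x) \<partial>K w s))"
      by (auto simp: fun_eq_iff indicator_def max_def)
    finally show ?thesis .
  qed
  have sec: "(\<lambda>x. g (s, x)) \<in> borel_measurable borel" if "g \<in> borel_measurable borel" for g :: "real \<times> (real^'n) \<Rightarrow> ennreal" and s
    using that unfolding borel_prod[symmetric] by measurable
  show ?thesis
    using f
  proof induction
    case (cong f g)
    then show ?case by (simp add: fun_eq_iff)
  next
    case (set A)
    have "(\<integral>\<^sup>+x. indicator A (s, x) \<partial>K w s) = emeasure (K w s) (Pair s -` A)" for s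
    proof -
      have "Pair s -` A \<in> sets borel"
        using sets_Pair1[of A "borel :: real measure" "borel :: (real^'n) measure" s] set by (simp only: borel_prod)
      then have "emeasure (K w s) (Pair s -` A) = (\<integral>\<^sup>+x. indicator (Pair s -` A) x \<partial>K w s)" by simp
      then show ?thesis by (simp add: indicator_def)
    qed
    then show ?case using nu_eq w set by simp
  next
    case (mult u c)
    then show ?case using sec[of u] km[of u]
      by (simp add: nn_integral_cmult mult.left_commute[of _ c])
  next
    case (add u v)
    then show ?case using sec[of u] km[of u] sec[of v] km[of v]
      by (simp add: nn_integral_add distrib_left)
  next
    case (seq U)
    have "(\<integral>\<^sup>+q. (SUP i. U i) q \<partial>\<nu> w) = (SUP i. \<integral>\<^sup>+q. U i q \<partial>\<nu> w)"
      using seq by (simp add: nn_integral_monotone_convergence_SUP image_comp)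
    also have "\<dots> = (SUP i. \<integral>\<^sup>+s. indicator {0<..} s * (\<integral>\<^sup>+x. U i (s, x) \<partial>K w s) \<partial>G w)"
      using seq by simp
    also have "\<dots> = (\<integral>\<^sup>+s. (SUP i. indicator {0<..} s * (\<integral>\<^sup>+x. U i (s, x) \<partial>K w s)) \<partial>G w)"
      using km seq by (intro nn_integral_monotone_convergence_SUP[symmetric])
        (auto simp: incseq_def le_fun_def intro!: mult_left_mono nn_integral_mono)
    also have "\<dots> = (\<integral>\<^sup>+s. indicator {0<..} s * (\<integral>\<^sup>+x. (SUP i. U i) (s, x) \<partial>K w s) \<partial>G w)"
      using sec seq
      by (intro nn_integral_cong)
         (simp add: SUP_mult_left_ennreal[symmetric] nn_integral_monotone_convergence_SUP[symmetric] incseq_def le_fun_def image_comp)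
    finally show ?case .
  qed
qed

text \<open>The jump part of G as an extended nonnegative number. Its sublevel sets in time serve as
  localising sets: on them every integrand dominated by min 1 |x| has a bounded
  \<nu>-integral.\<close>

definition A :: "'a \<Rightarrow> real \<Rightarrow> ennreal" where
  "A w t = (\<integral>\<^sup>+q. indicator ({0<..t} \<times> UNIV) q * ennreal (min 1 (l1 (snd q))) \<partial>\<nu> w)"

lemma A_measure:
  assumes w: "w \<in> space M"
  shows "A w t = emeasure (distr (density (\<nu> w) (\<lambda>q. ennreal (min 1 (l1 (snd q))))) borel fst) {0<..t}"
proof -
  have [simp, measurable_cong]: "sets (\<nu> w) = sets (borel \<Otimes>\<^sub>M borel)" unfolding borel_prod by (rule sets_nu[OF w])
  have "space (\<nu> w) = UNIV" using sets_eq_imp_space_eq[OF sets_nu[OF w]] by simp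
  then show ?thesis unfolding A_def
    by (subst emeasure_distr) (auto simp: vimage_fst emeasure_density mult.commute)
qed

text \<open>K gives min 1 |x| integral at most 1, so A is bounded by the mass of (0,t] under
  \<open>G w\<close>. That mass is finite before anything is known about the paths of G.\<close>

lemma A_finite: assumes w: "w \<in> space M" shows "A w t < \<infinity>"
proof -
  have [simp, measurable_cong]: "sets (\<nu> w) = sets borel" by (rule sets_nu[OF w])
  have "A w t = (\<integral>\<^sup>+s. indicator {0<..} s * (\<integral>\<^sup>+x. indicator ({0<..t} \<times> UNIV) (s, x) * ennreal (min 1 (l1 x)) \<partial>K w s) \<partial>G w)"
    unfolding A_def by (subst nu_integral[OF w]) (simp_all add: borel_prod[symmetric])
  also have "\<dots> \<le> (\<integral>\<^sup>+s. indicator {0<..t} s \<partial>G w)"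
  proof (intro nn_integral_mono)
    fix s
    show "indicator {0<..} s * (\<integral>\<^sup>+x. indicator ({0<..t} \<times> UNIV) (s, x) * ennreal (min 1 (l1 x)) \<partial>K w s) \<le> indicator {0<..t} s"
      using bK_le1(2)[OF w, of s] by (auto simp: indicator_def)
  qed
  also have "\<dots> < \<infinity>" by (simp add: finite_LS[of _ 0 t, simplified])
  finally show ?thesis .
qed

lemma b_density:
  assumes w: "w \<in> space M" and t: "t \<ge> 0"
  shows "ennreal (LINT s:{0<..t}|G w. b w s $ n) = emeasure (density (G w) (\<lambda>s. ennreal (b w (max 0 s) $ n))) {0<..t}"
    and "0 \<le> (LINT s:{0<..t}|G w. b w s $ n)"
    and "emeasure (density (G w) (\<lambda>s. ennreal (b w (max 0 s) $ n))) {0<..t} < \<infinity>"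
proof -
  note b_path_measurable[OF w, measurable]
  have eq: "indicator {0<..t} s *\<^sub>R b w s $ n = indicator {0<..t} s *\<^sub>R b w (max 0 s) $ n" for s
    by (auto simp: indicator_def)
  have int: "integrable (G w) (\<lambda>s. indicator {0<..t} s *\<^sub>R b w (max 0 s) $ n)"
  proof (rule Bochner_Integration.integrable_bound[of _ "indicator {0<..t} :: real \<Rightarrow> real"])
    show "integrable (G w) (indicator {0<..t} :: real \<Rightarrow> real)"
      using finite_LS[of _ 0 t] by (intro integrable_real_indicator) auto
    show "AE s in G w. norm (indicator {0<..t} s *\<^sub>R b w (max 0 s) $ n) \<le> norm (indicator {0<..t} s :: real)"
      using bK_le1(3)[OF w] b_nonneg'[OF w] by (auto simp: indicator_def)
  qed measurable
  have "(\<integral>\<^sup>+s. ennreal (b w (max 0 s) $ n) * indicator {0<..t} s \<partial>G w) = (\<integral>\<^sup>+s. ennreal (indicator {0<..t} s *\<^sub>R b w (max 0 s) $ n) \<partial>G w)"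
    by (intro nn_integral_cong) (auto simp: indicator_def)
  also have "\<dots> = ennreal (LINT s|G w. indicator {0<..t} s *\<^sub>R b w (max 0 s) $ n)"
    using b_nonneg'[OF w] by (intro nn_integral_eq_integral int) auto
  also have "(LINT s|G w. indicator {0<..t} s *\<^sub>R b w (max 0 s) $ n) = (LINT s:{0<..t}|G w. b w s $ n)"
    by (simp only: set_lebesgue_integral_def eq)
  finally show "ennreal (LINT s:{0<..t}|G w. b w s $ n) = emeasure (density (G w) (\<lambda>s. ennreal (b w (max 0 s) $ n))) {0<..t}"
    by (subst emeasure_density) auto
  then show "emeasure (density (G w) (\<lambda>s. ennreal (b w (max 0 s) $ n))) {0<..t} < \<infinity>"
    by (metis ennreal_less_top infinity_ennreal_def)
  show "0 \<le> (LINT s:{0<..t}|G w. b w s $ n)"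
    unfolding set_lebesgue_integral_def using b_nonneg'[OF w] by (intro integral_nonneg_AE) auto
qed

lemma cont_part_nonneg: "w \<in> space M \<Longrightarrow> t \<ge> 0 \<Longrightarrow> 0 \<le> cont_part X t w $ n"
  using Xc_eq b_density(2) by simp

text \<open>G is a sum of masses of (0,t] under locally finite measures: those with density b with
  respect to the measure of G itself, and the time projection of \<nu> weighted by min 1
  |x|.\<close>

lemma rc_mono_G:
  assumes w: "w \<in> space M"
  shows "rc_mono (\<lambda>r. Gproc X \<nu> r w)" and "Gproc X \<nu> 0 w = 0"
proof -
  let ?B = "\<lambda>n. density (G w) (\<lambda>s. ennreal (b w (max 0 s) $ n))"
  let ?A = "distr (density (\<nu> w) (\<lambda>q. ennreal (min 1 (l1 (snd q))))) borel fst"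
  have G: "Gproc X \<nu> t w = (\<Sum>n\<in>UNIV. measure (?B n) {0<..t}) + measure ?A {0<..t}" if "t \<ge> 0" for t
  proof -
    have "l1 (cont_part X t w) = (\<Sum>n\<in>UNIV. measure (?B n) {0<..t})"
      using cont_part_nonneg[OF w that] b_density[OF w that] Xc_eq w that
      by (simp add: l1_def measure_def b_density(1)[OF w that, symmetric])
    then show ?thesis unfolding Gproc_def measure_def A_measure[OF w, symmetric]
      by (simp add: A_def min.commute)
  qed
  have fB: "emeasure (?B n) {0<..t} < \<infinity>" for n t
    by (cases "t \<ge> 0") (use b_density(3)[OF w, of t n] in auto)
  have fA: "emeasure ?A {0<..t} < \<infinity>" for t using A_finite[OF w, of t] by (simp add: A_measure[OF w])
  have "rc_mono (\<lambda>t. (\<Sum>n\<in>UNIV. measure (?B n) {0<..t}) + measure ?A {0<..t})"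
    by (intro rc_mono_add rc_mono_sum rc_mono_measure fB fA) auto
  then show "rc_mono (\<lambda>r. Gproc X \<nu> r w)" by (rule rc_mono_cong) (simp add: G)
  show "Gproc X \<nu> 0 w = 0" by (simp add: G)
qed

lemma AE_G_pos: "w \<in> space M \<Longrightarrow> AE s in G w. 0 < s"
  using emeasure_LS_nonpos[OF rc_mono_G(1)] by (intro AE_I[where N="{..0}"]) auto

lemma nu_section:
  assumes w: "w \<in> space M" and s: "s > 0" and B: "B \<in> sets borel"
  shows "emeasure (\<nu> w) ({s} \<times> B) = emeasure (K w s) B * emeasure (G w) {s}"
proof -
  have "emeasure (\<nu> w) ({s} \<times> B) = (\<integral>\<^sup>+ r. indicator {0<..} r * emeasure (K w r) (Pair r -` ({s} \<times> B)) \<partial>G w)"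
    using nu_eq w B by (simp add: borel_prod[symmetric])
  also have "\<dots> = (\<integral>\<^sup>+ r. emeasure (K w s) B * indicator {s} r \<partial>G w)"
    using s by (intro nn_integral_cong) (auto simp: indicator_def)
  also have "\<dots> = emeasure (K w s) B * emeasure (G w) {s}" by (rule nn_integral_cmult_indicator) simp
  finally show ?thesis .
qed

lemma nu_nonpos: "w \<in> space M \<Longrightarrow> s \<le> 0 \<Longrightarrow> emeasure (\<nu> w) ({s} \<times> B) = 0"
proof -
  assume w: "w \<in> space M" and s: "s \<le> 0"
  have "emeasure (\<nu> w) ({s} \<times> B) \<le> emeasure (\<nu> w) ({..0} \<times> UNIV)"
    using s by (intro emeasure_mono) (auto simp: sets_nu[OF w] borel_prod[symmetric])
  also have "\<dots> = 0" using nu_comp w by (auto simp: compensator_def)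
  finally show ?thesis by simp
qed

lemma nu_zero: assumes w: "w \<in> space M" shows "emeasure (\<nu> w) ({s} \<times> {0}) = 0"
  using nu_section[OF w, of s "{0}"] nu_nonpos[OF w, of s "{0}"] K_zero w by (cases "s > 0") auto

lemma AE_nu:
  assumes w: "w \<in> space M"
  shows "AE q in \<nu> w. 0 < fst q \<and> snd q \<in> nonneg_vecs \<and> snd q \<noteq> 0"
proof -
  have [simp, measurable_cong]: "sets (\<nu> w) = sets borel" by (rule sets_nu[OF w])
  have "AE q in \<nu> w. 0 < fst q"
    using nu_comp w by (intro AE_I[where N="{..0} \<times> UNIV"]) (auto simp: compensator_def borel_prod[symmetric])
  moreover have "AE q in \<nu> w. snd q \<in> nonneg_vecs"
    using nu_comp w by (intro AE_I[where N="UNIV \<times> (UNIV - nonneg_vecs)"]) (auto simp: compensator_def borel_prod[symmetric])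
  moreover have "AE q in \<nu> w. snd q \<noteq> 0"
  proof (intro AE_I[where N="UNIV \<times> {0}"])
    have "emeasure (\<nu> w) (UNIV \<times> {0}) = (\<integral>\<^sup>+ s. indicator {0<..} s * emeasure (K w s) (Pair s -` (UNIV \<times> {0})) \<partial>G w)"
      using nu_eq w by (simp add: borel_prod[symmetric])
    also have "\<dots> = (\<integral>\<^sup>+ s. 0 \<partial>G w)" using K_zero w by (intro nn_integral_cong) simp
    finally show "emeasure (\<nu> w) (UNIV \<times> {0}) = 0" by simp
  qed (auto simp: borel_prod[symmetric])
  ultimately show ?thesis by eventually_elim simp
qed

lemma zeta_spec:
  assumes w: "w \<in> space M" and c: "c > 0"
  shows "jump_law (atom_law (\<nu> w) t) (nubar \<nu> w t) c"
    and "invested (atom_law (\<nu> w) t) (nubar \<nu> w t) c (zeta \<nu> w t c)"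
    and "0 \<le> zeta \<nu> w t c" "zeta \<nu> w t c \<le> c"
proof -
  have le: "emeasure (\<nu> w) ({t} \<times> nonneg_vecs) \<le> 1" using nu_bar_le1 w by auto
  show "jump_law (atom_law (\<nu> w) t) (nubar \<nu> w t) c" "invested (atom_law (\<nu> w) t) (nubar \<nu> w t) c (zeta \<nu> w t c)"
    using zeta_invested[where \<nu>=\<nu> and w=w and t=t and c=c, OF sets_nu[OF w] le nu_zero[OF w, of t] c] by auto
  then show "0 \<le> zeta \<nu> w t c" "zeta \<nu> w t c \<le> c" by (auto simp: invested_def)
qed

text \<open>Without an atom of G there is no fixed jump; the investment at the single time t is
  infinitesimal and leaves the wealth unchanged.\<close>

lemma zeta_no_atom:
  assumes "w \<in> space M" "emeasure (G w) {t} = 0"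
  shows "zeta \<nu> w t c = c"
proof -
  have "emeasure (\<nu> w) ({t} \<times> nonneg_vecs) = 0"
    using nu_section[OF assms(1), of t nonneg_vecs] nu_nonpos[OF assms(1), of t nonneg_vecs] assms(2)
    by (cases "t > 0") auto
  then show ?thesis by (simp add: zeta_def nubar_def)
qed

lemma b_atom:
  assumes w: "w \<in> space M" and "s > 0" "emeasure (G w) {s} \<noteq> 0"
  shows "b w s = 0"
proof -
  have "measure (G w) {s} > 0"
    using assms LS_left_limit(2)[OF rc_mono_G(1)[OF w] assms(2)] by (simp add: measure_def enn2real_positive_iff zero_less_iff_neq_zero)
  then show ?thesis using b_jump w assms(2) LS_jump[OF rc_mono_G(1)[OF w] assms(2)] by simp
qed

text \<open>Links the equation for \<open>zeta\<close>, which is about the jump law, to the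
  strategy, which is an integral against K: at an atom of G they differ by the mass of the
  atom.\<close>

lemma atom_law_K:
  assumes w: "w \<in> space M" and s: "s > 0" and f: "f \<in> borel_measurable borel"
  shows "(\<integral>\<^sup>+x. f x \<partial>atom_law (\<nu> w) s) = emeasure (G w) {s} * (\<integral>\<^sup>+x. f x \<partial>K w s)"
proof -
  have [simp, measurable_cong]: "sets (K w t) = sets borel" for t using K_sets w by auto
  have "(\<integral>\<^sup>+x. f x \<partial>atom_law (\<nu> w) s) = (\<integral>\<^sup>+q. indicator ({s} \<times> nonneg_vecs) q * f (snd q) \<partial>\<nu> w)"
    by (rule nn_integral_atom_law[OF sets_nu[OF w] f])
  also have "\<dots> = (\<integral>\<^sup>+r. indicator {0<..} r * (\<integral>\<^sup>+x. indicator ({s} \<times> nonneg_vecs) (r, x) * f x \<partial>K w r) \<partial>G w)"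
    using f by (subst nu_integral[OF w]) (simp_all add: borel_prod[symmetric])
  also have "\<dots> = (\<integral>\<^sup>+r. (\<integral>\<^sup>+x. f x \<partial>K w s) * indicator {s} r \<partial>G w)"
  proof (intro nn_integral_cong)
    fix r
    have "(\<integral>\<^sup>+x. indicator ({s} \<times> nonneg_vecs) (s, x) * f x \<partial>K w s) = (\<integral>\<^sup>+x. f x \<partial>K w s)"
      using K_AE[OF w, of s] by (intro nn_integral_cong_AE, eventually_elim) simp
    then show "indicator {0<..} r * (\<integral>\<^sup>+x. indicator ({s} \<times> nonneg_vecs) (r, x) * f x \<partial>K w r) = (\<integral>\<^sup>+x. f x \<partial>K w s) * indicator {s} r"
      using s by (cases "r = s") auto
  qed
  also have "\<dots> = (\<integral>\<^sup>+x. f x \<partial>K w s) * emeasure (G w) {s}" by (rule nn_integral_cmult_indicator) simp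
  finally show ?thesis by (simp add: mult.commute)
qed

text \<open>At an atom of G the bound for the jump law is divided by the mass of the atom; elsewhere
  \<open>zeta\<close> is c and the elementary bound applies. In both cases the K-integral of min 1
  |x| is at most 1.\<close>

lemma cost_bound:
  assumes w: "w \<in> space M" and s: "s > 0" and c: "c > 0"
  shows "(\<integral>\<^sup>+x. ennreal (c * l1 x / (zeta \<nu> w s c + l1 x)) \<partial>K w s) \<le> ennreal (max (2 * c) 4)"
proof -
  have [simp, measurable_cong]: "sets (K w t) = sets borel" for t using K_sets w by auto
  interpret jump_law "atom_law (\<nu> w) s" "nubar \<nu> w s" c by (rule zeta_spec(1)[OF w c])
  have fK: "(\<integral>\<^sup>+x. ennreal (max (2 * c) 4 * min 1 (l1 x)) \<partial>K w s) \<le> ennreal (max (2 * c) 4)"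
  proof -
    have "(\<integral>\<^sup>+x. ennreal (max (2 * c) 4 * min 1 (l1 x)) \<partial>K w s) = ennreal (max (2 * c) 4) * (\<integral>\<^sup>+x. ennreal (min 1 (l1 x)) \<partial>K w s)"
      using c by (subst nn_integral_cmult[symmetric]) (auto simp: ennreal_mult)
    also have "\<dots> \<le> ennreal (max (2 * c) 4) * 1"
      using bK_le1(2)[OF w, of s] s by (intro mult_left_mono) auto
    finally show ?thesis by simp
  qed
  have "(\<integral>\<^sup>+x. ennreal (c * l1 x / (zeta \<nu> w s c + l1 x)) \<partial>K w s) \<le> (\<integral>\<^sup>+x. ennreal (max (2 * c) 4 * min 1 (l1 x)) \<partial>K w s)"
  proof (cases "emeasure (G w) {s} = 0")
    case True
    then have z: "zeta \<nu> w s c = c" by (rule zeta_no_atom[OF w])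
    show ?thesis unfolding z using c by (intro nn_integral_mono ennreal_leI frac_bound_half) auto
  next
    case False
    have fin: "emeasure (G w) {s} \<noteq> \<infinity>" using LS_left_limit(2)[OF rc_mono_G(1)[OF w] s] by auto
    have "emeasure (G w) {s} * (\<integral>\<^sup>+x. ennreal (c * l1 x / (zeta \<nu> w s c + l1 x)) \<partial>K w s) \<le>
      emeasure (G w) {s} * (\<integral>\<^sup>+x. ennreal (max (2 * c) 4 * min 1 (l1 x)) \<partial>K w s)"
      using invested_cost_bound[OF zeta_spec(2)[OF w c]] by (simp add: atom_law_K[OF w s])
    then show ?thesis using False fin by (simp add: ennreal_mult_le_mult_iff)
  qed
  then show ?thesis using fK by simp
qed

end

section \<open>Jumps and continuous part of the payoffs\<close>

lemma nn_integral_count_space_eq':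
  "(\<And>x. x \<in> A - B \<Longrightarrow> f x = 0) \<Longrightarrow> (\<And>x. x \<in> B - A \<Longrightarrow> f x = 0) \<Longrightarrow>
   (\<integral>\<^sup>+x. f x \<partial>count_space A) = (\<integral>\<^sup>+x. f x \<partial>count_space B)"
  by (rule nn_integral_count_space_eq) auto

context payoff_characteristics
begin

abbreviation XL :: "'a \<Rightarrow> 'n \<Rightarrow> real measure" where "XL w n \<equiv> LS (\<lambda>t. X t w $ n)"

lemma rc_mono_X: "w \<in> space M \<Longrightarrow> rc_mono (\<lambda>t. X t w $ n)"
  using X_cadlag X_mono cadlag_right[of "\<lambda>t. X t w"]
  by (auto simp: rc_mono_def mono_on_def continuous_within intro!: tendsto_vec_nth)

lemma jump_component:
  assumes w: "w \<in> space M" and s: "s > 0"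
  shows "jump X w s $ n = measure (XL w n) {s}" "ennreal (jump X w s $ n) = emeasure (XL w n) {s}"
    "jump X w s = X s w - leftlim 0 (\<lambda>r. X r w) s"
proof -
  have c: "cadlag (\<lambda>t. X t w)" using X_cadlag w by auto
  show eq: "jump X w s = X s w - leftlim 0 (\<lambda>r. X r w) s" using s by (simp add: jump_def leftlim_def)
  have "((\<lambda>r. X r w $ n) \<longlongrightarrow> leftlim 0 (\<lambda>r. X r w) s $ n) (at_left s)"
    by (intro tendsto_vec_nth cadlag_leftlim[OF c s])
  from tendsto_unique[OF _ this LS_left_limit(1)[OF rc_mono_X[OF w] s]]
  show j: "jump X w s $ n = measure (XL w n) {s}" by (simp add: eq)
  show "ennreal (jump X w s $ n) = emeasure (XL w n) {s}"
    using LS_left_limit(2)[OF rc_mono_X[OF w] s, of n] by (simp add: j emeasure_eq_ennreal_measure less_top)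
qed

lemma jump_nonneg: "w \<in> space M \<Longrightarrow> s > 0 \<Longrightarrow> jump X w s \<in> nonneg_vecs"
  by (simp add: nonneg_vecs_def jump_component(1))

lemma XL_nonpos: "w \<in> space M \<Longrightarrow> s \<le> 0 \<Longrightarrow> emeasure (XL w n) {s} = 0"
  using emeasure_mono[of "{s}" "{..0}" "XL w n"] emeasure_LS_nonpos[OF rc_mono_X] by auto

lemma XL_atoms:
  assumes w: "w \<in> space M" and f: "f \<in> borel_measurable borel"
  shows "(\<integral>\<^sup>+s\<in>{s. emeasure (XL w n) {s} \<noteq> 0}. f s \<partial>XL w n) = (\<integral>\<^sup>+s. f s * ennreal (jump X w s $ n) \<partial>count_space {0<..})"
proof -
  have "(\<integral>\<^sup>+s\<in>{s. emeasure (XL w n) {s} \<noteq> 0}. f s \<partial>XL w n) = (\<integral>\<^sup>+s. f s * emeasure (XL w n) {s} \<partial>count_space {s. emeasure (XL w n) {s} \<noteq> 0})"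
    using f by (intro nn_integral_atoms countable_atoms_LS) auto
  also have "\<dots> = (\<integral>\<^sup>+s. f s * emeasure (XL w n) {s} \<partial>count_space {0<..})"
    using XL_nonpos[OF w] by (intro nn_integral_count_space_eq') (auto simp: not_less)
  also have "\<dots> = (\<integral>\<^sup>+s. f s * ennreal (jump X w s $ n) \<partial>count_space {0<..})"
    by (intro nn_integral_cong) (simp add: jump_component(2)[OF w])
  finally show ?thesis .
qed

text \<open>\<open>infsum\<close> is 0 for a family that is not summable, so the summability of the
  jumps has to be established first: they are atoms of dX, and dX has finite mass on (0,t].\<close>

lemma cont_part_eq:
  assumes w: "w \<in> space M" and t: "t \<ge> 0"
  shows "emeasure (XL w n) {0<..t} = ennreal (cont_part X t w $ n) +
      (\<integral>\<^sup>+s. indicator {0<..t} s * ennreal (jump X w s $ n) \<partial>count_space {0<..})"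
proof -
  have J: "(\<integral>\<^sup>+s. ennreal (jump X w s $ n) \<partial>count_space {0<..t}) =
      (\<integral>\<^sup>+s. indicator {0<..t} s * ennreal (jump X w s $ n) \<partial>count_space {0<..})" for n
  proof -
    have "(\<integral>\<^sup>+s. ennreal (jump X w s $ n) \<partial>count_space {0<..t}) = (\<integral>\<^sup>+s. indicator {0<..t} s * ennreal (jump X w s $ n) \<partial>count_space {0<..t})"
      by (intro nn_integral_cong) simp
    also have "\<dots> = (\<integral>\<^sup>+s. indicator {0<..t} s * ennreal (jump X w s $ n) \<partial>count_space {0<..})"
      by (intro nn_integral_count_space_eq') auto
    finally show ?thesis .
  qed
  have fin: "(\<integral>\<^sup>+s. ennreal (jump X w s $ n) \<partial>count_space {0<..t}) < \<infinity>" for n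
  proof -
    have "(\<integral>\<^sup>+s. ennreal (jump X w s $ n) \<partial>count_space {0<..t}) \<le> (\<integral>\<^sup>+s. indicator {0<..t} s \<partial>XL w n)"
      unfolding J XL_atoms[OF w, of "indicator {0<..t}", symmetric, simplified]
      by (intro nn_integral_mono) (auto simp: indicator_def)
    also have "\<dots> < \<infinity>" using finite_LS[of _ 0 t] by simp
    finally show ?thesis .
  qed
  have nn: "0 \<le> jump X w s $ n" if "s \<in> {0<..t}" for s n
    using jump_nonneg[OF w, of s] that by (auto simp: nonneg_vecs_def)
  have int: "integrable (count_space {0<..t}) (jump X w)"
  proof (rule integrableI_bounded)
    have "(\<integral>\<^sup>+s. ennreal (norm (jump X w s)) \<partial>count_space {0<..t}) \<le> (\<integral>\<^sup>+s. (\<Sum>n\<in>UNIV. ennreal (jump X w s $ n)) \<partial>count_space {0<..t})"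
    proof (intro nn_integral_mono)
      fix s assume "s \<in> space (count_space {0<..t})"
      then have s: "s \<in> {0<..t}" by simp
      have "norm (jump X w s) \<le> (\<Sum>n\<in>UNIV. \<bar>jump X w s $ n\<bar>)" by (rule norm_le_l1_cart)
      also have "\<dots> = (\<Sum>n\<in>UNIV. jump X w s $ n)" using nn[OF s] by simp
      finally show "ennreal (norm (jump X w s)) \<le> (\<Sum>n\<in>UNIV. ennreal (jump X w s $ n))"
        using nn[OF s] by (simp add: sum_ennreal ennreal_leI)
    qed
    also have "\<dots> = (\<Sum>n\<in>UNIV. \<integral>\<^sup>+s. ennreal (jump X w s $ n) \<partial>count_space {0<..t})"
      by (rule nn_integral_sum) simp
    also have "\<dots> < \<infinity>" using fin by simp
    finally show "(\<integral>\<^sup>+s. ennreal (norm (jump X w s)) \<partial>count_space {0<..t}) < \<infinity>" .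
  qed simp
  have "infsum (jump X w) {0<..t} = (LINT s|count_space {0<..t}. jump X w s)"
    using infsetsum_infsum[of "jump X w" "{0<..t}"] int by (simp add: Infinite_Set_Sum.abs_summable_on_def infsetsum_def)
  then have "infsum (jump X w) {0<..t} $ n = (LINT s|count_space {0<..t}. jump X w s $ n)"
    using integral_bounded_linear[OF bounded_linear_vec_nth[of n] int] by simp
  moreover have "ennreal (LINT s|count_space {0<..t}. jump X w s $ n) = (\<integral>\<^sup>+s. ennreal (jump X w s $ n) \<partial>count_space {0<..t})"
    using integrable_bounded_linear[OF bounded_linear_vec_nth[of n] int] nn
    by (intro nn_integral_eq_integral[symmetric]) (auto simp: AE_count_space)
  moreover have "0 \<le> (LINT s|count_space {0<..t}. jump X w s $ n)"
    using nn by (intro integral_nonneg_AE) (auto simp: AE_count_space)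
  moreover have "emeasure (XL w n) {0<..t} = ennreal (X t w $ n)"
    using emeasure_LS_Ioc[OF rc_mono_X[OF w], of 0 t n] t X_zero w by simp
  moreover have "X t w $ n = cont_part X t w $ n + infsum (jump X w) {0<..t} $ n"
    by (simp add: cont_part_def)
  ultimately show ?thesis using cont_part_nonneg[OF w t, of n] unfolding J[of n]
    by (simp add: ennreal_plus)
qed

text \<open>Removing the atoms from dX leaves the increments of the continuous part of X, which are
  b dG. The atoms have finite mass on (0,t] and can be cancelled.\<close>

lemma XL_continuous_part:
  assumes w: "w \<in> space M"
  shows "density (XL w n) (indicator {s. emeasure (XL w n) {s} = 0}) = density (G w) (\<lambda>s. ennreal (b w (max 0 s) $ n))"
proof -
  note b_path_measurable[OF w, measurable]
  let ?J = "{s. emeasure (XL w n) {s} \<noteq> 0}"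
  have cJ: "countable ?J" by (rule countable_atoms_LS)
  have J[measurable]: "?J \<in> sets borel" by (rule sets.countable[OF _ cJ]) simp
  have eqJ: "{s. emeasure (XL w n) {s} = 0} = - ?J" by auto
  have J'[measurable]: "{s. emeasure (XL w n) {s} = 0} \<in> sets borel" unfolding eqJ using J by auto
  have e: "emeasure (density (XL w n) (indicator {s. emeasure (XL w n) {s} = 0})) B = emeasure (XL w n) (B - ?J)" if "B \<in> sets borel" for B
  proof -
    have "emeasure (density (XL w n) (indicator {s. emeasure (XL w n) {s} = 0})) B = (\<integral>\<^sup>+s. indicator (B - ?J) s \<partial>XL w n)"
    proof (subst emeasure_density)
      show "(\<integral>\<^sup>+s\<in>B. indicator {s. emeasure (XL w n) {s} = 0} s \<partial>XL w n) = (\<integral>\<^sup>+s. indicator (B - ?J) s \<partial>XL w n)"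
        by (intro nn_integral_cong) (auto split: split_indicator)
    qed (use that in auto)
    then show ?thesis using that J by (simp add: sets.Diff)
  qed
  show ?thesis
  proof (rule measure_eqI_Ioc0)
    have "emeasure (XL w n) ({..0} - ?J) \<le> emeasure (XL w n) {..0}" by (intro emeasure_mono) auto
    then show "emeasure (density (XL w n) (indicator {s. emeasure (XL w n) {s} = 0})) {..0} = 0"
      using emeasure_LS_nonpos[OF rc_mono_X[OF w], of n] by (simp add: e)
    show "emeasure (density (G w) (\<lambda>s. ennreal (b w (max 0 s) $ n))) {..0} = 0"
      using AE_G_pos[OF w] by (subst emeasure_density)
        (auto simp: nn_integral_0_iff_AE elim!: eventually_mono simp: indicator_def)
    fix t :: real assume t: "t \<ge> 0"
    have ind: "(\<integral>\<^sup>+s. indicator {0<..t} s * ennreal (jump X w s $ n) \<partial>count_space {0<..}) = emeasure (XL w n) ({0<..t} \<inter> ?J)"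
    proof -
      have "(\<integral>\<^sup>+s. indicator {0<..t} s * ennreal (jump X w s $ n) \<partial>count_space {0<..}) = (\<integral>\<^sup>+s. indicator {0<..t} s * indicator ?J s \<partial>XL w n)"
        by (rule XL_atoms[OF w, symmetric]) simp
      also have "\<dots> = (\<integral>\<^sup>+s. indicator ({0<..t} \<inter> ?J) s \<partial>XL w n)" by (intro nn_integral_cong) (simp add: indicator_inter_arith)
      also have "\<dots> = emeasure (XL w n) ({0<..t} \<inter> ?J)" using J by (intro nn_integral_indicator) auto
      finally show ?thesis .
    qed
    have fin: "emeasure (XL w n) ({0<..t} \<inter> ?J) < \<infinity>"
      by (rule order_le_less_trans[OF emeasure_mono finite_LS[of _ 0 t]]) auto
    have "emeasure (XL w n) ({0<..t} - ?J) + emeasure (XL w n) ({0<..t} \<inter> ?J) = emeasure (XL w n) {0<..t}"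
      using J by (subst plus_emeasure) (auto intro!: arg_cong[where f="emeasure _"])
    also have "\<dots> = ennreal (cont_part X t w $ n) + emeasure (XL w n) ({0<..t} \<inter> ?J)"
      unfolding cont_part_eq[OF w t] ind ..
    also have "ennreal (cont_part X t w $ n) = emeasure (density (G w) (\<lambda>s. ennreal (b w (max 0 s) $ n))) {0<..t}"
      using Xc_eq w t b_density(1)[OF w t, of n] by simp
    finally show "emeasure (density (XL w n) (indicator {s. emeasure (XL w n) {s} = 0})) {0<..t} = emeasure (density (G w) (\<lambda>s. ennreal (b w (max 0 s) $ n))) {0<..t}"
      using fin by (auto simp: e)
    have "emeasure (XL w n) ({0<..t} - ?J) < \<infinity>"
      by (rule order_le_less_trans[OF emeasure_mono finite_LS[of _ 0 t]]) auto
    then show "emeasure (density (XL w n) (indicator {s. emeasure (XL w n) {s} = 0})) {0<..t} < \<infinity>" by (simp add: e)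
  qed auto
qed

lemma XL_continuous_integral:
  assumes w: "w \<in> space M" and f: "f \<in> borel_measurable borel"
  shows "(\<integral>\<^sup>+s. f s * indicator {s. emeasure (XL w n) {s} = 0} s \<partial>XL w n) = (\<integral>\<^sup>+s. f s * ennreal (b w (max 0 s) $ n) \<partial>G w)"
proof -
  note b_path_measurable[OF w, measurable] f[measurable]
  have [measurable]: "{s. emeasure (XL w n) {s} = 0} \<in> sets borel"
  proof -
    have "{s. emeasure (XL w n) {s} \<noteq> 0} \<in> sets borel" by (rule sets.countable[OF _ countable_atoms_LS]) simp
    then have "- {s. emeasure (XL w n) {s} \<noteq> 0} \<in> sets borel" by auto
    then show ?thesis by (simp add: Collect_neg_eq[symmetric])
  qed
  have "(\<integral>\<^sup>+s. f s * indicator {s. emeasure (XL w n) {s} = 0} s \<partial>XL w n) = (\<integral>\<^sup>+s. f s \<partial>density (XL w n) (indicator {s. emeasure (XL w n) {s} = 0}))"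
    by (subst nn_integral_density) (auto simp: mult.commute)
  also have "\<dots> = (\<integral>\<^sup>+s. f s * ennreal (b w (max 0 s) $ n) \<partial>G w)"
    unfolding XL_continuous_part[OF w] by (subst nn_integral_density) (auto simp: mult.commute)
  finally show ?thesis .
qed

lemma XL_integral:
  assumes w: "w \<in> space M" and f: "f \<in> borel_measurable borel"
  shows "(\<integral>\<^sup>+s. f s \<partial>XL w n) = (\<integral>\<^sup>+s. f s * ennreal (b w (max 0 s) $ n) \<partial>G w) +
     (\<integral>\<^sup>+s. f s * ennreal (jump X w s $ n) \<partial>count_space {0<..})"
proof -
  note f[measurable]
  have J[measurable]: "{s. emeasure (XL w n) {s} \<noteq> 0} \<in> sets borel" by (rule sets.countable[OF _ countable_atoms_LS]) simp
  have [measurable]: "{s. emeasure (XL w n) {s} = 0} \<in> sets borel"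
    using sets.compl_sets[OF J] by (simp add: Collect_neg_eq[symmetric] Compl_eq_Diff_UNIV[symmetric])
  have "(\<integral>\<^sup>+s. f s \<partial>XL w n) = (\<integral>\<^sup>+s. f s * indicator {s. emeasure (XL w n) {s} = 0} s + f s * indicator {s. emeasure (XL w n) {s} \<noteq> 0} s \<partial>XL w n)"
    by (intro nn_integral_cong) (auto simp: indicator_def)
  also have "\<dots> = (\<integral>\<^sup>+s. f s * indicator {s. emeasure (XL w n) {s} = 0} s \<partial>XL w n) + (\<integral>\<^sup>+s. f s * indicator {s. emeasure (XL w n) {s} \<noteq> 0} s \<partial>XL w n)"
    by (intro nn_integral_add) auto
  finally show ?thesis unfolding XL_continuous_integral[OF w f] XL_atoms[OF w f] .
qed

text \<open>\<open>measure_of\<close> keeps the given set function only if it is a measure; here it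
  is one, being the image of counting measure under s \<mapsto> (s, jump at s).\<close>

lemma jump_measure_integral:
  assumes f: "f \<in> borel_measurable borel"
  shows "(\<integral>\<^sup>+q. f q \<partial>jump_measure X w) = (\<integral>\<^sup>+s. f (s, jump X w s) \<partial>count_space {s. 0 < s \<and> jump X w s \<noteq> 0})"
proof -
  let ?S = "{s. 0 < s \<and> jump X w s \<noteq> 0}"
  let ?D = "distr (count_space ?S) borel (\<lambda>s. (s, jump X w s))"
  have "jump_measure X w = measure_of UNIV (sets borel) (emeasure ?D)"
    unfolding jump_measure_def
  proof (rule measure_of_eq)
    fix A :: "(real \<times> (real^'n)) set" assume "A \<in> sigma_sets UNIV (sets borel)"
    then have A: "A \<in> sets borel" using sets.sigma_sets_eq[of "borel :: (real \<times> (real^'n)) measure"] by simp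
    have "emeasure ?D A = (\<integral>\<^sup>+q. indicator A q \<partial>?D)" using A by simp
    also have "\<dots> = (\<integral>\<^sup>+ s. indicator A (s, jump X w s) \<partial>count_space ?S)"
      using A by (subst nn_integral_distr) auto
    finally show "(\<integral>\<^sup>+ s. indicator A (s, jump X w s) \<partial>count_space ?S) = emeasure ?D A" ..
  qed simp
  also have "\<dots> = ?D" using measure_of_of_measure[of ?D] by simp
  finally show ?thesis using f by (simp add: nn_integral_distr)
qed

lemma measurable_XL:
  assumes f: "f \<in> borel_measurable (M \<Otimes>\<^sub>M borel)"
  shows "(\<lambda>w. \<integral>\<^sup>+s. f (w, s) \<partial>XL w n) \<in> borel_measurable M"
proof (rule measurable_nn_integral_kernel[OF _ _ _ _ f])
  fix t :: real
  show "(\<lambda>w. emeasure (XL w n) {0<..t}) \<in> borel_measurable M"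
  proof (cases "t \<ge> 0")
    case True
    have "X t \<in> borel_measurable M" using X_adapted filtrationD(4)[OF filt True] True by (auto simp: adapted_def)
    then have "(\<lambda>w. ennreal (X t w $ n)) \<in> borel_measurable M" using measurable_vec_nth by measurable
    then show ?thesis
      using emeasure_LS_Ioc[OF rc_mono_X, of _ 0 t n] True X_zero by (simp cong: measurable_cong)
  qed simp
qed (use emeasure_LS_nonpos[OF rc_mono_X] finite_LS in auto)

text \<open>b dG is dX without its atoms, so the integral is taken against dX over the times at
  which component n does not jump. These times are jointly measurable by right- and left-continuity,
  and dX depends measurably on \<omega> because X is adapted.\<close>

lemma measurable_bG:
  assumes f: "f \<in> borel_measurable (M \<Otimes>\<^sub>M borel)"
  shows "(\<lambda>w. \<integral>\<^sup>+s. f (w, s) * ennreal (b w (max 0 s) $ n) \<partial>G w) \<in> borel_measurable M"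
proof -
  define h where "h = (\<lambda>(w, s). X (max 0 s) w $ n - leftlim 0 (\<lambda>r. X r w) (max 0 s) $ n)"
  have "(\<lambda>(w, s). X (max 0 s) w $ n) \<in> borel_measurable (M \<Otimes>\<^sub>M borel)"
  proof (rule measurable_joint_rightcont[where Z="\<lambda>s w. X s w $ n"])
    show "\<And>t. 0 \<le> t \<Longrightarrow> (\<lambda>w. X t w $ n) \<in> borel_measurable M"
      using X_adapted filtrationD(4)[OF filt] by (intro measurable_vec_nth) (auto simp: adapted_def)
  qed (use X_cadlag in \<open>auto intro!: tendsto_vec_nth cadlag_right\<close>)
  moreover have "(\<lambda>(w, s). leftlim 0 (\<lambda>r. X r w) (max 0 s) $ n) \<in> borel_measurable (M \<Otimes>\<^sub>M borel)"
    using measurable_compose[OF measurable_joint_section[OF filt] predictable_leftlim[OF filt X_adapted, of 0 n]] X_cadlag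
    by (simp add: case_prod_beta')
  ultimately have h[measurable]: "h \<in> borel_measurable (M \<Otimes>\<^sub>M borel)"
    unfolding h_def case_prod_beta' by measurable
  define g where "g = (\<lambda>q. f q * (if h q = 0 then 1 else 0))"
  have "g \<in> borel_measurable (M \<Otimes>\<^sub>M borel)" unfolding g_def using f by measurable
  from measurable_XL[OF this, of n]
  show ?thesis
  proof (rule measurable_cong[THEN iffD1, rotated])
    fix w assume w: "w \<in> space M"
    have fm: "(\<lambda>s. f (w, s)) \<in> borel_measurable borel"
      using measurable_compose[OF measurable_Pair1'[OF w, of borel] f] by simp
    have "(\<integral>\<^sup>+s. g (w, s) \<partial>XL w n) = (\<integral>\<^sup>+s. f (w, s) * indicator {s. emeasure (XL w n) {s} = 0} s \<partial>XL w n)"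
    proof (rule nn_integral_cong_AE)
      have "AE s in XL w n. 0 < s"
        using emeasure_LS_nonpos[OF rc_mono_X[OF w], of n] by (intro AE_I[where N="{..0}"]) auto
      then show "AE s in XL w n. g (w, s) = f (w, s) * indicator {s. emeasure (XL w n) {s} = 0} s"
      proof eventually_elim
        fix s :: real assume s: "0 < s"
        have "h (w, s) = jump X w s $ n" using s jump_component(3)[OF w s] by (simp add: h_def)
        then have "h (w, s) = 0 \<longleftrightarrow> emeasure (XL w n) {s} = 0"
          using jump_component(2)[OF w s, of n] jump_nonneg[OF w s] by (auto simp: nonneg_vecs_def ennreal_eq_0_iff order_antisym)
        then show "g (w, s) = f (w, s) * indicator {s. emeasure (XL w n) {s} = 0} s" by (auto simp: g_def)
      qed
    qed
    also have "\<dots> = (\<integral>\<^sup>+s. f (w, s) * ennreal (b w (max 0 s) $ n) \<partial>G w)"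
      by (rule XL_continuous_integral[OF w fm])
    finally show "(\<integral>\<^sup>+s. g (w, s) \<partial>XL w n) = (\<integral>\<^sup>+s. f (w, s) * ennreal (b w (max 0 s) $ n) \<partial>G w)" .
  qed
qed

text \<open>The compensator provides predictability of integrals up to a time; the whole half line
  is reached by monotone convergence. The last claim uses the positive part of the time to obtain a
  function on the whole line.\<close>

lemma nu_measurable:
  fixes W :: "('a \<times> real) \<times> (real^'n) \<Rightarrow> ennreal"
  assumes W: "W \<in> borel_measurable (pred_sigma M F \<Otimes>\<^sub>M borel)"
  shows "t \<ge> 0 \<Longrightarrow> (\<lambda>w. \<integral>\<^sup>+q. indicator {0<..t} (fst q) * W ((w, fst q), snd q) \<partial>\<nu> w) \<in> borel_measurable (F t)"
    and "(\<lambda>p. \<integral>\<^sup>+q. indicator {0<..snd p} (fst q) * W ((fst p, fst q), snd q) \<partial>\<nu> (fst p)) \<in> borel_measurable (pred_sigma M F)"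
    and "(\<lambda>w. \<integral>\<^sup>+q. indicator {0<..} (fst q) * W ((w, fst q), snd q) \<partial>\<nu> w) \<in> borel_measurable M"
    and "w \<in> space M \<Longrightarrow> (\<lambda>q. W ((w, max 0 (fst q)), snd q)) \<in> borel_measurable borel"
proof -
  show P: "(\<lambda>p. \<integral>\<^sup>+q. indicator {0<..snd p} (fst q) * W ((fst p, fst q), snd q) \<partial>\<nu> (fst p)) \<in> borel_measurable (pred_sigma M F)"
    using nu_comp W by (auto simp: compensator_def)
  have P': "(\<lambda>w. \<integral>\<^sup>+q. indicator {0<..t} (fst q) * W ((w, fst q), snd q) \<partial>\<nu> w) \<in> borel_measurable (F t)" if t: "t \<ge> 0" for t
    using measurable_compose[OF measurable_time_section[OF filt t] P] by simp
  then show "t \<ge> 0 \<Longrightarrow> (\<lambda>w. \<integral>\<^sup>+q. indicator {0<..t} (fst q) * W ((w, fst q), snd q) \<partial>\<nu> w) \<in> borel_measurable (F t)" .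
  have sec: "(\<lambda>q. W ((w, max 0 (fst q)), snd q)) \<in> borel_measurable borel" if w: "w \<in> space M" for w
  proof -
    have "(\<lambda>q. ((w, max 0 (fst q)), snd q)) \<in> measurable (borel \<Otimes>\<^sub>M borel) (pred_sigma M F \<Otimes>\<^sub>M borel)"
      by (intro measurable_Pair measurable_compose[OF measurable_fst measurable_path_section[OF filt w]] measurable_snd)
    from measurable_compose[OF this W] show ?thesis by (simp add: borel_prod)
  qed
  then show "w \<in> space M \<Longrightarrow> (\<lambda>q. W ((w, max 0 (fst q)), snd q)) \<in> borel_measurable borel" .
  have "(\<lambda>w. SUP k. \<integral>\<^sup>+q. indicator {0<..real k} (fst q) * W ((w, fst q), snd q) \<partial>\<nu> w) \<in> borel_measurable M"
    by (intro borel_measurable_SUP filtrationD(4)[OF filt _ P']) auto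
  then show "(\<lambda>w. \<integral>\<^sup>+q. indicator {0<..} (fst q) * W ((w, fst q), snd q) \<partial>\<nu> w) \<in> borel_measurable M"
  proof (rule measurable_cong[THEN iffD1, rotated])
    fix w assume w: "w \<in> space M"
    have [simp, measurable_cong]: "sets (\<nu> w) = sets (borel \<Otimes>\<^sub>M borel)" unfolding borel_prod by (rule sets_nu[OF w])
    have [measurable]: "(\<lambda>q. W ((w, max 0 (fst q)), snd q)) \<in> borel_measurable (borel \<Otimes>\<^sub>M borel)"
      using sec[OF w] by (simp add: borel_prod)
    have pos: "indicator I (fst q) * W ((w, fst q), snd q) = indicator I (fst q) * W ((w, max 0 (fst q)), snd q)" if "I \<subseteq> {0<..}" for I q
      using that by (auto simp: indicator_def max_def)
    have "(SUP k. \<integral>\<^sup>+q. indicator {0<..real k} (fst q) * W ((w, fst q), snd q) \<partial>\<nu> w)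
       = (SUP k. \<integral>\<^sup>+q. indicator {0<..real k} (fst q) * W ((w, max 0 (fst q)), snd q) \<partial>\<nu> w)"
      by (subst pos) auto
    also have "\<dots> = (\<integral>\<^sup>+q. (SUP k. indicator {0<..real k} (fst q) * W ((w, max 0 (fst q)), snd q)) \<partial>\<nu> w)"
      by (intro nn_integral_monotone_convergence_SUP[symmetric]) (auto simp: incseq_def le_fun_def split: split_indicator)
    also have "\<dots> = (\<integral>\<^sup>+q. indicator {0<..} (fst q) * W ((w, max 0 (fst q)), snd q) \<partial>\<nu> w)"
    proof (intro nn_integral_cong antisym)
      fix q :: "real \<times> (real^'n)"
      show "(SUP k. indicator {0<..real k} (fst q) * W ((w, max 0 (fst q)), snd q)) \<le> indicator {0<..} (fst q) * W ((w, max 0 (fst q)), snd q)"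
        by (intro SUP_least) (auto split: split_indicator)
      obtain k where "fst q \<le> real k" using real_arch_simple by blast
      then show "indicator {0<..} (fst q) * W ((w, max 0 (fst q)), snd q) \<le> (SUP k. indicator {0<..real k} (fst q) * W ((w, max 0 (fst q)), snd q))"
        by (intro SUP_upper2[of k]) (auto split: split_indicator)
    qed
    also have "\<dots> = (\<integral>\<^sup>+q. indicator {0<..} (fst q) * W ((w, fst q), snd q) \<partial>\<nu> w)" by (subst pos) auto
    finally show "(SUP k. \<integral>\<^sup>+q. indicator {0<..real k} (fst q) * W ((w, fst q), snd q) \<partial>\<nu> w)
       = (\<integral>\<^sup>+q. indicator {0<..} (fst q) * W ((w, fst q), snd q) \<partial>\<nu> w)" .
  qed
qed

end

section \<open>The wealth process\<close>

lemma component_le_l1: "x $ n \<le> l1 x"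
proof -
  have "\<bar>x $ n\<bar> \<le> l1 x" unfolding l1_def by (rule member_le_sum) auto
  then show ?thesis by linarith
qed

locale wealth = payoff_characteristics M F X \<nu> b K
  for M :: "'a measure" and F :: "real \<Rightarrow> 'a measure"
    and X :: "real \<Rightarrow> 'a \<Rightarrow> real^'n::finite"
    and \<nu> :: "'a \<Rightarrow> (real \<times> (real^'n)) measure"
    and b :: "'a \<Rightarrow> real \<Rightarrow> real^'n" and K :: "'a \<Rightarrow> real \<Rightarrow> (real^'n) measure" +
  fixes H :: "real \<Rightarrow> 'a \<Rightarrow> real" and y0 :: "real^'m::finite" and Y :: "real \<Rightarrow> 'a \<Rightarrow> real^'m"
    and l :: "'m \<Rightarrow> 'n \<Rightarrow> 'a \<Rightarrow> real \<Rightarrow> real"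
  assumes H_pred: "predictable M F H"
    and H_paths: "\<forall>w\<in>space M. cadlag (\<lambda>t. H t w) \<and> mono_on {0..} (\<lambda>t. H t w)"
    and G_ll_H: "AE w in M. absolutely_continuous (LS (\<lambda>t. H t w)) (LS (\<lambda>t. Gproc X \<nu> t w))"
    and y0_pos: "\<forall>m. 0 < y0 $ m"
    and Y_adapted: "adapted M F Y"
    and Y_nonneg: "\<forall>w\<in>space M. \<forall>t\<ge>0. Y t w \<in> nonneg_vecs"
    and Y_cadlag: "\<forall>w\<in>space M. cadlag (\<lambda>t. Y t w)"
    and l_deriv: "\<And>m n. leb_deriv M F (\<lambda>t w. L_hat X \<nu> b K y0 m w (\<lambda>s. Y s w) t $ n) H (l m n)"
    and Y_eq: "\<And>m. AE w in M. \<forall>t\<ge>0.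
           Y t w $ m = y0 $ m - l1 (L_hat X \<nu> b K y0 m w (\<lambda>s. Y s w) t)
             + (\<Sum>n\<in>UNIV. LINT s:{0<..t}|LS (\<lambda>r. X r w $ n).
                   l m n w s / (\<Sum>m'\<in>UNIV. \<bar>l m' n w s\<bar>))"
    and Y_absorbed: "\<forall>w\<in>space M. \<forall>m. \<forall>t\<ge>0.
        (Y t w $ m = 0 \<or> leftlim y0 (\<lambda>s. Y s w) t $ m = 0) \<longrightarrow> (\<forall>s\<ge>t. Y s w $ m = 0)"
begin

definition yl :: "'a \<Rightarrow> real \<Rightarrow> real^'m" where "yl w s = leftlim y0 (\<lambda>t. Y t w) s"
definition Wl :: "'a \<Rightarrow> real \<Rightarrow> real" where "Wl w s = l1 (yl w s)"
definition W :: "'a \<Rightarrow> real \<Rightarrow> real" where "W w t = l1 (Y t w)"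
definition z :: "'a \<Rightarrow> real \<Rightarrow> real" where "z w s = (if 0 < Wl w s then zeta \<nu> w s (Wl w s) else 0)"
text \<open>The rate dL/dG at which m invests in asset n along the wealth process.\<close>

definition fL :: "'m \<Rightarrow> 'n \<Rightarrow> 'a \<Rightarrow> real \<Rightarrow> real" where
  "fL m n w s = (if 0 < s then yl w s $ m * lam_hat \<nu> b K w s (Wl w s) $ n else 0)"

lemma W_tendsto:
  assumes w: "w \<in> space M"
  shows "t \<ge> 0 \<Longrightarrow> (W w \<longlongrightarrow> W w t) (at_right t)" "t > 0 \<Longrightarrow> (W w \<longlongrightarrow> Wl w t) (at_left t)"
proof -
  have c: "cadlag (\<lambda>t. Y t w)" using Y_cadlag w by auto
  show "t \<ge> 0 \<Longrightarrow> (W w \<longlongrightarrow> W w t) (at_right t)"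
    unfolding W_def l1_def by (intro tendsto_sum tendsto_rabs tendsto_vec_nth cadlag_right[OF c])
  show "t > 0 \<Longrightarrow> (W w \<longlongrightarrow> Wl w t) (at_left t)"
    unfolding W_def Wl_def l1_def yl_def by (intro tendsto_sum tendsto_rabs tendsto_vec_nth cadlag_leftlim[OF c])
qed

lemma W_nonneg [simp]: "0 \<le> W w t" and Wl_nonneg [simp]: "0 \<le> Wl w t"
  by (simp_all add: W_def Wl_def)

lemma W_cadlag: "w \<in> space M \<Longrightarrow> cadlag (W w)"
  using W_tendsto unfolding cadlag_def continuous_within by blast

lemma W_bounded:
  assumes w: "w \<in> space M" and t: "t \<ge> 0"
  shows "\<exists>B. \<forall>s\<in>{0..t}. W w s \<le> B \<and> (0 < s \<longrightarrow> Wl w s \<le> B)"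
proof -
  obtain B where B: "\<And>s. s \<in> {0..t} \<Longrightarrow> \<bar>W w s\<bar> \<le> B" using cadlag_bounded[OF W_cadlag[OF w] t] by blast
  have "Wl w s \<le> B" if s: "s \<in> {0..t}" "0 < s" for s
  proof (rule tendsto_upperbound[OF W_tendsto(2)[OF w s(2)]])
    show "\<forall>\<^sub>F x in at_left s. W w x \<le> B"
      unfolding eventually_at_left_field using s B by (intro exI[of _ 0]) (auto intro: order_trans[OF abs_ge_self])
  qed simp
  then show ?thesis using B by (intro exI[of _ B]) (auto intro: order_trans[OF abs_ge_self])
qed

lemma yl_nonneg: "w \<in> space M \<Longrightarrow> 0 \<le> yl w s $ m"
proof (cases "s > 0")
  case True
  assume w: "w \<in> space M"
  have "((\<lambda>t. Y t w $ m) \<longlongrightarrow> yl w s $ m) (at_left s)"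
    unfolding yl_def using Y_cadlag w True by (intro tendsto_vec_nth cadlag_leftlim) auto
  moreover have "\<forall>\<^sub>F t in at_left s. 0 \<le> Y t w $ m"
    unfolding eventually_at_left_field using True Y_nonneg w by (intro exI[of _ 0]) (auto simp: nonneg_vecs_def)
  ultimately show ?thesis by (rule tendsto_lowerbound) simp
next
  case False
  then show ?thesis using y0_pos by (simp add: yl_def leftlim_def less_imp_le)
qed

lemma Wl_sum: "w \<in> space M \<Longrightarrow> Wl w s = (\<Sum>m\<in>UNIV. yl w s $ m)"
  using yl_nonneg by (simp add: Wl_def l1_def)

lemma W_sum: "w \<in> space M \<Longrightarrow> s \<ge> 0 \<Longrightarrow> W w s = (\<Sum>m\<in>UNIV. Y s w $ m)"
  using Y_nonneg by (simp add: W_def l1_nonneg_vec)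

lemma yl_le_Wl: "w \<in> space M \<Longrightarrow> yl w s $ m \<le> Wl w s"
  unfolding Wl_sum by (rule member_le_sum) (auto simp: yl_nonneg)

lemma yl_pred [measurable]: "(\<lambda>p. yl (fst p) (snd p) $ m) \<in> borel_measurable (pred_sigma M F)"
  unfolding yl_def using Y_cadlag by (intro predictable_leftlim[OF filt Y_adapted]) auto

lemma Wl_pred [measurable]: "(\<lambda>p. Wl (fst p) (snd p)) \<in> borel_measurable (pred_sigma M F)"
  unfolding Wl_def l1_def by measurable

lemma yl_max: "yl w (max 0 s) = yl w s" "Wl w (max 0 s) = Wl w s"
  by (auto simp: yl_def Wl_def leftlim_def max_def)

lemma yl_path [measurable]: "w \<in> space M \<Longrightarrow> (\<lambda>s. yl w s $ m) \<in> borel_measurable borel"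
  using measurable_compose[OF measurable_path_section[OF filt] yl_pred[of m]] by (simp add: yl_max)

lemma Wl_path [measurable]: "w \<in> space M \<Longrightarrow> (\<lambda>s. Wl w s) \<in> borel_measurable borel"
  using measurable_compose[OF measurable_path_section[OF filt] Wl_pred] by (simp add: yl_max)

lemma z_bounds: "w \<in> space M \<Longrightarrow> 0 \<le> z w s" "w \<in> space M \<Longrightarrow> z w s \<le> Wl w s"
  using zeta_spec(3,4) by (auto simp: z_def)

lemma z_no_atom: "w \<in> space M \<Longrightarrow> emeasure (G w) {s} = 0 \<Longrightarrow> z w s = Wl w s"
  using zeta_no_atom[of w s] antisym[OF _ Wl_nonneg[of w s]] by (auto simp: z_def not_less)

text \<open>A Bochner integral defaults to 0, so the integral inside \<open>lam_hat\<close> has to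
  be shown to converge before it can be read as a nonnegative integral. The cost bound does this,
  since |x|/(z + |x|) dominates the norm of the integrand.\<close>

lemma lam_hat_nonneg_eq:
  assumes w: "w \<in> space M" and s: "s > 0"
  shows "0 \<le> lam_hat \<nu> b K w s (Wl w s) $ n"
    and "ennreal (yl w s $ m * lam_hat \<nu> b K w s (Wl w s) $ n) =
      ennreal (yl w s $ m / Wl w s * b w s $ n) + (\<integral>\<^sup>+x. ennreal (yl w s $ m * x $ n / (z w s + l1 x)) \<partial>K w s)"
proof -
  have [simp, measurable_cong]: "sets (K w t) = sets borel" for t using K_sets w by auto
  have y0: "0 \<le> yl w s $ m" by (rule yl_nonneg[OF w])
  have "0 \<le> lam_hat \<nu> b K w s (Wl w s) $ n \<and> ennreal (yl w s $ m * lam_hat \<nu> b K w s (Wl w s) $ n) =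
      ennreal (yl w s $ m / Wl w s * b w s $ n) + (\<integral>\<^sup>+x. ennreal (yl w s $ m * x $ n / (z w s + l1 x)) \<partial>K w s)"
  proof (cases "0 < Wl w s")
    case False
    then have "Wl w s = 0" "yl w s $ m = 0" using Wl_nonneg[of w s] yl_le_Wl[OF w, of s m] y0 by auto
    then show ?thesis by (simp add: lam_hat_def)
  next
    case True
    define zz where "zz = zeta \<nu> w s (Wl w s)"
    have z: "z w s = zz" using True by (simp add: z_def zz_def)
    have zz: "0 \<le> zz" unfolding zz_def by (rule zeta_spec(3)[OF w True])
    have nz: "AE x in K w s. 0 < zz + l1 x \<and> (\<forall>n. 0 \<le> x $ n)"
      using K_AE[OF w, of s] by eventually_elim (use zz in \<open>auto simp: nonneg_vecs_def l1_pos_iff intro: add_nonneg_pos\<close>)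
    have int: "integrable (K w s) (\<lambda>x. (1 / (zz + l1 x)) *\<^sub>R x)"
    proof (rule integrableI_bounded)
      have "(\<integral>\<^sup>+x. ennreal (norm ((1 / (zz + l1 x)) *\<^sub>R x)) \<partial>K w s) \<le> (\<integral>\<^sup>+x. ennreal (1 / Wl w s) * ennreal (Wl w s * l1 x / (zz + l1 x)) \<partial>K w s)"
        using nz
      proof (intro nn_integral_mono_AE, eventually_elim)
        fix x :: "real^'n" assume x: "0 < zz + l1 x \<and> (\<forall>n. 0 \<le> x $ n)"
        have "norm ((1 / (zz + l1 x)) *\<^sub>R x) = norm x / (zz + l1 x)" using x by simp
        also have "\<dots> \<le> l1 x / (zz + l1 x)"
          using x norm_le_l1_cart[of x] by (intro divide_right_mono) (auto simp: l1_def)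
        also have "\<dots> = 1 / Wl w s * (Wl w s * l1 x / (zz + l1 x))" using True by simp
        finally show "ennreal (norm ((1 / (zz + l1 x)) *\<^sub>R x)) \<le> ennreal (1 / Wl w s) * ennreal (Wl w s * l1 x / (zz + l1 x))"
          using True x by (simp add: ennreal_mult[symmetric] ennreal_leI)
      qed
      also have "\<dots> = ennreal (1 / Wl w s) * (\<integral>\<^sup>+x. ennreal (Wl w s * l1 x / (zz + l1 x)) \<partial>K w s)"
        by (rule nn_integral_cmult) measurable
      also have "\<dots> \<le> ennreal (1 / Wl w s) * ennreal (max (2 * Wl w s) 4)"
        unfolding zz_def by (intro mult_left_mono cost_bound[OF w s True]) auto
      also have "\<dots> < \<infinity>" by (simp add: ennreal_mult[symmetric] ennreal_mult_less_top)
      finally show "(\<integral>\<^sup>+x. ennreal (norm ((1 / (zz + l1 x)) *\<^sub>R x)) \<partial>K w s) < \<infinity>" .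
    qed measurable
    have intn: "integrable (K w s) (\<lambda>x. x $ n / (zz + l1 x))"
      using integrable_bounded_linear[OF bounded_linear_vec_nth[of n] int] by simp
    have eq: "lam_hat \<nu> b K w s (Wl w s) $ n = b w s $ n / Wl w s + (LINT x|K w s. x $ n / (zz + l1 x))"
      using True integral_bounded_linear[OF bounded_linear_vec_nth[of n] int] by (simp add: lam_hat_def zz_def)
    have I0: "0 \<le> (LINT x|K w s. x $ n / (zz + l1 x))"
      using nz by (intro integral_nonneg_AE, eventually_elim) auto
    have lam0: "0 \<le> lam_hat \<nu> b K w s (Wl w s) $ n" unfolding eq using I0 b_nonneg'[OF w] True by auto
    have "ennreal (yl w s $ m * lam_hat \<nu> b K w s (Wl w s) $ n) =
       ennreal (yl w s $ m / Wl w s * b w s $ n) + ennreal (yl w s $ m * (LINT x|K w s. x $ n / (zz + l1 x)))"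
      unfolding eq using y0 I0 b_nonneg'[OF w] True by (subst ennreal_plus[symmetric]) (auto simp: distrib_left)
    also have "ennreal (yl w s $ m * (LINT x|K w s. x $ n / (zz + l1 x))) = ennreal (LINT x|K w s. yl w s $ m * x $ n / (zz + l1 x))"
      by (subst integral_mult_right_zero[symmetric]) simp
    also have "\<dots> = (\<integral>\<^sup>+x. ennreal (yl w s $ m * x $ n / (zz + l1 x)) \<partial>K w s)"
    proof (rule nn_integral_eq_integral[symmetric])
      show "integrable (K w s) (\<lambda>x. yl w s $ m * x $ n / (zz + l1 x))"
        using integrable_mult_right[OF intn, of "yl w s $ m"] by simp
      show "AE x in K w s. 0 \<le> yl w s $ m * x $ n / (zz + l1 x)"
        using nz by eventually_elim (use y0 in \<open>auto intro!: divide_nonneg_pos\<close>)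
    qed
    finally show ?thesis using lam0 by (simp add: z)
  qed
  then show "0 \<le> lam_hat \<nu> b K w s (Wl w s) $ n"
    and "ennreal (yl w s $ m * lam_hat \<nu> b K w s (Wl w s) $ n) =
      ennreal (yl w s $ m / Wl w s * b w s $ n) + (\<integral>\<^sup>+x. ennreal (yl w s $ m * x $ n / (z w s + l1 x)) \<partial>K w s)" by auto
qed

lemma fL_nonneg: "w \<in> space M \<Longrightarrow> 0 \<le> fL m n w s"
  using lam_hat_nonneg_eq(1) yl_nonneg by (auto simp: fL_def)

lemma fL_eq:
  assumes w: "w \<in> space M" and s: "s > 0"
  shows "ennreal (fL m n w s) = ennreal (yl w s $ m / Wl w s * b w (max 0 s) $ n) +
     (\<integral>\<^sup>+x. ennreal (yl w s $ m * x $ n / (z w s + l1 x)) \<partial>K w (max 0 s))"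
  using lam_hat_nonneg_eq(2)[OF assms] s by (simp add: fL_def max_def)

text \<open>The measurability of z is not yet at hand, but z differs from the left limit of W only
  at the countably many atoms of G, and a change on a countable set preserves Borel
  measurability.\<close>

lemma fL_measurable [measurable]:
  assumes w: "w \<in> space M"
  shows "fL m n w \<in> borel_measurable borel"
proof -
  note [measurable] = yl_path[OF w] Wl_path[OF w] b_path_measurable[OF w]
  have [measurable]: "(\<lambda>q. yl w (fst q) $ m) \<in> borel_measurable (borel \<Otimes>\<^sub>M (borel :: (real^'n) measure))"
     "(\<lambda>q. (snd q :: real^'n) $ n) \<in> borel_measurable ((borel :: real measure) \<Otimes>\<^sub>M borel)"
    using measurable_compose[OF measurable_fst yl_path[OF w]] measurable_compose[OF measurable_snd borel_measurable_nth]
    by auto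
  have K: "(\<lambda>s. \<integral>\<^sup>+x. ennreal (yl w s $ m * x $ n / (Wl w s + l1 x)) \<partial>K w (max 0 s)) \<in> borel_measurable borel"
    using K_int_measurable[OF w, of "\<lambda>q. ennreal (yl w (fst q) $ m * snd q $ n / (Wl w (fst q) + l1 (snd q)))"]
    by simp
  define g where "g s = (if 0 < s then enn2real (ennreal (yl w s $ m / Wl w s * b w (max 0 s) $ n) +
     (\<integral>\<^sup>+x. ennreal (yl w s $ m * x $ n / (Wl w s + l1 x)) \<partial>K w (max 0 s))) else 0)" for s
  have "g \<in> borel_measurable borel" unfolding g_def using K by measurable
  then show ?thesis
  proof (rule measurable_discrete_difference[where X="{s. emeasure (G w) {s} \<noteq> 0}"])
    fix s assume "s \<notin> {s. emeasure (G w) {s} \<noteq> 0}"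
    then have z: "z w s = Wl w s" using z_no_atom[OF w] by auto
    show "g s = fL m n w s"
    proof (cases "0 < s")
      case True
      have "g s = enn2real (ennreal (fL m n w s))" unfolding fL_eq[OF w True] z using True by (simp add: g_def)
      then show ?thesis using fL_nonneg[OF w] by simp
    qed (simp add: g_def fL_def)
  qed (auto simp: countable_atoms_LS)
qed

lemma fL_bound:
  assumes w: "w \<in> space M" and s: "s > 0" and B: "Wl w s \<le> B"
  shows "fL m n w s \<le> 1 + max (2 * B) 4"
proof (cases "0 < Wl w s")
  case False
  then have "yl w s $ m = 0" using Wl_nonneg[of w s] yl_le_Wl[OF w, of s m] yl_nonneg[OF w, of s m] by auto
  then show ?thesis using B Wl_nonneg[of w s] by (simp add: fL_def max_def)
next
  case True
  have q: "0 \<le> yl w s $ m / Wl w s" "yl w s $ m / Wl w s \<le> 1"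
    using True yl_le_Wl[OF w, of s m] yl_nonneg[OF w, of s m] by auto
  have "(\<integral>\<^sup>+x. ennreal (yl w s $ m * x $ n / (z w s + l1 x)) \<partial>K w (max 0 s)) \<le> (\<integral>\<^sup>+x. ennreal (Wl w s * l1 x / (z w s + l1 x)) \<partial>K w (max 0 s))"
    using K_AE[OF w, of "max 0 s"]
  proof (intro nn_integral_mono_AE, eventually_elim)
    fix x :: "real^'n" assume "x \<in> nonneg_vecs \<and> x \<noteq> 0"
    then have x: "0 \<le> x $ n" "x $ n \<le> l1 x"
      by (auto simp: nonneg_vecs_def component_le_l1)
    show "ennreal (yl w s $ m * x $ n / (z w s + l1 x)) \<le> ennreal (Wl w s * l1 x / (z w s + l1 x))"
      using x yl_le_Wl[OF w, of s m] yl_nonneg[OF w, of s m] z_bounds(1)[OF w, of s]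
      by (intro ennreal_leI divide_right_mono mult_mono) auto
  qed
  also have "\<dots> \<le> ennreal (max (2 * Wl w s) 4)"
    using cost_bound[OF w s True] True s by (simp add: z_def max_def)
  finally have 2: "(\<integral>\<^sup>+x. ennreal (yl w s $ m * x $ n / (z w s + l1 x)) \<partial>K w (max 0 s)) \<le> ennreal (max (2 * B) 4)"
    using B by (elim order_trans) (auto intro!: ennreal_leI)
  have "yl w s $ m / Wl w s * b w (max 0 s) $ n \<le> 1 * 1"
    using q bK_le1(3)[OF w, of "max 0 s" n] b_nonneg'[OF w] by (intro mult_mono) auto
  then have "ennreal (fL m n w s) \<le> ennreal 1 + ennreal (max (2 * B) 4)"
    unfolding fL_eq[OF w s] using 2 by (intro add_mono ennreal_leI) auto
  also have "\<dots> = ennreal (1 + max (2 * B) 4)" by (rule ennreal_plus[symmetric]) auto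
  finally show ?thesis by (subst (asm) ennreal_le_iff) auto
qed

section \<open>Investments and received payoffs as measures on the time axis\<close>

definition L :: "'m \<Rightarrow> 'n \<Rightarrow> 'a \<Rightarrow> real \<Rightarrow> real" where
  "L m n w t = L_hat X \<nu> b K y0 m w (\<lambda>s. Y s w) t $ n"

lemma L_eq:
  assumes w: "w \<in> space M" and t: "t \<ge> 0"
  shows "emeasure (density (G w) (\<lambda>s. ennreal (fL m n w s))) {0<..t} = ennreal (L m n w t)" "0 \<le> L m n w t"
proof -
  note [measurable] = fL_measurable[OF w]
  obtain B where B: "\<And>s. s \<in> {0..t} \<Longrightarrow> 0 < s \<Longrightarrow> Wl w s \<le> B" using W_bounded[OF w t] by blast
  have L: "L m n w t = (LINT s|G w. indicator {0<..t} s *\<^sub>R fL m n w s)"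
    unfolding L_def L_hat_def set_lebesgue_integral_def
    by (simp, intro Bochner_Integration.integral_cong refl) (auto simp: fL_def yl_def Wl_def indicator_def)
  have int: "integrable (G w) (\<lambda>s. indicator {0<..t} s *\<^sub>R fL m n w s)"
  proof (rule Bochner_Integration.integrable_bound[of _ "\<lambda>s. indicator {0<..t} s * (1 + max (2 * B) 4)"])
    show "integrable (G w) (\<lambda>s. indicator {0<..t} s * (1 + max (2 * B) 4))"
      using finite_LS[of _ 0 t] by (intro integrable_mult_left integrable_real_indicator) auto
    show "AE s in G w. norm (indicator {0<..t} s *\<^sub>R fL m n w s) \<le> norm (indicator {0<..t} s * (1 + max (2 * B) 4))"
      using fL_nonneg[OF w] fL_bound[OF w _ B] by (auto simp: indicator_def)
  qed measurable
  have "emeasure (density (G w) (\<lambda>s. ennreal (fL m n w s))) {0<..t} = (\<integral>\<^sup>+s. ennreal (indicator {0<..t} s *\<^sub>R fL m n w s) \<partial>G w)"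
    by (subst emeasure_density) (auto intro!: nn_integral_cong split: split_indicator)
  also have "\<dots> = ennreal (L m n w t)"
    unfolding L using fL_nonneg[OF w] by (intro nn_integral_eq_integral int) auto
  finally show "emeasure (density (G w) (\<lambda>s. ennreal (fL m n w s))) {0<..t} = ennreal (L m n w t)" .
  show "0 \<le> L m n w t" unfolding L using fL_nonneg[OF w] by (intro integral_nonneg_AE) auto
qed

text \<open>Needed because the Lebesgue derivative in the definition of feasibility is taken of the
  measure induced by the path of L, while the strategy is given by its density with respect to
  G.\<close>

lemma LS_L:
  assumes w: "w \<in> space M"
  shows "LS (L m n w) = density (G w) (\<lambda>s. ennreal (fL m n w s))"
proof (rule LS_eqI)
  note [measurable] = fL_measurable[OF w]
  let ?D = "density (G w) (\<lambda>s. ennreal (fL m n w s))"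
  have "emeasure ?D {0<..t} < \<infinity>" for t
    by (cases "t \<ge> 0") (auto simp: L_eq[OF w])
  then have "rc_mono (\<lambda>t. measure ?D {0<..t})" by (intro rc_mono_measure) auto
  then show "rc_mono (L m n w)"
    by (rule rc_mono_cong) (simp add: measure_def L_eq[OF w])
  show "emeasure ?D {..0} = 0"
    using AE_G_pos[OF w] by (subst emeasure_density)
      (auto simp: nn_integral_0_iff_AE elim!: eventually_mono split: split_indicator)
  have "L m n w 0 = 0" using L_eq[OF w, of 0 m n] by (simp add: order_antisym)
  then show "\<And>t. 0 \<le> t \<Longrightarrow> emeasure ?D {0<..t} = ennreal (L m n w t - L m n w 0)"
    by (simp add: L_eq[OF w])
qed simp

text \<open>With 0/0 = 0 the payoff of asset n reaches the investors exactly at the times at which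
  some derivative is nonzero. \<open>\<alpha> n\<close> is the payoff that reaches them,
  \<open>\<beta>\<close> the total investment.\<close>

definition active :: "'n \<Rightarrow> 'a \<Rightarrow> real \<Rightarrow> bool" where "active n w s \<longleftrightarrow> (\<exists>m. l m n w s \<noteq> 0)"
definition \<alpha> :: "'n \<Rightarrow> 'a \<Rightarrow> real measure" where
  "\<alpha> n w = density (XL w n) (\<lambda>s. if active n w (max 0 s) then 1 else 0)"
definition \<beta> :: "'a \<Rightarrow> real measure" where
  "\<beta> w = density (G w) (\<lambda>s. \<Sum>n\<in>UNIV. \<Sum>m\<in>UNIV. ennreal (fL m n w s))"

lemma l_pred [measurable]: "(\<lambda>p. l m n (fst p) (snd p)) \<in> borel_measurable (pred_sigma M F)"
  using l_deriv[of m n] by (auto simp: leb_deriv_def)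

lemma l_nonneg: "w \<in> space M \<Longrightarrow> t \<ge> 0 \<Longrightarrow> 0 \<le> l m n w t"
  using l_deriv[of m n] by (auto simp: leb_deriv_def)

lemma l_path: "w \<in> space M \<Longrightarrow> (\<lambda>s. l m n w (max 0 s)) \<in> borel_measurable borel"
  using measurable_compose[OF measurable_path_section[OF filt] l_pred[of m n]] by simp

lemma active_pred [measurable]: "Measurable.pred (pred_sigma M F) (\<lambda>p. active n (fst p) (snd p))"
  unfolding active_def by measurable

lemma active_path: "w \<in> space M \<Longrightarrow> Measurable.pred borel (\<lambda>s. active n w (max 0 s))"
  using measurable_compose[OF measurable_path_section[OF filt] active_pred[of n]] by simp

lemma sets_\<alpha> [simp]: "sets (\<alpha> n w) = sets borel" and sets_\<beta> [simp]: "sets (\<beta> w) = sets borel"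
  by (simp_all add: \<alpha>_def \<beta>_def)

lemma emeasure_\<alpha>:
  assumes w: "w \<in> space M"
  shows "(\<integral>\<^sup>+s. indicator {0<..t} s * (if active n w (max 0 s) then 1 else 0) \<partial>XL w n) = emeasure (\<alpha> n w) {0<..t}"
    "emeasure (\<alpha> n w) {0<..t} < \<infinity>"
proof -
  note [measurable] = active_path[OF w]
  show *: "(\<integral>\<^sup>+s. indicator {0<..t} s * (if active n w (max 0 s) then 1 else 0) \<partial>XL w n) = emeasure (\<alpha> n w) {0<..t}"
    unfolding \<alpha>_def by (subst emeasure_density) (auto simp: mult.commute)
  have "emeasure (\<alpha> n w) {0<..t} \<le> (\<integral>\<^sup>+s. indicator {0<..t} s \<partial>XL w n)"
    unfolding *[symmetric] by (intro nn_integral_mono) (auto split: split_indicator)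
  also have "\<dots> < \<infinity>" using finite_LS[of _ 0 t] by simp
  finally show "emeasure (\<alpha> n w) {0<..t} < \<infinity>" .
qed

lemma emeasure_\<beta>:
  assumes w: "w \<in> space M" and t: "t \<ge> 0"
  shows "emeasure (\<beta> w) {0<..t} = ennreal (\<Sum>n\<in>UNIV. \<Sum>m\<in>UNIV. L m n w t)"
proof -
  note [measurable] = fL_measurable[OF w]
  have "emeasure (\<beta> w) {0<..t} = (\<integral>\<^sup>+s. (\<Sum>n\<in>UNIV. \<Sum>m\<in>UNIV. ennreal (fL m n w s) * indicator {0<..t} s) \<partial>G w)"
    unfolding \<beta>_def by (subst emeasure_density) (auto simp: sum_distrib_right)
  also have "\<dots> = (\<Sum>n\<in>UNIV. \<integral>\<^sup>+s. (\<Sum>m\<in>UNIV. ennreal (fL m n w s) * indicator {0<..t} s) \<partial>G w)"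
    by (rule nn_integral_sum) measurable
  also have "\<dots> = (\<Sum>n\<in>UNIV. \<Sum>m\<in>UNIV. \<integral>\<^sup>+s. ennreal (fL m n w s) * indicator {0<..t} s \<partial>G w)"
    by (intro sum.cong refl nn_integral_sum) measurable
  also have "\<dots> = (\<Sum>n\<in>UNIV. \<Sum>m\<in>UNIV. ennreal (L m n w t))"
    by (intro sum.cong refl) (simp add: L_eq(1)[OF w t, symmetric] emeasure_density)
  finally show ?thesis using L_eq(2)[OF w t] by (simp add: sum_nonneg)
qed

lemma finite_\<beta>: "w \<in> space M \<Longrightarrow> emeasure (\<beta> w) {0<..t} < \<infinity>"
  by (cases "t \<ge> 0") (auto simp: emeasure_\<beta>)

text \<open>The shares of the investors add up to 1 where the asset is active and to 0
  elsewhere.\<close>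

lemma wealth_equation:
  "AE w in M. \<forall>t\<ge>0. W w t = l1 y0 + (\<Sum>n\<in>UNIV. measure (\<alpha> n w) {0<..t}) - measure (\<beta> w) {0<..t}"
proof -
  have "AE w in M. \<forall>m\<in>UNIV. \<forall>t\<ge>0.
           Y t w $ m = y0 $ m - l1 (L_hat X \<nu> b K y0 m w (\<lambda>s. Y s w) t)
             + (\<Sum>n\<in>UNIV. LINT s:{0<..t}|XL w n. l m n w s / (\<Sum>m'\<in>UNIV. \<bar>l m' n w s\<bar>))"
    by (rule AE_finite_allI) (use Y_eq in auto)
  then show ?thesis
  proof (rule AE_mp, intro AE_I2 impI allI)
    fix w t assume w: "w \<in> space M" and t: "t \<ge> (0::real)"
      and eq: "\<forall>m\<in>UNIV. \<forall>t\<ge>0.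
           Y t w $ m = y0 $ m - l1 (L_hat X \<nu> b K y0 m w (\<lambda>s. Y s w) t)
             + (\<Sum>n\<in>UNIV. LINT s:{0<..t}|XL w n. l m n w s / (\<Sum>m'\<in>UNIV. \<bar>l m' n w s\<bar>))"
    note [measurable] = active_path[OF w] l_path[OF w]
    define r where "r m n s = l m n w (max 0 s) / (\<Sum>m'\<in>UNIV. \<bar>l m' n w (max 0 s)\<bar>)" for m n s
    have rsum: "(\<Sum>m\<in>UNIV. r m n s) = (if active n w (max 0 s) then 1 else 0)" for n s
    proof -
      have *: "(\<Sum>m'\<in>UNIV. \<bar>l m' n w (max 0 s)\<bar>) = (\<Sum>m'\<in>UNIV. l m' n w (max 0 s))"
        using l_nonneg[OF w, of "max 0 s"] by simp
      have "(\<Sum>m'\<in>UNIV. l m' n w (max 0 s)) = 0 \<longleftrightarrow> \<not> active n w (max 0 s)"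
        using l_nonneg[OF w, of "max 0 s"] by (subst sum_nonneg_eq_0_iff) (auto simp: active_def)
      then show ?thesis unfolding r_def * by (simp add: sum_divide_distrib[symmetric])
    qed
    have r01: "0 \<le> r m n s" "r m n s \<le> 1" for m n s
    proof -
      show r0: "0 \<le> r m n s" for m n s using l_nonneg[OF w, of "max 0 s"] by (auto simp: r_def intro!: divide_nonneg_nonneg sum_nonneg)
      have "r m n s \<le> (\<Sum>m\<in>UNIV. r m n s)" by (rule member_le_sum) (auto intro: r0)
      then show "r m n s \<le> 1" by (simp add: rsum split: if_splits)
    qed
    have int: "integrable (XL w n) (\<lambda>s. indicator {0<..t} s *\<^sub>R r m n s)" for m n
    proof (rule Bochner_Integration.integrable_bound[of _ "indicator {0<..t} :: real \<Rightarrow> real"])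
      show "integrable (XL w n) (indicator {0<..t} :: real \<Rightarrow> real)"
        using finite_LS[of _ 0 t] by (intro integrable_real_indicator) auto
      show "AE s in XL w n. norm (indicator {0<..t} s *\<^sub>R r m n s) \<le> norm (indicator {0<..t} s :: real)"
        using r01 by (auto simp: indicator_def)
    qed (unfold r_def, measurable)
    have I: "(LINT s:{0<..t}|XL w n. l m n w s / (\<Sum>m'\<in>UNIV. \<bar>l m' n w s\<bar>)) = (LINT s|XL w n. indicator {0<..t} s *\<^sub>R r m n s)" for m n
      unfolding set_lebesgue_integral_def by (intro Bochner_Integration.integral_cong refl) (auto simp: r_def indicator_def)
    have sumI: "(\<Sum>m\<in>UNIV. LINT s:{0<..t}|XL w n. l m n w s / (\<Sum>m'\<in>UNIV. \<bar>l m' n w s\<bar>)) = measure (\<alpha> n w) {0<..t}" for n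
    proof -
      have "(\<Sum>m\<in>UNIV. LINT s:{0<..t}|XL w n. l m n w s / (\<Sum>m'\<in>UNIV. \<bar>l m' n w s\<bar>)) = (LINT s|XL w n. (\<Sum>m\<in>UNIV. indicator {0<..t} s *\<^sub>R r m n s))"
        unfolding I by (rule Bochner_Integration.integral_sum[symmetric]) (rule int)
      also have "\<dots> = enn2real (\<integral>\<^sup>+s. ennreal (\<Sum>m\<in>UNIV. indicator {0<..t} s *\<^sub>R r m n s) \<partial>XL w n)"
      proof (rule integral_eq_nn_integral)
        show "(\<lambda>s. \<Sum>m\<in>UNIV. indicator {0<..t} s *\<^sub>R r m n s) \<in> borel_measurable (XL w n)"
          by (intro borel_measurable_sum borel_measurable_integrable int)
        show "AE s in XL w n. 0 \<le> (\<Sum>m\<in>UNIV. indicator {0<..t} s *\<^sub>R r m n s)"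
          using r01(1) by (intro AE_I2 sum_nonneg scaleR_nonneg_nonneg) (auto simp: indicator_def)
      qed
      also have "(\<integral>\<^sup>+s. ennreal (\<Sum>m\<in>UNIV. indicator {0<..t} s *\<^sub>R r m n s) \<partial>XL w n) = emeasure (\<alpha> n w) {0<..t}"
        unfolding emeasure_\<alpha>(1)[OF w, symmetric] by (intro nn_integral_cong) (auto simp: rsum scaleR_sum_right[symmetric] split: split_indicator)
      finally show ?thesis by (simp add: measure_def)
    qed
    have L1: "l1 (L_hat X \<nu> b K y0 m w (\<lambda>s. Y s w) t) = (\<Sum>n\<in>UNIV. L m n w t)" for m
      using L_eq(2)[OF w t] by (simp add: l1_def L_def)
    have "W w t = (\<Sum>m\<in>UNIV. y0 $ m - (\<Sum>n\<in>UNIV. L m n w t)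
             + (\<Sum>n\<in>UNIV. LINT s:{0<..t}|XL w n. l m n w s / (\<Sum>m'\<in>UNIV. \<bar>l m' n w s\<bar>)))"
      unfolding W_sum[OF w t] using eq t by (intro sum.cong refl) (simp add: L1)
    also have "\<dots> = (\<Sum>m\<in>UNIV. y0 $ m) - (\<Sum>m\<in>UNIV. \<Sum>n\<in>UNIV. L m n w t) + (\<Sum>m\<in>UNIV. \<Sum>n\<in>UNIV. LINT s:{0<..t}|XL w n. l m n w s / (\<Sum>m'\<in>UNIV. \<bar>l m' n w s\<bar>))"
      by (simp add: sum.distrib sum_subtractf)
    also have "(\<Sum>m\<in>UNIV. \<Sum>n\<in>UNIV. LINT s:{0<..t}|XL w n. l m n w s / (\<Sum>m'\<in>UNIV. \<bar>l m' n w s\<bar>)) = (\<Sum>n\<in>UNIV. measure (\<alpha> n w) {0<..t})"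
      by (subst sum.swap) (simp add: sumI)
    also have "(\<Sum>m\<in>UNIV. \<Sum>n\<in>UNIV. L m n w t) = measure (\<beta> w) {0<..t}"
      unfolding measure_def emeasure_\<beta>[OF w t] using L_eq(2)[OF w t] by (subst sum.swap) (simp add: sum_nonneg)
    also have "(\<Sum>m\<in>UNIV. y0 $ m) = l1 y0" using y0_pos by (simp add: l1_def less_imp_le)
    finally show "W w t = l1 y0 + (\<Sum>n\<in>UNIV. measure (\<alpha> n w) {0<..t}) - measure (\<beta> w) {0<..t}" by simp
  qed
qed

section \<open>Absence of lost payoffs\<close>

lemma PZ_L:
  assumes "\<And>w. w \<in> space M \<Longrightarrow> (\<lambda>s. indicator Q (w, max 0 s) :: ennreal) \<in> borel_measurable borel"
  shows "PZ M (\<lambda>t w. L_hat X \<nu> b K y0 m w (\<lambda>s. Y s w) t $ n) Q =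
    (\<integral>\<^sup>+w. (\<integral>\<^sup>+s. indicator Q (w, max 0 s) * ennreal (fL m n w s) \<partial>G w) \<partial>M)"
  unfolding PZ_def
proof (rule nn_integral_cong)
  fix w assume w: "w \<in> space M"
  note [measurable] = fL_measurable[OF w] assms[OF w]
  have eq: "(\<lambda>r. L_hat X \<nu> b K y0 m w (\<lambda>s. Y s w) r $ n) = L m n w" by (simp add: L_def fun_eq_iff)
  have "emeasure (LS (L m n w)) {..0} = 0"
    using AE_G_pos[OF w] unfolding LS_L[OF w] by (subst emeasure_density)
      (auto simp: nn_integral_0_iff_AE elim!: eventually_mono split: split_indicator)
  then have pos: "AE s in LS (L m n w). 0 < s" by (intro AE_I[where N="{..0}"]) auto
  have "(\<integral>\<^sup>+s. indicator Q (w, s) \<partial>LS (L m n w)) = (\<integral>\<^sup>+s. indicator Q (w, max 0 s) \<partial>LS (L m n w))"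
    using pos by (intro nn_integral_cong_AE, eventually_elim) simp
  also have "\<dots> = (\<integral>\<^sup>+s. indicator Q (w, max 0 s) * ennreal (fL m n w s) \<partial>G w)"
    unfolding LS_L[OF w] by (subst nn_integral_density) (auto simp: mult.commute)
  finally show "(\<integral>\<^sup>+s. indicator Q (w, s) \<partial>LS (\<lambda>r. L_hat X \<nu> b K y0 m w (\<lambda>s. Y s w) r $ n)) = (\<integral>\<^sup>+s. indicator Q (w, max 0 s) * ennreal (fL m n w s) \<partial>G w)"
    unfolding eq .
qed

lemma indicator_pred_path:
  assumes "Q \<in> sets (pred_sigma M F)"
  shows "(\<lambda>(w, s). indicator Q (w, max 0 s) :: ennreal) \<in> borel_measurable (M \<Otimes>\<^sub>M borel)"
    "w \<in> space M \<Longrightarrow> (\<lambda>s. indicator Q (w, max 0 s) :: ennreal) \<in> borel_measurable borel"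
proof -
  have m: "(indicator Q :: 'a \<times> real \<Rightarrow> ennreal) \<in> borel_measurable (pred_sigma M F)" by (rule borel_measurable_indicator[OF assms])
  show "(\<lambda>(w, s). indicator Q (w, max 0 s) :: ennreal) \<in> borel_measurable (M \<Otimes>\<^sub>M borel)"
    using measurable_compose[OF measurable_joint_section[OF filt] m] by (simp add: case_prod_beta')
  show "w \<in> space M \<Longrightarrow> (\<lambda>s. indicator Q (w, max 0 s) :: ennreal) \<in> borel_measurable borel"
    using measurable_compose[OF measurable_path_section[OF filt] m] by simp
qed

text \<open>The dominated measure of G inherits null sets path by path; measurability of the kernel
  of H turns a null mean into almost every path.\<close>

lemma H_null:
  assumes \<Gamma>: "\<Gamma> \<in> sets (pred_sigma M F)" and 0: "PZ M H \<Gamma> = 0"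
  shows "AE w in M. AE s in G w. indicator \<Gamma> (w, max 0 s) = (0::ennreal)"
proof -
  have rc: "rc_mono (\<lambda>t. H t w)" if "w \<in> space M" for w
    using H_paths that cadlag_right[of "\<lambda>t. H t w"] by (auto simp: rc_mono_def continuous_within)
  have Hm: "H t \<in> borel_measurable M" if "t \<ge> 0" for t
    using filtrationD(4)[OF filt that measurable_compose[OF measurable_time_section[OF filt that] H_pred[unfolded predictable_def]]]
    by simp
  have km: "(\<lambda>w. \<integral>\<^sup>+s. (\<lambda>(w, s). indicator \<Gamma> (w, max 0 s)) (w, s) \<partial>LS (\<lambda>t. H t w)) \<in> borel_measurable M"
  proof (rule measurable_nn_integral_kernel[OF _ _ _ _ indicator_pred_path(1)[OF \<Gamma>]])
    fix t :: real
    show "(\<lambda>w. emeasure (LS (\<lambda>t. H t w)) {0<..t}) \<in> borel_measurable M"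
    proof (cases "t \<ge> 0")
      case True
      then have "(\<lambda>w. ennreal (H t w - H 0 w)) \<in> borel_measurable M" using Hm[of t] Hm[of 0] by measurable
      then show ?thesis using emeasure_LS_Ioc[OF rc, of _ 0 t] True by (simp cong: measurable_cong)
    qed simp
  qed (use emeasure_LS_nonpos[OF rc] finite_LS in auto)
  have "PZ M H \<Gamma> = (\<integral>\<^sup>+w. (\<integral>\<^sup>+s. indicator \<Gamma> (w, max 0 s) \<partial>LS (\<lambda>t. H t w)) \<partial>M)"
    unfolding PZ_def
  proof (rule nn_integral_cong)
    fix w assume w: "w \<in> space M"
    have "AE s in LS (\<lambda>t. H t w). 0 < s" using emeasure_LS_nonpos[OF rc[OF w]] by (intro AE_I[where N="{..0}"]) auto
    then show "(\<integral>\<^sup>+s. indicator \<Gamma> (w, s) \<partial>LS (\<lambda>r. H r w)) = (\<integral>\<^sup>+s. indicator \<Gamma> (w, max 0 s) \<partial>LS (\<lambda>t. H t w))"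
      by (intro nn_integral_cong_AE, eventually_elim) simp
  qed
  then have "AE w in M. (\<integral>\<^sup>+s. indicator \<Gamma> (w, max 0 s) \<partial>LS (\<lambda>t. H t w)) = 0"
    using km 0 by (simp add: nn_integral_0_iff_AE)
  with G_ll_H show ?thesis
  proof (rule AE_mp[OF _ AE_mp[OF _ AE_I2]], intro impI)
    fix w assume w: "w \<in> space M" and ac: "absolutely_continuous (LS (\<lambda>t. H t w)) (G w)"
      and z: "(\<integral>\<^sup>+s. indicator \<Gamma> (w, max 0 s) \<partial>LS (\<lambda>t. H t w)) = 0"
    note m[measurable] = indicator_pred_path(2)[OF \<Gamma> w]
    let ?N = "{s. indicator \<Gamma> (w, max 0 s) \<noteq> (0::ennreal)}"
    have N: "?N \<in> sets borel" by measurable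
    have "AE s in LS (\<lambda>t. H t w). indicator \<Gamma> (w, max 0 s) = (0::ennreal)"
      using z by (subst (asm) nn_integral_0_iff_AE) auto
    then have "?N \<in> null_sets (LS (\<lambda>t. H t w))"
      using N by (simp add: AE_iff_null[of _ "\<lambda>s. indicator \<Gamma> (w, max 0 s) = (0::ennreal)"])
    then have "?N \<in> null_sets (G w)" using ac by (auto simp: absolutely_continuous_def)
    then show "AE s in G w. indicator \<Gamma> (w, max 0 s) = (0::ennreal)"
      by (rule AE_I') auto
  qed
qed

text \<open>On the inactive set l vanishes, and the singular part of the investment lives on an
  H-null set, which G and hence the investment do not charge. So nothing is invested there, and the
  two claims read off the b-part and the K-part. The second has the left limit of W in place of the
  smaller z, whose predictability is not yet available; this only decreases the integrand.\<close>

lemma inactive_null: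
  "AE w in M. (\<integral>\<^sup>+s. (if active n w (max 0 s) then 0 else ennreal (yl w s $ m / Wl w s)) * ennreal (b w (max 0 s) $ n) \<partial>G w) = 0"
  "AE w in M. (\<integral>\<^sup>+q. indicator {0<..} (fst q) * (if active n w (fst q) then 0 else ennreal (yl w (fst q) $ m * snd q $ n / (Wl w (fst q) + l1 (snd q)))) \<partial>\<nu> w) = 0"
proof -
  let ?Z = "\<lambda>t w. L_hat X \<nu> b K y0 m w (\<lambda>s. Y s w) t $ n"
  define Q where "Q = {p \<in> space (pred_sigma M F). \<not> active n (fst p) (snd p)}"
  have Q: "Q \<in> sets (pred_sigma M F)" unfolding Q_def by measurable
  obtain \<Gamma> where \<Gamma>: "\<Gamma> \<in> sets (pred_sigma M F)" "PZ M H \<Gamma> = 0"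
    and \<Gamma>eq: "\<And>Q. Q \<in> sets (pred_sigma M F) \<Longrightarrow>
           PZ M ?Z Q = (\<integral>\<^sup>+ w. (\<integral>\<^sup>+ s. indicator Q (w, s) * ennreal (l m n w s) \<partial>LS (\<lambda>r. H r w)) \<partial>M) + PZ M ?Z (Q \<inter> \<Gamma>)"
    using l_deriv[of m n] unfolding leb_deriv_def by blast
  have 1: "(\<integral>\<^sup>+ w. (\<integral>\<^sup>+ s. indicator Q (w, s) * ennreal (l m n w s) \<partial>LS (\<lambda>r. H r w)) \<partial>M) = 0"
  proof -
    have "indicator Q (w, s) * ennreal (l m n w s) = 0" for w s
      by (cases "l m n w s = 0") (auto simp: Q_def active_def indicator_def)
    then show ?thesis by (simp only: nn_integral_const) simp
  qed
  have Q\<Gamma>: "Q \<inter> \<Gamma> \<in> sets (pred_sigma M F)" using Q \<Gamma> by auto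
  have 2: "PZ M ?Z (Q \<inter> \<Gamma>) = 0"
  proof -
    have "PZ M ?Z (Q \<inter> \<Gamma>) = (\<integral>\<^sup>+w. (\<integral>\<^sup>+s. indicator (Q \<inter> \<Gamma>) (w, max 0 s) * ennreal (fL m n w s) \<partial>G w) \<partial>M)"
      by (rule PZ_L) (rule indicator_pred_path(2)[OF Q\<Gamma>])
    also have "\<dots> = (\<integral>\<^sup>+w. 0 \<partial>M)"
      using H_null[OF \<Gamma>]
    proof (intro nn_integral_cong_AE, eventually_elim)
      fix w assume "AE s in G w. indicator \<Gamma> (w, max 0 s) = (0::ennreal)"
      then have "(\<integral>\<^sup>+s. indicator (Q \<inter> \<Gamma>) (w, max 0 s) * ennreal (fL m n w s) \<partial>G w) = (\<integral>\<^sup>+s. 0 \<partial>G w)"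
        by (intro nn_integral_cong_AE, eventually_elim) (simp add: indicator_inter_arith)
      then show "(\<integral>\<^sup>+s. indicator (Q \<inter> \<Gamma>) (w, max 0 s) * ennreal (fL m n w s) \<partial>G w) = 0" by simp
    qed
    finally show ?thesis by simp
  qed
  have 0: "(\<integral>\<^sup>+w. (\<integral>\<^sup>+s. indicator Q (w, max 0 s) * ennreal (fL m n w s) \<partial>G w) \<partial>M) = 0"
    using \<Gamma>eq[OF Q] 1 2 PZ_L[of Q m n, OF indicator_pred_path(2)[OF Q]] by simp
  have Aind: "indicator Q (w, max 0 s) = (if active n w (max 0 s) then 0 else 1 :: ennreal)" if "w \<in> space M" for w s
    using that by (auto simp: Q_def indicator_def)
  define h1 where "h1 w = (\<integral>\<^sup>+s. (if active n w (max 0 s) then 0 else ennreal (yl w s $ m / Wl w s)) * ennreal (b w (max 0 s) $ n) \<partial>G w)" for w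
  define h2 where "h2 w = (\<integral>\<^sup>+q. indicator {0<..} (fst q) * (if active n w (fst q) then 0 else ennreal (yl w (fst q) $ m * snd q $ n / (Wl w (fst q) + l1 (snd q)))) \<partial>\<nu> w)" for w
  have "(\<lambda>p. if active n (fst p) (snd p) then 0 else ennreal (yl (fst p) (snd p) $ m / Wl (fst p) (snd p))) \<in> borel_measurable (pred_sigma M F)"
    by measurable
  from measurable_compose[OF measurable_joint_section[OF filt] this]
  have "(\<lambda>(w, s). if active n w (max 0 s) then 0 else ennreal (yl w s $ m / Wl w s)) \<in> borel_measurable (M \<Otimes>\<^sub>M borel)"
    by (simp add: case_prod_beta case_prod_beta' yl_max cong: if_cong)
  from measurable_bG[OF this, of n] have h1m: "h1 \<in> borel_measurable M"
    unfolding h1_def[abs_def] by simp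
  have m[measurable]: "(\<lambda>q. (snd q :: real^'n) $ n) \<in> borel_measurable (pred_sigma M F \<Otimes>\<^sub>M borel)"
    using measurable_compose[OF measurable_snd borel_measurable_nth] .
  have yl2[measurable]: "(\<lambda>q. yl (fst (fst q)) (snd (fst q)) $ m) \<in> borel_measurable (pred_sigma M F \<Otimes>\<^sub>M (borel :: (real^'n) measure))"
    using measurable_compose[OF measurable_fst yl_pred] .
  have Wl2[measurable]: "(\<lambda>q. Wl (fst (fst q)) (snd (fst q))) \<in> borel_measurable (pred_sigma M F \<Otimes>\<^sub>M (borel :: (real^'n) measure))"
    using measurable_compose[OF measurable_fst Wl_pred] .
  have ac2[measurable]: "Measurable.pred (pred_sigma M F \<Otimes>\<^sub>M (borel :: (real^'n) measure)) (\<lambda>q. active n (fst (fst q)) (snd (fst q)))"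
    using measurable_compose[OF measurable_fst active_pred] .
  have h2W: "(\<lambda>q. if active n (fst (fst q)) (snd (fst q)) then 0 else
      ennreal (yl (fst (fst q)) (snd (fst q)) $ m * snd q $ n / (Wl (fst (fst q)) (snd (fst q)) + l1 (snd q)))) \<in> borel_measurable (pred_sigma M F \<Otimes>\<^sub>M borel)"
    by measurable
  have h2m: "h2 \<in> borel_measurable M"
    unfolding h2_def[abs_def] using nu_measurable(3)[OF h2W] by (simp cong: if_cong)
  have h1le: "h1 w \<le> (\<integral>\<^sup>+s. indicator Q (w, max 0 s) * ennreal (fL m n w s) \<partial>G w)" if w: "w \<in> space M" for w
    unfolding h1_def using AE_G_pos[OF w]
  proof (intro nn_integral_mono_AE, eventually_elim)
    fix s :: real assume s: "0 < s"
    have "ennreal (yl w s $ m / Wl w s) * ennreal (b w (max 0 s) $ n) \<le> ennreal (fL m n w s)"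
      unfolding fL_eq[OF w s] using yl_nonneg[OF w, of s m] b_nonneg'[OF w]
      by (subst ennreal_mult[symmetric]) (auto intro: add_increasing2)
    then show "(if active n w (max 0 s) then 0 else ennreal (yl w s $ m / Wl w s)) * ennreal (b w (max 0 s) $ n) \<le> indicator Q (w, max 0 s) * ennreal (fL m n w s)"
      unfolding Aind[OF w] by simp
  qed
  have h2le: "h2 w \<le> (\<integral>\<^sup>+s. indicator Q (w, max 0 s) * ennreal (fL m n w s) \<partial>G w)" if w: "w \<in> space M" for w
  proof -
    have meas: "(\<lambda>q. indicator {0<..} (fst q) * (if active n w (max 0 (fst q)) then 0 else ennreal (yl w (fst q) $ m * snd q $ n / (Wl w (fst q) + l1 (snd q))))) \<in> borel_measurable (borel \<Otimes>\<^sub>M borel)"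
      using nu_measurable(4)[OF h2W w] unfolding borel_prod[symmetric] by (intro borel_measurable_times_ennreal) (auto simp: yl_max cong: if_cong)
    have "h2 w = (\<integral>\<^sup>+q. indicator {0<..} (fst q) * (if active n w (max 0 (fst q)) then 0 else ennreal (yl w (fst q) $ m * snd q $ n / (Wl w (fst q) + l1 (snd q)))) \<partial>\<nu> w)"
      unfolding h2_def by (intro nn_integral_cong) (auto split: split_indicator)
    also have "\<dots> = (\<integral>\<^sup>+s. indicator {0<..} s * (\<integral>\<^sup>+x. indicator {0<..} s * (if active n w (max 0 s) then 0 else ennreal (yl w s $ m * x $ n / (Wl w s + l1 x))) \<partial>K w s) \<partial>G w)"
      using meas by (subst nu_integral[OF w]) (simp_all add: borel_prod cong: if_cong)
    also have "\<dots> \<le> (\<integral>\<^sup>+s. indicator Q (w, max 0 s) * ennreal (fL m n w s) \<partial>G w)"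
    proof (intro nn_integral_mono)
      fix s
      show "indicator {0<..} s * (\<integral>\<^sup>+x. indicator {0<..} s * (if active n w (max 0 s) then 0 else ennreal (yl w s $ m * x $ n / (Wl w s + l1 x))) \<partial>K w s)
         \<le> indicator Q (w, max 0 s) * ennreal (fL m n w s)"
      proof (cases "0 < s \<and> \<not> active n w (max 0 s)")
        case True
        then have s: "0 < s" "\<not> active n w (max 0 s)" by auto
        have "(\<integral>\<^sup>+x. ennreal (yl w s $ m * x $ n / (Wl w s + l1 x)) \<partial>K w s) \<le> (\<integral>\<^sup>+x. ennreal (yl w s $ m * x $ n / (z w s + l1 x)) \<partial>K w (max 0 s))"
          using K_AE[OF w, of s] unfolding max_absorb2[OF less_imp_le[OF s(1)]]
        proof (intro nn_integral_mono_AE, eventually_elim)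
          fix x :: "real^'n" assume x: "x \<in> nonneg_vecs \<and> x \<noteq> 0"
          then have "0 < l1 x" "0 \<le> x $ n" by (auto simp: l1_pos_iff nonneg_vecs_def)
          then show "ennreal (yl w s $ m * x $ n / (Wl w s + l1 x)) \<le> ennreal (yl w s $ m * x $ n / (z w s + l1 x))"
            using z_bounds[OF w, of s] yl_nonneg[OF w, of s m] by (intro ennreal_leI divide_left_mono mult_pos_pos) auto
        qed
        also have "\<dots> \<le> ennreal (fL m n w s)" unfolding fL_eq[OF w s(1)] by simp
        finally show ?thesis unfolding Aind[OF w] using s by simp
      next
        case False
        then show ?thesis by (cases "0 < s") auto
      qed
    qed
    finally show ?thesis .
  qed
  have "(\<integral>\<^sup>+w. h1 w \<partial>M) \<le> 0" unfolding 0[symmetric] by (intro nn_integral_mono h1le)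
  then have "AE w in M. h1 w = 0" using h1m by (simp add: nn_integral_0_iff_AE)
  then show "AE w in M. (\<integral>\<^sup>+s. (if active n w (max 0 s) then 0 else ennreal (yl w s $ m / Wl w s)) * ennreal (b w (max 0 s) $ n) \<partial>G w) = 0"
    unfolding h1_def .
  have "(\<integral>\<^sup>+w. h2 w \<partial>M) \<le> 0" unfolding 0[symmetric] by (intro nn_integral_mono h2le)
  then have "AE w in M. h2 w = 0" using h2m by (simp add: nn_integral_0_iff_AE)
  then show "AE w in M. (\<integral>\<^sup>+q. indicator {0<..} (fst q) * (if active n w (fst q) then 0 else ennreal (yl w (fst q) $ m * snd q $ n / (Wl w (fst q) + l1 (snd q)))) \<partial>\<nu> w) = 0"
    unfolding h2_def .
qed

text \<open>If the wealth before s is positive, some investor has positive wealth, and the rate of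
  that investor is a positive multiple of b and of the payoffs under K. Vanishing investment
  therefore forces vanishing payoff.\<close>

lemma inactive_no_payoff:
  "AE w in M. \<forall>n. (AE s in G w. 0 < Wl w s \<longrightarrow> \<not> active n w (max 0 s) \<longrightarrow> b w (max 0 s) $ n = 0) \<and>
     (AE q in \<nu> w. 0 < Wl w (fst q) \<longrightarrow> \<not> active n w (fst q) \<longrightarrow> snd q $ n = 0)"
proof -
  have "AE w in M. \<forall>p\<in>UNIV. (case p of (m, n) \<Rightarrow>
    (\<integral>\<^sup>+s. (if active n w (max 0 s) then 0 else ennreal (yl w s $ m / Wl w s)) * ennreal (b w (max 0 s) $ n) \<partial>G w) = 0 \<and>
    (\<integral>\<^sup>+q. indicator {0<..} (fst q) * (if active n w (fst q) then 0 else ennreal (yl w (fst q) $ m * snd q $ n / (Wl w (fst q) + l1 (snd q)))) \<partial>\<nu> w) = 0)"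
    by (rule AE_finite_allI) (use inactive_null in \<open>auto simp: split_beta\<close>)
  then show ?thesis
  proof (rule AE_mp, intro AE_I2 impI allI)
    fix w n assume w: "w \<in> space M" and *: "\<forall>p\<in>UNIV. (case p of (m, n) \<Rightarrow>
    (\<integral>\<^sup>+s. (if active n w (max 0 s) then 0 else ennreal (yl w s $ m / Wl w s)) * ennreal (b w (max 0 s) $ n) \<partial>G w) = 0 \<and>
    (\<integral>\<^sup>+q. indicator {0<..} (fst q) * (if active n w (fst q) then 0 else ennreal (yl w (fst q) $ m * snd q $ n / (Wl w (fst q) + l1 (snd q)))) \<partial>\<nu> w) = 0)"
    note [measurable] = active_path[OF w] b_path_measurable[OF w] yl_path[OF w] Wl_path[OF w]
    have [simp, measurable_cong]: "sets (\<nu> w) = sets (borel \<Otimes>\<^sub>M borel)" unfolding borel_prod by (rule sets_nu[OF w])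
    have [measurable]: "(\<lambda>q. (snd q :: real^'n) $ n) \<in> borel_measurable ((borel :: real measure) \<Otimes>\<^sub>M borel)"
      using measurable_compose[OF measurable_snd borel_measurable_nth] .
    have [measurable]: "(\<lambda>q. yl w (fst q) $ m) \<in> borel_measurable (borel \<Otimes>\<^sub>M (borel :: (real^'n) measure))" for m
      using measurable_compose[OF measurable_fst yl_path[OF w]] .
    have ex: "\<exists>m. 0 < yl w s $ m" if "0 < Wl w s" for s
    proof (rule ccontr)
      assume "\<not> ?thesis"
      then have "Wl w s \<le> 0" unfolding Wl_sum[OF w] by (intro sum_nonpos) (auto simp: not_less)
      then show False using that by simp
    qed
    have "AE s in G w. \<forall>m\<in>UNIV. (if active n w (max 0 s) then 0 else ennreal (yl w s $ m / Wl w s)) * ennreal (b w (max 0 s) $ n) = 0"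
    proof (rule AE_finite_allI)
      fix m show "AE s in G w. (if active n w (max 0 s) then 0 else ennreal (yl w s $ m / Wl w s)) * ennreal (b w (max 0 s) $ n) = 0"
        using bspec[OF *, of "(m, n)"] by (subst nn_integral_0_iff_AE[symmetric]) auto
    qed simp
    then have 1: "AE s in G w. 0 < Wl w s \<longrightarrow> \<not> active n w (max 0 s) \<longrightarrow> b w (max 0 s) $ n = 0"
    proof (eventually_elim, intro impI)
      fix s assume s: "\<forall>m\<in>UNIV. (if active n w (max 0 s) then 0 else ennreal (yl w s $ m / Wl w s)) * ennreal (b w (max 0 s) $ n) = 0"
        and "0 < Wl w s" "\<not> active n w (max 0 s)"
      moreover obtain m where "0 < yl w s $ m" using ex \<open>0 < Wl w s\<close> by auto
      ultimately have "b w (max 0 s) $ n \<le> 0" using s[rule_format, of m] by (auto simp: ennreal_eq_0_iff divide_le_0_iff)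
      then show "b w (max 0 s) $ n = 0" using b_nonneg'[OF w, of "max 0 s" n] by simp
    qed
    have "AE q in \<nu> w. \<forall>m\<in>UNIV. indicator {0<..} (fst q) * (if active n w (max 0 (fst q)) then 0 else ennreal (yl w (fst q) $ m * snd q $ n / (Wl w (fst q) + l1 (snd q)))) = 0"
    proof (rule AE_finite_allI)
      fix m
      have "(\<integral>\<^sup>+q. indicator {0<..} (fst q) * (if active n w (max 0 (fst q)) then 0 else ennreal (yl w (fst q) $ m * snd q $ n / (Wl w (fst q) + l1 (snd q)))) \<partial>\<nu> w)
        = (\<integral>\<^sup>+q. indicator {0<..} (fst q) * (if active n w (fst q) then 0 else ennreal (yl w (fst q) $ m * snd q $ n / (Wl w (fst q) + l1 (snd q)))) \<partial>\<nu> w)"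
        by (intro nn_integral_cong) (auto split: split_indicator)
      also have "\<dots> = 0" using bspec[OF *, of "(m, n)"] by simp
      finally show "AE q in \<nu> w. indicator {0<..} (fst q) * (if active n w (max 0 (fst q)) then 0 else ennreal (yl w (fst q) $ m * snd q $ n / (Wl w (fst q) + l1 (snd q)))) = 0"
        by (subst nn_integral_0_iff_AE[symmetric]) auto
    qed simp
    then have 2: "AE q in \<nu> w. 0 < Wl w (fst q) \<longrightarrow> \<not> active n w (fst q) \<longrightarrow> snd q $ n = 0"
      using AE_nu[OF w]
    proof (eventually_elim, intro impI)
      fix q :: "real \<times> (real^'n)"
      assume q: "\<forall>m\<in>UNIV. indicator {0<..} (fst q) * (if active n w (max 0 (fst q)) then 0 else ennreal (yl w (fst q) $ m * snd q $ n / (Wl w (fst q) + l1 (snd q)))) = 0"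
        "0 < fst q \<and> snd q \<in> nonneg_vecs \<and> snd q \<noteq> 0" and "0 < Wl w (fst q)" "\<not> active n w (fst q)"
      obtain m where m: "0 < yl w (fst q) $ m" using ex \<open>0 < Wl w (fst q)\<close> by auto
      have "0 < Wl w (fst q) + l1 (snd q)" using \<open>0 < Wl w (fst q)\<close> by (simp add: add_pos_nonneg)
      moreover have "yl w (fst q) $ m * snd q $ n / (Wl w (fst q) + l1 (snd q)) \<le> 0"
        using q(1)[rule_format, of m] q(2) \<open>\<not> active n w (fst q)\<close> by (simp add: ennreal_eq_0_iff)
      ultimately have "snd q $ n \<le> 0" using m by (auto simp: divide_le_0_iff mult_le_0_iff)
      then show "snd q $ n = 0" using q(2) by (simp add: nonneg_vecs_def order_antisym)
    qed
    show "(AE s in G w. 0 < Wl w s \<longrightarrow> \<not> active n w (max 0 s) \<longrightarrow> b w (max 0 s) $ n = 0) \<and>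
     (AE q in \<nu> w. 0 < Wl w (fst q) \<longrightarrow> \<not> active n w (fst q) \<longrightarrow> snd q $ n = 0)"
      using 1 2 by blast
  qed
qed

section \<open>The pathwise balance of the reciprocal wealth\<close>

definition good :: "'a \<Rightarrow> bool" where
  "good w \<longleftrightarrow> (\<forall>t\<ge>0. W w t = l1 y0 + (\<Sum>n\<in>UNIV. measure (\<alpha> n w) {0<..t}) - measure (\<beta> w) {0<..t}) \<and>
    (\<forall>n. (AE s in G w. 0 < Wl w s \<longrightarrow> \<not> active n w (max 0 s) \<longrightarrow> b w (max 0 s) $ n = 0) \<and>
     (AE q in \<nu> w. 0 < Wl w (fst q) \<longrightarrow> \<not> active n w (fst q) \<longrightarrow> snd q $ n = 0))"

lemma AE_good: "AE w in M. good w"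
  using wealth_equation inactive_no_payoff by eventually_elim (simp add: good_def)

text \<open>\<open>xl\<close> is the part of a payoff x that reaches the investors,
  \<open>gp\<close> the weight of the chain rule, cut off where the wealth before is 0, and
  \<open>cost\<close> the amount invested against a possible payoff x.\<close>

definition xl :: "'a \<Rightarrow> real \<Rightarrow> real^'n \<Rightarrow> real" where
  "xl w s x = (\<Sum>n\<in>UNIV. if active n w s then x $ n else 0)"
definition gp :: "real \<Rightarrow> 'a \<Rightarrow> real \<Rightarrow> real" where
  "gp e w r = (if 0 < Wl w r then 1 / ((e + W w r) * (e + Wl w r)) else 0)"
definition cost :: "'a \<Rightarrow> real \<Rightarrow> real^'n \<Rightarrow> real" where
  "cost w s x = Wl w s * l1 x / (z w s + l1 x)"

lemma xl_bounds: "x \<in> nonneg_vecs \<Longrightarrow> 0 \<le> xl w s x" "x \<in> nonneg_vecs \<Longrightarrow> xl w s x \<le> l1 x"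
  by (auto simp: xl_def l1_nonneg_vec nonneg_vecs_def intro!: sum_nonneg sum_mono)

lemma gp_nonneg: "0 < e \<Longrightarrow> 0 \<le> gp e w r"
  by (auto simp: gp_def intro!: divide_nonneg_nonneg mult_nonneg_nonneg add_nonneg_nonneg)

lemma cost_nonneg: "w \<in> space M \<Longrightarrow> 0 \<le> cost w s x"
  using z_bounds(1)[of w s] by (auto simp: cost_def intro!: divide_nonneg_nonneg)

lemma z_path:
  assumes w: "w \<in> space M"
  shows "z w \<in> borel_measurable borel"
  by (rule measurable_discrete_difference[where X="{s. emeasure (G w) {s} \<noteq> 0}", OF Wl_path[OF w]])
     (use z_no_atom[OF w] countable_atoms_LS in auto)

lemma cost_path:
  assumes w: "w \<in> space M"
  shows "(\<lambda>q. cost w (fst q) (snd q)) \<in> borel_measurable (borel \<Otimes>\<^sub>M borel)"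
proof -
  note [measurable] = measurable_compose[OF measurable_fst z_path[OF w]] measurable_compose[OF measurable_fst Wl_path[OF w]]
  show ?thesis unfolding cost_def by measurable
qed

text \<open>Over the investors, the wealth shares sum to 1 and the wealths to the total wealth; over
  the assets, the components of x sum to |x|.\<close>

lemma fL_sum:
  assumes w: "w \<in> space M" and s: "s > 0"
  shows "(\<Sum>n\<in>UNIV. \<Sum>m\<in>UNIV. ennreal (fL m n w s)) =
    (if 0 < Wl w s then \<Sum>n\<in>UNIV. ennreal (b w (max 0 s) $ n) else 0) + (\<integral>\<^sup>+x. ennreal (cost w s x) \<partial>K w s)"
proof -
  have [simp, measurable_cong]: "sets (K w t) = sets borel" for t using K_sets w by auto
  have y: "0 \<le> yl w s $ m" for m by (rule yl_nonneg[OF w])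
  have Wls: "(\<Sum>m\<in>UNIV. yl w s $ m) = Wl w s" by (rule Wl_sum[OF w, symmetric])
  have "(\<Sum>m\<in>UNIV. ennreal (yl w s $ m / Wl w s * b w (max 0 s) $ n)) = (if 0 < Wl w s then ennreal (b w (max 0 s) $ n) else 0)" for n
  proof -
    have "(\<Sum>m\<in>UNIV. ennreal (yl w s $ m / Wl w s * b w (max 0 s) $ n)) = ennreal (\<Sum>m\<in>UNIV. yl w s $ m / Wl w s * b w (max 0 s) $ n)"
      using y b_nonneg'[OF w] by (intro sum_ennreal) auto
    also have "(\<Sum>m\<in>UNIV. yl w s $ m / Wl w s * b w (max 0 s) $ n) = Wl w s / Wl w s * b w (max 0 s) $ n"
      by (simp only: sum_distrib_right[symmetric] sum_divide_distrib[symmetric] Wls)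
    finally show ?thesis using Wl_nonneg[of w s] by (auto simp: less_le)
  qed
  then have 1: "(\<Sum>n\<in>UNIV. \<Sum>m\<in>UNIV. ennreal (yl w s $ m / Wl w s * b w (max 0 s) $ n)) = (if 0 < Wl w s then \<Sum>n\<in>UNIV. ennreal (b w (max 0 s) $ n) else 0)"
    by simp
  have [measurable]: "(\<lambda>x. ennreal (yl w s $ m * x $ n / (z w s + l1 x))) \<in> borel_measurable borel" for m n
    by measurable
  have "(\<Sum>n\<in>UNIV. \<Sum>m\<in>UNIV. \<integral>\<^sup>+x. ennreal (yl w s $ m * x $ n / (z w s + l1 x)) \<partial>K w (max 0 s)) =
     (\<Sum>n\<in>UNIV. \<integral>\<^sup>+x. (\<Sum>m\<in>UNIV. ennreal (yl w s $ m * x $ n / (z w s + l1 x))) \<partial>K w (max 0 s))"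
    by (intro sum.cong refl nn_integral_sum[symmetric]) measurable
  also have "\<dots> = (\<integral>\<^sup>+x. (\<Sum>n\<in>UNIV. \<Sum>m\<in>UNIV. ennreal (yl w s $ m * x $ n / (z w s + l1 x))) \<partial>K w (max 0 s))"
    by (rule nn_integral_sum[symmetric]) measurable
  also have "\<dots> = (\<integral>\<^sup>+x. ennreal (cost w s x) \<partial>K w s)"
    using K_AE[OF w, of s] unfolding max_absorb2[OF less_imp_le[OF s]]
  proof (intro nn_integral_cong_AE, eventually_elim)
    fix x :: "real^'n" assume "x \<in> nonneg_vecs \<and> x \<noteq> 0"
    then have x: "x \<in> nonneg_vecs" "\<And>n. 0 \<le> x $ n" by (auto simp: nonneg_vecs_def)
    have zz: "0 \<le> z w s + l1 x" using z_bounds(1)[OF w, of s] by simp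
    have "(\<Sum>n\<in>UNIV. \<Sum>m\<in>UNIV. ennreal (yl w s $ m * x $ n / (z w s + l1 x))) = (\<Sum>n\<in>UNIV. ennreal (\<Sum>m\<in>UNIV. yl w s $ m * x $ n / (z w s + l1 x)))"
      using y x zz by (intro sum.cong refl sum_ennreal) auto
    also have "\<dots> = ennreal (\<Sum>n\<in>UNIV. \<Sum>m\<in>UNIV. yl w s $ m * x $ n / (z w s + l1 x))"
      using y x zz by (intro sum_ennreal sum_nonneg) auto
    also have "(\<Sum>n\<in>UNIV. \<Sum>m\<in>UNIV. yl w s $ m * x $ n / (z w s + l1 x)) = cost w s x"
      by (simp only: sum_divide_distrib[symmetric] sum_distrib_right[symmetric] sum_distrib_left[symmetric] Wls cost_def l1_nonneg_vec[OF x(1)])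
    finally show "(\<Sum>n\<in>UNIV. \<Sum>m\<in>UNIV. ennreal (yl w s $ m * x $ n / (z w s + l1 x))) = ennreal (cost w s x)" .
  qed
  finally show ?thesis unfolding fL_eq[OF w s] sum.distrib 1 by simp
qed

lemma \<beta>_integral:
  assumes w: "w \<in> space M" and f[measurable]: "f \<in> borel_measurable borel"
  shows "(\<integral>\<^sup>+s. f s \<partial>\<beta> w) = (\<integral>\<^sup>+s. f s * (if 0 < Wl w s then \<Sum>n\<in>UNIV. ennreal (b w (max 0 s) $ n) else 0) \<partial>G w) +
     (\<integral>\<^sup>+q. f (fst q) * ennreal (cost w (fst q) (snd q)) \<partial>\<nu> w)"
proof -
  note [measurable] = fL_measurable[OF w] cost_path[OF w] Wl_path[OF w] b_path_measurable[OF w]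
  have [simp, measurable_cong]: "sets (K w t) = sets borel" for t using K_sets w by auto
  have fc: "(\<lambda>q. f (fst q) * ennreal (cost w (fst q) (snd q))) \<in> borel_measurable (borel \<Otimes>\<^sub>M borel)" by measurable
  have km: "(\<lambda>s. indicator {0<..} s * (\<integral>\<^sup>+x. f s * ennreal (cost w s x) \<partial>K w s)) \<in> borel_measurable borel"
  proof -
    have "(\<lambda>s. indicator {0<..} s * (\<integral>\<^sup>+x. f s * ennreal (cost w s x) \<partial>K w (max 0 s))) \<in> borel_measurable borel"
      using K_int_measurable[OF w fc] by auto
    also have "(\<lambda>s. indicator {0<..} s * (\<integral>\<^sup>+x. f s * ennreal (cost w s x) \<partial>K w (max 0 s))) = (\<lambda>s. indicator {0<..} s * (\<integral>\<^sup>+x. f s * ennreal (cost w s x) \<partial>K w s))"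
      by (auto simp: fun_eq_iff max_def split: split_indicator)
    finally show ?thesis .
  qed
  have "(\<integral>\<^sup>+s. f s \<partial>\<beta> w) = (\<integral>\<^sup>+s. (\<Sum>n\<in>UNIV. \<Sum>m\<in>UNIV. ennreal (fL m n w s)) * f s \<partial>G w)"
    unfolding \<beta>_def by (rule nn_integral_density) measurable
  also have "\<dots> = (\<integral>\<^sup>+s. f s * (if 0 < Wl w s then \<Sum>n\<in>UNIV. ennreal (b w (max 0 s) $ n) else 0) +
     indicator {0<..} s * (\<integral>\<^sup>+x. f s * ennreal (cost w s x) \<partial>K w s) \<partial>G w)"
    using AE_G_pos[OF w]
  proof (intro nn_integral_cong_AE, eventually_elim)
    fix s :: real assume s: "0 < s"
    have "(\<lambda>x. ennreal (cost w s x)) \<in> borel_measurable borel"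
      using measurable_compose[OF measurable_Pair1'[of s borel borel] cost_path[OF w]] by simp
    then have "(\<integral>\<^sup>+x. f s * ennreal (cost w s x) \<partial>K w s) = f s * (\<integral>\<^sup>+x. ennreal (cost w s x) \<partial>K w s)"
      by (intro nn_integral_cmult) simp
    then show "(\<Sum>n\<in>UNIV. \<Sum>m\<in>UNIV. ennreal (fL m n w s)) * f s = f s * (if 0 < Wl w s then \<Sum>n\<in>UNIV. ennreal (b w (max 0 s) $ n) else 0) +
     indicator {0<..} s * (\<integral>\<^sup>+x. f s * ennreal (cost w s x) \<partial>K w s)"
      unfolding fL_sum[OF w s] using s by (simp only: distrib_right) (simp add: mult.commute)
  qed
  also have "\<dots> = (\<integral>\<^sup>+s. f s * (if 0 < Wl w s then \<Sum>n\<in>UNIV. ennreal (b w (max 0 s) $ n) else 0) \<partial>G w) +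
     (\<integral>\<^sup>+s. indicator {0<..} s * (\<integral>\<^sup>+x. f s * ennreal (cost w s x) \<partial>K w s) \<partial>G w)"
    by (rule nn_integral_add) (use km in measurable)
  also have "(\<integral>\<^sup>+s. indicator {0<..} s * (\<integral>\<^sup>+x. f s * ennreal (cost w s x) \<partial>K w s) \<partial>G w) = (\<integral>\<^sup>+q. f (fst q) * ennreal (cost w (fst q) (snd q)) \<partial>\<nu> w)"
    using nu_integral[OF w, of "\<lambda>q. f (fst q) * ennreal (cost w (fst q) (snd q))"] fc by (simp add: borel_prod)
  finally show ?thesis .
qed

lemma \<alpha>_integral:
  assumes w: "w \<in> space M" and f[measurable]: "f \<in> borel_measurable borel"
  shows "(\<Sum>n\<in>UNIV. \<integral>\<^sup>+s. f s \<partial>\<alpha> n w) =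
     (\<integral>\<^sup>+s. f s * (\<Sum>n\<in>UNIV. if active n w (max 0 s) then ennreal (b w (max 0 s) $ n) else 0) \<partial>G w) +
     (\<integral>\<^sup>+s. f s * ennreal (xl w s (jump X w s)) \<partial>count_space {0<..})"
proof -
  note [measurable] = active_path[OF w] b_path_measurable[OF w]
  have "(\<integral>\<^sup>+s. f s \<partial>\<alpha> n w) = (\<integral>\<^sup>+s. f s * (if active n w (max 0 s) then ennreal (b w (max 0 s) $ n) else 0) \<partial>G w) +
     (\<integral>\<^sup>+s. f s * (if active n w s then ennreal (jump X w s $ n) else 0) \<partial>count_space {0<..})" for n
  proof -
    have "(\<integral>\<^sup>+s. f s \<partial>\<alpha> n w) = (\<integral>\<^sup>+s. (if active n w (max 0 s) then 1 else 0) * f s \<partial>XL w n)"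
      unfolding \<alpha>_def by (rule nn_integral_density) measurable
    also have "\<dots> = (\<integral>\<^sup>+s. (if active n w (max 0 s) then 1 else 0) * f s * ennreal (b w (max 0 s) $ n) \<partial>G w) +
       (\<integral>\<^sup>+s. (if active n w (max 0 s) then 1 else 0) * f s * ennreal (jump X w s $ n) \<partial>count_space {0<..})"
      by (rule XL_integral[OF w]) measurable
    also have "(\<integral>\<^sup>+s. (if active n w (max 0 s) then 1 else 0) * f s * ennreal (b w (max 0 s) $ n) \<partial>G w) = (\<integral>\<^sup>+s. f s * (if active n w (max 0 s) then ennreal (b w (max 0 s) $ n) else 0) \<partial>G w)"
      by (intro nn_integral_cong) auto
    also have "(\<integral>\<^sup>+s. (if active n w (max 0 s) then 1 else 0) * f s * ennreal (jump X w s $ n) \<partial>count_space {0<..}) = (\<integral>\<^sup>+s. f s * (if active n w s then ennreal (jump X w s $ n) else 0) \<partial>count_space {0<..})"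
      by (intro nn_integral_cong) auto
    finally show ?thesis .
  qed
  then have "(\<Sum>n\<in>UNIV. \<integral>\<^sup>+s. f s \<partial>\<alpha> n w) = (\<Sum>n\<in>UNIV. \<integral>\<^sup>+s. f s * (if active n w (max 0 s) then ennreal (b w (max 0 s) $ n) else 0) \<partial>G w) +
     (\<Sum>n\<in>UNIV. \<integral>\<^sup>+s. f s * (if active n w s then ennreal (jump X w s $ n) else 0) \<partial>count_space {0<..})"
    by (simp add: sum.distrib)
  also have "(\<Sum>n\<in>UNIV. \<integral>\<^sup>+s. f s * (if active n w (max 0 s) then ennreal (b w (max 0 s) $ n) else 0) \<partial>G w) =
     (\<integral>\<^sup>+s. f s * (\<Sum>n\<in>UNIV. if active n w (max 0 s) then ennreal (b w (max 0 s) $ n) else 0) \<partial>G w)"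
    unfolding sum_distrib_left by (rule nn_integral_sum[symmetric]) measurable
  also have "(\<Sum>n\<in>UNIV. \<integral>\<^sup>+s. f s * (if active n w s then ennreal (jump X w s $ n) else 0) \<partial>count_space {0<..}) =
     (\<integral>\<^sup>+s. (\<Sum>n\<in>UNIV. f s * (if active n w s then ennreal (jump X w s $ n) else 0)) \<partial>count_space {0<..})"
    by (rule nn_integral_sum[symmetric]) simp
  also have "\<dots> = (\<integral>\<^sup>+s. f s * ennreal (xl w s (jump X w s)) \<partial>count_space {0<..})"
  proof (intro nn_integral_cong)
    fix s :: real assume "s \<in> space (count_space {0<..})"
    then have "jump X w s \<in> nonneg_vecs" using jump_nonneg[OF w] by simp
    then have "ennreal (xl w s (jump X w s)) = (\<Sum>n\<in>UNIV. ennreal (if active n w s then jump X w s $ n else 0))"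
      unfolding xl_def by (intro sum_ennreal[symmetric]) (auto simp: nonneg_vecs_def)
    also have "\<dots> = (\<Sum>n\<in>UNIV. if active n w s then ennreal (jump X w s $ n) else 0)"
      by (intro sum.cong) auto
    finally show "(\<Sum>n\<in>UNIV. f s * (if active n w s then ennreal (jump X w s $ n) else 0)) = f s * ennreal (xl w s (jump X w s))"
      by (simp add: sum_distrib_left)
  qed
  finally show ?thesis .
qed

text \<open>At an atom of G the b-part vanishes, and the K-part times the mass of the atom is the
  mean cost under the jump law, already known to be the wealth minus z.\<close>

lemma \<beta>_atom:
  assumes w: "w \<in> space M" and r: "r > 0" and Wl: "0 < Wl w r"
  shows "emeasure (\<beta> w) {r} = ennreal (Wl w r - z w r)"
    and "(\<integral>\<^sup>+x. ennreal (cost w r x) \<partial>atom_law (\<nu> w) r) = ennreal (Wl w r - z w r)"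
proof -
  note [measurable] = fL_measurable[OF w]
  interpret J: jump_law "atom_law (\<nu> w) r" "nubar \<nu> w r" "Wl w r" by (rule zeta_spec(1)[OF w Wl])
  show c: "(\<integral>\<^sup>+x. ennreal (cost w r x) \<partial>atom_law (\<nu> w) r) = ennreal (Wl w r - z w r)"
    using J.invested_cost[OF zeta_spec(2)[OF w Wl]] Wl by (simp add: cost_def z_def)
  have cm: "(\<lambda>x. ennreal (cost w r x)) \<in> borel_measurable borel"
    using measurable_compose[OF measurable_Pair1'[of r borel borel] cost_path[OF w]] by simp
  have "emeasure (\<beta> w) {r} = (\<Sum>n\<in>UNIV. \<Sum>m\<in>UNIV. ennreal (fL m n w r)) * emeasure (G w) {r}"
    unfolding \<beta>_def by (subst emeasure_density) (auto simp: nn_integral_indicator_singleton)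
  also have "\<dots> = (\<integral>\<^sup>+x. ennreal (cost w r x) \<partial>atom_law (\<nu> w) r)"
  proof (cases "emeasure (G w) {r} = 0")
    case True
    then show ?thesis by (simp add: atom_law_K[OF w r cm])
  next
    case False
    then have "b w r = 0" by (rule b_atom[OF w r])
    then have "(\<Sum>n\<in>UNIV. \<Sum>m\<in>UNIV. ennreal (fL m n w r)) = (\<integral>\<^sup>+x. ennreal (cost w r x) \<partial>K w r)"
      unfolding fL_sum[OF w r] using r by simp
    then show ?thesis by (simp add: atom_law_K[OF w r cm] mult.commute)
  qed
  finally show "emeasure (\<beta> w) {r} = ennreal (Wl w r - z w r)" unfolding c .
qed

lemma \<alpha>_atom:
  assumes w: "w \<in> space M" and r: "r > 0"
  shows "measure (\<alpha> n w) {r} = (if active n w r then jump X w r $ n else 0)"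
proof -
  note [measurable] = active_path[OF w]
  have "emeasure (\<alpha> n w) {r} = (if active n w (max 0 r) then 1 else 0) * emeasure (XL w n) {r}"
    unfolding \<alpha>_def by (subst emeasure_density) (auto simp: nn_integral_indicator_singleton)
  then show ?thesis using r by (auto simp: measure_def jump_component(1)[OF w r])
qed

lemma measure_left_limit:
  fixes N :: "real measure"
  assumes N: "sets N = sets borel" "emeasure N {..0} = 0" "\<And>t. emeasure N {0<..t} < \<infinity>" and r: "r > 0"
  shows "((\<lambda>t. measure N {0<..t}) \<longlongrightarrow> measure N {0<..r} - measure N {r}) (at_left r)"
proof -
  have rc: "rc_mono (\<lambda>t. measure N {0<..t})" by (rule rc_mono_measure[OF N(1,3)])
  have "LS (\<lambda>t. measure N {0<..t}) = N"
    by (rule LS_eqI[OF rc N(1,2)]) (use N(3) in \<open>simp add: emeasure_eq_ennreal_measure less_top\<close>)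
  then show ?thesis using LS_left_limit(1)[OF rc r] by simp
qed

text \<open>The left limit of the wealth equation at r differs from its value by the atoms at r: the
  investment \<open>Wl w r - z w r\<close> and the payoff that reaches the investors.\<close>

lemma W_after_jump:
  assumes w: "w \<in> space M" "good w" and r: "r > 0" and Wl: "0 < Wl w r"
  shows "W w r = z w r + xl w r (jump X w r)"
proof -
  note [measurable] = active_path[OF w(1)] fL_measurable[OF w(1)]
  have \<alpha>0: "emeasure (\<alpha> n w) {..0} = 0" for n
  proof -
    have "emeasure (\<alpha> n w) {..0} = (\<integral>\<^sup>+s\<in>{..0}. (if active n w (max 0 s) then 1 else 0) \<partial>XL w n)"
      unfolding \<alpha>_def by (subst emeasure_density) auto
    also have "\<dots> \<le> (\<integral>\<^sup>+s. indicator {..0} s \<partial>XL w n)"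
      by (intro nn_integral_mono) (auto split: split_indicator)
    finally have "emeasure (\<alpha> n w) {..0} \<le> (\<integral>\<^sup>+s. indicator {..0} s \<partial>XL w n)" .
    then show ?thesis using emeasure_LS_nonpos[OF rc_mono_X[OF w(1)], of n] by simp
  qed
  have \<beta>0: "emeasure (\<beta> w) {..0} = 0"
    unfolding \<beta>_def using AE_G_pos[OF w(1)] by (subst emeasure_density)
      (auto simp: nn_integral_0_iff_AE elim!: eventually_mono split: split_indicator)
  have "((\<lambda>t. l1 y0 + (\<Sum>n\<in>UNIV. measure (\<alpha> n w) {0<..t}) - measure (\<beta> w) {0<..t}) \<longlongrightarrow>
     l1 y0 + (\<Sum>n\<in>UNIV. measure (\<alpha> n w) {0<..r} - measure (\<alpha> n w) {r}) - (measure (\<beta> w) {0<..r} - measure (\<beta> w) {r})) (at_left r)"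
    by (intro tendsto_intros measure_left_limit \<alpha>0 \<beta>0 emeasure_\<alpha>(2)[OF w(1)] finite_\<beta>[OF w(1)] r) auto
  moreover have "\<forall>\<^sub>F t in at_left r. l1 y0 + (\<Sum>n\<in>UNIV. measure (\<alpha> n w) {0<..t}) - measure (\<beta> w) {0<..t} = W w t"
    unfolding eventually_at_left_field using w(2) r by (intro exI[of _ 0]) (auto simp: good_def)
  ultimately have "(W w \<longlongrightarrow> l1 y0 + (\<Sum>n\<in>UNIV. measure (\<alpha> n w) {0<..r} - measure (\<alpha> n w) {r}) - (measure (\<beta> w) {0<..r} - measure (\<beta> w) {r})) (at_left r)"
    by (rule Lim_transform_eventually)
  from tendsto_unique[OF _ W_tendsto(2)[OF w(1) r] this]
  have "Wl w r = l1 y0 + (\<Sum>n\<in>UNIV. measure (\<alpha> n w) {0<..r} - measure (\<alpha> n w) {r}) - (measure (\<beta> w) {0<..r} - measure (\<beta> w) {r})"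
    by simp
  moreover have "W w r = l1 y0 + (\<Sum>n\<in>UNIV. measure (\<alpha> n w) {0<..r}) - measure (\<beta> w) {0<..r}"
    using w(2) r by (simp add: good_def)
  moreover have "measure (\<beta> w) {r} = Wl w r - z w r"
    using \<beta>_atom(1)[OF w(1) r Wl] z_bounds(2)[OF w(1), of r] by (simp add: measure_def)
  moreover have "(\<Sum>n\<in>UNIV. measure (\<alpha> n w) {r}) = xl w r (jump X w r)"
    by (simp add: xl_def \<alpha>_atom[OF w(1) r])
  ultimately show ?thesis by (simp add: sum_subtractf)
qed

text \<open>The continuous payoffs cancel against the part of the investment that is proportional to b.\<close>

lemma reciprocal_wealth:
  assumes w: "w \<in> space M" "good w" and e: "e > 0" and st: "0 \<le> s" "s \<le> t"
  shows "(\<lambda>r. indicator {s<..t} r * ennreal (gp e w r)) \<in> borel_measurable borel" (is ?M)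
    and "ennreal (1 / (e + W w t)) + (\<integral>\<^sup>+r. indicator {s<..t} r * ennreal (gp e w r) * ennreal (xl w r (jump X w r)) \<partial>count_space {0<..})
     \<le> ennreal (1 / (e + W w s)) + (\<integral>\<^sup>+q. indicator {s<..t} (fst q) * ennreal (gp e w (fst q)) * ennreal (cost w (fst q) (snd q)) \<partial>\<nu> w)"
    and "(\<And>r. s < r \<Longrightarrow> r \<le> t \<Longrightarrow> 0 < Wl w r) \<Longrightarrow>
     ennreal (1 / (e + W w t)) + (\<integral>\<^sup>+r. indicator {s<..t} r * ennreal (gp e w r) * ennreal (xl w r (jump X w r)) \<partial>count_space {0<..})
     = ennreal (1 / (e + W w s)) + (\<integral>\<^sup>+q. indicator {s<..t} (fst q) * ennreal (gp e w (fst q)) * ennreal (cost w (fst q) (snd q)) \<partial>\<nu> w)"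
proof -
  note [measurable] = active_path[OF w(1)] fL_measurable[OF w(1)] Wl_path[OF w(1)] b_path_measurable[OF w(1)]
  define g where "g r = ennreal (1 / ((e + W w r) * (e + Wl w r)))" for r
  note cr = reciprocal_chain_rule[of "\<lambda>n. \<alpha> n w" "\<beta> w" "W w" "l1 y0" "Wl w" e s t,
      OF sets_\<alpha> sets_\<beta> emeasure_\<alpha>(2)[OF w(1)] finite_\<beta>[OF w(1)] _ _ W_tendsto[OF w(1)] e st, folded g_def]
  have eqW: "W w t = l1 y0 + (\<Sum>n\<in>UNIV. measure (\<alpha> n w) {0<..t}) - measure (\<beta> w) {0<..t}" if "t \<ge> 0" for t
    using w(2) that by (simp add: good_def)
  have gm[measurable]: "(\<lambda>r. indicator {s<..t} r * g r) \<in> borel_measurable borel"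
    by (rule cr(1)[OF eqW]) auto
  have chain: "ennreal (1 / (e + W w t)) + (\<Sum>n\<in>UNIV. \<integral>\<^sup>+r\<in>{s<..t}. g r \<partial>\<alpha> n w) =
     ennreal (1 / (e + W w s)) + (\<integral>\<^sup>+r\<in>{s<..t}. g r \<partial>\<beta> w)"
    by (rule cr(2)[OF eqW]) auto
  define h where "h r = indicator {s<..t} r * ennreal (gp e w r)" for r
  have h_eq: "h r = indicator {s<..t} r * g r * (if 0 < Wl w r then 1 else 0)" for r
    by (simp add: h_def gp_def g_def)
  have hm[measurable]: "h \<in> borel_measurable borel" unfolding h_eq[abs_def] by measurable
  then show ?M by (simp add: h_def[abs_def])
  let ?B = "\<integral>\<^sup>+s. h s * (\<Sum>n\<in>UNIV. ennreal (b w (max 0 s) $ n)) \<partial>G w"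
  \<comment> \<open>Payoffs at times with zero wealth before them are dropped here. This is the only
    inequality of the argument, and it becomes an equality when the left limit of W stays
    positive.\<close>
  have ga: "(\<integral>\<^sup>+r\<in>{s<..t}. g r \<partial>\<alpha> n w) \<ge> (\<integral>\<^sup>+r. h r \<partial>\<alpha> n w)" for n
    by (intro nn_integral_mono) (auto simp: h_eq mult.commute)
  have gb: "(\<integral>\<^sup>+r\<in>{s<..t}. g r \<partial>\<beta> w) = (\<integral>\<^sup>+r. h r \<partial>\<beta> w)"
  proof -
    have [measurable]: "(\<lambda>r. g r * indicator {s<..t} r) \<in> borel_measurable borel"
      using gm by (simp add: mult.commute)
    have "(\<integral>\<^sup>+r\<in>{s<..t}. g r \<partial>\<beta> w) = (\<integral>\<^sup>+r. (\<Sum>n\<in>UNIV. \<Sum>m\<in>UNIV. ennreal (fL m n w r)) * (g r * indicator {s<..t} r) \<partial>G w)"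
      unfolding \<beta>_def by (rule nn_integral_density) measurable
    also have "\<dots> = (\<integral>\<^sup>+r. (\<Sum>n\<in>UNIV. \<Sum>m\<in>UNIV. ennreal (fL m n w r)) * h r \<partial>G w)"
    proof (intro nn_integral_cong)
      fix r
      have "fL m n w r = 0" if "\<not> 0 < Wl w r" for m n
      proof -
        have "yl w r $ m = 0" using that yl_le_Wl[OF w(1), of r m] yl_nonneg[OF w(1), of r m] by simp
        then show ?thesis by (simp add: fL_def)
      qed
      then show "(\<Sum>n\<in>UNIV. \<Sum>m\<in>UNIV. ennreal (fL m n w r)) * (g r * indicator {s<..t} r) = (\<Sum>n\<in>UNIV. \<Sum>m\<in>UNIV. ennreal (fL m n w r)) * h r"
        by (cases "0 < Wl w r") (simp_all add: h_eq mult.commute)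
    qed
    also have "\<dots> = (\<integral>\<^sup>+r. h r \<partial>\<beta> w)" unfolding \<beta>_def by (rule nn_integral_density[symmetric]) measurable
    finally show ?thesis .
  qed
  \<comment> \<open>The common term can be cancelled only if it is finite; e > 0 bounds
    \<open>gp\<close> by 1/e^2, and each component of b is at most 1.\<close>
  have Bfin: "?B < \<infinity>"
  proof -
    have "?B \<le> (\<integral>\<^sup>+s. ennreal (1 / e\<^sup>2 * real CARD('n)) * indicator {0<..t} s \<partial>G w)"
      using AE_G_pos[OF w(1)]
    proof (intro nn_integral_mono_AE, eventually_elim)
      fix r :: real assume "0 < r"
      have "(\<Sum>n\<in>UNIV. ennreal (b w (max 0 r) $ n)) \<le> (\<Sum>n\<in>(UNIV::'n set). ennreal 1)"
        using bK_le1(3)[OF w(1), of "max 0 r"] by (intro sum_mono ennreal_leI) auto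
      then have 1: "(\<Sum>n\<in>UNIV. ennreal (b w (max 0 r) $ n)) \<le> ennreal (real CARD('n))"
        by (simp add: ennreal_of_nat_eq_real_of_nat)
      have "gp e w r \<le> 1 / e\<^sup>2"
        unfolding gp_def power2_eq_square using e by (auto intro!: divide_left_mono mult_mono mult_pos_pos add_pos_nonneg)
      then have "ennreal (gp e w r) * (\<Sum>n\<in>UNIV. ennreal (b w (max 0 r) $ n)) \<le> ennreal (1 / e\<^sup>2) * ennreal (real CARD('n))"
        by (intro mult_mono ennreal_leI 1) auto
      then show "h r * (\<Sum>n\<in>UNIV. ennreal (b w (max 0 r) $ n)) \<le> ennreal (1 / e\<^sup>2 * real CARD('n)) * indicator {0<..t} r"
        unfolding h_def using e st(1) by (subst ennreal_mult) (auto split: split_indicator)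
    qed
    also have "\<dots> = ennreal (1 / e\<^sup>2 * real CARD('n)) * emeasure (G w) {0<..t}" by (rule nn_integral_cmult_indicator) simp
    also have "\<dots> < \<infinity>" using finite_LS[of _ 0 t] by (simp add: ennreal_mult_less_top)
    finally show ?thesis .
  qed
  have Ba: "(\<integral>\<^sup>+s. h s * (\<Sum>n\<in>UNIV. if active n w (max 0 s) then ennreal (b w (max 0 s) $ n) else 0) \<partial>G w) = ?B"
  proof -
    have "AE s in G w. \<forall>n\<in>UNIV. 0 < Wl w s \<longrightarrow> \<not> active n w (max 0 s) \<longrightarrow> b w (max 0 s) $ n = 0"
      by (rule AE_finite_allI) (use w(2) in \<open>auto simp: good_def\<close>)
    then show ?thesis
    proof (intro nn_integral_cong_AE, eventually_elim)
      fix r assume *: "\<forall>n\<in>UNIV. 0 < Wl w r \<longrightarrow> \<not> active n w (max 0 r) \<longrightarrow> b w (max 0 r) $ n = 0"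
      show "h r * (\<Sum>n\<in>UNIV. if active n w (max 0 r) then ennreal (b w (max 0 r) $ n) else 0) = h r * (\<Sum>n\<in>UNIV. ennreal (b w (max 0 r) $ n))"
      proof (cases "0 < Wl w r")
        case True
        then show ?thesis using * by (intro arg_cong2[where f="(*)"] refl sum.cong) auto
      qed (simp add: h_eq)
    qed
  qed
  have Bb: "(\<integral>\<^sup>+s. h s * (if 0 < Wl w s then \<Sum>n\<in>UNIV. ennreal (b w (max 0 s) $ n) else 0) \<partial>G w) = ?B"
    by (intro nn_integral_cong) (simp add: h_eq)
  let ?J = "\<integral>\<^sup>+r. h r * ennreal (xl w r (jump X w r)) \<partial>count_space {0<..}"
  let ?C = "\<integral>\<^sup>+q. h (fst q) * ennreal (cost w (fst q) (snd q)) \<partial>\<nu> w"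
  have a: "(\<Sum>n\<in>UNIV. \<integral>\<^sup>+r. h r \<partial>\<alpha> n w) = ?B + ?J"
    unfolding \<alpha>_integral[OF w(1) hm] Ba ..
  have b: "(\<integral>\<^sup>+r. h r \<partial>\<beta> w) = ?B + ?C"
    unfolding \<beta>_integral[OF w(1) hm] Bb ..
  have cancel: "(?B + x \<le> ?B + y) = (x \<le> y)" "(?B + x = ?B + y) = (x = y)" for x y :: ennreal
    using Bfin by (auto simp: ennreal_add_left_cancel_le ennreal_add_left_cancel)
  have "?B + (ennreal (1 / (e + W w t)) + ?J) = ennreal (1 / (e + W w t)) + (\<Sum>n\<in>UNIV. \<integral>\<^sup>+r. h r \<partial>\<alpha> n w)"
    unfolding a by (simp add: ac_simps)
  also have "\<dots> \<le> ennreal (1 / (e + W w t)) + (\<Sum>n\<in>UNIV. \<integral>\<^sup>+r\<in>{s<..t}. g r \<partial>\<alpha> n w)"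
    by (intro add_left_mono sum_mono ga)
  also have "\<dots> = ?B + (ennreal (1 / (e + W w s)) + ?C)"
    unfolding chain gb b by (simp add: ac_simps)
  finally have "ennreal (1 / (e + W w t)) + ?J \<le> ennreal (1 / (e + W w s)) + ?C" by (simp only: cancel)
  then show "ennreal (1 / (e + W w t)) + (\<integral>\<^sup>+r. indicator {s<..t} r * ennreal (gp e w r) * ennreal (xl w r (jump X w r)) \<partial>count_space {0<..})
     \<le> ennreal (1 / (e + W w s)) + (\<integral>\<^sup>+q. indicator {s<..t} (fst q) * ennreal (gp e w (fst q)) * ennreal (cost w (fst q) (snd q)) \<partial>\<nu> w)"
    unfolding h_def .
  assume pos: "\<And>r. s < r \<Longrightarrow> r \<le> t \<Longrightarrow> 0 < Wl w r"
  have ga': "(\<integral>\<^sup>+r\<in>{s<..t}. g r \<partial>\<alpha> n w) = (\<integral>\<^sup>+r. h r \<partial>\<alpha> n w)" for n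
    using pos by (intro nn_integral_cong) (auto simp: h_eq mult.commute split: split_indicator)
  have "?B + (ennreal (1 / (e + W w t)) + ?J) = ?B + (ennreal (1 / (e + W w s)) + ?C)"
    using chain unfolding gb b ga' a by (simp add: ac_simps)
  then have "ennreal (1 / (e + W w t)) + ?J = ennreal (1 / (e + W w s)) + ?C" by (simp only: cancel)
  then show "ennreal (1 / (e + W w t)) + (\<integral>\<^sup>+r. indicator {s<..t} r * ennreal (gp e w r) * ennreal (xl w r (jump X w r)) \<partial>count_space {0<..})
     = ennreal (1 / (e + W w s)) + (\<integral>\<^sup>+q. indicator {s<..t} (fst q) * ennreal (gp e w (fst q)) * ennreal (cost w (fst q) (snd q)) \<partial>\<nu> w)"
    unfolding h_def .
qed

end

section \<open>Predictability of the jump laws at fixed times\<close>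

context payoff_characteristics
begin

text \<open>Each atom of G contributes its jump law, and at every other positive time the jump law
  is null, so the sum may run over all positive times.\<close>

lemma nu_atoms:
  assumes w: "w \<in> space M" and f[measurable]: "f \<in> borel_measurable (borel \<Otimes>\<^sub>M borel)"
  shows "(\<integral>\<^sup>+q. indicator {r. emeasure (G w) {r} \<noteq> 0} (fst q) * f q \<partial>\<nu> w) =
    (\<integral>\<^sup>+r. (\<integral>\<^sup>+x. f (r, x) \<partial>atom_law (\<nu> w) r) \<partial>count_space {0<..})"
proof -
  let ?D = "{r. emeasure (G w) {r} \<noteq> 0}"
  have [simp, measurable_cong]: "sets (K w t) = sets borel" for t using K_sets w by auto
  have D[measurable]: "?D \<in> sets borel" by (rule sets.countable[OF _ countable_atoms_LS]) simp
  have sec: "(\<lambda>x. f (r, x)) \<in> borel_measurable borel" for r by measurable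
  define h where "h s = indicator {0<..} s * (\<integral>\<^sup>+x. f (s, x) \<partial>K w (max 0 s))" for s
  have hm: "h \<in> borel_measurable borel" unfolding h_def using K_int_measurable[OF w f] by measurable
  have "(\<integral>\<^sup>+q. indicator ?D (fst q) * f q \<partial>\<nu> w) = (\<integral>\<^sup>+s. indicator {0<..} s * (\<integral>\<^sup>+x. indicator ?D s * f (s, x) \<partial>K w s) \<partial>G w)"
  proof -
    have "(\<lambda>q. indicator ?D (fst q) * f q) \<in> borel_measurable (borel \<Otimes>\<^sub>M borel)" by measurable
    then show ?thesis using nu_integral[OF w, of "\<lambda>q. indicator ?D (fst q) * f q"] by (simp add: borel_prod)
  qed
  also have "\<dots> = (\<integral>\<^sup>+s\<in>?D. h s \<partial>G w)"
    using sec by (intro nn_integral_cong) (auto simp: h_def nn_integral_cmult max_def split: split_indicator)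
  also have "\<dots> = (\<integral>\<^sup>+r. h r * emeasure (G w) {r} \<partial>count_space ?D)"
    using hm by (intro nn_integral_atoms countable_atoms_LS) auto
  also have "\<dots> = (\<integral>\<^sup>+r. h r * emeasure (G w) {r} \<partial>count_space {0<..})"
    by (intro nn_integral_count_space_eq') (auto simp: h_def)
  also have "\<dots> = (\<integral>\<^sup>+r. (\<integral>\<^sup>+x. f (r, x) \<partial>atom_law (\<nu> w) r) \<partial>count_space {0<..})"
    by (intro nn_integral_cong) (simp add: h_def atom_law_K[OF w _ sec] mult.commute max_def)
  finally show ?thesis .
qed

text \<open>A countable set of times without atoms is null for G, and \<nu> is obtained by
  integrating K against G.\<close>

lemma AE_nu_countable:
  assumes w: "w \<in> space M" and C: "countable C" "\<And>r. r \<in> C \<Longrightarrow> emeasure (G w) {r} = 0"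
  shows "AE q in \<nu> w. fst q \<notin> C"
proof -
  have [simp, measurable_cong]: "sets (\<nu> w) = sets borel" by (rule sets_nu[OF w])
  have [simp]: "space (\<nu> w) = UNIV" using sets_eq_imp_space_eq[OF sets_nu[OF w]] by simp
  have Cm[measurable]: "C \<in> sets borel" by (rule sets.countable[OF _ C(1)]) simp
  have "emeasure (G w) C = (\<integral>\<^sup>+r. emeasure (G w) {r} \<partial>count_space C)"
    by (rule emeasure_countable_singleton[OF _ C(1)]) simp
  also have "\<dots> = (\<integral>\<^sup>+r. 0 \<partial>count_space C)" using C(2) by (intro nn_integral_cong) simp
  finally have "AE s in G w. s \<notin> C" using Cm by (intro AE_I[where N=C]) auto
  have Cs: "C \<times> UNIV \<in> sets (borel :: (real \<times> (real^'n)) measure)" unfolding borel_prod[symmetric] by measurable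
  have "emeasure (\<nu> w) (C \<times> UNIV) = (\<integral>\<^sup>+ s. indicator {0<..} s * emeasure (K w s) (Pair s -` (C \<times> UNIV)) \<partial>G w)"
    using nu_eq w Cs by blast
  also have "\<dots> = (\<integral>\<^sup>+ s. 0 \<partial>G w)"
    using \<open>AE s in G w. s \<notin> C\<close> by (intro nn_integral_cong_AE, eventually_elim) simp
  finally show ?thesis using Cs by (intro AE_I[where N="C \<times> UNIV"]) auto
qed

text \<open>The integral over the open interval (0,t) is left-continuous in t and known at t, being
  a supremum over intervals (0,s] with s < t. Domination by min 1 |x| makes it finite, so it is a
  real-valued process.\<close>

lemma nu_interval_predictable:
  fixes f :: "('a \<times> real) \<times> (real^'n) \<Rightarrow> ennreal"
  assumes f: "f \<in> borel_measurable (pred_sigma M F \<Otimes>\<^sub>M borel)"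
    and bound: "\<And>p x. f (p, x) \<le> ennreal c * ennreal (min 1 (l1 x))"
  shows "(\<lambda>p. enn2real (\<integral>\<^sup>+q. indicator {0<..<snd p} (fst q) * f ((fst p, fst q), snd q) \<partial>\<nu> (fst p))) \<in> borel_measurable (pred_sigma M F)"
    and "w \<in> space M \<Longrightarrow> (\<integral>\<^sup>+q. indicator {0<..t} (fst q) * f ((w, fst q), snd q) \<partial>\<nu> w) < \<infinity>"
proof -
  have fin: "(\<integral>\<^sup>+q. indicator {0<..t} (fst q) * f ((w, fst q), snd q) \<partial>\<nu> w) < \<infinity>" if w: "w \<in> space M" for w t
  proof -
    have [simp, measurable_cong]: "sets (\<nu> w) = sets (borel \<Otimes>\<^sub>M borel)" unfolding borel_prod by (rule sets_nu[OF w])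
    have "(\<integral>\<^sup>+q. indicator {0<..t} (fst q) * f ((w, fst q), snd q) \<partial>\<nu> w) \<le> (\<integral>\<^sup>+q. ennreal c * (indicator ({0<..t} \<times> UNIV) q * ennreal (min 1 (l1 (snd q)))) \<partial>\<nu> w)"
      using bound by (intro nn_integral_mono) (auto split: split_indicator)
    also have "\<dots> = ennreal c * A w t" unfolding A_def by (rule nn_integral_cmult) measurable
    also have "\<dots> < \<infinity>" using A_finite[OF w, of t] by (simp add: ennreal_mult_less_top)
    finally show ?thesis .
  qed
  then show "w \<in> space M \<Longrightarrow> (\<integral>\<^sup>+q. indicator {0<..t} (fst q) * f ((w, fst q), snd q) \<partial>\<nu> w) < \<infinity>" .
  have sup: "(\<integral>\<^sup>+q. indicator {0<..<t} (fst q) * f ((w, fst q), snd q) \<partial>\<nu> w) = (SUP n. \<integral>\<^sup>+q. indicator {0<..S n} (fst q) * f ((w, fst q), snd q) \<partial>\<nu> w)"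
    and fin': "(\<integral>\<^sup>+q. indicator {0<..<t} (fst q) * f ((w, fst q), snd q) \<partial>\<nu> w) < \<infinity>"
    if w: "w \<in> space M" and S: "incseq S" "\<And>n. S n < t" "S \<longlonglongrightarrow> t" for w t and S :: "nat \<Rightarrow> real"
  proof -
    have [simp, measurable_cong]: "sets (\<nu> w) = sets (borel \<Otimes>\<^sub>M borel)" unfolding borel_prod by (rule sets_nu[OF w])
    have [measurable]: "(\<lambda>q. f ((w, max 0 (fst q)), snd q)) \<in> borel_measurable (borel \<Otimes>\<^sub>M borel)"
      using nu_measurable(4)[OF f w] by (simp add: borel_prod)
    have "(\<integral>\<^sup>+q. indicator {0<..<t} (fst q) * f ((w, fst q), snd q) \<partial>\<nu> w) = (\<integral>\<^sup>+q. (SUP n. indicator {0<..S n} (fst q) * f ((w, max 0 (fst q)), snd q)) \<partial>\<nu> w)"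
    proof (intro nn_integral_cong antisym)
      fix q :: "real \<times> (real^'n)"
      show "(SUP n. indicator {0<..S n} (fst q) * f ((w, max 0 (fst q)), snd q)) \<le> indicator {0<..<t} (fst q) * f ((w, fst q), snd q)"
        using S(2) by (intro SUP_least) (auto simp: less_le_trans order_le_less_trans split: split_indicator)
      show "indicator {0<..<t} (fst q) * f ((w, fst q), snd q) \<le> (SUP n. indicator {0<..S n} (fst q) * f ((w, max 0 (fst q)), snd q))"
      proof (cases "fst q \<in> {0<..<t}")
        case True
        then have "\<forall>\<^sub>F n in sequentially. fst q < S n" using order_tendstoD(1)[OF S(3), of "fst q"] by simp
        then obtain n where "fst q < S n" by (auto simp: eventually_sequentially)
        then show ?thesis using True by (intro SUP_upper2[of n]) (auto split: split_indicator)
      qed simp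
    qed
    also have "\<dots> = (SUP n. \<integral>\<^sup>+q. indicator {0<..S n} (fst q) * f ((w, max 0 (fst q)), snd q) \<partial>\<nu> w)"
    proof (rule nn_integral_monotone_convergence_SUP)
      show "incseq (\<lambda>n q. indicator {0<..S n} (fst q) * f ((w, max 0 (fst q)), snd q))"
        using S(1) by (fastforce simp: incseq_def le_fun_def split: split_indicator)
    qed measurable
    also have "\<dots> = (SUP n. \<integral>\<^sup>+q. indicator {0<..S n} (fst q) * f ((w, fst q), snd q) \<partial>\<nu> w)"
      by (intro SUP_cong refl nn_integral_cong) (auto split: split_indicator)
    finally show "(\<integral>\<^sup>+q. indicator {0<..<t} (fst q) * f ((w, fst q), snd q) \<partial>\<nu> w) = (SUP n. \<integral>\<^sup>+q. indicator {0<..S n} (fst q) * f ((w, fst q), snd q) \<partial>\<nu> w)" .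
    have "(\<integral>\<^sup>+q. indicator {0<..<t} (fst q) * f ((w, fst q), snd q) \<partial>\<nu> w) \<le> (\<integral>\<^sup>+q. indicator {0<..t} (fst q) * f ((w, fst q), snd q) \<partial>\<nu> w)"
      by (intro nn_integral_mono) (auto split: split_indicator)
    then show "(\<integral>\<^sup>+q. indicator {0<..<t} (fst q) * f ((w, fst q), snd q) \<partial>\<nu> w) < \<infinity>"
      using fin[OF w, of t] by (rule order_le_less_trans)
  qed
  show "(\<lambda>p. enn2real (\<integral>\<^sup>+q. indicator {0<..<snd p} (fst q) * f ((fst p, fst q), snd q) \<partial>\<nu> (fst p))) \<in> borel_measurable (pred_sigma M F)"
  proof (rule measurable_pred_leftcont[where Z="\<lambda>t w. enn2real (\<integral>\<^sup>+q. indicator {0<..<t} (fst q) * f ((w, fst q), snd q) \<partial>\<nu> w)"])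
    fix t :: real assume t: "t \<ge> 0"
    show "(\<lambda>w. enn2real (\<integral>\<^sup>+q. indicator {0<..<t} (fst q) * f ((w, fst q), snd q) \<partial>\<nu> w)) \<in> borel_measurable (F t)"
    proof (cases "t = 0")
      case False
      let ?S = "\<lambda>n. t - t / real (n + 2)"
      have S: "incseq ?S" "\<And>n. ?S n < t" "?S \<longlonglongrightarrow> t" "\<And>n. 0 \<le> ?S n"
      proof -
        show "incseq ?S" using t by (intro incseq_SucI) (auto intro!: divide_left_mono)
        show "?S n < t" "0 \<le> ?S n" for n using t False by (auto simp: field_simps)
        show "?S \<longlonglongrightarrow> t" using at_left_approx[of t] t False by (auto simp: filterlim_at)
      qed
      have "(\<lambda>w. SUP n. \<integral>\<^sup>+q. indicator {0<..?S n} (fst q) * f ((w, fst q), snd q) \<partial>\<nu> w) \<in> borel_measurable (F t)"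
      proof (intro borel_measurable_SUP)
        fix n
        show "(\<lambda>w. \<integral>\<^sup>+q. indicator {0<..?S n} (fst q) * f ((w, fst q), snd q) \<partial>\<nu> w) \<in> borel_measurable (F t)"
          by (rule filtration_mono_measurable[OF filt S(4) less_imp_le[OF S(2)] nu_measurable(1)[OF f S(4)]])
      qed simp
      then have "(\<lambda>w. \<integral>\<^sup>+q. indicator {0<..<t} (fst q) * f ((w, fst q), snd q) \<partial>\<nu> w) \<in> borel_measurable (F t)"
        by (rule measurable_cong[THEN iffD1, rotated]) (use sup[OF _ S(1-3)] filtrationD(1)[OF filt t] in auto)
      then show ?thesis by measurable
    qed simp
  next
    fix w and t :: real assume w: "w \<in> space M" and t: "t > 0"
    show "((\<lambda>s. enn2real (\<integral>\<^sup>+q. indicator {0<..<s} (fst q) * f ((w, fst q), snd q) \<partial>\<nu> w)) \<longlongrightarrow>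
       enn2real (\<integral>\<^sup>+q. indicator {0<..<t} (fst q) * f ((w, fst q), snd q) \<partial>\<nu> w)) (at_left t)"
    proof (rule tendsto_at_left_sequentially[of 0, OF t])
      fix S :: "nat \<Rightarrow> real" assume S: "\<And>n. S n < t" "\<And>n. 0 < S n" "incseq S" "S \<longlonglongrightarrow> t"
      let ?R = "\<lambda>s. \<integral>\<^sup>+q. indicator {0<..s} (fst q) * f ((w, fst q), snd q) \<partial>\<nu> w"
      let ?L = "\<lambda>s. \<integral>\<^sup>+q. indicator {0<..<s} (fst q) * f ((w, fst q), snd q) \<partial>\<nu> w"
      have s2: "?L (S n) \<le> ?L t" for n
        using S(1)[of n] by (intro nn_integral_mono) (auto split: split_indicator)
      have inc: "incseq (\<lambda>n. ?L (S n))"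
      proof (intro incseq_SucI nn_integral_mono)
        fix n q show "indicator {0<..<S n} (fst q) * f ((w, fst q), snd q) \<le> indicator {0<..<S (Suc n)} (fst q) * f ((w, fst q), snd q)"
          using incseq_SucD[OF S(3), of n] by (auto split: split_indicator)
      qed
      have "(SUP n. ?L (S n)) = ?L t"
      proof (rule antisym)
        show "(SUP n. ?L (S n)) \<le> ?L t" by (intro SUP_least s2)
        have "?R (S n) \<le> (SUP n. ?L (S n))" for n
        proof -
          have "\<forall>\<^sub>F m in sequentially. S n < S m" using order_tendstoD(1)[OF S(4) S(1)[of n]] .
          then obtain m where "S n < S m" by (auto simp: eventually_sequentially)
          then have "?R (S n) \<le> ?L (S m)" by (intro nn_integral_mono) (auto split: split_indicator)
          then show ?thesis by (rule SUP_upper2[OF UNIV_I])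
        qed
        then show "?L t \<le> (SUP n. ?L (S n))" unfolding sup[OF w S(3,1,4)] by (intro SUP_least)
      qed
      then have "(\<lambda>n. ?L (S n)) \<longlonglongrightarrow> ?L t" using LIMSEQ_SUP[OF inc] by simp
      then show "(\<lambda>n. enn2real (?L (S n))) \<longlonglongrightarrow> enn2real (?L t)"
        using fin'[OF w S(3,1,4)] by (intro tendsto_enn2real) auto
    qed
  qed
qed

text \<open>The integral over the atom at t is that over (0,t] minus that over (0,t), and both are
  predictable. The truncations \<open>g j\<close>, to jumps larger than 1/(j+1) and values at most
  j, make both finite so that the difference exists in the reals.\<close>

lemma atom_law_predictable:
  fixes f :: "('a \<times> real) \<times> (real^'n) \<Rightarrow> ennreal"
  assumes f[measurable]: "f \<in> borel_measurable (pred_sigma M F \<Otimes>\<^sub>M borel)"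
  shows "(\<lambda>p. \<integral>\<^sup>+x. f (p, x) \<partial>atom_law (\<nu> (fst p)) (snd p)) \<in> borel_measurable (pred_sigma M F)"
proof -
  define g where "g j q = (if 1 / real (Suc j) < l1 (snd q) then min (f q) (ennreal (real j)) else 0)" for j q
  have gm[measurable]: "g j \<in> borel_measurable (pred_sigma M F \<Otimes>\<^sub>M borel)" for j unfolding g_def by measurable
  \<comment> \<open>On {|x| > 1/(j+1)} one has 1 \<le> (j+1) min 1 |x|, whence the constant j
    (j+1).\<close>
  have gb: "g j (p, x) \<le> ennreal (real j * real (Suc j)) * ennreal (min 1 (l1 x))" for j p x
  proof (cases "1 / real (Suc j) < l1 x")
    case True
    have "1 \<le> real (Suc j) * min 1 (l1 x)" using True by (auto simp: min_def pos_divide_less_eq mult.commute)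
    then have "real j * 1 \<le> real j * (real (Suc j) * min 1 (l1 x))" by (intro mult_left_mono) auto
    then have "ennreal (real j) \<le> ennreal (real j * real (Suc j)) * ennreal (min 1 (l1 x))"
      by (subst ennreal_mult[symmetric]) (auto intro!: ennreal_leI simp: mult.assoc)
    then show ?thesis using True by (auto simp: g_def intro: order_trans[OF min.cobounded2])
  qed (simp add: g_def)
  define R where "R j p = (\<integral>\<^sup>+q. indicator {0<..snd p} (fst q) * g j ((fst p, fst q), snd q) \<partial>\<nu> (fst p))" for j p
  define Z where "Z j p = (\<integral>\<^sup>+q. indicator {0<..<snd p} (fst q) * g j ((fst p, fst q), snd q) \<partial>\<nu> (fst p))" for j p
  have "(\<lambda>p. SUP j. ennreal (enn2real (R j p) - enn2real (Z j p))) \<in> borel_measurable (pred_sigma M F)"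
    using nu_measurable(2)[OF gm] nu_interval_predictable(1)[OF gm gb] unfolding R_def Z_def by measurable
  then show ?thesis
  proof (rule measurable_cong[THEN iffD1, rotated])
    fix p assume "p \<in> space (pred_sigma M F)"
    then obtain w t where p: "p = (w, t)" and w: "w \<in> space M" and t: "t \<ge> 0" by auto
    have [simp, measurable_cong]: "sets (\<nu> w) = sets (borel \<Otimes>\<^sub>M borel)" unfolding borel_prod by (rule sets_nu[OF w])
    have [measurable]: "(\<lambda>x. f ((w, t), x)) \<in> borel_measurable borel" "(\<lambda>x. g j ((w, t), x)) \<in> borel_measurable borel" for j
      using measurable_compose[OF measurable_Pair1'[of "(w, t)" "pred_sigma M F" borel] f]
        measurable_compose[OF measurable_Pair1'[of "(w, t)" "pred_sigma M F" borel] gm] w t by auto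
    have [measurable]: "(\<lambda>q. g j ((w, max 0 (fst q)), snd q)) \<in> borel_measurable (borel \<Otimes>\<^sub>M borel)" for j
      using nu_measurable(4)[OF gm w] by (simp add: borel_prod)
    have RZ: "R j p = Z j p + (\<integral>\<^sup>+x. g j (p, x) \<partial>atom_law (\<nu> w) t)" for j
    proof -
      have "R j p = (\<integral>\<^sup>+q. indicator {0<..<t} (fst q) * g j ((w, max 0 (fst q)), snd q) + indicator {t} (fst q) * indicator nonneg_vecs (snd q) * g j ((w, t), snd q) \<partial>\<nu> w)"
        unfolding R_def p fst_conv snd_conv using AE_nu[OF w]
        by (intro nn_integral_cong_AE, eventually_elim) (auto split: split_indicator)
      also have "\<dots> = (\<integral>\<^sup>+q. indicator {0<..<t} (fst q) * g j ((w, max 0 (fst q)), snd q) \<partial>\<nu> w) + (\<integral>\<^sup>+q. indicator {t} (fst q) * indicator nonneg_vecs (snd q) * g j ((w, t), snd q) \<partial>\<nu> w)"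
        by (rule nn_integral_add) measurable
      also have "(\<integral>\<^sup>+q. indicator {0<..<t} (fst q) * g j ((w, max 0 (fst q)), snd q) \<partial>\<nu> w) = Z j p"
        unfolding Z_def p fst_conv snd_conv by (intro nn_integral_cong) (auto split: split_indicator)
      also have "(\<integral>\<^sup>+q. indicator {t} (fst q) * indicator nonneg_vecs (snd q) * g j ((w, t), snd q) \<partial>\<nu> w) = (\<integral>\<^sup>+x. g j (p, x) \<partial>atom_law (\<nu> w) t)"
        unfolding p by (subst nn_integral_atom_law[OF sets_nu[OF w]]) (auto intro!: nn_integral_cong split: split_indicator)
      finally show ?thesis .
    qed
    have fin: "R j p < \<infinity>" for j unfolding R_def p using nu_interval_predictable(2)[OF gm gb w, of t j] by simp
    have diff: "ennreal (enn2real (R j p) - enn2real (Z j p)) = (\<integral>\<^sup>+x. g j (p, x) \<partial>atom_law (\<nu> w) t)" for j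
    proof -
      have "Z j p < \<infinity>" "(\<integral>\<^sup>+x. g j (p, x) \<partial>atom_law (\<nu> w) t) < \<infinity>" using fin[of j] RZ[of j] by auto
      then show ?thesis unfolding RZ[of j] by (simp add: enn2real_plus)
    qed
    have nz: "AE x in atom_law (\<nu> w) t. 0 < l1 x"
      using jump_law.nz[OF zeta_spec(1)[OF w, of 1 t]] by simp
    have [simp, measurable_cong]: "sets (atom_law (\<nu> w) t) = sets borel" by (simp add: atom_law_def)
    have "(\<integral>\<^sup>+x. f (p, x) \<partial>atom_law (\<nu> w) t) = (\<integral>\<^sup>+x. (SUP j. g j (p, x)) \<partial>atom_law (\<nu> w) t)"
      using nz
    proof (intro nn_integral_cong_AE, eventually_elim)
      fix x :: "real^'n" assume x: "0 < l1 x"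
      show "f (p, x) = (SUP j. g j (p, x))"
      proof (rule antisym)
        show "(SUP j. g j (p, x)) \<le> f (p, x)" by (intro SUP_least) (auto simp: g_def)
        obtain j0 where j0: "1 / real (Suc j0) < l1 x" using x reals_Archimedean[of "l1 x"] by (auto simp: inverse_eq_divide)
        have "min (f (p, x)) (ennreal (real j)) \<le> (SUP j. g j (p, x))" for j
        proof -
          have "1 / real (Suc (max j j0)) \<le> 1 / real (Suc j0)" by (intro divide_left_mono) auto
          then have "g (max j j0) (p, x) = min (f (p, x)) (ennreal (real (max j j0)))" using j0 by (auto simp: g_def)
          moreover have "min (f (p, x)) (ennreal (real j)) \<le> min (f (p, x)) (ennreal (real (max j j0)))"
            by (intro min.mono ennreal_leI) auto
          ultimately show ?thesis by (intro SUP_upper2[of "max j j0"]) auto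
        qed
        then have "(SUP j. min (f (p, x)) (of_nat j)) \<le> (SUP j. g j (p, x))"
          by (intro SUP_least) (simp add: ennreal_of_nat_eq_real_of_nat)
        moreover have "(SUP j. min (f (p, x)) (of_nat j :: ennreal)) = f (p, x)"
        proof (rule antisym)
          show "f (p, x) \<le> (SUP j. min (f (p, x)) (of_nat j))"
          proof (rule ccontr)
            assume "\<not> ?thesis"
            then have lt: "(SUP j. min (f (p, x)) (of_nat j :: ennreal)) < f (p, x)" by simp
            then obtain j where j: "(SUP j. min (f (p, x)) (of_nat j :: ennreal)) < of_nat j"
              using ennreal_Ex_less_of_nat[of "SUP j. min (f (p, x)) (of_nat j :: ennreal)"] by (metis less_top_ennreal order_less_le_trans top_greatest less_top)
            have "min (f (p, x)) (of_nat j) \<le> (SUP j. min (f (p, x)) (of_nat j :: ennreal))" by (rule SUP_upper) simp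
            then show False using lt j by (auto simp: min_le_iff_disj)
          qed
        qed (intro SUP_least min.cobounded1)
        ultimately show "f (p, x) \<le> (SUP j. g j (p, x))" by simp
      qed
    qed
    also have "\<dots> = (SUP j. \<integral>\<^sup>+x. g j (p, x) \<partial>atom_law (\<nu> w) t)"
    proof (rule nn_integral_monotone_convergence_SUP)
      show "incseq (\<lambda>j x. g j (p, x))"
      proof (intro incseq_SucI le_funI)
        fix j x
        have "1 / real (Suc (Suc j)) \<le> 1 / real (Suc j)" by (intro divide_left_mono) auto
        then show "g j (p, x) \<le> g (Suc j) (p, x)"
          unfolding g_def by (auto intro!: min.mono ennreal_leI simp del: of_nat_Suc) (simp add: ennreal_leI min.coboundedI2)
      qed
    qed (unfold p, measurable)
    finally show "(SUP j. ennreal (enn2real (R j p) - enn2real (Z j p))) = (\<integral>\<^sup>+x. f (p, x) \<partial>atom_law (\<nu> (fst p)) (snd p))"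
      by (simp add: p diff[unfolded p])
  qed
qed

lemma nubar_predictable: "(\<lambda>p. nubar \<nu> (fst p) (snd p)) \<in> borel_measurable (pred_sigma M F)"
proof -
  have "(\<lambda>p. enn2real (\<integral>\<^sup>+x. 1 \<partial>atom_law (\<nu> (fst p)) (snd p))) \<in> borel_measurable (pred_sigma M F)"
    using atom_law_predictable[of "\<lambda>_. 1"] by measurable
  then show ?thesis
  proof (rule measurable_cong[THEN iffD1, rotated])
    fix p assume "p \<in> space (pred_sigma M F)"
    then show "enn2real (\<integral>\<^sup>+x. 1 \<partial>atom_law (\<nu> (fst p)) (snd p)) = nubar \<nu> (fst p) (snd p)"
      using emeasure_atom_law[OF sets_nu, of "fst p" UNIV "snd p"] by (auto simp: nubar_def atom_law_def)
  qed
qed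

end

text \<open>z is only defined as a root, so its superlevel sets are computed instead: a < z is
  equivalent to an inequality between integrals against the jump law, which are predictable.\<close>

lemma (in wealth) z_predictable [measurable]: "(\<lambda>p. z (fst p) (snd p)) \<in> borel_measurable (pred_sigma M F)"
proof -
  define \<Psi> where "\<Psi> a p = (\<integral>\<^sup>+x. ennreal (Wl (fst p) (snd p) / (a + l1 x)) \<partial>atom_law (\<nu> (fst p)) (snd p)) +
     ennreal (Wl (fst p) (snd p) / a * (1 - nubar \<nu> (fst p) (snd p)))" for a :: real and p
  have [measurable]: "(\<lambda>q. Wl (fst (fst q)) (snd (fst q))) \<in> borel_measurable (pred_sigma M F \<Otimes>\<^sub>M (borel :: (real^'n) measure))"
    using measurable_compose[OF measurable_fst Wl_pred] .
  have "(\<lambda>p. \<integral>\<^sup>+x. ennreal (Wl (fst p) (snd p) / (a + l1 x)) \<partial>atom_law (\<nu> (fst p)) (snd p)) \<in> borel_measurable (pred_sigma M F)" for a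
    using atom_law_predictable[of "\<lambda>q. ennreal (Wl (fst (fst q)) (snd (fst q)) / (a + l1 (snd q)))"] by simp
  then have \<Psi>[measurable]: "\<Psi> a \<in> borel_measurable (pred_sigma M F)" for a
    unfolding \<Psi>_def using nubar_predictable by measurable
  have iff: "a < z (fst p) (snd p) \<longleftrightarrow> 0 < Wl (fst p) (snd p) \<and> 1 < \<Psi> a p" if p: "p \<in> space (pred_sigma M F)" and a: "a > 0" for a p
  proof (cases "0 < Wl (fst p) (snd p)")
    case True
    have w: "fst p \<in> space M" using p by auto
    show ?thesis using jump_law.invested_gt_iff[OF zeta_spec(1)[OF w True] zeta_spec(2)[OF w True] a] True
      by (simp add: \<Psi>_def z_def)
  qed (use a in \<open>simp add: z_def\<close>)
  show ?thesis
  proof (subst borel_measurable_iff_greater, intro allI)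
    fix a :: real
    consider "a < 0" | "a = 0" | "a > 0" by linarith
    then show "{p \<in> space (pred_sigma M F). a < z (fst p) (snd p)} \<in> sets (pred_sigma M F)"
    proof cases
      case 1
      then have "{p \<in> space (pred_sigma M F). a < z (fst p) (snd p)} = space (pred_sigma M F)"
        using z_bounds(1) by (auto intro: less_le_trans)
      then show ?thesis by (metis sets.top)
    next
      \<comment> \<open>The criterion applies to positive levels, so {0 < z} is exhausted by the
        levels 1/(n+1).\<close>
      case 2
      have "{p \<in> space (pred_sigma M F). a < z (fst p) (snd p)} = (\<Union>n. {p \<in> space (pred_sigma M F). 1 / real (Suc n) < z (fst p) (snd p)})"
        unfolding 2 by (auto simp: inverse_eq_divide[symmetric] simp del: of_nat_Suc dest: reals_Archimedean intro: less_trans[rotated])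
      also have "\<dots> = (\<Union>n. {p \<in> space (pred_sigma M F). 0 < Wl (fst p) (snd p) \<and> 1 < \<Psi> (1 / real (Suc n)) p})"
        using iff[of _ "1 / real (Suc _)"] by (intro SUP_cong refl Collect_cong conj_cong) auto
      also have "\<dots> \<in> sets (pred_sigma M F)" by measurable
      finally show ?thesis .
    next
      case 3
      have "{p \<in> space (pred_sigma M F). a < z (fst p) (snd p)} = {p \<in> space (pred_sigma M F). 0 < Wl (fst p) (snd p) \<and> 1 < \<Psi> a p}"
        using iff[OF _ 3] by auto
      also have "\<dots> \<in> sets (pred_sigma M F)" by measurable
      finally show ?thesis .
    qed
  qed
qed

section \<open>Compensation of the jumps of 1/(e + W)\<close>

context wealth
begin

text \<open>The fall of 1/(e + W) when a payoff a arrives after the investment has left z.\<close>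

definition u :: "real \<Rightarrow> 'a \<Rightarrow> real \<Rightarrow> real \<Rightarrow> real" where
  "u e w s a = (if 0 < Wl w s then 1 / (e + z w s) - 1 / (e + z w s + a) else 0)"

lemma u_zero [simp]: "u e w s 0 = 0"
  by (simp add: u_def)

lemma xl_zero [simp]: "xl w s 0 = 0"
  unfolding xl_def by (intro sum.neutral) auto

lemma u_path:
  assumes w: "w \<in> space M"
  shows "(\<lambda>q. u e w (fst q) (l1 (snd q))) \<in> borel_measurable (borel \<Otimes>\<^sub>M borel)"
proof -
  note [measurable] = measurable_compose[OF measurable_fst z_path[OF w]] measurable_compose[OF measurable_fst Wl_path[OF w]]
  show ?thesis unfolding u_def by measurable
qed

lemma countable_payoff_times: "countable {r. 0 < r \<and> jump X w r \<noteq> 0}" if w: "w \<in> space M"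
proof (rule countable_subset)
  show "{r. 0 < r \<and> jump X w r \<noteq> 0} \<subseteq> (\<Union>n. {r. emeasure (XL w n) {r} \<noteq> 0})"
  proof safe
    fix r :: real assume r: "0 < r" "jump X w r \<noteq> 0"
    then obtain n where "jump X w r $ n \<noteq> 0" by (auto simp: vec_eq_iff)
    then have "0 < jump X w r $ n" using jump_nonneg[OF w r(1)] by (auto simp: nonneg_vecs_def order_less_le)
    then have "emeasure (XL w n) {r} \<noteq> 0" by (simp add: jump_component(2)[OF w r(1), symmetric])
    then show "r \<in> (\<Union>n. {r. emeasure (XL w n) {r} \<noteq> 0})" by auto
  qed
qed (auto simp: countable_atoms_LS)

text \<open>Off the atoms of G, W jumps only at payoff times. There are countably many of these, and
  those without an atom of G are \<nu>-null.\<close>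

lemma AE_W_eq_Wl:
  assumes w: "w \<in> space M" "good w"
  shows "AE q in \<nu> w. emeasure (G w) {fst q} = 0 \<longrightarrow> 0 < Wl w (fst q) \<longrightarrow> W w (fst q) = Wl w (fst q)"
proof -
  have "AE q in \<nu> w. fst q \<notin> {r. 0 < r \<and> jump X w r \<noteq> 0} \<inter> {r. emeasure (G w) {r} = 0}"
    using countable_payoff_times[OF w(1)] by (intro AE_nu_countable[OF w(1)]) (auto intro: countable_subset)
  then show ?thesis using AE_nu[OF w(1)]
  proof (eventually_elim, intro impI)
    fix q :: "real \<times> (real^'n)"
    assume q: "fst q \<notin> {r. 0 < r \<and> jump X w r \<noteq> 0} \<inter> {r. emeasure (G w) {r} = 0}" "0 < fst q \<and> snd q \<in> nonneg_vecs \<and> snd q \<noteq> 0"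
      and G0: "emeasure (G w) {fst q} = 0" and Wl: "0 < Wl w (fst q)"
    then have "jump X w (fst q) = 0" by auto
    then have "xl w (fst q) (jump X w (fst q)) = 0" by simp
    then show "W w (fst q) = Wl w (fst q)"
      using W_after_jump[OF w, of "fst q"] q Wl z_no_atom[OF w(1) G0] by simp
  qed
qed

text \<open>The weight \<open>gp\<close> contains the wealth before the investment, whereas
  \<open>u\<close> starts from the wealth after it. The first claim isolates the difference; the
  second combines it with the cost to the rise of 1/(e + W) caused by the investment alone.\<close>

lemma u_decompose:
  assumes w: "w \<in> space M" "good w" and e: "e > 0" and r: "r > 0"
  shows "u e w r (xl w r (jump X w r)) = gp e w r * xl w r (jump X w r) + gp e w r * xl w r (jump X w r) * (Wl w r - z w r) / (e + z w r)"
    and "0 < Wl w r \<Longrightarrow> gp e w r * (Wl w r - z w r) + gp e w r * xl w r (jump X w r) * (Wl w r - z w r) / (e + z w r) = 1 / (e + z w r) - 1 / (e + Wl w r)"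
proof -
  define a where "a = xl w r (jump X w r)"
  have a: "0 \<le> a" unfolding a_def by (rule xl_bounds(1)[OF jump_nonneg[OF w(1) r]])
  have zb: "0 \<le> z w r" "z w r \<le> Wl w r" using z_bounds[OF w(1)] by auto
  have pos: "0 < e + z w r" "0 < e + z w r + a" "0 < e + Wl w r" using e zb a by auto
  have gp: "gp e w r = 1 / ((e + z w r + a) * (e + Wl w r))" if "0 < Wl w r"
    using W_after_jump[OF w r that] that by (simp add: gp_def a_def add.assoc)
  have "u e w r a = gp e w r * a + gp e w r * a * (Wl w r - z w r) / (e + z w r)"
  proof (cases "0 < Wl w r")
    case True
    show ?thesis unfolding gp[OF True] u_def using True pos by (simp add: divide_simps) (simp add: algebra_simps)
  qed (simp add: u_def gp_def)
  then show "u e w r (xl w r (jump X w r)) = gp e w r * xl w r (jump X w r) + gp e w r * xl w r (jump X w r) * (Wl w r - z w r) / (e + z w r)"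
    by (simp add: a_def)
  assume Wl: "0 < Wl w r"
  have "gp e w r * (Wl w r - z w r) + gp e w r * a * (Wl w r - z w r) / (e + z w r) = 1 / (e + z w r) - 1 / (e + Wl w r)"
    unfolding gp[OF Wl] using pos by (simp add: divide_simps) (simp add: algebra_simps)
  then show "gp e w r * (Wl w r - z w r) + gp e w r * xl w r (jump X w r) * (Wl w r - z w r) / (e + z w r) = 1 / (e + z w r) - 1 / (e + Wl w r)"
    by (simp add: a_def)
qed

text \<open>At the atoms of G the correction turns the weighted cost into the rise of 1/(e + W) due
  to the investment, which the inequality for the jump law bounds by the mean of \<open>u\<close>.
  Outside the atoms z is the wealth itself, and \<open>u\<close> exceeds the weighted cost by an
  explicit nonnegative term.\<close>

lemma reciprocal_wealth_compensated:
  assumes w: "w \<in> space M" "good w" and e: "e > 0" and st: "0 \<le> s" "s \<le> t"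
  shows "ennreal (1 / (e + W w t)) + (\<integral>\<^sup>+r. indicator {s<..t} r * ennreal (u e w r (xl w r (jump X w r))) \<partial>count_space {0<..})
     \<le> ennreal (1 / (e + W w s)) + (\<integral>\<^sup>+q. indicator {s<..t} (fst q) * ennreal (u e w (fst q) (l1 (snd q))) \<partial>\<nu> w)"
proof -
  have [simp, measurable_cong]: "sets (\<nu> w) = sets (borel \<Otimes>\<^sub>M borel)" unfolding borel_prod by (rule sets_nu[OF w(1)])
  let ?D = "{r. emeasure (G w) {r} \<noteq> 0}"
  have D[measurable]: "?D \<in> sets borel" by (rule sets.countable[OF _ countable_atoms_LS]) simp
  define F1 where "F1 q = indicator {s<..t} (fst q) * ennreal (gp e w (fst q)) * ennreal (cost w (fst q) (snd q))" for q :: "real \<times> (real^'n)"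
  define F2 where "F2 q = indicator {s<..t} (fst q) * ennreal (u e w (fst q) (l1 (snd q)))" for q :: "real \<times> (real^'n)"
  \<comment> \<open>The excess of \<open>u\<close> over the chain rule term. It vanishes where z
    equals the left limit of W, so it is concentrated on atoms of G; it is added to both sides and
    used up there.\<close>
  define T where "T r = indicator {s<..t} r * ennreal (gp e w r * xl w r (jump X w r) * (Wl w r - z w r) / (e + z w r))" for r
  have F1m[measurable]: "F1 \<in> borel_measurable (borel \<Otimes>\<^sub>M borel)"
    unfolding F1_def using measurable_compose[OF measurable_fst reciprocal_wealth(1)[OF w e st]] cost_path[OF w(1)] by measurable
  have F2m[measurable]: "F2 \<in> borel_measurable (borel \<Otimes>\<^sub>M borel)"
    unfolding F2_def using u_path[OF w(1)] by measurable
  have split: "(\<integral>\<^sup>+q. f q \<partial>\<nu> w) = (\<integral>\<^sup>+q. indicator (- ?D) (fst q) * f q \<partial>\<nu> w) + (\<integral>\<^sup>+r. (\<integral>\<^sup>+x. f (r, x) \<partial>atom_law (\<nu> w) r) \<partial>count_space {0<..})"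
    if [measurable]: "f \<in> borel_measurable (borel \<Otimes>\<^sub>M borel)" for f
  proof -
    have "(\<integral>\<^sup>+q. f q \<partial>\<nu> w) = (\<integral>\<^sup>+q. indicator (- ?D) (fst q) * f q + indicator ?D (fst q) * f q \<partial>\<nu> w)"
      by (intro nn_integral_cong) (auto split: split_indicator)
    also have "\<dots> = (\<integral>\<^sup>+q. indicator (- ?D) (fst q) * f q \<partial>\<nu> w) + (\<integral>\<^sup>+q. indicator ?D (fst q) * f q \<partial>\<nu> w)"
      using D by (intro nn_integral_add) measurable
    finally show ?thesis unfolding nu_atoms[OF w(1) that] .
  qed
  have gx: "0 \<le> gp e w r * xl w r (jump X w r)" "0 \<le> gp e w r * xl w r (jump X w r) * (Wl w r - z w r) / (e + z w r)" if "r > 0" for r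
    using gp_nonneg[OF e] xl_bounds(1)[OF jump_nonneg[OF w(1) that]] z_bounds[OF w(1), of r] e by (auto intro!: mult_nonneg_nonneg divide_nonneg_nonneg)
  have "(\<integral>\<^sup>+r. indicator {s<..t} r * ennreal (u e w r (xl w r (jump X w r))) \<partial>count_space {0<..}) =
      (\<integral>\<^sup>+r. indicator {s<..t} r * ennreal (gp e w r) * ennreal (xl w r (jump X w r)) + T r \<partial>count_space {0<..})"
  proof (intro nn_integral_cong)
    fix r :: real assume "r \<in> space (count_space {0<..})"
    then have r: "r > 0" by simp
    show "indicator {s<..t} r * ennreal (u e w r (xl w r (jump X w r))) = indicator {s<..t} r * ennreal (gp e w r) * ennreal (xl w r (jump X w r)) + T r"
      unfolding u_decompose(1)[OF w e r] T_def using gx[OF r] gp_nonneg[OF e] xl_bounds(1)[OF jump_nonneg[OF w(1) r]]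
      by (simp add: ennreal_mult[symmetric] distrib_left mult.assoc)
  qed
  also have "\<dots> = (\<integral>\<^sup>+r. indicator {s<..t} r * ennreal (gp e w r) * ennreal (xl w r (jump X w r)) \<partial>count_space {0<..}) + (\<integral>\<^sup>+r. T r \<partial>count_space {0<..})"
    by (rule nn_integral_add) auto
  finally have "ennreal (1 / (e + W w t)) + (\<integral>\<^sup>+r. indicator {s<..t} r * ennreal (u e w r (xl w r (jump X w r))) \<partial>count_space {0<..})
     \<le> ennreal (1 / (e + W w s)) + (\<integral>\<^sup>+q. F1 q \<partial>\<nu> w) + (\<integral>\<^sup>+r. T r \<partial>count_space {0<..})"
    using add_right_mono[OF reciprocal_wealth(2)[OF w e st], of "\<integral>\<^sup>+r. T r \<partial>count_space {0<..}"] by (simp add: F1_def add.assoc)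
  also have "\<dots> = ennreal (1 / (e + W w s)) + ((\<integral>\<^sup>+q. indicator (- ?D) (fst q) * F1 q \<partial>\<nu> w) + ((\<integral>\<^sup>+r. (\<integral>\<^sup>+x. F1 (r, x) \<partial>atom_law (\<nu> w) r) \<partial>count_space {0<..}) + (\<integral>\<^sup>+r. T r \<partial>count_space {0<..})))"
    unfolding split[OF F1m] by (simp add: add.assoc)
  also have "(\<integral>\<^sup>+r. (\<integral>\<^sup>+x. F1 (r, x) \<partial>atom_law (\<nu> w) r) \<partial>count_space {0<..}) + (\<integral>\<^sup>+r. T r \<partial>count_space {0<..}) =
      (\<integral>\<^sup>+r. (\<integral>\<^sup>+x. F1 (r, x) \<partial>atom_law (\<nu> w) r) + T r \<partial>count_space {0<..})"
    by (rule nn_integral_add[symmetric]) auto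
  also have "\<dots> \<le> (\<integral>\<^sup>+r. (\<integral>\<^sup>+x. F2 (r, x) \<partial>atom_law (\<nu> w) r) \<partial>count_space {0<..})"
  proof (intro nn_integral_mono)
    fix r :: real assume "r \<in> space (count_space {0<..})"
    then have r: "r > 0" by simp
    have [simp, measurable_cong]: "sets (atom_law (\<nu> w) r) = sets borel" by (simp add: atom_law_def)
    show "(\<integral>\<^sup>+x. F1 (r, x) \<partial>atom_law (\<nu> w) r) + T r \<le> (\<integral>\<^sup>+x. F2 (r, x) \<partial>atom_law (\<nu> w) r)"
    proof (cases "r \<in> {s<..t} \<and> 0 < Wl w r")
      case False
      then have "F1 (r, x) = 0" "T r = 0" for x by (auto simp: F1_def T_def gp_def)
      then show ?thesis by simp
    next
      case True
      then have Wl: "0 < Wl w r" and ind: "indicator {s<..t} r = (1::ennreal)" by auto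
      have "(\<lambda>x. ennreal (cost w r x)) \<in> borel_measurable borel"
        using measurable_compose[OF measurable_Pair1'[of r borel borel] cost_path[OF w(1)]] by simp
      then have "(\<integral>\<^sup>+x. F1 (r, x) \<partial>atom_law (\<nu> w) r) = ennreal (gp e w r) * ennreal (Wl w r - z w r)"
        unfolding \<beta>_atom(2)[OF w(1) r Wl, symmetric] F1_def by (subst nn_integral_cmult[symmetric]) (simp_all add: ind)
      then have "(\<integral>\<^sup>+x. F1 (r, x) \<partial>atom_law (\<nu> w) r) + T r = ennreal (1 / (e + z w r) - 1 / (e + Wl w r))"
        unfolding u_decompose(2)[OF w e r Wl, symmetric] T_def ind
        using gx[OF r] gp_nonneg[OF e] z_bounds(2)[OF w(1), of r] by (simp add: ennreal_mult[symmetric] ennreal_plus[symmetric] del: ennreal_plus)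
      also have "\<dots> \<le> (\<integral>\<^sup>+x. ennreal (1 / (e + z w r) - 1 / (e + z w r + l1 x)) \<partial>atom_law (\<nu> w) r)"
        using jump_law.invested_growth[OF zeta_spec(1)[OF w(1) Wl] zeta_spec(2)[OF w(1) Wl] e, of r] Wl by (simp add: z_def)
      also have "\<dots> = (\<integral>\<^sup>+x. F2 (r, x) \<partial>atom_law (\<nu> w) r)"
        using Wl ind by (simp add: F2_def u_def)
      finally show ?thesis .
    qed
  qed
  also have "(\<integral>\<^sup>+q. indicator (- ?D) (fst q) * F1 q \<partial>\<nu> w) \<le> (\<integral>\<^sup>+q. indicator (- ?D) (fst q) * F2 q \<partial>\<nu> w)"
    using AE_W_eq_Wl[OF w]
  proof (intro nn_integral_mono_AE, eventually_elim)
    fix q :: "real \<times> (real^'n)"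
    assume q: "emeasure (G w) {fst q} = 0 \<longrightarrow> 0 < Wl w (fst q) \<longrightarrow> W w (fst q) = Wl w (fst q)"
    show "indicator (- ?D) (fst q) * F1 q \<le> indicator (- ?D) (fst q) * F2 q"
    proof (cases "fst q \<notin> ?D \<and> fst q \<in> {s<..t} \<and> 0 < Wl w (fst q)")
      case True
      let ?wl = "Wl w (fst q)" and ?x = "l1 (snd q)"
      have wl: "0 < ?wl" "W w (fst q) = ?wl" "z w (fst q) = ?wl" using True q z_no_atom[OF w(1)] by auto
      \<comment> \<open>This excess has the form of the drift \<open>d\<close> of the
        quasi-continuous case.\<close>
      have eq: "u e w (fst q) ?x - gp e w (fst q) * cost w (fst q) (snd q) = e * ?x\<^sup>2 / ((e + ?wl)\<^sup>2 * (?wl + ?x) * (e + ?wl + ?x))"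
      proof -
        have nz: "e + ?wl \<noteq> 0" "?wl + ?x \<noteq> 0" "e + ?wl + ?x \<noteq> 0" using e wl(1) l1_nonneg[of "snd q"] by linarith+
        then show ?thesis unfolding u_def gp_def cost_def wl using wl(1) by (simp add: divide_simps power2_eq_square) (simp add: algebra_simps)
      qed
      have "0 \<le> e * ?x\<^sup>2 / ((e + ?wl)\<^sup>2 * (?wl + ?x) * (e + ?wl + ?x))" using e wl(1) by (intro divide_nonneg_nonneg mult_nonneg_nonneg) auto
      then have "ennreal (gp e w (fst q)) * ennreal (cost w (fst q) (snd q)) \<le> ennreal (u e w (fst q) ?x)"
        using gp_nonneg[OF e] cost_nonneg[OF w(1)] eq by (subst ennreal_mult[symmetric]) (auto intro!: ennreal_leI)
      then show ?thesis using True by (simp add: F1_def F2_def)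
    next
      case False
      then show ?thesis by (auto simp: F1_def gp_def split: split_indicator)
    qed
  qed
  also have "ennreal (1 / (e + W w s)) + ((\<integral>\<^sup>+q. indicator (- ?D) (fst q) * F2 q \<partial>\<nu> w) + (\<integral>\<^sup>+r. (\<integral>\<^sup>+x. F2 (r, x) \<partial>atom_law (\<nu> w) r) \<partial>count_space {0<..})) =
      ennreal (1 / (e + W w s)) + (\<integral>\<^sup>+q. F2 q \<partial>\<nu> w)" unfolding split[OF F2m] ..
  finally show ?thesis by (simp add: F2_def add_left_mono)
qed

text \<open>The product of \<open>gp\<close> and \<open>cost\<close> when W, its left limit and z
  agree, as they do \<nu>-almost everywhere without atoms of G and with positive wealth.\<close>

definition u1 :: "real \<Rightarrow> 'a \<Rightarrow> real \<Rightarrow> real \<Rightarrow> real" where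
  "u1 e w s a = (if 0 < Wl w s then Wl w s * a / ((e + Wl w s)\<^sup>2 * (Wl w s + a)) else 0)"

text \<open>Without atoms the correction term is 0 and W agrees with its left limit \<nu>-almost
  everywhere; positivity of the wealth makes the pathwise balance an equality.\<close>

lemma reciprocal_wealth_quasi_continuous:
  assumes w: "w \<in> space M" "good w" and e: "e > 0" and st: "0 \<le> s" "s \<le> t"
    and noatom: "\<And>r. r > 0 \<Longrightarrow> emeasure (G w) {r} = 0" and pos: "\<And>r. 0 < r \<Longrightarrow> 0 < Wl w r"
  shows "ennreal (1 / (e + W w t)) + (\<integral>\<^sup>+r. indicator {s<..t} r * ennreal (u e w r (xl w r (jump X w r))) \<partial>count_space {0<..})
     = ennreal (1 / (e + W w s)) + (\<integral>\<^sup>+q. indicator {s<..t} (fst q) * ennreal (u1 e w (fst q) (l1 (snd q))) \<partial>\<nu> w)"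
proof -
  have "(\<integral>\<^sup>+r. indicator {s<..t} r * ennreal (u e w r (xl w r (jump X w r))) \<partial>count_space {0<..}) =
      (\<integral>\<^sup>+r. indicator {s<..t} r * ennreal (gp e w r) * ennreal (xl w r (jump X w r)) \<partial>count_space {0<..})"
  proof (intro nn_integral_cong)
    fix r :: real assume "r \<in> space (count_space {0<..})"
    then have r: "r > 0" by simp
    show "indicator {s<..t} r * ennreal (u e w r (xl w r (jump X w r))) = indicator {s<..t} r * ennreal (gp e w r) * ennreal (xl w r (jump X w r))"
      unfolding u_decompose(1)[OF w e r] z_no_atom[OF w(1) noatom[OF r]] using gp_nonneg[OF e] xl_bounds(1)[OF jump_nonneg[OF w(1) r]]
      by (simp add: ennreal_mult mult.assoc)
  qed
  moreover have "(\<integral>\<^sup>+q. indicator {s<..t} (fst q) * ennreal (gp e w (fst q)) * ennreal (cost w (fst q) (snd q)) \<partial>\<nu> w) =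
      (\<integral>\<^sup>+q. indicator {s<..t} (fst q) * ennreal (u1 e w (fst q) (l1 (snd q))) \<partial>\<nu> w)"
    using AE_W_eq_Wl[OF w] AE_nu[OF w(1)]
  proof (intro nn_integral_cong_AE, eventually_elim)
    fix q :: "real \<times> (real^'n)"
    assume q: "emeasure (G w) {fst q} = 0 \<longrightarrow> 0 < Wl w (fst q) \<longrightarrow> W w (fst q) = Wl w (fst q)"
      and p: "0 < fst q \<and> snd q \<in> nonneg_vecs \<and> snd q \<noteq> 0"
    have wl: "W w (fst q) = Wl w (fst q)" "z w (fst q) = Wl w (fst q)" "0 < Wl w (fst q)"
      using q p noatom[of "fst q"] pos[of "fst q"] z_no_atom[OF w(1), of "fst q"] by auto
    have "gp e w (fst q) * cost w (fst q) (snd q) = u1 e w (fst q) (l1 (snd q))"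
      using wl by (simp add: gp_def cost_def u1_def power2_eq_square)
    then show "indicator {s<..t} (fst q) * ennreal (gp e w (fst q)) * ennreal (cost w (fst q) (snd q)) = indicator {s<..t} (fst q) * ennreal (u1 e w (fst q) (l1 (snd q)))"
      using gp_nonneg[OF e, of w "fst q"] cost_nonneg[OF w(1), of "fst q" "snd q"] by (simp add: mult.assoc ennreal_mult[symmetric])
  qed
  ultimately show ?thesis using reciprocal_wealth(3)[OF w e st] pos st by simp
qed

end

lemma ennreal_add_cancel: "a + c \<le> b + c \<Longrightarrow> c < \<infinity> \<Longrightarrow> a \<le> b" for a b c :: ennreal
  by (auto simp: add.commute[of _ c] ennreal_add_left_cancel_le)

text \<open>The set ends before the mass exceeds k, and it is exhausted by intervals (0,r] with r in
  the set. Hence there is no overshoot by a final atom, as there would be at a first passage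
  time.\<close>

lemma emeasure_localised:
  assumes [simp]: "sets m = sets (borel :: real measure)"
  shows "{r. 0 < r \<and> emeasure m {0<..r} \<le> k} \<in> sets borel"
    and "emeasure m {r. 0 < r \<and> emeasure m {0<..r} \<le> k} \<le> k"
proof -
  let ?S = "{r. 0 < r \<and> emeasure m {0<..r} \<le> k}"
  have le: "?S \<inter> {0<..T} \<in> sets borel \<and> emeasure m (?S \<inter> {0<..T}) \<le> k" for T
  proof (cases "?S \<inter> {0<..T} = {}")
    case False
    have down: "r' \<in> ?S \<inter> {0<..T}" if "r \<in> ?S \<inter> {0<..T}" "0 < r'" "r' \<le> r" for r r'
    proof -
      have "emeasure m {0<..r'} \<le> emeasure m {0<..r}" using that by (intro emeasure_mono) auto
      then show ?thesis using that by auto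
    qed
    obtain r where r: "incseq r" "\<And>n. r n \<in> ?S \<inter> {0<..T}" "?S \<inter> {0<..T} = (\<Union>n. {0<..r n})"
      by (rule downclosed_exhaust[OF _ down False]) auto
    have "emeasure m (?S \<inter> {0<..T}) = (SUP n. emeasure m {0<..r n})"
      unfolding r(3) using r(1) by (intro SUP_emeasure_incseq[symmetric]) (auto simp: incseq_def, meson order_trans)
    also have "\<dots> \<le> k" using r(2) by (intro SUP_least) auto
    finally show ?thesis unfolding r(3) by auto
  qed simp
  have U: "?S = (\<Union>T. ?S \<inter> {0<..real T})"
  proof (intro equalityI subsetI)
    fix x assume "x \<in> ?S"
    moreover obtain n where "x \<le> real n" using real_arch_simple by blast
    ultimately show "x \<in> (\<Union>T. ?S \<inter> {0<..real T})" by auto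
  qed auto
  have "(\<Union>T. ?S \<inter> {0<..real T}) \<in> sets borel" using le by blast
  then show "?S \<in> sets borel" using U by simp
  have "emeasure m ?S = emeasure m (\<Union>T. ?S \<inter> {0<..real T})" using U by simp
  also have "\<dots> = (SUP T. emeasure m (?S \<inter> {0<..real T}))"
    using le by (intro SUP_emeasure_incseq[symmetric]) (auto simp: incseq_def)
  also have "\<dots> \<le> k" using le by (intro SUP_least) auto
  finally show "emeasure m ?S \<le> k" .
qed

section \<open>Means of compensated jumps on predictable sets\<close>

context payoff_characteristics
begin

lemma A_mono: "r \<le> r' \<Longrightarrow> A w r \<le> A w r'"
  unfolding A_def by (intro nn_integral_mono) (auto split: split_indicator)

lemma A_predictable [measurable]: "(\<lambda>p. A (fst p) (snd p)) \<in> borel_measurable (pred_sigma M F)"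
proof -
  have "(\<lambda>q. ennreal (min 1 (l1 (snd q)))) \<in> borel_measurable (pred_sigma M F \<Otimes>\<^sub>M borel)" by measurable
  from nu_measurable(2)[OF this] show ?thesis
    by (simp add: A_def indicator_def of_bool_def mem_Times_iff)
qed

text \<open>The defining identity of the compensator, with the jump measure written as a sum over
  all positive times: an integrand that vanishes at jump size 0 sees only the actual jumps.\<close>

lemma mean_compensation:
  fixes f :: "('a \<times> real) \<times> (real^'n) \<Rightarrow> ennreal"
  assumes f: "f \<in> borel_measurable (pred_sigma M F \<Otimes>\<^sub>M borel)" and zero: "\<And>p. f (p, 0) = 0"
  shows "(\<integral>\<^sup>+w. (\<integral>\<^sup>+r. f ((w, r), jump X w r) \<partial>count_space {0<..}) \<partial>M) =
    (\<integral>\<^sup>+w. (\<integral>\<^sup>+q. indicator {0<..} (fst q) * f ((w, fst q), snd q) \<partial>\<nu> w) \<partial>M)"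
proof -
  have "(\<integral>\<^sup>+w. (\<integral>\<^sup>+r. f ((w, r), jump X w r) \<partial>count_space {0<..}) \<partial>M) =
      (\<integral>\<^sup>+w. (\<integral>\<^sup>+q. indicator {0<..} (fst q) * f ((w, fst q), snd q) \<partial>jump_measure X w) \<partial>M)"
  proof (rule nn_integral_cong)
    fix w assume w: "w \<in> space M"
    have m: "(\<lambda>q. indicator {0<..} (fst q) * f ((w, max 0 (fst q)), snd q)) \<in> borel_measurable borel"
      using nu_measurable(4)[OF f w] unfolding borel_prod[symmetric] by measurable
    have "(\<integral>\<^sup>+q. indicator {0<..} (fst q) * f ((w, fst q), snd q) \<partial>jump_measure X w) =
      (\<integral>\<^sup>+q. indicator {0<..} (fst q) * f ((w, max 0 (fst q)), snd q) \<partial>jump_measure X w)"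
      by (intro nn_integral_cong) (auto split: split_indicator)
    also have "\<dots> = (\<integral>\<^sup>+s. indicator {0<..} s * f ((w, max 0 s), jump X w s) \<partial>count_space {s. 0 < s \<and> jump X w s \<noteq> 0})"
      by (subst jump_measure_integral[OF m]) simp
    also have "\<dots> = (\<integral>\<^sup>+s. f ((w, s), jump X w s) \<partial>count_space {s. 0 < s \<and> jump X w s \<noteq> 0})"
      by (intro nn_integral_cong) auto
    also have "\<dots> = (\<integral>\<^sup>+r. f ((w, r), jump X w r) \<partial>count_space {0<..})"
      by (intro nn_integral_count_space_eq') (auto simp: zero)
    finally show "(\<integral>\<^sup>+r. f ((w, r), jump X w r) \<partial>count_space {0<..}) = (\<integral>\<^sup>+q. indicator {0<..} (fst q) * f ((w, fst q), snd q) \<partial>jump_measure X w)" ..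
  qed
  also have "\<dots> = (\<integral>\<^sup>+w. (\<integral>\<^sup>+q. indicator {0<..} (fst q) * f ((w, fst q), snd q) \<partial>\<nu> w) \<partial>M)"
    using nu_comp f by (auto simp: compensator_def)
  finally show ?thesis .
qed

text \<open>Collects the integrals of f over sets of times into a measure on the time axis. Together
  with \<open>jump_time\<close> it brings the pathwise balance into the form that can be stopped at
  a down-closed set.\<close>

definition nu_time :: "'a \<Rightarrow> (real \<times> (real^'n) \<Rightarrow> ennreal) \<Rightarrow> real measure" where
  "nu_time w f = distr (density (\<nu> w) f) borel fst"

lemma emeasure_nu_time:
  assumes w: "w \<in> space M" and f: "f \<in> borel_measurable (borel \<Otimes>\<^sub>M borel)" and B: "B \<in> sets borel"
  shows "emeasure (nu_time w f) B = (\<integral>\<^sup>+q. indicator B (fst q) * f q \<partial>\<nu> w)"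
proof -
  have [simp, measurable_cong]: "sets (\<nu> w) = sets (borel \<Otimes>\<^sub>M borel)" unfolding borel_prod by (rule sets_nu[OF w])
  have [measurable]: "f \<in> borel_measurable (\<nu> w)" "B \<in> sets borel" using f B by simp_all
  have "emeasure (nu_time w f) B = (\<integral>\<^sup>+s. indicator B s \<partial>nu_time w f)" using B by (simp add: nu_time_def)
  also have "\<dots> = (\<integral>\<^sup>+q. indicator B (fst q) \<partial>density (\<nu> w) f)"
    unfolding nu_time_def by (rule nn_integral_distr) measurable
  also have "\<dots> = (\<integral>\<^sup>+q. indicator B (fst q) * f q \<partial>\<nu> w)"
    by (subst nn_integral_density) (auto simp: mult.commute)
  finally show ?thesis .
qed

lemma sets_nu_time [simp]: "sets (nu_time w f) = sets borel" by (simp add: nu_time_def)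

definition jump_time :: "(real \<Rightarrow> ennreal) \<Rightarrow> real measure" where
  "jump_time f = distr (density (count_space {0<..}) f) borel (\<lambda>r. r)"

lemma emeasure_jump_time:
  assumes B: "B \<in> sets borel"
  shows "emeasure (jump_time f) B = (\<integral>\<^sup>+r. indicator B r * f r \<partial>count_space {0<..})"
proof -
  have "emeasure (jump_time f) B = (\<integral>\<^sup>+s. indicator B s \<partial>jump_time f)" using B by (simp add: jump_time_def)
  also have "\<dots> = (\<integral>\<^sup>+r. indicator B r \<partial>density (count_space {0<..}) f)"
    unfolding jump_time_def
  proof (rule nn_integral_distr)
    show "(\<lambda>r. r) \<in> measurable (density (count_space {0<..}) f) borel" by (simp add: measurable_def)
    show "indicator B \<in> borel_measurable (distr (density (count_space {0<..}) f) borel (\<lambda>r. r))" using B by simp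
  qed
  also have "\<dots> = (\<integral>\<^sup>+r. indicator B r * f r \<partial>count_space {0<..})"
    by (subst nn_integral_density) (auto simp: mult.commute)
  finally show ?thesis .
qed

lemma sets_jump_time [simp]: "sets (jump_time f) = sets borel" by (simp add: jump_time_def)

lemma localised_bound:
  assumes w: "w \<in> space M" and f: "f \<in> borel_measurable (borel \<Otimes>\<^sub>M borel)"
  shows "{r. 0 < r \<and> (\<integral>\<^sup>+q. indicator {0<..r} (fst q) * f q \<partial>\<nu> w) \<le> k} \<in> sets borel"
    and "(\<integral>\<^sup>+q. indicator {r. 0 < r \<and> (\<integral>\<^sup>+q. indicator {0<..r} (fst q) * f q \<partial>\<nu> w) \<le> k} (fst q) * f q \<partial>\<nu> w) \<le> k"
  using emeasure_localised[OF sets_nu_time, of w f k]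
  by (simp_all add: emeasure_nu_time[OF w f])

lemma A_eq: "A w r = (\<integral>\<^sup>+q. indicator {0<..r} (fst q) * ennreal (min 1 (l1 (snd q))) \<partial>\<nu> w)"
  unfolding A_def by (intro nn_integral_cong) (auto split: split_indicator)

end

context wealth
begin

lemma u_predictable:
  "(\<lambda>q. ennreal (u e (fst (fst q)) (snd (fst q)) (xl (fst (fst q)) (snd (fst q)) (snd q)))) \<in> borel_measurable (pred_sigma M F \<Otimes>\<^sub>M borel)"
  "(\<lambda>q. ennreal (u e (fst (fst q)) (snd (fst q)) (l1 (snd q)))) \<in> borel_measurable (pred_sigma M F \<Otimes>\<^sub>M borel)"
proof -
  have [measurable]: "(\<lambda>q. Wl (fst (fst q)) (snd (fst q))) \<in> borel_measurable (pred_sigma M F \<Otimes>\<^sub>M (borel :: (real^'n) measure))"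
    using measurable_compose[OF measurable_fst Wl_pred] .
  have [measurable]: "(\<lambda>q. z (fst (fst q)) (snd (fst q))) \<in> borel_measurable (pred_sigma M F \<Otimes>\<^sub>M (borel :: (real^'n) measure))"
    using measurable_compose[OF measurable_fst z_predictable] .
  have [measurable]: "Measurable.pred (pred_sigma M F \<Otimes>\<^sub>M (borel :: (real^'n) measure)) (\<lambda>q. active n (fst (fst q)) (snd (fst q)))" for n
    using measurable_compose[OF measurable_fst active_pred] .
  have [measurable]: "(\<lambda>q. (snd q :: real^'n) $ n) \<in> borel_measurable (pred_sigma M F \<Otimes>\<^sub>M borel)" for n
    using measurable_compose[OF measurable_snd borel_measurable_nth] .
  show "(\<lambda>q. ennreal (u e (fst (fst q)) (snd (fst q)) (xl (fst (fst q)) (snd (fst q)) (snd q)))) \<in> borel_measurable (pred_sigma M F \<Otimes>\<^sub>M borel)"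
    unfolding u_def xl_def by measurable
  show "(\<lambda>q. ennreal (u e (fst (fst q)) (snd (fst q)) (l1 (snd q)))) \<in> borel_measurable (pred_sigma M F \<Otimes>\<^sub>M borel)"
    unfolding u_def by measurable
qed

text \<open>Where it is nonzero, u is |x|/((e + z)(e + z + |x|)), which is at most |x|/e^2 and at
  most 1/e.\<close>

lemma u_bound:
  assumes w: "w \<in> space M" and e: "0 < e"
  shows "u e w s (l1 x) \<le> max (1 / e) (1 / e\<^sup>2) * min 1 (l1 x)"
proof (cases "0 < Wl w s")
  case True
  have z: "0 \<le> z w s" by (rule z_bounds(1)[OF w])
  have eq: "u e w s (l1 x) = l1 x / ((e + z w s) * (e + z w s + l1 x))"
    using True e z l1_nonneg[of x] by (simp add: u_def divide_simps add_pos_nonneg add_nonneg_eq_0_iff)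
  show ?thesis
  proof (cases "l1 x \<le> 1")
    case True
    have "l1 x / ((e + z w s) * (e + z w s + l1 x)) \<le> l1 x / (e * e)"
      using e z by (intro divide_left_mono mult_mono mult_pos_pos) (auto simp: add_pos_nonneg)
    also have "\<dots> = 1 / e\<^sup>2 * l1 x" by (simp add: power2_eq_square)
    also have "\<dots> \<le> max (1 / e) (1 / e\<^sup>2) * l1 x" by (intro mult_right_mono) auto
    finally show ?thesis using True by (simp add: eq)
  next
    case False
    have "l1 x / ((e + z w s) * (e + z w s + l1 x)) \<le> l1 x / (e * l1 x)"
      using e z False by (intro divide_left_mono mult_mono mult_pos_pos) (auto simp: add_pos_nonneg)
    also have "\<dots> = 1 / e"
    proof -
      have "l1 x \<noteq> 0" using False by linarith
      then show ?thesis by simp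
    qed
    finally show ?thesis using False by (simp add: eq)
  qed
qed (use e l1_nonneg[of x] in \<open>simp add: u_def le_max_iff_disj\<close>)

text \<open>Under \<nu> inactive assets pay nothing while the wealth is positive, so
  \<open>xl\<close> becomes |x| as soon as the jumps are compensated. Finiteness follows from A
  \<le> k on P and the bound for \<open>u\<close>.\<close>

lemma mean_u:
  assumes e: "e > 0" and P[measurable]: "Measurable.pred (pred_sigma M F) P"
    and P_le: "\<forall>w\<in>space M. \<forall>r. P (w, r) \<longrightarrow> 0 < r \<and> A w r \<le> ennreal k"
  shows "(\<integral>\<^sup>+w. (\<integral>\<^sup>+r. (if P (w, r) then ennreal (u e w r (xl w r (jump X w r))) else 0) \<partial>count_space {0<..}) \<partial>M) =
      (\<integral>\<^sup>+w. (\<integral>\<^sup>+q. (if P (w, fst q) then ennreal (u e w (fst q) (l1 (snd q))) else 0) \<partial>\<nu> w) \<partial>M)"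
    and "(\<integral>\<^sup>+w. (\<integral>\<^sup>+q. (if P (w, fst q) then ennreal (u e w (fst q) (l1 (snd q))) else 0) \<partial>\<nu> w) \<partial>M) < \<infinity>"
    and "(\<lambda>w. \<integral>\<^sup>+q. (if P (w, fst q) then ennreal (u e w (fst q) (l1 (snd q))) else 0) \<partial>\<nu> w) \<in> borel_measurable M"
proof -
  interpret prob_space M by (rule prob)
  have k: "\<And>w r. w \<in> space M \<Longrightarrow> P (w, r) \<Longrightarrow> 0 < r \<and> A w r \<le> ennreal k" using P_le by auto
  have [measurable]: "Measurable.pred (pred_sigma M F \<Otimes>\<^sub>M (borel :: (real^'n) measure)) (\<lambda>q. P (fst q))"
    using measurable_compose[OF measurable_fst P] .
  have fx: "(\<lambda>q. if P (fst q) then ennreal (u e (fst (fst q)) (snd (fst q)) (xl (fst (fst q)) (snd (fst q)) (snd q))) else 0) \<in> borel_measurable (pred_sigma M F \<Otimes>\<^sub>M borel)"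
    using u_predictable(1)[of e] by measurable
  have fl: "(\<lambda>q. if P (fst q) then ennreal (u e (fst (fst q)) (snd (fst q)) (l1 (snd q))) else 0) \<in> borel_measurable (pred_sigma M F \<Otimes>\<^sub>M borel)"
    using u_predictable(2)[of e] by measurable
  have pos: "indicator {0<..} (fst q) * (if P (w, fst q) then a else 0) = (if P (w, fst q) then a else 0 :: ennreal)"
    if "w \<in> space M" for w q a using k[OF that] by auto
  show m: "(\<lambda>w. \<integral>\<^sup>+q. (if P (w, fst q) then ennreal (u e w (fst q) (l1 (snd q))) else 0) \<partial>\<nu> w) \<in> borel_measurable M"
    using nu_measurable(3)[OF fl] by (rule measurable_cong[THEN iffD1, rotated]) (simp add: pos cong: if_cong)
  have "(\<integral>\<^sup>+w. (\<integral>\<^sup>+r. (if P (w, r) then ennreal (u e w r (xl w r (jump X w r))) else 0) \<partial>count_space {0<..}) \<partial>M) =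
      (\<integral>\<^sup>+w. (\<integral>\<^sup>+q. indicator {0<..} (fst q) * (if P (w, fst q) then ennreal (u e w (fst q) (xl w (fst q) (snd q))) else 0) \<partial>\<nu> w) \<partial>M)"
    using mean_compensation[OF fx] by (simp cong: if_cong)
  also have "\<dots> = (\<integral>\<^sup>+w. (\<integral>\<^sup>+q. (if P (w, fst q) then ennreal (u e w (fst q) (l1 (snd q))) else 0) \<partial>\<nu> w) \<partial>M)"
  proof (rule nn_integral_cong_AE, rule AE_mp[OF AE_good], rule AE_I2, rule impI)
    fix w assume w: "w \<in> space M" "good w"
    have "AE q in \<nu> w. \<forall>n\<in>UNIV. 0 < Wl w (fst q) \<longrightarrow> \<not> active n w (fst q) \<longrightarrow> snd q $ n = 0"
      by (rule AE_finite_allI) (use w(2) in \<open>auto simp: good_def\<close>)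
    then show "(\<integral>\<^sup>+q. indicator {0<..} (fst q) * (if P (w, fst q) then ennreal (u e w (fst q) (xl w (fst q) (snd q))) else 0) \<partial>\<nu> w) =
       (\<integral>\<^sup>+q. (if P (w, fst q) then ennreal (u e w (fst q) (l1 (snd q))) else 0) \<partial>\<nu> w)"
      using AE_nu[OF w(1)]
    proof (intro nn_integral_cong_AE, eventually_elim)
      fix q :: "real \<times> (real^'n)"
      assume q: "\<forall>n\<in>UNIV. 0 < Wl w (fst q) \<longrightarrow> \<not> active n w (fst q) \<longrightarrow> snd q $ n = 0" "0 < fst q \<and> snd q \<in> nonneg_vecs \<and> snd q \<noteq> 0"
      have "u e w (fst q) (xl w (fst q) (snd q)) = u e w (fst q) (l1 (snd q))"
      proof (cases "0 < Wl w (fst q)")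
        case True
        then have "xl w (fst q) (snd q) = l1 (snd q)"
          using q unfolding xl_def by (subst l1_nonneg_vec) (auto intro!: sum.cong)
        then show ?thesis by simp
      qed (simp add: u_def)
      then show "indicator {0<..} (fst q) * (if P (w, fst q) then ennreal (u e w (fst q) (xl w (fst q) (snd q))) else 0) = (if P (w, fst q) then ennreal (u e w (fst q) (l1 (snd q))) else 0)"
        using q by simp
    qed
  qed
  finally show "(\<integral>\<^sup>+w. (\<integral>\<^sup>+r. (if P (w, r) then ennreal (u e w r (xl w r (jump X w r))) else 0) \<partial>count_space {0<..}) \<partial>M) =
      (\<integral>\<^sup>+w. (\<integral>\<^sup>+q. (if P (w, fst q) then ennreal (u e w (fst q) (l1 (snd q))) else 0) \<partial>\<nu> w) \<partial>M)" .
  let ?c = "ennreal (max (1 / e) (1 / e\<^sup>2))"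
  have "(\<integral>\<^sup>+w. (\<integral>\<^sup>+q. (if P (w, fst q) then ennreal (u e w (fst q) (l1 (snd q))) else 0) \<partial>\<nu> w) \<partial>M) \<le> (\<integral>\<^sup>+w. ?c * ennreal k \<partial>M)"
  proof (intro nn_integral_mono)
    fix w assume w: "w \<in> space M"
    have [simp, measurable_cong]: "sets (\<nu> w) = sets (borel \<Otimes>\<^sub>M borel)" unfolding borel_prod by (rule sets_nu[OF w])
    have fm: "(\<lambda>q. ennreal (min 1 (l1 (snd q)))) \<in> borel_measurable (borel \<Otimes>\<^sub>M (borel :: (real^'n) measure))" by measurable
    note loc = localised_bound[OF w fm, of "ennreal k", folded A_eq]
    note [measurable] = loc(1)
    have "(\<integral>\<^sup>+q. (if P (w, fst q) then ennreal (u e w (fst q) (l1 (snd q))) else 0) \<partial>\<nu> w) \<le>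
      (\<integral>\<^sup>+q. ?c * (indicator {r. 0 < r \<and> A w r \<le> ennreal k} (fst q) * ennreal (min 1 (l1 (snd q)))) \<partial>\<nu> w)"
    proof (intro nn_integral_mono)
      fix q :: "real \<times> (real^'n)"
      show "(if P (w, fst q) then ennreal (u e w (fst q) (l1 (snd q))) else 0) \<le> ?c * (indicator {r. 0 < r \<and> A w r \<le> ennreal k} (fst q) * ennreal (min 1 (l1 (snd q))))"
      proof (cases "P (w, fst q)")
        case True
        have "ennreal (u e w (fst q) (l1 (snd q))) \<le> ?c * ennreal (min 1 (l1 (snd q)))"
          using u_bound[OF w e] e by (subst ennreal_mult[symmetric]) (auto simp: le_max_iff_disj intro!: ennreal_leI)
        then show ?thesis using True k[OF w True] by simp
      qed simp
    qed
    also have "\<dots> = ?c * (\<integral>\<^sup>+q. indicator {r. 0 < r \<and> A w r \<le> ennreal k} (fst q) * ennreal (min 1 (l1 (snd q))) \<partial>\<nu> w)"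
      by (rule nn_integral_cmult) measurable
    also have "\<dots> \<le> ?c * ennreal k" by (intro mult_left_mono loc(2)) auto
    finally show "(\<integral>\<^sup>+q. (if P (w, fst q) then ennreal (u e w (fst q) (l1 (snd q))) else 0) \<partial>\<nu> w) \<le> ?c * ennreal k" .
  qed
  also have "\<dots> < \<infinity>" by (simp add: emeasure_space_1 ennreal_mult_less_top)
  finally show "(\<integral>\<^sup>+w. (\<integral>\<^sup>+q. (if P (w, fst q) then ennreal (u e w (fst q) (l1 (snd q))) else 0) \<partial>\<nu> w) \<partial>M) < \<infinity>" .
qed

lemma W_measurable: "t \<ge> 0 \<Longrightarrow> (\<lambda>w. W w t) \<in> borel_measurable (F t)"
  unfolding W_def using Y_adapted by (intro measurable_compose[OF _ borel_measurable_l1]) (auto simp: adapted_def)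

lemma W_measurable_M [measurable]: "t \<ge> 0 \<Longrightarrow> (\<lambda>w. W w t) \<in> borel_measurable M"
  using filtrationD(4)[OF filt _ W_measurable] .

lemma A_measurable_M [measurable]: "t \<ge> 0 \<Longrightarrow> (\<lambda>w. A w t) \<in> borel_measurable M"
  using filtrationD(4)[OF filt _ measurable_compose[OF measurable_time_section[OF filt] A_predictable]] by simp

text \<open>The pathwise inequality is stopped at {A \<le> k} and restricted to Q; both restrictions
  are encoded in the predictable set P. In the mean the jump sum and its compensator are equal and
  finite, hence cancel. The jump sum is separated by superadditivity, its measurability being
  unknown.\<close>

lemma mean_reciprocal_localised:
  assumes e: "e > 0" and st: "0 \<le> s" "s \<le> t" and Q: "Q \<in> sets (F s)"
  shows "(\<integral>\<^sup>+w. indicator Q w * (indicator {r. A w r \<le> ennreal k} t * ennreal (1 / (e + W w t))) \<partial>M) \<le> (\<integral>\<^sup>+w. indicator Q w * ennreal (1 / (e + W w s)) \<partial>M)"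
proof -
  interpret prob_space M by (rule prob)
  have t0: "t \<ge> 0" using st by simp
  have QM[measurable]: "Q \<in> sets M" using filtrationD(2)[OF filt st(1)] Q by auto
  have [measurable]: "(\<lambda>w. W w s) \<in> borel_measurable M" "(\<lambda>w. W w t) \<in> borel_measurable M" "(\<lambda>w. A w t) \<in> borel_measurable M"
    using W_measurable_M[OF st(1)] W_measurable_M[OF t0] A_measurable_M[OF t0] by auto
  define P where "P p \<longleftrightarrow> fst p \<in> Q \<and> s < snd p \<and> snd p \<le> t \<and> A (fst p) (snd p) \<le> ennreal k" for p
  have rect: "(\<lambda>p. indicator Q (fst p) * indicator {s<..t} (snd p) :: real) \<in> borel_measurable (pred_sigma M F)"
    by (rule predictable_rectangle[OF filt st(1) Q])
  have "Measurable.pred (pred_sigma M F) (\<lambda>p. indicator Q (fst p) * indicator {s<..t} (snd p) = (1::real) \<and> A (fst p) (snd p) \<le> ennreal k)"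
    using rect by measurable
  also have "(\<lambda>p. indicator Q (fst p) * indicator {s<..t} (snd p) = (1::real) \<and> A (fst p) (snd p) \<le> ennreal k) = P"
    by (auto simp: P_def fun_eq_iff split: split_indicator)
  finally have P: "Measurable.pred (pred_sigma M F) P" .
  have Pk: "\<forall>w\<in>space M. \<forall>r. P (w, r) \<longrightarrow> 0 < r \<and> A w r \<le> ennreal k" using st by (auto simp: P_def)
  let ?J = "\<lambda>w. \<integral>\<^sup>+r. (if P (w, r) then ennreal (u e w r (xl w r (jump X w r))) else 0) \<partial>count_space {0<..}"
  let ?N = "\<lambda>w. \<integral>\<^sup>+q. (if P (w, fst q) then ennreal (u e w (fst q) (l1 (snd q))) else 0) \<partial>\<nu> w"
  note mu = mean_u[OF e P Pk]
  have path: "indicator Q w * (indicator {r. A w r \<le> ennreal k} t * ennreal (1 / (e + W w t))) + ?J w \<le> indicator Q w * ennreal (1 / (e + W w s)) + ?N w"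
    if w: "w \<in> space M" "good w" for w
  proof (cases "w \<in> Q")
    case False
    then show ?thesis by (simp add: P_def)
  next
    case True
    define S where "S = {r. A w r \<le> ennreal k}"
    have Am: "(\<lambda>r. A w (max 0 r)) \<in> borel_measurable borel"
      using measurable_compose[OF measurable_path_section[OF filt w(1)] A_predictable] by simp
    have "S \<inter> {s<..t} = {r. A w (max 0 r) \<le> ennreal k} \<inter> {s<..t}" using st by (auto simp: S_def)
    then have Sm: "S \<inter> {s<..t} \<in> sets borel" using Am by simp
    have um: "(\<lambda>q. ennreal (u e w (fst q) (l1 (snd q)))) \<in> borel_measurable (borel \<Otimes>\<^sub>M borel)" using u_path[OF w(1)] by measurable
    let ?m = "jump_time (\<lambda>r. ennreal (u e w r (xl w r (jump X w r))))"
    let ?n = "nu_time w (\<lambda>q. ennreal (u e w (fst q) (l1 (snd q))))"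
    have "indicator S t * ennreal (1 / (e + W w t)) + emeasure ?m (S \<inter> {s<..t}) \<le> ennreal (1 / (e + W w s)) + emeasure ?n (S \<inter> {s<..t})"
    proof (rule stop_downclosed)
      fix r assume r: "s \<le> r" "r \<le> t"
      show "ennreal (1 / (e + W w r)) + emeasure ?m {s<..r} \<le> ennreal (1 / (e + W w s)) + emeasure ?n {s<..r}"
        using reciprocal_wealth_compensated[OF w e st(1) r(1)] by (simp add: emeasure_jump_time emeasure_nu_time[OF w(1) um])
    next
      fix r r' assume "r \<in> S" "s < r'" "r' \<le> r"
      then show "r' \<in> S" using A_mono[of r' r w] by (auto simp: S_def)
    qed (use st in auto)
    moreover have "emeasure ?m (S \<inter> {s<..t}) = ?J w"
      unfolding emeasure_jump_time[OF Sm] using True by (intro nn_integral_cong) (auto simp: P_def S_def split: split_indicator)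
    moreover have "emeasure ?n (S \<inter> {s<..t}) = ?N w"
      unfolding emeasure_nu_time[OF w(1) um Sm] using True by (intro nn_integral_cong) (auto simp: P_def S_def split: split_indicator)
    ultimately show ?thesis using True by (simp add: S_def)
  qed
  have "(\<integral>\<^sup>+w. indicator Q w * (indicator {r. A w r \<le> ennreal k} t * ennreal (1 / (e + W w t))) \<partial>M) + (\<integral>\<^sup>+w. ?J w \<partial>M) \<le>
    (\<integral>\<^sup>+w. indicator Q w * (indicator {r. A w r \<le> ennreal k} t * ennreal (1 / (e + W w t))) + ?J w \<partial>M)"
    by (rule nn_integral_superadditive)
  also have "\<dots> \<le> (\<integral>\<^sup>+w. indicator Q w * ennreal (1 / (e + W w s)) + ?N w \<partial>M)"
    by (rule nn_integral_mono_AE, rule AE_mp[OF AE_good], rule AE_I2, rule impI) (rule path)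
  also have "\<dots> = (\<integral>\<^sup>+w. indicator Q w * ennreal (1 / (e + W w s)) \<partial>M) + (\<integral>\<^sup>+w. ?N w \<partial>M)"
    using mu(3) by (intro nn_integral_add) measurable
  finally show ?thesis using mu(2) unfolding mu(1) by (rule ennreal_add_cancel)
qed

end

text \<open>At wl = 0 both sides are \<infinity>, whereas the real quotient 1/wl would be 0. The
  extended inverse is therefore the one that detects zero wealth.\<close>

lemma inverse_ennreal_eq_SUP:
  assumes wl: "0 \<le> wl"
  shows "inverse (ennreal wl) = (SUP n. ennreal (1 / (1 / real (Suc n) + wl)))"
proof -
  have inc: "incseq (\<lambda>n. ennreal (1 / (1 / real (Suc n) + wl)))"
    using wl by (intro incseq_SucI ennreal_leI divide_left_mono add_mono mult_pos_pos add_pos_nonneg) (auto simp: frac_le)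
  have "(\<lambda>n. inverse (ennreal (1 / real (Suc n) + wl))) \<longlonglongrightarrow> inverse (ennreal wl)"
  proof (rule continuous_on_tendsto_compose[where s=UNIV and f=inverse])
    show "continuous_on UNIV (inverse :: ennreal \<Rightarrow> ennreal)" by (intro continuous_on_inverse_ennreal continuous_on_id)
    have "(\<lambda>n. 1 / real (Suc n) + wl) \<longlonglongrightarrow> 0 + wl"
      using LIMSEQ_inverse_real_of_nat by (intro tendsto_intros) (simp add: inverse_eq_divide)
    then show "(\<lambda>n. ennreal (1 / real (Suc n) + wl)) \<longlonglongrightarrow> ennreal wl" by (intro tendsto_ennrealI) simp
  qed auto
  also have "(\<lambda>n. inverse (ennreal (1 / real (Suc n) + wl))) = (\<lambda>n. ennreal (1 / (1 / real (Suc n) + wl)))"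
    using wl by (intro ext, subst inverse_ennreal) (auto simp: inverse_eq_divide intro: add_pos_nonneg)
  finally show ?thesis using LIMSEQ_SUP[OF inc] LIMSEQ_unique by blast
qed

text \<open>The inequality of integrals is tested on the set where the conditional expectation
  exceeds g, which belongs to N.\<close>

lemma (in prob_space) real_cond_exp_le:
  fixes f g :: "'a \<Rightarrow> real"
  assumes sub: "subalgebra M N" and f: "integrable M f" and g: "integrable M g" "g \<in> borel_measurable N"
    and le: "\<And>B. B \<in> sets N \<Longrightarrow> (LINT w:B|M. f w) \<le> (LINT w:B|M. g w)"
  shows "AE w in M. real_cond_exp M N f w \<le> g w"
proof -
  interpret finite_measure_subalgebra M N by standard (rule sub)
  let ?E = "real_cond_exp M N f"
  define B where "B = {w \<in> space M. g w < ?E w}"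
  have "B = {w \<in> space N. g w < ?E w}" using sub by (simp add: B_def subalgebra_def)
  then have B: "B \<in> sets N" using g(2) by simp
  then have BM[measurable]: "B \<in> sets M" using sub by (auto simp: subalgebra_def)
  have E: "integrable M ?E" by (rule real_cond_exp_int(1)[OF f])
  have int: "integrable M (\<lambda>w. indicator B w *\<^sub>R (?E w - g w))"
    by (intro integrable_mult_indicator BM Bochner_Integration.integrable_diff E g)
  have ints: "set_integrable M B ?E" "set_integrable M B g"
    unfolding set_integrable_def by (intro integrable_mult_indicator BM E g)+
  have "(LINT w|M. indicator B w *\<^sub>R (?E w - g w)) = (LINT w:B|M. ?E w) - (LINT w:B|M. g w)"
    using set_integral_diff(2)[OF ints] by (simp add: set_lebesgue_integral_def)
  also have "\<dots> \<le> 0" using le[OF B] real_cond_exp_intA[OF f B] by simp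
  finally have "(LINT w|M. indicator B w *\<^sub>R (?E w - g w)) \<le> 0" .
  moreover have nn: "AE w in M. 0 \<le> indicator B w *\<^sub>R (?E w - g w)" by (auto simp: B_def split: split_indicator)
  ultimately have "(LINT w|M. indicator B w *\<^sub>R (?E w - g w)) = 0" using integral_nonneg_AE[OF nn] by (intro antisym) auto
  then have "AE w in M. indicator B w *\<^sub>R (?E w - g w) = 0" using integral_nonneg_eq_0_iff_AE[OF int nn] by simp
  then show ?thesis using AE_space by eventually_elim (auto simp: B_def not_less split: split_indicator_asm)
qed

section \<open>Positivity of the wealth and the supermartingale property\<close>

context wealth
begin

text \<open>A is finite at t on every path, so the restriction A \<le> k disappears as k
  grows.\<close>

lemma localised_limit:
  assumes t: "t \<ge> 0" and f [measurable]: "f \<in> borel_measurable M"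
    and le: "\<And>k. (\<integral>\<^sup>+w. (if A w t \<le> ennreal (real k) then f w else 0) \<partial>M) \<le> c"
  shows "(\<integral>\<^sup>+w. f w \<partial>M) \<le> c"
proof -
  note [measurable] = A_measurable_M[OF t]
  let ?f = "\<lambda>k w. if A w t \<le> ennreal (real k) then f w else 0"
  have "(\<integral>\<^sup>+w. f w \<partial>M) = (\<integral>\<^sup>+w. (SUP k. ?f k w) \<partial>M)"
  proof (intro nn_integral_cong antisym)
    fix w assume w: "w \<in> space M"
    obtain a where a: "A w t = ennreal a" using A_finite[OF w, of t] by (cases "A w t") auto
    obtain k where "a \<le> real k" using real_arch_simple by blast
    then show "f w \<le> (SUP k. ?f k w)" using a by (intro SUP_upper2[of k]) (auto simp: ennreal_leI)
    show "(SUP k. ?f k w) \<le> f w" by (intro SUP_least) auto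
  qed
  also have "\<dots> = (SUP k. \<integral>\<^sup>+w. ?f k w \<partial>M)"
  proof (rule nn_integral_monotone_convergence_SUP)
    have "A w t \<le> ennreal (real (Suc k))" if "A w t \<le> ennreal (real k)" for w k
      using that by (rule order_trans) (auto intro!: ennreal_leI)
    then show "incseq ?f" by (intro incseq_SucI le_funI) auto
  qed measurable
  also have "\<dots> \<le> c" by (intro SUP_least le)
  finally show ?thesis .
qed

lemma mean_reciprocal:
  assumes e: "e > 0" and st: "0 \<le> s" "s \<le> t" and Q: "Q \<in> sets (F s)"
  shows "(\<integral>\<^sup>+w. indicator Q w * ennreal (1 / (e + W w t)) \<partial>M) \<le> (\<integral>\<^sup>+w. indicator Q w * ennreal (1 / (e + W w s)) \<partial>M)"
proof -
  have t0: "t \<ge> 0" using st by simp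
  have QM[measurable]: "Q \<in> sets M" using filtrationD(2)[OF filt st(1)] Q by auto
  have [measurable]: "(\<lambda>w. W w t) \<in> borel_measurable M" "(\<lambda>w. A w t) \<in> borel_measurable M"
    using W_measurable_M[OF t0] A_measurable_M[OF t0] by auto
  show ?thesis
  proof (rule localised_limit[OF t0])
    show "(\<integral>\<^sup>+w. (if A w t \<le> ennreal (real k) then indicator Q w * ennreal (1 / (e + W w t)) else 0) \<partial>M)
      \<le> (\<integral>\<^sup>+w. indicator Q w * ennreal (1 / (e + W w s)) \<partial>M)" for k
      by (rule order_trans[OF _ mean_reciprocal_localised[OF e st Q, of "real k"]], rule nn_integral_mono) auto
  qed measurable
qed

text \<open>Monotone convergence along e = 1/(n+1). The extended inverse keeps the value \<infinity>
  at zero wealth, and this is what yields positivity from a finite mean.\<close>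

lemma mean_inverse:
  assumes st: "0 \<le> s" "s \<le> t" and Q: "Q \<in> sets (F s)"
  shows "(\<integral>\<^sup>+w. indicator Q w * inverse (ennreal (W w t)) \<partial>M) \<le> (\<integral>\<^sup>+w. indicator Q w * inverse (ennreal (W w s)) \<partial>M)"
proof -
  have t0: "t \<ge> 0" using st by simp
  have QM[measurable]: "Q \<in> sets M" using filtrationD(2)[OF filt st(1)] Q by auto
  have [measurable]: "(\<lambda>w. W w t) \<in> borel_measurable M" using W_measurable_M[OF t0] .
  let ?f = "\<lambda>n w. indicator Q w * ennreal (1 / (1 / real (Suc n) + W w t))"
  have "(\<integral>\<^sup>+w. indicator Q w * inverse (ennreal (W w t)) \<partial>M) = (\<integral>\<^sup>+w. (SUP n. ?f n w) \<partial>M)"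
    by (simp add: inverse_ennreal_eq_SUP SUP_mult_left_ennreal)
  also have "\<dots> = (SUP n. \<integral>\<^sup>+w. ?f n w \<partial>M)"
  proof (rule nn_integral_monotone_convergence_SUP)
    show "incseq ?f"
      by (intro incseq_SucI le_funI mult_left_mono ennreal_leI divide_left_mono add_mono mult_pos_pos add_pos_nonneg) (auto simp: frac_le)
  qed measurable
  also have "\<dots> \<le> (\<integral>\<^sup>+w. indicator Q w * inverse (ennreal (W w s)) \<partial>M)"
  proof (intro SUP_least)
    fix n
    have "(\<integral>\<^sup>+w. ?f n w \<partial>M) \<le> (\<integral>\<^sup>+w. indicator Q w * ennreal (1 / (1 / real (Suc n) + W w s)) \<partial>M)"
      by (rule mean_reciprocal[OF _ st Q]) simp
    also have "\<dots> \<le> (\<integral>\<^sup>+w. indicator Q w * inverse (ennreal (W w s)) \<partial>M)"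
      by (intro nn_integral_mono mult_left_mono) (auto simp: inverse_ennreal_eq_SUP intro: SUP_upper)
    finally show "(\<integral>\<^sup>+w. ?f n w \<partial>M) \<le> (\<integral>\<^sup>+w. indicator Q w * inverse (ennreal (W w s)) \<partial>M)" .
  qed
  finally show ?thesis .
qed

lemma W_zero: "good w \<Longrightarrow> W w 0 = l1 y0"
  by (auto simp: good_def)

lemma l1_y0_pos: "0 < l1 y0"
  using y0_pos by (auto simp: l1_pos_iff vec_eq_iff less_imp_neq[symmetric] intro: less_imp_neq)

lemma inverse_wealth_finite: "t \<ge> 0 \<Longrightarrow> (\<integral>\<^sup>+w. inverse (ennreal (W w t)) \<partial>M) < \<infinity>"
proof -
  assume t: "t \<ge> 0"
  interpret prob_space M by (rule prob)
  have sp: "space M \<in> sets (F 0)" using filtrationD(1)[OF filt, of 0] sets.top[of "F 0"] by simp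
  have "(\<integral>\<^sup>+w. inverse (ennreal (W w t)) \<partial>M) = (\<integral>\<^sup>+w. indicator (space M) w * inverse (ennreal (W w t)) \<partial>M)"
    by (intro nn_integral_cong) auto
  also have "\<dots> \<le> (\<integral>\<^sup>+w. indicator (space M) w * inverse (ennreal (W w 0)) \<partial>M)"
    by (rule mean_inverse[OF _ t sp]) simp
  also have "\<dots> = (\<integral>\<^sup>+w. inverse (ennreal (l1 y0)) \<partial>M)"
    using AE_good by (intro nn_integral_cong_AE) (auto elim!: eventually_mono simp: W_zero AE_space split: split_indicator intro: AE_I2)
  also have "\<dots> < \<infinity>" using l1_y0_pos by (simp add: emeasure_space_1 inverse_ennreal)
  finally show ?thesis .
qed

text \<open>The inverse has finite mean at each integer time, so W is a.s. positive at all integers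
  simultaneously. If W or its left limit vanished at some t, every investor would be absorbed at 0
  and W would vanish at a later integer.\<close>

lemma AE_wealth_pos: "AE w in M. \<forall>t\<ge>0. 0 < W w t \<and> 0 < Wl w t"
proof -
  have "AE w in M. inverse (ennreal (W w (real n))) \<noteq> \<infinity>" for n
    using inverse_wealth_finite[of "real n"] W_measurable_M[of "real n"] by (intro nn_integral_PInf_AE) auto
  then have "AE w in M. \<forall>n. inverse (ennreal (W w (real n))) \<noteq> \<infinity>" by (simp add: AE_all_countable)
  then show ?thesis using AE_space
  proof (eventually_elim, safe)
    fix w and t :: real assume w: "w \<in> space M" and t: "0 \<le> t" and pos: "\<forall>n. inverse (ennreal (W w (real n))) \<noteq> \<infinity>"
    have W: "\<exists>m. Y s w $ m \<noteq> 0" if s: "s \<ge> 0" for s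
    proof (rule ccontr)
      assume "\<not> ?thesis"
      then have 0: "Y s w $ m = 0" for m by auto
      obtain n where "s \<le> real n" using real_arch_simple by blast
      then have "Y (real n) w $ m = 0" for m using Y_absorbed w s 0 by blast
      then have "W w (real n) = 0" by (simp add: W_def l1_def)
      then show False using pos by auto
    qed
    then have "Y t w \<noteq> 0" using t by (auto simp: vec_eq_iff)
    then show "0 < W w t" by (simp add: W_def l1_pos_iff)
    have "yl w t \<noteq> 0"
    proof
      assume "yl w t = 0"
      then have "leftlim y0 (\<lambda>s. Y s w) t $ m = 0" for m by (simp add: yl_def)
      then have "Y t w $ m = 0" for m using Y_absorbed w t by blast
      then show False using W[OF t] by blast
    qed
    then show "0 < Wl w t" by (simp add: Wl_def l1_pos_iff)
  qed
qed

lemma reciprocal_measurable: "t \<ge> 0 \<Longrightarrow> (\<lambda>w. 1 / W w t) \<in> borel_measurable (F t)"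
  using W_measurable[of t] by measurable

text \<open>The real quotient 1/W is 0 where W = 0; almost sure positivity identifies it with the
  extended inverse.\<close>

lemma reciprocal_set_integral:
  assumes t: "t \<ge> 0" and B: "B \<in> sets M"
  shows "integrable M (\<lambda>w. 1 / W w t)"
    and "ennreal (LINT w:B|M. 1 / W w t) = (\<integral>\<^sup>+w. indicator B w * inverse (ennreal (W w t)) \<partial>M)"
proof -
  have AE: "AE w in M. ennreal (1 / W w t) = inverse (ennreal (W w t))"
    using AE_wealth_pos by eventually_elim (use t in \<open>simp add: inverse_ennreal inverse_eq_divide\<close>)
  show int: "integrable M (\<lambda>w. 1 / W w t)"
  proof (rule integrableI_nonneg)
    show "(\<lambda>w. 1 / W w t) \<in> borel_measurable M" using W_measurable_M[OF t] by measurable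
    have "(\<integral>\<^sup>+w. ennreal (1 / W w t) \<partial>M) = (\<integral>\<^sup>+w. inverse (ennreal (W w t)) \<partial>M)" by (rule nn_integral_cong_AE[OF AE])
    then show "(\<integral>\<^sup>+w. ennreal (1 / W w t) \<partial>M) < \<infinity>" using inverse_wealth_finite[OF t] by simp
  qed simp
  have "ennreal (LINT w:B|M. 1 / W w t) = (\<integral>\<^sup>+w. ennreal (indicator B w *\<^sub>R (1 / W w t)) \<partial>M)"
    unfolding set_lebesgue_integral_def using integrable_mult_indicator[OF B int]
    by (intro nn_integral_eq_integral[symmetric]) auto
  also have "\<dots> = (\<integral>\<^sup>+w. indicator B w * inverse (ennreal (W w t)) \<partial>M)"
    using AE by (intro nn_integral_cong_AE) (auto elim!: eventually_mono split: split_indicator)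
  finally show "ennreal (LINT w:B|M. 1 / W w t) = (\<integral>\<^sup>+w. indicator B w * inverse (ennreal (W w t)) \<partial>M)" .
qed

lemma reciprocal_set_integral_mono:
  assumes st: "0 \<le> s" "s \<le> t" and B: "B \<in> sets (F s)"
  shows "(LINT w:B|M. 1 / W w t) \<le> (LINT w:B|M. 1 / W w s)"
proof -
  have BM: "B \<in> sets M" using filtrationD(2)[OF filt st(1)] B by auto
  have t: "t \<ge> 0" using st by simp
  have "ennreal (LINT w:B|M. 1 / W w t) \<le> ennreal (LINT w:B|M. 1 / W w s)"
    using mean_inverse[OF st B] by (simp only: reciprocal_set_integral(2)[OF t BM] reciprocal_set_integral(2)[OF st(1) BM])
  moreover have "0 \<le> (LINT w:B|M. 1 / W w s)"
    unfolding set_lebesgue_integral_def by (intro integral_nonneg_AE) auto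
  ultimately show ?thesis by (simp add: ennreal_le_iff)
qed

lemma reciprocal_supermartingale: "supermartingale M F (\<lambda>t w. 1 / W w t)"
  unfolding supermartingale_def
proof (intro conjI allI impI)
  interpret prob_space M by (rule prob)
  show "adapted M F (\<lambda>t w. 1 / W w t)" by (auto simp: adapted_def intro: reciprocal_measurable)
  show int: "integrable M (\<lambda>w. 1 / W w t)" if "t \<ge> 0" for t using reciprocal_set_integral(1)[OF that, of "{}"] by simp
  fix s t :: real assume st: "0 \<le> s" "s \<le> t"
  show "AE w in M. real_cond_exp M (F s) (\<lambda>w. 1 / W w t) w \<le> 1 / W w s"
    using st filt by (intro real_cond_exp_le int reciprocal_measurable reciprocal_set_integral_mono) (auto simp: filtration_def)
qed

text \<open>The limit c of 1/W is finite, so W cannot tend to 0: c = 0 means that W diverges, and c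
  > 0 that it converges to 1/c.\<close>

lemma wealth_limit: "AE w in M. (\<exists>c>0. (W w \<longlongrightarrow> c) at_top) \<or> filterlim (W w) at_top at_top"
proof -
  interpret prob_space M by (rule prob)
  have "AE w in M. \<exists>c. ((\<lambda>t. 1 / W w t) \<longlongrightarrow> c) at_top"
  proof (rule supermartingale_convergence[OF filt reciprocal_measurable])
    show "AE w in M. \<forall>t\<ge>0. ((\<lambda>s. 1 / W w s) \<longlongrightarrow> 1 / W w t) (at_right t)"
      using AE_wealth_pos AE_space
    proof (eventually_elim, safe)
      fix w and t :: real assume w: "w \<in> space M" "\<forall>t\<ge>0. 0 < W w t \<and> 0 < Wl w t" and t: "0 \<le> t"
      have "W w t \<noteq> 0" using w(2) t by (auto simp: less_le)
      then show "((\<lambda>s. 1 / W w s) \<longlongrightarrow> 1 / W w t) (at_right t)"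
        by (intro tendsto_divide W_tendsto(1)[OF w(1) t] tendsto_const)
    qed
  qed (auto intro: reciprocal_set_integral(1)[of _ "{}"] reciprocal_set_integral_mono)
  then show ?thesis using AE_wealth_pos
  proof eventually_elim
    fix w assume "\<exists>c. ((\<lambda>t. 1 / W w t) \<longlongrightarrow> c) at_top" and pos: "\<forall>t\<ge>0. 0 < W w t \<and> 0 < Wl w t"
    then obtain c where c: "((\<lambda>t. 1 / W w t) \<longlongrightarrow> c) at_top" by blast
    have inv: "inverse (1 / W w t) = W w t" for t by simp
    have ev: "\<forall>\<^sub>F t in at_top. 0 < 1 / W w t" using eventually_ge_at_top[of 0] by eventually_elim (use pos in simp)
    have "0 \<le> c" by (rule tendsto_lowerbound[OF c]) auto
    then consider "c = 0" | "0 < c" by linarith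
    then show "(\<exists>c>0. (W w \<longlongrightarrow> c) at_top) \<or> filterlim (W w) at_top at_top"
    proof cases
      case 1
      then show ?thesis using filterlim_inverse_at_top[OF _ ev] c unfolding inv by simp
    next
      case 2
      then have "(W w \<longlongrightarrow> inverse c) at_top" using tendsto_inverse[OF c] unfolding inv by simp
      then show ?thesis using 2 by (intro disjI1 exI[of _ "inverse c"]) simp
    qed
  qed
qed

end

section \<open>Quasi-continuous payoffs\<close>

context wealth
begin

text \<open>\<open>d\<close> is the drift, the excess of \<open>u\<close> over \<open>u1\<close>.
  \<open>h\<close> is the square of the share of a payoff in the wealth after it, and
  \<open>Hq\<close> its \<nu>-integral up to t, a quadratic activity relative to the wealth.
  \<open>q2\<close> lies in between: d \<le> q2/e and q2 \<le> h, and q2 tends to 0 as e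
  grows.\<close>

definition d :: "real \<Rightarrow> 'a \<Rightarrow> real \<Rightarrow> real \<Rightarrow> real" where
  "d e w s a = e * a\<^sup>2 / ((e + Wl w s)\<^sup>2 * (Wl w s + a) * (e + Wl w s + a))"
definition h :: "'a \<Rightarrow> real \<Rightarrow> real \<Rightarrow> real" where
  "h w s a = a\<^sup>2 / (Wl w s + a)\<^sup>2"
definition Hq :: "'a \<Rightarrow> real \<Rightarrow> ennreal" where
  "Hq w t = (\<integral>\<^sup>+q. indicator {0<..t} (fst q) * ennreal (h w (fst q) (l1 (snd q))) \<partial>\<nu> w)"
definition q2 :: "real \<Rightarrow> 'a \<Rightarrow> real \<Rightarrow> real \<Rightarrow> real" where
  "q2 e w s a = a\<^sup>2 / ((Wl w s + a) * (e + Wl w s + a))"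

lemma predictable_integrands [measurable]:
  "(\<lambda>q. ennreal (d e (fst (fst q)) (snd (fst q)) (l1 (snd q)))) \<in> borel_measurable (pred_sigma M F \<Otimes>\<^sub>M (borel :: (real^'n) measure))"
  "(\<lambda>q. ennreal (h (fst (fst q)) (snd (fst q)) (l1 (snd q)))) \<in> borel_measurable (pred_sigma M F \<Otimes>\<^sub>M (borel :: (real^'n) measure))"
  "(\<lambda>q. ennreal (q2 e (fst (fst q)) (snd (fst q)) (l1 (snd q)))) \<in> borel_measurable (pred_sigma M F \<Otimes>\<^sub>M (borel :: (real^'n) measure))"
  "(\<lambda>q. ennreal (u1 e (fst (fst q)) (snd (fst q)) (l1 (snd q)))) \<in> borel_measurable (pred_sigma M F \<Otimes>\<^sub>M (borel :: (real^'n) measure))"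
  unfolding d_def h_def q2_def u1_def by measurable

lemma nu_path_measurable:
  fixes f :: "('a \<times> real) \<times> (real^'n) \<Rightarrow> ennreal"
  assumes f: "f \<in> borel_measurable (pred_sigma M F \<Otimes>\<^sub>M borel)" and w: "w \<in> space M"
  shows "(\<lambda>q. indicator {0<..} (fst q) * f ((w, fst q), snd q)) \<in> borel_measurable (borel \<Otimes>\<^sub>M borel)"
proof -
  have [measurable]: "(\<lambda>q. f ((w, max 0 (fst q)), snd q)) \<in> borel_measurable (borel \<Otimes>\<^sub>M borel)"
    using nu_measurable(4)[OF f w] by (simp add: borel_prod)
  have "(\<lambda>q. indicator {0<..} (fst q) * f ((w, max 0 (fst q)), snd q)) \<in> borel_measurable (borel \<Otimes>\<^sub>M borel)"
    by measurable
  also have "(\<lambda>q. indicator {0<..} (fst q) * f ((w, max 0 (fst q)), snd q)) = (\<lambda>q. indicator {0<..} (fst q) * f ((w, fst q), snd q))"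
    by (auto split: split_indicator simp: fun_eq_iff)
  finally show ?thesis .
qed

text \<open>At an atom of G the drift rate b is 0, and vanishing \<open>nubar\<close> would make K
  null as well, against the normalisation of b and K.\<close>

lemma no_atom:
  assumes qc: "\<forall>t. nubar \<nu> w t = 0" and w: "w \<in> space M" and r: "r > 0"
  shows "emeasure (G w) {r} = 0"
proof (rule ccontr)
  assume G: "emeasure (G w) {r} \<noteq> 0"
  have [simp, measurable_cong]: "sets (K w r) = sets borel" using K_sets w by auto
  \<comment> \<open>\<open>enn2real\<close> sends \<top> to 0, so \<open>nubar\<close> = 0 means a
    null mass only because the mass is at most 1.\<close>
  have "emeasure (\<nu> w) ({r} \<times> nonneg_vecs) \<le> 1" using nu_bar_le1 w by auto
  then have "emeasure (\<nu> w) ({r} \<times> nonneg_vecs) < \<top>" by (rule order_le_less_trans) simp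
  then have "emeasure (\<nu> w) ({r} \<times> nonneg_vecs) = 0"
    using qc[rule_format, of r] by (auto simp: nubar_def enn2real_eq_0_iff)
  then have "emeasure (K w r) nonneg_vecs = 0"
    using nu_section[OF w r nonneg_vecs_borel] G by simp
  then have "AE x in K w r. x \<notin> nonneg_vecs" by (intro AE_I[where N=nonneg_vecs]) (auto simp: nonneg_vecs_borel)
  then have "AE x in K w r. ennreal (min 1 (l1 x)) = 0" using K_AE[OF w, of r] by eventually_elim simp
  then have "(\<integral>\<^sup>+x. ennreal (min 1 (l1 x)) \<partial>K w r) = (\<integral>\<^sup>+x. 0 \<partial>K w r)" by (rule nn_integral_cong_AE)
  moreover have "ennreal (l1 (b w r)) + (\<integral>\<^sup>+x. ennreal (min 1 (l1 x)) \<partial>K w r) = 1"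
    using bK_norm w r by auto
  ultimately show False using b_atom[OF w r G] by simp
qed

lemma u_split:
  assumes w: "w \<in> space M" and e: "e > 0" and a: "a \<ge> 0" and Wl: "0 < Wl w r" and G: "emeasure (G w) {r} = 0"
  shows "ennreal (u e w r a) = ennreal (u1 e w r a) + ennreal (d e w r a)"
proof -
  define wl where "wl = Wl w r"
  have wl: "0 < wl" using Wl by (simp add: wl_def)
  have nz: "e + wl \<noteq> 0" "wl + a \<noteq> 0" "e + wl + a \<noteq> 0" using e a wl by auto
  have "u e w r a = 1 / (e + wl) - 1 / (e + wl + a)"
    using Wl z_no_atom[OF w G] by (simp add: u_def wl_def)
  also have "\<dots> = wl * a / ((e + wl)\<^sup>2 * (wl + a)) + e * a\<^sup>2 / ((e + wl)\<^sup>2 * (wl + a) * (e + wl + a))"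
    using nz by (simp add: divide_simps power2_eq_square) (simp add: algebra_simps)
  also have "\<dots> = u1 e w r a + d e w r a"
    using Wl by (simp add: u1_def d_def wl_def)
  finally show ?thesis
    using wl a e by (simp add: u1_def d_def ennreal_plus wl_def)
qed

text \<open>The balance for 1/(e + W) is an equality, so it can be used in both directions. Dropping
  the final value bounds the drift by the initial value 1/(e + w0). For the second claim the balance
  is rewritten for 1/e - 1/(e + W), which is nonnegative too and may again be dropped at the end of
  a down-closed set; its mean growth is paid for by the drift. R is left free for a further
  predictable restriction.\<close>

lemma quasi_continuous_balance:
  fixes k :: real
  assumes qc: "\<forall>w\<in>space M. \<forall>t. nubar \<nu> w t = 0" and e: "e > 0" and t: "t \<ge> 0"
    and R[measurable]: "Measurable.pred (pred_sigma M F) R"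
    and down: "\<And>w r r'. R (w, r) \<Longrightarrow> 0 < r' \<Longrightarrow> r' \<le> r \<Longrightarrow> R (w, r')"
  defines "P \<equiv> \<lambda>w r. 0 < r \<and> r \<le> t \<and> A w r \<le> ennreal k \<and> R (w, r)"
  defines "Nd \<equiv> \<integral>\<^sup>+w. (\<integral>\<^sup>+q. (if P w (fst q) then ennreal (d e w (fst q) (l1 (snd q))) else 0) \<partial>\<nu> w) \<partial>M"
  shows "Nd \<le> ennreal (1 / (e + l1 y0))"
    and "(\<integral>\<^sup>+w. (if A w t \<le> ennreal k \<and> R (w, t) then ennreal (1 / e - 1 / (e + W w t)) else 0) \<partial>M) \<le> ennreal (1 / e - 1 / (e + l1 y0)) + Nd"
proof -
  interpret prob_space M by (rule prob)
  have sp: "space M \<in> sets (F 0)" using filtrationD(1)[OF filt, of 0] sets.top[of "F 0"] by simp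
  let ?P = "\<lambda>p. fst p \<in> space M \<and> P (fst p) (snd p)"
  have rect: "(\<lambda>p. indicator (space M) (fst p) * indicator {0<..t} (snd p) :: real) \<in> borel_measurable (pred_sigma M F)"
    by (rule predictable_rectangle[OF filt _ sp]) simp
  have "Measurable.pred (pred_sigma M F) (\<lambda>p. indicator (space M) (fst p) * indicator {0<..t} (snd p) = (1::real) \<and> A (fst p) (snd p) \<le> ennreal k \<and> R p)"
    using rect by measurable
  also have "(\<lambda>p. indicator (space M) (fst p) * indicator {0<..t} (snd p) = (1::real) \<and> A (fst p) (snd p) \<le> ennreal k \<and> R p) = ?P"
    by (auto simp: P_def fun_eq_iff split: split_indicator)
  finally have P: "Measurable.pred (pred_sigma M F) ?P" .
  have Pk: "\<forall>w\<in>space M. \<forall>r. ?P (w, r) \<longrightarrow> 0 < r \<and> A w r \<le> ennreal k" by (auto simp: P_def)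
  have P'[measurable]: "Measurable.pred (pred_sigma M F \<Otimes>\<^sub>M (borel :: (real^'n) measure)) (\<lambda>q. ?P (fst q))"
    using measurable_compose[OF measurable_fst P] .
  let ?J = "\<lambda>w. \<integral>\<^sup>+r. (if P w r then ennreal (u e w r (xl w r (jump X w r))) else 0) \<partial>count_space {0<..}"
  let ?I = "\<lambda>v w. \<integral>\<^sup>+q. (if P w (fst q) then ennreal (v w (fst q) (l1 (snd q))) else 0) \<partial>\<nu> w"
  have mu: "(\<integral>\<^sup>+w. ?J w \<partial>M) = (\<integral>\<^sup>+w. ?I (u e) w \<partial>M)" "(\<integral>\<^sup>+w. ?I (u e) w \<partial>M) < \<infinity>"
    using mean_u(1,2)[OF e P Pk] by (simp_all cong: nn_integral_cong_simp)
  have N1m: "?I (u1 e) \<in> borel_measurable M"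
  proof -
    have "(\<lambda>q. if ?P (fst q) then ennreal (u1 e (fst (fst q)) (snd (fst q)) (l1 (snd q))) else 0) \<in> borel_measurable (pred_sigma M F \<Otimes>\<^sub>M (borel :: (real^'n) measure))"
      by measurable
    from nu_measurable(3)[OF this] show ?thesis
      by (rule measurable_cong[THEN iffD1, rotated]) (auto intro!: nn_integral_cong simp: P_def)
  qed
  have split: "?I (u e) w = ?I (u1 e) w + ?I (d e) w"
    if w: "w \<in> space M" and pos: "\<forall>t\<ge>0. 0 < W w t \<and> 0 < Wl w t" for w
  proof -
    have snu [simp, measurable_cong]: "sets (\<nu> w) = sets (borel \<Otimes>\<^sub>M borel)" unfolding borel_prod by (rule sets_nu[OF w])
    have m: "(\<lambda>q. if P w (fst q) then ennreal (v w (fst q) (l1 (snd q))) else 0) \<in> borel_measurable (\<nu> w)"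
      if v: "(\<lambda>q. ennreal (v (fst (fst q)) (snd (fst q)) (l1 (snd q)))) \<in> borel_measurable (pred_sigma M F \<Otimes>\<^sub>M (borel :: (real^'n) measure))" for v
    proof -
      note [measurable] = v
      have "(\<lambda>q. if ?P (fst q) then ennreal (v (fst (fst q)) (snd (fst q)) (l1 (snd q))) else 0) \<in> borel_measurable (pred_sigma M F \<Otimes>\<^sub>M (borel :: (real^'n) measure))"
        by measurable
      from nu_path_measurable[OF this w]
      have "(\<lambda>q. indicator {0<..} (fst q) * (if P w (fst q) then ennreal (v w (fst q) (l1 (snd q))) else 0)) \<in> borel_measurable (\<nu> w)"
        using w by (simp add: measurable_cong_sets[OF snu refl] cong: if_cong)
      also have "(\<lambda>q. indicator {0<..} (fst q) * (if P w (fst q) then ennreal (v w (fst q) (l1 (snd q))) else 0)) = (\<lambda>q. if P w (fst q) then ennreal (v w (fst q) (l1 (snd q))) else 0)"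
        by (auto simp: P_def fun_eq_iff)
      finally show ?thesis .
    qed
    have "?I (u e) w = (\<integral>\<^sup>+q. (if P w (fst q) then ennreal (u1 e w (fst q) (l1 (snd q))) else 0) + (if P w (fst q) then ennreal (d e w (fst q) (l1 (snd q))) else 0) \<partial>\<nu> w)"
      using pos no_atom[OF _ w] qc w by (intro nn_integral_cong) (auto simp: P_def intro!: u_split e)
    also have "\<dots> = ?I (u1 e) w + ?I (d e) w"
      by (intro nn_integral_add m predictable_integrands)
    finally show ?thesis .
  qed
  \<comment> \<open>The mean of \<open>u\<close> splits into those of \<open>u1\<close> and
    \<open>d\<close>: one direction is superadditivity, the other uses that the \<open>u1\<close>
    part is measurable with finite mean.\<close>
  have IN: "(\<integral>\<^sup>+w. ?I (u1 e) w \<partial>M) + Nd \<le> (\<integral>\<^sup>+w. ?I (u e) w \<partial>M)"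
    "(\<integral>\<^sup>+w. ?I (u e) w \<partial>M) \<le> (\<integral>\<^sup>+w. ?I (u1 e) w \<partial>M) + Nd"
    "(\<integral>\<^sup>+w. ?I (u1 e) w \<partial>M) < \<infinity>"
  proof -
    have eq: "(\<integral>\<^sup>+w. ?I (u e) w \<partial>M) = (\<integral>\<^sup>+w. ?I (u1 e) w + ?I (d e) w \<partial>M)"
      by (rule nn_integral_cong_AE, rule AE_mp[OF AE_wealth_pos], rule AE_I2, rule impI) (rule split)
    show 1: "(\<integral>\<^sup>+w. ?I (u1 e) w \<partial>M) + Nd \<le> (\<integral>\<^sup>+w. ?I (u e) w \<partial>M)"
      unfolding eq Nd_def by (rule nn_integral_superadditive)
    have "(\<integral>\<^sup>+w. ?I (u1 e) w \<partial>M) \<le> (\<integral>\<^sup>+w. ?I (u1 e) w \<partial>M) + Nd" by simp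
    then show 2: "(\<integral>\<^sup>+w. ?I (u1 e) w \<partial>M) < \<infinity>" using 1 mu(2) by (meson order_le_less_trans)
    show "(\<integral>\<^sup>+w. ?I (u e) w \<partial>M) \<le> (\<integral>\<^sup>+w. ?I (u1 e) w \<partial>M) + Nd"
      unfolding eq Nd_def by (rule nn_integral_add_le_left_measurable[OF N1m 2])
  qed
  define w0 where "w0 = l1 y0"
  have w0: "0 < w0" using l1_y0_pos by (simp add: w0_def)
  have path: "?J w \<le> ennreal (1 / (e + w0)) + ?I (u1 e) w"
    "(if A w t \<le> ennreal k \<and> R (w, t) then ennreal (1 / e - 1 / (e + W w t)) else 0) + ?I (u1 e) w \<le> ennreal (1 / e - 1 / (e + w0)) + ?J w"
    if w: "w \<in> space M" "good w" and pos: "\<forall>t\<ge>0. 0 < W w t \<and> 0 < Wl w t" for w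
  proof -
    define S where "S = {r. A w r \<le> ennreal k \<and> R (w, r)}"
    have Sd: "r' \<in> S" if "r \<in> S" "0 < r'" "r' \<le> r" for r r'
      using that A_mono[of r' r w] down[of w r r'] by (auto simp: S_def)
    have "(\<lambda>r. R (w, max 0 r) \<and> A w (max 0 r) \<le> ennreal k) \<in> measurable borel (count_space UNIV)"
    proof -
      have "(\<lambda>p. R p \<and> A (fst p) (snd p) \<le> ennreal k) \<in> measurable (pred_sigma M F) (count_space UNIV)" by measurable
      from measurable_compose[OF measurable_path_section[OF filt w(1)] this] show ?thesis by simp
    qed
    then have "{r. R (w, max 0 r) \<and> A w (max 0 r) \<le> ennreal k} \<in> sets borel" by simp
    moreover have "S \<inter> {0<..t} = {r. R (w, max 0 r) \<and> A w (max 0 r) \<le> ennreal k} \<inter> {0<..t}" by (auto simp: S_def)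
    ultimately have Sm: "S \<inter> {0<..t} \<in> sets borel" by simp
    define f1 where "f1 = (\<lambda>q. indicator {0<..} (fst q) * ennreal (u1 e w (fst q) (l1 (snd q :: real^'n))))"
    have f1m: "f1 \<in> borel_measurable (borel \<Otimes>\<^sub>M borel)"
      unfolding f1_def using nu_path_measurable[OF predictable_integrands(4) w(1)] by simp
    let ?m = "jump_time (\<lambda>r. ennreal (u e w r (xl w r (jump X w r))))" and ?n = "nu_time w f1"
    have bal: "ennreal (1 / (e + W w r)) + emeasure ?m {0<..r} = ennreal (1 / (e + w0)) + emeasure ?n {0<..r}" if r: "0 \<le> r" for r
    proof -
      have "(\<integral>\<^sup>+q. indicator {0<..r} (fst q) * f1 q \<partial>\<nu> w) = (\<integral>\<^sup>+q. indicator {0<..r} (fst q) * ennreal (u1 e w (fst q) (l1 (snd q))) \<partial>\<nu> w)"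
        by (intro nn_integral_cong) (auto simp: f1_def split: split_indicator)
      then show ?thesis
        using reciprocal_wealth_quasi_continuous[OF w e order_refl r no_atom[OF _ w(1)]] qc w(1) pos W_zero[OF w(2)]
        by (simp add: emeasure_jump_time emeasure_nu_time[OF w(1) f1m] w0_def)
    qed
    \<comment> \<open>Adding 1/(e + w0) to both sides and cancelling it afterwards replaces a
      subtraction of extended numbers.\<close>
    have gain: "ennreal (1 / e - 1 / (e + W w r)) + emeasure ?n {0<..r} = ennreal (1 / e - 1 / (e + w0)) + emeasure ?m {0<..r}" if r: "0 \<le> r" for r
    proof -
      have c: "ennreal (1 / e - 1 / (e + wl)) + ennreal (1 / (e + wl)) = ennreal (1 / e)" if "0 \<le> wl" for wl
        using e that by (subst ennreal_plus[symmetric]) (auto intro!: frac_le)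
      have "ennreal (1 / (e + w0)) + (ennreal (1 / e - 1 / (e + W w r)) + emeasure ?n {0<..r})
        = ennreal (1 / e - 1 / (e + W w r)) + (ennreal (1 / (e + W w r)) + emeasure ?m {0<..r})"
        unfolding bal[OF r] by (simp add: ac_simps)
      also have "\<dots> = ennreal (1 / e) + emeasure ?m {0<..r}" by (simp add: add.assoc[symmetric] c)
      also have "\<dots> = ennreal (1 / (e + w0)) + (ennreal (1 / e - 1 / (e + w0)) + emeasure ?m {0<..r})"
        using c[of w0] w0 by (simp add: ac_simps flip: add.assoc)
      finally show ?thesis by (simp add: ennreal_add_left_cancel)
    qed
    have mS: "emeasure ?m (S \<inter> {0<..t}) = ?J w"
      unfolding emeasure_jump_time[OF Sm] by (intro nn_integral_cong) (auto simp: P_def S_def split: split_indicator)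
    have nS: "emeasure ?n (S \<inter> {0<..t}) = ?I (u1 e) w"
      unfolding emeasure_nu_time[OF w(1) f1m Sm] by (intro nn_integral_cong) (auto simp: P_def S_def f1_def split: split_indicator)
    have "indicator S t * ennreal (1 / (e + W w t)) + emeasure ?m (S \<inter> {0<..t}) \<le> ennreal (1 / (e + w0)) + emeasure ?n (S \<inter> {0<..t})"
      by (rule stop_downclosed) (use bal Sd t in auto)
    then have "emeasure ?m (S \<inter> {0<..t}) \<le> ennreal (1 / (e + w0)) + emeasure ?n (S \<inter> {0<..t})"
      by (rule order_trans[rotated]) simp
    then show "?J w \<le> ennreal (1 / (e + w0)) + ?I (u1 e) w" unfolding mS nS .
    have "indicator S t * ennreal (1 / e - 1 / (e + W w t)) + emeasure ?n (S \<inter> {0<..t}) \<le> ennreal (1 / e - 1 / (e + w0)) + emeasure ?m (S \<inter> {0<..t})"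
      by (rule stop_downclosed) (use gain Sd t in auto)
    then show "(if A w t \<le> ennreal k \<and> R (w, t) then ennreal (1 / e - 1 / (e + W w t)) else 0) + ?I (u1 e) w \<le> ennreal (1 / e - 1 / (e + w0)) + ?J w"
      unfolding mS nS by (auto simp: S_def split: if_splits)
  qed
  have AE: "AE w in M. good w \<and> (\<forall>t\<ge>0. 0 < W w t \<and> 0 < Wl w t)"
    using AE_good AE_wealth_pos by eventually_elim simp
  have "Nd + (\<integral>\<^sup>+w. ?I (u1 e) w \<partial>M) \<le> (\<integral>\<^sup>+w. ?J w \<partial>M)" using IN(1) unfolding mu(1) by (simp add: add.commute)
  also have "\<dots> \<le> (\<integral>\<^sup>+w. ennreal (1 / (e + w0)) + ?I (u1 e) w \<partial>M)"
    by (rule nn_integral_mono_AE, rule AE_mp[OF AE], rule AE_I2, rule impI, elim conjE) (rule path(1))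
  also have "\<dots> = ennreal (1 / (e + w0)) + (\<integral>\<^sup>+w. ?I (u1 e) w \<partial>M)"
    using N1m by (subst nn_integral_add) (auto simp: emeasure_space_1)
  finally show "Nd \<le> ennreal (1 / (e + l1 y0))"
    unfolding w0_def[symmetric] using IN(3) by (rule ennreal_add_cancel)
  let ?g = "\<lambda>w. if A w t \<le> ennreal k \<and> R (w, t) then ennreal (1 / e - 1 / (e + W w t)) else 0"
  have "(\<integral>\<^sup>+w. ?g w \<partial>M) + (\<integral>\<^sup>+w. ?I (u1 e) w \<partial>M) \<le> (\<integral>\<^sup>+w. ?g w + ?I (u1 e) w \<partial>M)"
    by (rule nn_integral_superadditive)
  also have "\<dots> \<le> (\<integral>\<^sup>+w. ennreal (1 / e - 1 / (e + w0)) + ?J w \<partial>M)"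
    by (rule nn_integral_mono_AE, rule AE_mp[OF AE], rule AE_I2, rule impI, elim conjE) (rule path(2))
  also have "\<dots> \<le> (\<integral>\<^sup>+w. ennreal (1 / e - 1 / (e + w0)) \<partial>M) + (\<integral>\<^sup>+w. ?J w \<partial>M)"
    by (rule nn_integral_add_le_left_measurable) (simp_all add: emeasure_space_1)
  also have "\<dots> \<le> ennreal (1 / e - 1 / (e + w0)) + ((\<integral>\<^sup>+w. ?I (u1 e) w \<partial>M) + Nd)"
    unfolding mu(1) using IN(2) by (intro add_mono) (simp_all add: emeasure_space_1)
  also have "\<dots> = (ennreal (1 / e - 1 / (e + w0)) + Nd) + (\<integral>\<^sup>+w. ?I (u1 e) w \<partial>M)" by (simp add: ac_simps)
  finally show "(\<integral>\<^sup>+w. ?g w \<partial>M) \<le> ennreal (1 / e - 1 / (e + l1 y0)) + Nd"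
    unfolding w0_def[symmetric] using IN(3) by (rule ennreal_add_cancel)
qed

text \<open>The bound on the drift at e = 1 depends neither on the horizon n nor on the localisation
  A \<le> n, so monotone convergence removes both at once.\<close>

lemma mean_d_finite:
  assumes qc: "\<forall>w\<in>space M. \<forall>t. nubar \<nu> w t = 0"
  shows "AE w in M. (\<integral>\<^sup>+q. indicator {0<..} (fst q) * ennreal (d 1 w (fst q) (l1 (snd q))) \<partial>\<nu> w) < \<infinity>"
proof -
  let ?f = "\<lambda>n w q. if 0 < fst q \<and> fst q \<le> real n \<and> A w (fst q) \<le> ennreal (real n) then ennreal (d 1 w (fst q) (l1 (snd q))) else 0"
  let ?D = "\<lambda>w. \<integral>\<^sup>+q. indicator {0<..} (fst q) * ennreal (d 1 w (fst q) (l1 (snd q))) \<partial>\<nu> w"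
  have Dm: "?D \<in> borel_measurable M" using nu_measurable(3)[OF predictable_integrands(1)] by simp
  have "A w r \<le> ennreal (real (Suc k))" if "A w r \<le> ennreal (real k)" for w k r
    using that by (rule order_trans) (auto intro!: ennreal_leI)
  then have mono: "?f n w q \<le> ?f (Suc n) w q" for n w and q :: "real \<times> (real^'n)" by auto
  have SUP: "?D w = (SUP n. \<integral>\<^sup>+q. ?f n w q \<partial>\<nu> w)" if w: "w \<in> space M" for w
  proof -
    have snu: "sets (\<nu> w) = sets (borel \<Otimes>\<^sub>M borel)" unfolding borel_prod by (rule sets_nu[OF w])
    have fm: "?f n w \<in> borel_measurable (\<nu> w)" for n
    proof -
      have [measurable]: "(\<lambda>q. A (fst (fst q)) (snd (fst q))) \<in> borel_measurable (pred_sigma M F \<Otimes>\<^sub>M (borel :: (real^'n) measure))"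
        using measurable_compose[OF measurable_fst A_predictable] .
      have "(\<lambda>q. if A (fst (fst q)) (snd (fst q)) \<le> ennreal (real n) then ennreal (d 1 (fst (fst q)) (snd (fst q)) (l1 (snd q))) else 0) \<in> borel_measurable (pred_sigma M F \<Otimes>\<^sub>M (borel :: (real^'n) measure))"
        by measurable
      from nu_path_measurable[OF this w]
      have [measurable]: "(\<lambda>q. indicator {0<..} (fst q) * (if A w (fst q) \<le> ennreal (real n) then ennreal (d 1 w (fst q) (l1 (snd q))) else 0)) \<in> borel_measurable (borel \<Otimes>\<^sub>M (borel :: (real^'n) measure))"
        by (simp cong: if_cong)
      have "(\<lambda>q. indicator {..real n} (fst q) * (indicator {0<..} (fst q) * (if A w (fst q) \<le> ennreal (real n) then ennreal (d 1 w (fst q) (l1 (snd q))) else 0))) \<in> borel_measurable (borel \<Otimes>\<^sub>M (borel :: (real^'n) measure))"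
        by measurable
      also have "(\<lambda>q. indicator {..real n} (fst q) * (indicator {0<..} (fst q) * (if A w (fst q) \<le> ennreal (real n) then ennreal (d 1 w (fst q) (l1 (snd q))) else 0))) = ?f n w"
        by (auto simp: fun_eq_iff split: split_indicator)
      finally show ?thesis by (simp add: measurable_cong_sets[OF snu refl])
    qed
    have "?D w = (\<integral>\<^sup>+q. (SUP n. ?f n w q) \<partial>\<nu> w)"
    proof (intro nn_integral_cong antisym)
      fix q :: "real \<times> (real^'n)"
      show "(SUP n. ?f n w q) \<le> indicator {0<..} (fst q) * ennreal (d 1 w (fst q) (l1 (snd q)))"
        by (intro SUP_least) auto
      obtain a where a: "A w (fst q) = ennreal a" using A_finite[OF w, of "fst q"] by (cases "A w (fst q)") auto
      obtain n where "max a (fst q) \<le> real n" using real_arch_simple by blast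
      then show "indicator {0<..} (fst q) * ennreal (d 1 w (fst q) (l1 (snd q))) \<le> (SUP n. ?f n w q)"
        using a by (intro SUP_upper2[of n]) (auto simp: ennreal_leI split: split_indicator)
    qed
    also have "\<dots> = (SUP n. \<integral>\<^sup>+q. ?f n w q \<partial>\<nu> w)"
      using mono by (intro nn_integral_monotone_convergence_SUP fm incseq_SucI le_funI)
    finally show ?thesis .
  qed
  have m: "(\<lambda>w. \<integral>\<^sup>+q. ?f n w q \<partial>\<nu> w) \<in> borel_measurable M" for n
  proof -
    have [measurable]: "(\<lambda>q. A (fst (fst q)) (snd (fst q))) \<in> borel_measurable (pred_sigma M F \<Otimes>\<^sub>M (borel :: (real^'n) measure))"
      using measurable_compose[OF measurable_fst A_predictable] .
    have "(\<lambda>q. if A (fst (fst q)) (snd (fst q)) \<le> ennreal (real n) then ennreal (d 1 (fst (fst q)) (snd (fst q)) (l1 (snd q))) else 0) \<in> borel_measurable (pred_sigma M F \<Otimes>\<^sub>M (borel :: (real^'n) measure))"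
      by measurable
    from filtrationD(4)[OF filt _ nu_measurable(1)[OF this, of "real n"]]
    have "(\<lambda>w. \<integral>\<^sup>+q. indicator {0<..real n} (fst q) * (if A w (fst q) \<le> ennreal (real n) then ennreal (d 1 w (fst q) (l1 (snd q))) else 0) \<partial>\<nu> w) \<in> borel_measurable M"
      by (simp cong: if_cong)
    also have "(\<lambda>w. \<integral>\<^sup>+q. indicator {0<..real n} (fst q) * (if A w (fst q) \<le> ennreal (real n) then ennreal (d 1 w (fst q) (l1 (snd q))) else 0) \<partial>\<nu> w) = (\<lambda>w. \<integral>\<^sup>+q. ?f n w q \<partial>\<nu> w)"
      by (intro ext nn_integral_cong) (auto split: split_indicator)
    finally show ?thesis .
  qed
  have "(\<integral>\<^sup>+w. ?D w \<partial>M) = (\<integral>\<^sup>+w. (SUP n. \<integral>\<^sup>+q. ?f n w q \<partial>\<nu> w) \<partial>M)"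
    by (intro nn_integral_cong SUP)
  also have "\<dots> = (SUP n. \<integral>\<^sup>+w. \<integral>\<^sup>+q. ?f n w q \<partial>\<nu> w \<partial>M)"
    using m mono by (intro nn_integral_monotone_convergence_SUP incseq_SucI le_funI nn_integral_mono) auto
  also have "\<dots> \<le> ennreal (1 / (1 + l1 y0))"
    using quasi_continuous_balance(1)[OF qc, of 1 "real n" "\<lambda>_. True" "real n" for n]
    by (intro SUP_least) simp
  finally have "(\<integral>\<^sup>+w. ?D w \<partial>M) \<noteq> \<infinity>" by (auto simp: top_unique)
  from nn_integral_PInf_AE[OF Dm this] show ?thesis by (simp add: less_top)
qed

text \<open>A convergent cadlag path is bounded, and while W is at most C the drift at e = 1
  dominates a fixed multiple of min 1 a^2.\<close>

lemma finite_if_wealth_converges: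
  assumes w: "w \<in> space M" and c: "(W w \<longlongrightarrow> c) at_top"
    and fin: "(\<integral>\<^sup>+q. indicator {0<..} (fst q) * ennreal (d 1 w (fst q) (l1 (snd q))) \<partial>\<nu> w) < \<infinity>"
  shows "(\<integral>\<^sup>+q. indicator ({0<..} \<times> UNIV) q * ennreal (min 1 ((l1 (snd q))\<^sup>2)) \<partial>\<nu> w) < \<infinity>"
proof -
  have snu [measurable_cong]: "sets (\<nu> w) = sets (borel \<Otimes>\<^sub>M borel)" unfolding borel_prod by (rule sets_nu[OF w])
  have "\<forall>\<^sub>F t in at_top. W w t < c + 1" using c by (rule order_tendstoD) simp
  then obtain T where T: "\<And>t. t \<ge> T \<Longrightarrow> W w t < c + 1" unfolding eventually_at_top_linorder by blast
  obtain B where B: "\<forall>s\<in>{0..max 0 T + 1}. W w s \<le> B \<and> (0 < s \<longrightarrow> Wl w s \<le> B)"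
    using W_bounded[OF w, of "max 0 T + 1"] by auto
  define C where "C = max B (c + 1)"
  have Wl: "Wl w s \<le> C" if s: "0 < s" for s
  proof (cases "s \<le> max 0 T + 1")
    case True
    then show ?thesis using B s by (auto simp: C_def le_max_iff_disj)
  next
    case False
    have "\<forall>\<^sub>F x in at_left s. W w x \<le> c + 1"
      unfolding eventually_at_left_field using False by (intro exI[of _ T]) (auto intro!: less_imp_le T)
    then have "Wl w s \<le> c + 1" by (intro tendsto_upperbound[OF W_tendsto(2)[OF w s]]) auto
    then show ?thesis by (simp add: C_def)
  qed
  have C0: "0 \<le> C" using order_trans[OF Wl_nonneg Wl[of 1]] by simp
  \<comment> \<open>The denominator of \<open>d\<close> has four factors, counting the square twice.
    For a \<le> 1 each is at most 2 + C; for a > 1 the last two are at most (2 + C) a. Hence the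
    fourth power.\<close>
  have ineq: "min 1 (a\<^sup>2) \<le> (2 + C) ^ 4 * d 1 w s a" if s: "0 < s" and a: "0 \<le> a" for s a
  proof (cases "a = 0")
    case False
    define wl where "wl = Wl w s"
    have wl: "0 \<le> wl" "wl \<le> C" using Wl[OF s] by (auto simp: wl_def)
    have a: "0 < a" using a False by simp
    let ?q = "(1 + wl)\<^sup>2 * (wl + a) * (1 + wl + a)"
    have q: "0 < ?q" using wl a by (intro mult_pos_pos) (auto intro: add_nonneg_pos)
    have "min 1 (a\<^sup>2) * ?q \<le> (2 + C) ^ 4 * a\<^sup>2"
    proof (cases "a \<le> 1")
      case True
      have "?q \<le> (2 + C)\<^sup>2 * (2 + C) * (2 + C)"
        using wl a True by (intro mult_mono power_mono) auto
      also have "\<dots> = (2 + C) ^ 4" by (simp add: power2_eq_square power4_eq_xxxx)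
      finally have "?q * a\<^sup>2 \<le> (2 + C) ^ 4 * a\<^sup>2" by (rule mult_right_mono) simp
      moreover have "min 1 (a\<^sup>2) \<le> a\<^sup>2" by simp
      then have "min 1 (a\<^sup>2) * ?q \<le> a\<^sup>2 * ?q" using q by (intro mult_right_mono) auto
      ultimately show ?thesis by (simp add: mult.commute)
    next
      case False
      have "wl \<le> C * a" "1 \<le> a" using wl C0 False mult_mono[of wl C 1 a] by auto
      then have wa: "wl + a \<le> (2 + C) * a" "1 + wl + a \<le> (2 + C) * a" by (auto simp: distrib_right)
      have "?q \<le> (2 + C)\<^sup>2 * ((2 + C) * a) * ((2 + C) * a)"
        using wl a wa C0 by (intro mult_mono power_mono) auto
      also have "\<dots> = (2 + C) ^ 4 * a\<^sup>2" by (simp add: power2_eq_square power4_eq_xxxx)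
      finally have "?q \<le> (2 + C) ^ 4 * a\<^sup>2" .
      moreover have "min 1 (a\<^sup>2) * ?q \<le> 1 * ?q" using q by (intro mult_right_mono) auto
      ultimately show ?thesis by linarith
    qed
    then show ?thesis using q by (simp add: d_def wl_def pos_le_divide_eq)
  qed (simp add: d_def)
  have "(\<integral>\<^sup>+q. indicator ({0<..} \<times> UNIV) q * ennreal (min 1 ((l1 (snd q))\<^sup>2)) \<partial>\<nu> w)
    \<le> (\<integral>\<^sup>+q. ennreal ((2 + C) ^ 4) * (indicator {0<..} (fst q) * ennreal (d 1 w (fst q) (l1 (snd q)))) \<partial>\<nu> w)"
  proof (intro nn_integral_mono)
    fix q :: "real \<times> (real^'n)"
    show "indicator ({0<..} \<times> UNIV) q * ennreal (min 1 ((l1 (snd q))\<^sup>2)) \<le> ennreal ((2 + C) ^ 4) * (indicator {0<..} (fst q) * ennreal (d 1 w (fst q) (l1 (snd q))))"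
    proof (cases "0 < fst q")
      case True
      then have "ennreal (min 1 ((l1 (snd q))\<^sup>2)) \<le> ennreal ((2 + C) ^ 4 * d 1 w (fst q) (l1 (snd q)))"
        by (intro ennreal_leI ineq) auto
      also have "\<dots> = ennreal ((2 + C) ^ 4) * ennreal (d 1 w (fst q) (l1 (snd q)))"
        using C0 by (intro ennreal_mult) (auto simp: d_def)
      finally show ?thesis using True by (auto simp: indicator_def)
    qed (auto simp: indicator_def)
  qed
  also have "\<dots> = ennreal ((2 + C) ^ 4) * (\<integral>\<^sup>+q. indicator {0<..} (fst q) * ennreal (d 1 w (fst q) (l1 (snd q))) \<partial>\<nu> w)"
    using nu_path_measurable[OF predictable_integrands(1) w, of 1] by (intro nn_integral_cmult) (simp add: measurable_cong_sets[OF snu refl])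
  also have "\<dots> < \<infinity>" using fin by (simp add: ennreal_mult_less_top)
  finally show ?thesis .
qed

text \<open>W is bounded away from 0: it is eventually at least 1, and on the remaining compact
  interval 1/W is cadlag, hence bounded. With the lower bound 1/C the integrand \<open>h\<close> is
  at most C^2 min 1 a^2.\<close>

lemma Hq_finite:
  assumes w: "w \<in> space M" and pos: "\<forall>t\<ge>0. 0 < W w t \<and> 0 < Wl w t" and lim: "filterlim (W w) at_top at_top"
    and fin: "(\<integral>\<^sup>+q. indicator ({0<..} \<times> UNIV) q * ennreal (min 1 ((l1 (snd q))\<^sup>2)) \<partial>\<nu> w) < \<infinity>"
  shows "\<exists>k::nat. \<forall>t. Hq w t \<le> ennreal (real k)"
proof -
  have snu [measurable_cong]: "sets (\<nu> w) = sets (borel \<Otimes>\<^sub>M borel)" unfolding borel_prod by (rule sets_nu[OF w])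
  have "\<forall>\<^sub>F t in at_top. 1 \<le> W w t" using lim by (simp add: filterlim_at_top)
  then obtain T where T: "\<And>t. t \<ge> T \<Longrightarrow> 1 \<le> W w t" unfolding eventually_at_top_linorder by blast
  have "cadlag (\<lambda>t. 1 / W w t)"
    unfolding cadlag_def continuous_within
  proof (intro allI impI conjI)
    fix t :: real assume t: "0 \<le> t"
    have nz: "W w t \<noteq> 0" "Wl w t \<noteq> 0" using pos t by (auto simp: less_le)
    show "((\<lambda>t. 1 / W w t) \<longlongrightarrow> 1 / W w t) (at_right t)"
      by (intro tendsto_divide tendsto_const W_tendsto(1)[OF w t] nz)
    assume "0 < t"
    then have "((\<lambda>t. 1 / W w t) \<longlongrightarrow> 1 / Wl w t) (at_left t)"
      by (intro tendsto_divide tendsto_const W_tendsto(2)[OF w] nz)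
    then show "\<exists>l. ((\<lambda>t. 1 / W w t) \<longlongrightarrow> l) (at_left t)" by blast
  qed
  from this have "\<exists>B. \<forall>s\<in>{0..max 0 T}. \<bar>1 / W w s\<bar> \<le> B" by (rule cadlag_bounded) simp
  then obtain B where B: "\<And>s. s \<in> {0..max 0 T} \<Longrightarrow> \<bar>1 / W w s\<bar> \<le> B" by blast
  define C where "C = max 1 B"
  have C: "1 \<le> C" by (simp add: C_def)
  have W: "1 / C \<le> W w s" if s: "0 \<le> s" for s
  proof -
    have "0 < W w s" using pos s by auto
    moreover have "1 / W w s \<le> C"
    proof (cases "s \<le> max 0 T")
      case True
      then show ?thesis using B[of s] s by (auto simp: C_def le_max_iff_disj)
    next
      case False
      then have "1 \<le> W w s" using T[of s] by simp
      then have "1 / W w s \<le> 1" by simp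
      then show ?thesis using C by linarith
    qed
    ultimately show ?thesis using C by (simp add: field_simps)
  qed
  have Wl: "1 / C \<le> Wl w s" if s: "0 < s" for s
  proof (rule tendsto_lowerbound[OF W_tendsto(2)[OF w s]])
    show "\<forall>\<^sub>F x in at_left s. 1 / C \<le> W w x"
      unfolding eventually_at_left_field using s by (intro exI[of _ 0]) (auto intro!: W)
  qed simp
  have ineq: "h w s a \<le> C\<^sup>2 * min 1 (a\<^sup>2)" if s: "0 < s" and a: "0 \<le> a" for s a
  proof -
    define wl where "wl = Wl w s"
    have wl: "0 < wl" "1 / C \<le> wl" using Wl[OF s] C by (auto simp: wl_def intro: less_le_trans[OF _ Wl[OF s]])
    have "a\<^sup>2 / (wl + a)\<^sup>2 \<le> 1" using wl a by (simp add: divide_le_eq power_mono)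
    also have "1 \<le> C\<^sup>2 * 1" using C by simp
    finally have 1: "a\<^sup>2 / (wl + a)\<^sup>2 \<le> C\<^sup>2 * 1" .
    have "1 \<le> C * wl" using wl C by (simp add: field_simps)
    moreover have "0 \<le> C * a" using a C by simp
    ultimately have "1 \<le> C * (wl + a)" by (simp add: distrib_left)
    then have "1 \<le> (C * (wl + a))\<^sup>2" by simp
    then have "a\<^sup>2 * 1 \<le> a\<^sup>2 * (C * (wl + a))\<^sup>2" by (intro mult_left_mono) auto
    then have "a\<^sup>2 / (wl + a)\<^sup>2 \<le> C\<^sup>2 * a\<^sup>2" using wl a by (simp add: divide_le_eq power_mult_distrib ac_simps)
    with 1 show ?thesis by (auto simp: h_def wl_def min_def)
  qed
  have le: "Hq w t \<le> ennreal (C\<^sup>2) * (\<integral>\<^sup>+q. indicator ({0<..} \<times> UNIV) q * ennreal (min 1 ((l1 (snd q))\<^sup>2)) \<partial>\<nu> w)" for t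
  proof -
    have "Hq w t \<le> (\<integral>\<^sup>+q. ennreal (C\<^sup>2) * (indicator ({0<..} \<times> UNIV) q * ennreal (min 1 ((l1 (snd q))\<^sup>2))) \<partial>\<nu> w)"
      unfolding Hq_def
    proof (intro nn_integral_mono)
      fix q :: "real \<times> (real^'n)"
      show "indicator {0<..t} (fst q) * ennreal (h w (fst q) (l1 (snd q))) \<le> ennreal (C\<^sup>2) * (indicator ({0<..} \<times> UNIV) q * ennreal (min 1 ((l1 (snd q))\<^sup>2)))"
      proof (cases "0 < fst q")
        case True
        then have "ennreal (h w (fst q) (l1 (snd q))) \<le> ennreal (C\<^sup>2 * min 1 ((l1 (snd q))\<^sup>2))"
          by (intro ennreal_leI ineq) auto
        also have "\<dots> = ennreal (C\<^sup>2) * ennreal (min 1 ((l1 (snd q))\<^sup>2))" by (intro ennreal_mult) auto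
        finally show ?thesis using True by (auto simp: indicator_def mem_Times_iff)
      qed (auto simp: indicator_def)
    qed
    also have "\<dots> = ennreal (C\<^sup>2) * (\<integral>\<^sup>+q. indicator ({0<..} \<times> UNIV) q * ennreal (min 1 ((l1 (snd q))\<^sup>2)) \<partial>\<nu> w)"
      by (intro nn_integral_cmult) measurable
    finally show ?thesis .
  qed
  define I where "I = ennreal (C\<^sup>2) * (\<integral>\<^sup>+q. indicator ({0<..} \<times> UNIV) q * ennreal (min 1 ((l1 (snd q))\<^sup>2)) \<partial>\<nu> w)"
  have "I < \<top>" unfolding I_def using fin by (simp add: ennreal_mult_less_top)
  then obtain r where r: "I = ennreal r" by (cases I) auto
  obtain k where "r \<le> real k" using real_arch_simple by blast
  then have "Hq w t \<le> ennreal (real k)" for t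
    using le[of t] unfolding I_def[symmetric] r by (elim order_trans) (rule ennreal_leI)
  then show ?thesis by blast
qed

lemma Hq_predictable [measurable]: "(\<lambda>p. Hq (fst p) (snd p)) \<in> borel_measurable (pred_sigma M F)"
  using nu_measurable(2)[OF predictable_integrands(2)] by (simp add: Hq_def)

lemma Hq_mono: "r \<le> r' \<Longrightarrow> Hq w r \<le> Hq w r'"
  unfolding Hq_def by (intro nn_integral_mono) (auto split: split_indicator)

text \<open>An upper bound for the wealth created, relative to the level e, while the quadratic activity stays below k.\<close>

definition remainder :: "real \<Rightarrow> real \<Rightarrow> 'a \<Rightarrow> ennreal" where
  "remainder k e w = (\<integral>\<^sup>+q. indicator {0<..} (fst q) * (if Hq w (fst q) \<le> ennreal k then ennreal (q2 e w (fst q) (l1 (snd q))) else 0) \<partial>\<nu> w)"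

lemma remainder_pred:
  "(\<lambda>q. if Hq (fst (fst q)) (snd (fst q)) \<le> ennreal k then ennreal (q2 e (fst (fst q)) (snd (fst q)) (l1 (snd q))) else 0)
    \<in> borel_measurable (pred_sigma M F \<Otimes>\<^sub>M (borel :: (real^'n) measure))"
proof -
  have [measurable]: "(\<lambda>q. Hq (fst (fst q)) (snd (fst q))) \<in> borel_measurable (pred_sigma M F \<Otimes>\<^sub>M (borel :: (real^'n) measure))"
    using measurable_compose[OF measurable_fst Hq_predictable] .
  show ?thesis by measurable
qed

lemma remainder_measurable [measurable]: "remainder k e \<in> borel_measurable M"
  using nu_measurable(3)[OF remainder_pred] by (simp add: remainder_def[abs_def] cong: if_cong)

text \<open>Dominated convergence twice: under \<nu> the dominating function is \<open>h\<close>
  restricted to {Hq \<le> k}, whose integral is at most k; in the mean over \<omega> it is the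
  constant k.\<close>

lemma remainder_vanishes: "(\<lambda>j. \<integral>\<^sup>+w. remainder k (real (Suc j)) w \<partial>M) \<longlonglongrightarrow> 0"
proof -
  interpret prob_space M by (rule prob)
  have ptwise: "(\<lambda>j. remainder k (real (Suc j)) w) \<longlonglongrightarrow> 0" and bound: "remainder k (real (Suc j)) w \<le> ennreal k"
    if w: "w \<in> space M" for w j
  proof -
    have snu [measurable_cong]: "sets (\<nu> w) = sets (borel \<Otimes>\<^sub>M borel)" unfolding borel_prod by (rule sets_nu[OF w])
    let ?f = "\<lambda>j q. indicator {0<..} (fst q) * (if Hq w (fst q) \<le> ennreal k then ennreal (q2 (real (Suc j)) w (fst q) (l1 (snd q))) else 0)"
    let ?h = "\<lambda>q. indicator {0<..} (fst q) * ennreal (h w (fst q) (l1 (snd q :: real^'n)))"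
    let ?S = "{r. 0 < r \<and> Hq w r \<le> ennreal k}"
    have hm: "?h \<in> borel_measurable (borel \<Otimes>\<^sub>M borel)" using nu_path_measurable[OF predictable_integrands(2) w] by simp
    have Hq: "Hq w r = (\<integral>\<^sup>+q. indicator {0<..r} (fst q) * ?h q \<partial>\<nu> w)" for r
      unfolding Hq_def by (intro nn_integral_cong) (auto split: split_indicator)
    note loc = localised_bound[OF w hm, of "ennreal k", folded Hq]
    have fm: "?f j \<in> borel_measurable (\<nu> w)" for j
      using nu_path_measurable[OF remainder_pred w] by (simp add: measurable_cong_sets[OF snu refl] cong: if_cong)
    have le: "?f j q \<le> indicator ?S (fst q) * ?h q" for j q
    proof -
      define wl where "wl = Wl w (fst q)" define a where "a = l1 (snd q)"
      have wl: "0 \<le> wl" "0 \<le> a" by (auto simp: wl_def a_def)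
      have "a\<^sup>2 / ((wl + a) * (real (Suc j) + wl + a)) \<le> a\<^sup>2 / (wl + a)\<^sup>2"
      proof (cases "a = 0")
        case False
        then show ?thesis using wl by (intro divide_left_mono) (auto simp: power2_eq_square intro!: mult_left_mono mult_pos_pos add_nonneg_pos)
      qed simp
      then have "q2 (real (Suc j)) w (fst q) (l1 (snd q)) \<le> h w (fst q) (l1 (snd q))" by (simp add: q2_def h_def wl_def a_def)
      then show ?thesis by (auto simp: ennreal_leI split: split_indicator)
    qed
    have "remainder k (real (Suc j)) w \<le> (\<integral>\<^sup>+q. indicator ?S (fst q) * ?h q \<partial>\<nu> w)"
      unfolding remainder_def by (intro nn_integral_mono le)
    also have "\<dots> \<le> ennreal k" by (rule loc(2))
    finally show "remainder k (real (Suc j)) w \<le> ennreal k" .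
    have "(\<lambda>j. \<integral>\<^sup>+q. ?f j q \<partial>\<nu> w) \<longlonglongrightarrow> (\<integral>\<^sup>+q. 0 \<partial>\<nu> w)"
    proof (rule nn_integral_dominated_convergence[where w="\<lambda>q. indicator ?S (fst q) * ?h q"])
      show "(\<lambda>q. indicator ?S (fst q) * ?h q) \<in> borel_measurable (\<nu> w)"
        using hm loc(1) by (simp add: measurable_cong_sets[OF snu refl])
      show "(\<integral>\<^sup>+q. indicator ?S (fst q) * ?h q \<partial>\<nu> w) < \<infinity>" using loc(2) by (rule order_le_less_trans) simp
      show "AE q in \<nu> w. (\<lambda>j. ?f j q) \<longlonglongrightarrow> 0"
      proof (rule AE_I2)
        fix q :: "real \<times> (real^'n)"
        define wl where "wl = Wl w (fst q)" define a where "a = l1 (snd q)"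
        have "(\<lambda>j. a\<^sup>2 / (wl + a) * inverse (real (Suc j) + (wl + a))) \<longlonglongrightarrow> a\<^sup>2 / (wl + a) * 0"
        proof (intro tendsto_mult tendsto_const tendsto_inverse_0_at_top)
          show "filterlim (\<lambda>j. real (Suc j) + (wl + a)) at_top sequentially"
            by (rule filterlim_at_top_mono[OF filterlim_real_sequentially]) (auto simp: wl_def a_def)
        qed
        then have "(\<lambda>j. q2 (real (Suc j)) w (fst q) (l1 (snd q))) \<longlonglongrightarrow> 0"
          by (simp add: q2_def wl_def a_def field_simps)
        then have q2: "(\<lambda>j. ennreal (q2 (real (Suc j)) w (fst q) (l1 (snd q)))) \<longlonglongrightarrow> 0"
          using tendsto_ennrealI by fastforce
        show "(\<lambda>j. ?f j q) \<longlonglongrightarrow> 0"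
        proof (cases "0 < fst q \<and> Hq w (fst q) \<le> ennreal k")
          case True
          then show ?thesis using q2 by simp
        next
          case False
          then have "(\<lambda>j. ?f j q) = (\<lambda>_. 0)" by (auto simp: fun_eq_iff split: split_indicator)
          then show ?thesis by (simp only: tendsto_const)
        qed
      qed
    qed (use fm le in auto)
    then show "(\<lambda>j. remainder k (real (Suc j)) w) \<longlonglongrightarrow> 0" by (simp add: remainder_def del: of_nat_Suc)
  qed
  have "(\<lambda>j. \<integral>\<^sup>+w. remainder k (real (Suc j)) w \<partial>M) \<longlonglongrightarrow> (\<integral>\<^sup>+w. 0 \<partial>M)"
    by (rule nn_integral_dominated_convergence[where w="\<lambda>_. ennreal k"])
       (use ptwise bound in \<open>auto simp: emeasure_space_1\<close>)
  then show ?thesis by simp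
qed

text \<open>W/(e + W) is e times 1/e - 1/(e + W), so the balance is multiplied by e; the drift is at
  most \<open>q2\<close>/e, and the factor e cancels. The localisation A \<le> n is removed at the
  end, whereas Hq \<le> k stays.\<close>

lemma mean_wealth_fraction:
  assumes qc: "\<forall>w\<in>space M. \<forall>t. nubar \<nu> w t = 0" and e: "e > 0" and t: "t \<ge> 0"
  shows "(\<integral>\<^sup>+w. (if Hq w t \<le> ennreal k then ennreal (W w t / (e + W w t)) else 0) \<partial>M) \<le> ennreal (l1 y0 / (e + l1 y0)) + (\<integral>\<^sup>+w. remainder k e w \<partial>M)"
proof -
  have Hm[measurable]: "(\<lambda>w. Hq w t) \<in> borel_measurable M"
    using filtrationD(4)[OF filt t measurable_compose[OF measurable_time_section[OF filt t] Hq_predictable]] by simp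
  note [measurable] = W_measurable_M[OF t] A_measurable_M[OF t]
  have frac: "ennreal (wl / (e + wl)) = ennreal e * ennreal (1 / e - 1 / (e + wl))" if "0 \<le> wl" for wl
  proof -
    have "e + wl \<noteq> 0" using e that by linarith
    then have "wl / (e + wl) = 1 - e / (e + wl)" by (simp add: field_simps)
    also have "\<dots> = e * (1 / e - 1 / (e + wl))" using e by (simp add: right_diff_distrib)
    finally have "wl / (e + wl) = e * (1 / e - 1 / (e + wl))" .
    then show ?thesis using e that by (simp add: ennreal_mult frac_le)
  qed
  show ?thesis
  proof (rule localised_limit[OF t])
    fix n :: nat
    define Nd where "Nd = (\<integral>\<^sup>+w. (\<integral>\<^sup>+q. (if 0 < fst q \<and> fst q \<le> t \<and> A w (fst q) \<le> ennreal (real n) \<and> Hq w (fst q) \<le> ennreal k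
        then ennreal (d e w (fst q) (l1 (snd q))) else 0) \<partial>\<nu> w) \<partial>M)"
    have Nd: "Nd \<le> ennreal (1 / e) * (\<integral>\<^sup>+w. remainder k e w \<partial>M)"
    proof -
      have "Nd \<le> (\<integral>\<^sup>+w. ennreal (1 / e) * remainder k e w \<partial>M)"
        unfolding Nd_def
      proof (intro nn_integral_mono)
        fix w assume w: "w \<in> space M"
        have snu [measurable_cong]: "sets (\<nu> w) = sets (borel \<Otimes>\<^sub>M borel)" unfolding borel_prod by (rule sets_nu[OF w])
        have "(\<integral>\<^sup>+q. (if 0 < fst q \<and> fst q \<le> t \<and> A w (fst q) \<le> ennreal (real n) \<and> Hq w (fst q) \<le> ennreal k
            then ennreal (d e w (fst q) (l1 (snd q))) else 0) \<partial>\<nu> w)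
          \<le> (\<integral>\<^sup>+q. ennreal (1 / e) * (indicator {0<..} (fst q) * (if Hq w (fst q) \<le> ennreal k then ennreal (q2 e w (fst q) (l1 (snd q))) else 0)) \<partial>\<nu> w)"
        proof (intro nn_integral_mono)
          fix q :: "real \<times> (real^'n)"
          define wl where "wl = Wl w (fst q)" define a where "a = l1 (snd q)"
          have wl: "0 \<le> wl" "0 \<le> a" by (auto simp: wl_def a_def)
          have "e * a\<^sup>2 / ((e + wl)\<^sup>2 * (wl + a) * (e + wl + a)) = e / (e + wl)\<^sup>2 * (a\<^sup>2 / ((wl + a) * (e + wl + a)))"
            by simp
          also have "\<dots> \<le> 1 / e * (a\<^sup>2 / ((wl + a) * (e + wl + a)))"
          proof (rule mult_right_mono)
            have "e * e \<le> (e + wl) * (e + wl)" using e wl by (intro mult_mono) auto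
            then show "e / (e + wl)\<^sup>2 \<le> 1 / e" using e wl by (simp add: divide_simps power2_eq_square)
          qed (use e wl in auto)
          finally have "d e w (fst q) (l1 (snd q)) \<le> 1 / e * q2 e w (fst q) (l1 (snd q))"
            by (simp add: d_def q2_def wl_def a_def)
          then have "ennreal (d e w (fst q) (l1 (snd q))) \<le> ennreal (1 / e) * ennreal (q2 e w (fst q) (l1 (snd q)))"
            using e by (subst ennreal_mult[symmetric]) (auto simp: q2_def intro!: ennreal_leI)
          then show "(if 0 < fst q \<and> fst q \<le> t \<and> A w (fst q) \<le> ennreal (real n) \<and> Hq w (fst q) \<le> ennreal k
              then ennreal (d e w (fst q) (l1 (snd q))) else 0)
            \<le> ennreal (1 / e) * (indicator {0<..} (fst q) * (if Hq w (fst q) \<le> ennreal k then ennreal (q2 e w (fst q) (l1 (snd q))) else 0))"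
            by auto
        qed
        also have "\<dots> = ennreal (1 / e) * remainder k e w"
          unfolding remainder_def using nu_path_measurable[OF remainder_pred w]
          by (intro nn_integral_cmult) (simp add: measurable_cong_sets[OF snu refl] cong: if_cong)
        finally show "(\<integral>\<^sup>+q. (if 0 < fst q \<and> fst q \<le> t \<and> A w (fst q) \<le> ennreal (real n) \<and> Hq w (fst q) \<le> ennreal k
            then ennreal (d e w (fst q) (l1 (snd q))) else 0) \<partial>\<nu> w) \<le> ennreal (1 / e) * remainder k e w" .
      qed
      also have "\<dots> = ennreal (1 / e) * (\<integral>\<^sup>+w. remainder k e w \<partial>M)" by (rule nn_integral_cmult) measurable
      finally show ?thesis .
    qed
    have bal: "(\<integral>\<^sup>+w. (if A w t \<le> ennreal (real n) \<and> Hq w t \<le> ennreal k then ennreal (1 / e - 1 / (e + W w t)) else 0) \<partial>M) \<le> ennreal (1 / e - 1 / (e + l1 y0)) + Nd"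
    proof -
      have "Measurable.pred (pred_sigma M F) (\<lambda>p. Hq (fst p) (snd p) \<le> ennreal k)" by measurable
      moreover have "Hq w r' \<le> ennreal k" if "Hq w r \<le> ennreal k" "r' \<le> r" for w r r'
        using Hq_mono[OF that(2)] that(1) by (rule order_trans)
      ultimately show ?thesis
        using quasi_continuous_balance(2)[OF qc e t, of "\<lambda>p. Hq (fst p) (snd p) \<le> ennreal k" "real n"]
        by (simp add: Nd_def cong: if_cong)
    qed
    have "(\<integral>\<^sup>+w. (if A w t \<le> ennreal (real n) then (if Hq w t \<le> ennreal k then ennreal (W w t / (e + W w t)) else 0) else 0) \<partial>M)
      = (\<integral>\<^sup>+w. ennreal e * (if A w t \<le> ennreal (real n) \<and> Hq w t \<le> ennreal k then ennreal (1 / e - 1 / (e + W w t)) else 0) \<partial>M)"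
      by (intro nn_integral_cong) (auto simp: frac)
    also have "\<dots> = ennreal e * (\<integral>\<^sup>+w. (if A w t \<le> ennreal (real n) \<and> Hq w t \<le> ennreal k then ennreal (1 / e - 1 / (e + W w t)) else 0) \<partial>M)"
      by (rule nn_integral_cmult) measurable
    also have "\<dots> \<le> ennreal e * (ennreal (1 / e - 1 / (e + l1 y0)) + ennreal (1 / e) * (\<integral>\<^sup>+w. remainder k e w \<partial>M))"
      by (intro mult_left_mono order_trans[OF bal] add_left_mono Nd) auto
    also have "\<dots> = ennreal (l1 y0 / (e + l1 y0)) + (\<integral>\<^sup>+w. remainder k e w \<partial>M)"
      using e by (simp add: distrib_left frac mult.assoc[symmetric] ennreal_mult[symmetric])
    finally show "(\<integral>\<^sup>+w. (if A w t \<le> ennreal (real n) then (if Hq w t \<le> ennreal k then ennreal (W w t / (e + W w t)) else 0) else 0) \<partial>M)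
      \<le> ennreal (l1 y0 / (e + l1 y0)) + (\<integral>\<^sup>+w. remainder k e w \<partial>M)" .
  qed measurable
qed

text \<open>On exploding paths with activity at most k the fraction W/(e + W) tends to 1 for every
  e. By Fatou's lemma its mean over the paths with activity at most k is in the limit at most l1
  y0/(e + l1 y0) plus the mean of the remainder, and both vanish as e \<rightarrow> \<infinity>. So
  these paths form a null set.\<close>

lemma bounded_activity_no_explosion:
  assumes qc: "\<forall>w\<in>space M. \<forall>t. nubar \<nu> w t = 0"
  shows "AE w in M. (\<forall>t. Hq w t \<le> ennreal k) \<longrightarrow> \<not> filterlim (W w) at_top at_top"
proof -
  have Hm[measurable]: "(\<lambda>w. Hq w (real n)) \<in> borel_measurable M" for n
    using filtrationD(4)[OF filt _ measurable_compose[OF measurable_time_section[OF filt] Hq_predictable], of "real n"] by simp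
  have [measurable]: "(\<lambda>w. W w (real n)) \<in> borel_measurable M" for n by (rule W_measurable_M) simp
  define f where "f e n w = (if \<forall>i. Hq w (real i) \<le> ennreal k then ennreal (W w (real n) / (e + W w (real n))) else 0)" for e n w
  have fm[measurable]: "f e n \<in> borel_measurable M" for e n unfolding f_def by measurable
  have le: "(\<integral>\<^sup>+w. liminf (\<lambda>n. f e n w) \<partial>M) \<le> ennreal (l1 y0 / (e + l1 y0)) + (\<integral>\<^sup>+w. remainder k e w \<partial>M)" if e: "e > 0" for e
  proof -
    have "(\<integral>\<^sup>+w. liminf (\<lambda>n. f e n w) \<partial>M) \<le> liminf (\<lambda>n. \<integral>\<^sup>+w. f e n w \<partial>M)"
      by (rule nn_integral_liminf) measurable
    also have "\<dots> \<le> ennreal (l1 y0 / (e + l1 y0)) + (\<integral>\<^sup>+w. remainder k e w \<partial>M)"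
    proof (rule Liminf_le)
      show "\<forall>\<^sub>F n in sequentially. (\<integral>\<^sup>+w. f e n w \<partial>M) \<le> ennreal (l1 y0 / (e + l1 y0)) + (\<integral>\<^sup>+w. remainder k e w \<partial>M)"
      proof (rule always_eventually, rule allI)
        fix n
        have "(\<integral>\<^sup>+w. f e n w \<partial>M) \<le> (\<integral>\<^sup>+w. (if Hq w (real n) \<le> ennreal k then ennreal (W w (real n) / (e + W w (real n))) else 0) \<partial>M)"
          by (intro nn_integral_mono) (auto simp: f_def)
        also have "\<dots> \<le> ennreal (l1 y0 / (e + l1 y0)) + (\<integral>\<^sup>+w. remainder k e w \<partial>M)"
          by (rule mean_wealth_fraction[OF qc e]) simp
        finally show "(\<integral>\<^sup>+w. f e n w \<partial>M) \<le> ennreal (l1 y0 / (e + l1 y0)) + (\<integral>\<^sup>+w. remainder k e w \<partial>M)" .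
      qed
    qed simp
    finally show ?thesis .
  qed
  \<comment> \<open>The infimum over e = j + 1 has mean 0 but equals 1 on the paths to be
    excluded.\<close>
  define \<psi> where "\<psi> w = (INF j. liminf (\<lambda>n. f (real (Suc j)) n w))" for w
  have \<psi>m: "\<psi> \<in> borel_measurable M" unfolding \<psi>_def by measurable
  have "(\<integral>\<^sup>+w. \<psi> w \<partial>M) \<le> 0"
  proof (rule LIMSEQ_le_const)
    have "filterlim (\<lambda>j. real (Suc j) + l1 y0) at_top sequentially"
      by (rule filterlim_at_top_mono[OF filterlim_real_sequentially]) (use l1_y0_pos in auto)
    then have "(\<lambda>j. l1 y0 * inverse (real (Suc j) + l1 y0)) \<longlonglongrightarrow> l1 y0 * 0"
      by (intro tendsto_mult tendsto_const tendsto_inverse_0_at_top)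
    then have "(\<lambda>j. ennreal (l1 y0 / (real (Suc j) + l1 y0))) \<longlonglongrightarrow> ennreal 0"
      by (intro tendsto_ennrealI) (simp add: divide_inverse)
    then show "(\<lambda>j. ennreal (l1 y0 / (real (Suc j) + l1 y0)) + (\<integral>\<^sup>+w. remainder k (real (Suc j)) w \<partial>M)) \<longlonglongrightarrow> 0"
      using tendsto_add[OF _ remainder_vanishes[of k]] by fastforce
    show "\<exists>N. \<forall>j\<ge>N. (\<integral>\<^sup>+w. \<psi> w \<partial>M) \<le> ennreal (l1 y0 / (real (Suc j) + l1 y0)) + (\<integral>\<^sup>+w. remainder k (real (Suc j)) w \<partial>M)"
    proof (intro exI allI impI)
      fix j
      have "(\<integral>\<^sup>+w. \<psi> w \<partial>M) \<le> (\<integral>\<^sup>+w. liminf (\<lambda>n. f (real (Suc j)) n w) \<partial>M)"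
        unfolding \<psi>_def by (intro nn_integral_mono INF_lower) simp
      also have "\<dots> \<le> ennreal (l1 y0 / (real (Suc j) + l1 y0)) + (\<integral>\<^sup>+w. remainder k (real (Suc j)) w \<partial>M)"
        by (rule le) simp
      finally show "(\<integral>\<^sup>+w. \<psi> w \<partial>M) \<le> ennreal (l1 y0 / (real (Suc j) + l1 y0)) + (\<integral>\<^sup>+w. remainder k (real (Suc j)) w \<partial>M)" .
    qed
  qed
  then have "AE w in M. \<psi> w = 0" using \<psi>m by (simp add: nn_integral_0_iff_AE)
  then show ?thesis
  proof (eventually_elim, intro impI notI)
    fix w assume \<psi>0: "\<psi> w = 0" and Hk: "\<forall>t. Hq w t \<le> ennreal k" and lim: "filterlim (W w) at_top at_top"
    have "liminf (\<lambda>n. f (real (Suc j)) n w) = 1" for j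
    proof (rule lim_imp_Liminf)
      have "filterlim (\<lambda>n. W w (real n)) at_top sequentially"
        using filterlim_compose[OF lim filterlim_real_sequentially] .
      then have "filterlim (\<lambda>n. real (Suc j) + W w (real n)) at_top sequentially"
        by (rule filterlim_at_top_mono) auto
      then have "(\<lambda>n. 1 - real (Suc j) * inverse (real (Suc j) + W w (real n))) \<longlonglongrightarrow> 1 - real (Suc j) * 0"
        by (intro tendsto_diff tendsto_mult tendsto_const tendsto_inverse_0_at_top)
      also have "(\<lambda>n. 1 - real (Suc j) * inverse (real (Suc j) + W w (real n))) = (\<lambda>n. W w (real n) / (real (Suc j) + W w (real n)))"
      proof
        fix n
        have "real (Suc j) + W w (real n) > 0" by (intro add_pos_nonneg) auto
        then show "1 - real (Suc j) * inverse (real (Suc j) + W w (real n)) = W w (real n) / (real (Suc j) + W w (real n))"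
          by (simp add: field_simps)
      qed
      finally have "(\<lambda>n. ennreal (W w (real n) / (real (Suc j) + W w (real n)))) \<longlonglongrightarrow> ennreal 1"
        by (intro tendsto_ennrealI) simp
      then show "(\<lambda>n. f (real (Suc j)) n w) \<longlonglongrightarrow> 1" using Hk by (simp add: f_def)
    qed simp
    then show False using \<psi>0 by (simp add: \<psi>_def)
  qed
qed

text \<open>A finite total activity would bound \<open>Hq\<close> along a diverging path, which is
  excluded for every integer bound; an infinite one rules out a finite limit of W, and by the
  dichotomy for the limit only divergence remains.\<close>

lemma wealth_diverges_iff:
  assumes qc: "\<forall>w\<in>space M. \<forall>t. nubar \<nu> w t = 0"
  shows "AE w in M. filterlim (W w) at_top at_top \<longleftrightarrow>
    (\<integral>\<^sup>+q. indicator ({0<..} \<times> UNIV) q * ennreal (min 1 ((l1 (snd q))\<^sup>2)) \<partial>\<nu> w) = \<infinity>"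
proof -
  have "AE w in M. \<forall>k::nat. (\<forall>t. Hq w t \<le> ennreal (real k)) \<longrightarrow> \<not> filterlim (W w) at_top at_top"
    unfolding AE_all_countable using bounded_activity_no_explosion[OF qc] by blast
  then show ?thesis using wealth_limit AE_wealth_pos mean_d_finite[OF qc] AE_space
  proof eventually_elim
    fix w assume no: "\<forall>k::nat. (\<forall>t. Hq w t \<le> ennreal (real k)) \<longrightarrow> \<not> filterlim (W w) at_top at_top"
      and lim: "(\<exists>c>0. (W w \<longlongrightarrow> c) at_top) \<or> filterlim (W w) at_top at_top"
      and pos: "\<forall>t\<ge>0. 0 < W w t \<and> 0 < Wl w t"
      and fin: "(\<integral>\<^sup>+q. indicator {0<..} (fst q) * ennreal (d 1 w (fst q) (l1 (snd q))) \<partial>\<nu> w) < \<infinity>"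
      and w: "w \<in> space M"
    show "filterlim (W w) at_top at_top \<longleftrightarrow>
      (\<integral>\<^sup>+q. indicator ({0<..} \<times> UNIV) q * ennreal (min 1 ((l1 (snd q))\<^sup>2)) \<partial>\<nu> w) = \<infinity>" (is "?L \<longleftrightarrow> ?I = \<infinity>")
    proof
      assume ?L
      show "?I = \<infinity>"
      proof (rule ccontr)
        assume "?I \<noteq> \<infinity>"
        then have "?I < \<infinity>" by (simp add: less_top)
        from Hq_finite[OF w pos \<open>?L\<close> this] no \<open>?L\<close> show False by blast
      qed
    next
      assume I: "?I = \<infinity>"
      have "\<not> (W w \<longlongrightarrow> c) at_top" for c
        using finite_if_wealth_converges[OF w _ fin, of c] I by auto
      then show ?L using lim by blast
    qed
  qed
qed

end

theorem theorem4:
  fixes M :: "'a measure" and F :: "real \<Rightarrow> 'a measure"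
    and X :: "real \<Rightarrow> 'a \<Rightarrow> real^'n::finite"
    and \<nu> :: "'a \<Rightarrow> (real \<times> (real^'n)) measure"
    and b :: "'a \<Rightarrow> real \<Rightarrow> real^'n" and K :: "'a \<Rightarrow> real \<Rightarrow> (real^'n) measure"
    and H :: "real \<Rightarrow> 'a \<Rightarrow> real"
    and y0 :: "real^'m::finite" and Y :: "real \<Rightarrow> 'a \<Rightarrow> real^'m"
  assumes prob: "prob_space M"
    and usual: "usual_conditions M F"
    and investors: "CARD('m) \<ge> 2"
    \<comment> \<open>payoff process X\<close>
    and X_adapted: "adapted M F X"
    and X_cadlag: "\<forall>\<omega>\<in>space M. cadlag (\<lambda>t. X t \<omega>)"
    and X_nonneg: "\<forall>\<omega>\<in>space M. \<forall>t\<ge>0. X t \<omega> \<in> nonneg_vecs"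
    and X_mono: "\<forall>\<omega>\<in>space M. \<forall>s t. 0 \<le> s \<longrightarrow> s \<le> t \<longrightarrow> (\<forall>n. X s \<omega> $ n \<le> X t \<omega> $ n)"
    and X_zero: "\<forall>\<omega>\<in>space M. X 0 \<omega> = 0"
    \<comment> \<open>compensator \<nu> of the jump measure of X, with \<bar>\<nu>_t \<in> [0,1]\<close>
    and nu_comp: "compensator M F X \<nu>"
    and nu_bar_le1: "\<forall>\<omega>\<in>space M. \<forall>t. emeasure (\<nu> \<omega>) ({t} \<times> nonneg_vecs) \<le> 1"
    \<comment> \<open>the decomposition X^c = b\<cdot>G, \<nu>(dt,dx) = K_t(dx) dG_t\<close>
    and b_pred: "predictable M F (\<lambda>t \<omega>. b \<omega> t)"
    and b_nonneg: "\<forall>\<omega>\<in>space M. \<forall>t. b \<omega> t \<in> nonneg_vecs"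
    and K_sets: "\<forall>\<omega>\<in>space M. \<forall>t. sets (K \<omega> t) = sets borel"
    and K_kernel: "\<forall>B\<in>sets borel. (\<lambda>p. emeasure (K (fst p) (snd p)) B) \<in> borel_measurable (pred_sigma M F)"
    and K_support: "\<forall>\<omega>\<in>space M. \<forall>t. emeasure (K \<omega> t) (UNIV - nonneg_vecs) = 0"
    and K_zero: "\<forall>\<omega>\<in>space M. \<forall>t. emeasure (K \<omega> t) {0} = 0"
    and Xc_eq: "\<forall>\<omega>\<in>space M. \<forall>t\<ge>0. \<forall>n. cont_part X t \<omega> $ n =
                  (LINT s:{0<..t}|LS (\<lambda>r. Gproc X \<nu> r \<omega>). b \<omega> s $ n)"
    and nu_eq: "\<forall>\<omega>\<in>space M. \<forall>A\<in>sets borel. emeasure (\<nu> \<omega>) A =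
                  (\<integral>\<^sup>+ s. indicator {0<..} s * emeasure (K \<omega> s) (Pair s -` A) \<partial>LS (\<lambda>r. Gproc X \<nu> r \<omega>))"
    and b_jump: "\<forall>\<omega>\<in>space M. \<forall>t>0.
                  Gproc X \<nu> t \<omega> - Lim (at_left t) (\<lambda>r. Gproc X \<nu> r \<omega>) > 0 \<longrightarrow> l1 (b \<omega> t) = 0"
    and bK_norm: "\<forall>\<omega>\<in>space M. \<forall>t\<ge>0.
                  ennreal (l1 (b \<omega> t)) + (\<integral>\<^sup>+ x. ennreal (min 1 (l1 x)) \<partial>K \<omega> t) = 1"
    \<comment> \<open>the reference process H used in the definition of feasibility\<close>
    and H_pred: "predictable M F H"
    and H_paths: "\<forall>\<omega>\<in>space M. cadlag (\<lambda>t. H t \<omega>) \<and> mono_on {0..} (\<lambda>t. H t \<omega>)"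
    and G_ll_H: "AE \<omega> in M. absolutely_continuous (LS (\<lambda>t. H t \<omega>)) (LS (\<lambda>t. Gproc X \<nu> t \<omega>))"
    \<comment> \<open>all investors use \<hat>L; the profile with y0 is feasible, Y its wealth process\<close>
    and y0_pos: "\<forall>m. 0 < y0 $ m"
    and feas: "feasible M F X H (L_hat X \<nu> b K y0) y0"
    and Y_wealth: "wealth_process M F X H (L_hat X \<nu> b K y0) y0 Y"
  shows "supermartingale M F (\<lambda>t \<omega>. 1 / l1 (Y t \<omega>)) \<and>
         (AE \<omega> in M. \<exists>Winf :: ereal. 0 < Winf \<and> ((\<lambda>t. ereal (l1 (Y t \<omega>))) \<longlongrightarrow> Winf) at_top) \<and>
         ((\<forall>\<omega>\<in>space M. \<forall>t. nubar \<nu> \<omega> t = 0) \<longrightarrow>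
            (AE \<omega> in M. (Lim at_top (\<lambda>t. ereal (l1 (Y t \<omega>))) = \<infinity>) \<longleftrightarrow>
               (\<integral>\<^sup>+ q. indicator ({0<..} \<times> UNIV) q * ennreal (min 1 ((l1 (snd q))\<^sup>2)) \<partial>\<nu> \<omega>) = \<infinity>))"
proof -
  have filt: "filtration M F" using usual by (simp add: usual_conditions_def)
  obtain l where l: "\<And>m n. leb_deriv M F (\<lambda>t \<omega>. L_hat X \<nu> b K y0 m \<omega> (\<lambda>s. Y s \<omega>) t $ n) H (l m n)"
    and eq: "\<And>m. AE \<omega> in M. \<forall>t\<ge>0. Y t \<omega> $ m = y0 $ m - l1 (L_hat X \<nu> b K y0 m \<omega> (\<lambda>s. Y s \<omega>) t)
             + (\<Sum>n\<in>UNIV. LINT s:{0<..t}|LS (\<lambda>r. X r \<omega> $ n). l m n \<omega> s / (\<Sum>m'\<in>UNIV. \<bar>l m' n \<omega> s\<bar>))"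
    using Y_wealth unfolding wealth_process_def by blast
  have Y: "adapted M F Y" "\<forall>\<omega>\<in>space M. \<forall>t\<ge>0. Y t \<omega> \<in> nonneg_vecs" "\<forall>\<omega>\<in>space M. cadlag (\<lambda>t. Y t \<omega>)"
    using Y_wealth unfolding wealth_process_def by auto
  have absorbed: "\<forall>\<omega>\<in>space M. \<forall>m. \<forall>t\<ge>0. (Y t \<omega> $ m = 0 \<or> leftlim y0 (\<lambda>s. Y s \<omega>) t $ m = 0) \<longrightarrow> (\<forall>s\<ge>t. Y s \<omega> $ m = 0)"
    using Y_wealth unfolding wealth_process_def by fast
  interpret wealth M F X \<nu> b K H y0 Y l
    by (rule wealth.intro[OF payoff_characteristics.intro wealth_axioms.intro]) (rule prob filt X_adapted X_cadlag X_mono X_zero nu_comp nu_bar_le1 b_pred b_nonneg K_sets K_kernel K_support K_zero Xc_eq nu_eq b_jump bK_norm H_pred H_paths G_ll_H y0_pos Y l eq absorbed)+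
  have W: "W \<omega> = (\<lambda>t. l1 (Y t \<omega>))" for \<omega> by (simp add: W_def fun_eq_iff)
  have div: "((\<lambda>t. ereal (l1 (Y t \<omega>))) \<longlongrightarrow> \<infinity>) at_top \<longleftrightarrow> filterlim (W \<omega>) at_top at_top" for \<omega>
    by (simp add: W tendsto_PInfty_eq_at_top)
  show ?thesis
  proof (intro conjI impI)
    show "supermartingale M F (\<lambda>t \<omega>. 1 / l1 (Y t \<omega>))"
      using reciprocal_supermartingale by (simp add: W_def)
    show "AE \<omega> in M. \<exists>Winf :: ereal. 0 < Winf \<and> ((\<lambda>t. ereal (l1 (Y t \<omega>))) \<longlongrightarrow> Winf) at_top"
      using wealth_limit
    proof eventually_elim
      fix \<omega> assume "(\<exists>c>0. (W \<omega> \<longlongrightarrow> c) at_top) \<or> filterlim (W \<omega>) at_top at_top"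
      then show "\<exists>Winf :: ereal. 0 < Winf \<and> ((\<lambda>t. ereal (l1 (Y t \<omega>))) \<longlongrightarrow> Winf) at_top"
      proof
        assume "\<exists>c>0. (W \<omega> \<longlongrightarrow> c) at_top"
        then obtain c where "0 < c" "(W \<omega> \<longlongrightarrow> c) at_top" by blast
        then show ?thesis by (intro exI[of _ "ereal c"]) (simp add: W)
      next
        assume "filterlim (W \<omega>) at_top at_top"
        then show ?thesis by (intro exI[of _ \<infinity>]) (simp add: div)
      qed
    qed
    assume qc: "\<forall>\<omega>\<in>space M. \<forall>t. nubar \<nu> \<omega> t = 0"
    show "AE \<omega> in M. (Lim at_top (\<lambda>t. ereal (l1 (Y t \<omega>))) = \<infinity>) \<longleftrightarrow>
               (\<integral>\<^sup>+ q. indicator ({0<..} \<times> UNIV) q * ennreal (min 1 ((l1 (snd q))\<^sup>2)) \<partial>\<nu> \<omega>) = \<infinity>"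
      using wealth_diverges_iff[OF qc] wealth_limit
    proof eventually_elim
      fix \<omega>
      assume iff: "filterlim (W \<omega>) at_top at_top \<longleftrightarrow> (\<integral>\<^sup>+ q. indicator ({0<..} \<times> UNIV) q * ennreal (min 1 ((l1 (snd q))\<^sup>2)) \<partial>\<nu> \<omega>) = \<infinity>"
        and lim: "(\<exists>c>0. (W \<omega> \<longlongrightarrow> c) at_top) \<or> filterlim (W \<omega>) at_top at_top"
      \<comment> \<open>\<open>Lim\<close> is a mere description, so it carries information only
        because the limit in \<open>ereal\<close> is already known to exist.\<close>
      have "Lim at_top (\<lambda>t. ereal (l1 (Y t \<omega>))) = \<infinity> \<longleftrightarrow> filterlim (W \<omega>) at_top at_top"
      proof
        assume inf: "Lim at_top (\<lambda>t. ereal (l1 (Y t \<omega>))) = \<infinity>"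
        show "filterlim (W \<omega>) at_top at_top"
        proof (rule ccontr)
          assume "\<not> filterlim (W \<omega>) at_top at_top"
          then obtain c where "(W \<omega> \<longlongrightarrow> c) at_top" using lim by blast
          then have "((\<lambda>t. ereal (l1 (Y t \<omega>))) \<longlongrightarrow> ereal c) at_top" by (simp add: W)
          then have "Lim at_top (\<lambda>t. ereal (l1 (Y t \<omega>))) = ereal c" by (intro tendsto_Lim) simp_all
          then show False using inf by simp
        qed
      next
        assume "filterlim (W \<omega>) at_top at_top"
        then show "Lim at_top (\<lambda>t. ereal (l1 (Y t \<omega>))) = \<infinity>" by (intro tendsto_Lim) (simp_all add: div)
      qed
      then show "(Lim at_top (\<lambda>t. ereal (l1 (Y t \<omega>))) = \<infinity>) \<longleftrightarrow>
               (\<integral>\<^sup>+ q. indicator ({0<..} \<times> UNIV) q * ennreal (min 1 ((l1 (snd q))\<^sup>2)) \<partial>\<nu> \<omega>) = \<infinity>"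
        using iff by simp
    qed
  qed
qed

end
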